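(* Let $q\in(0,1)$ and $r>0$. The zero point process $\mathcal{Z}_{X_{\mathbb{A}_q}^r}$ on $\mathbb{A}_q=\{z\in\mathbb{C}:q<|z|<1\}$ is a permanental-determinantal point process in the sense that it has correlation functions $\{\rho^n_{\mathbb{A}_q}\}_{n\in\mathbb{N}}$ with respect to $m/\pi$ ($m$ being Lebesgue measure on $\mathbb{C}$) given by $$\rho^n_{\mathbb{A}_q}(z_1,\dots,z_n;r)=\frac{\theta(-r)}{\theta\big(-r\prod_{k=1}^n|z_k|^4\big)}\ \mathrm{perdet}_{1\le i,j\le n}\Big[S_{\mathbb{A}_q}\Big(z_i,z_j;r\prod_{\ell=1}^n|z_\ell|^2\Big)\Big]$$ for every $n\in\mathbb{N}$ and $z_1,\dots,z_n\in\mathbb{A}_q$.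
   Context: For an $n\times n$ matrix $M$, $\mathrm{perdet}\,M:=\mathrm{per}\,M\cdot\det M$ (permanent times determinant). Theta function: $\theta(z)=\prod_{n=0}^\infty(1-zq^{2n})(1-q^{2n+2}/z)$, $z\in\mathbb{C}\setminus\{0\}$. For $s>0$, $S_{\mathbb{A}_q}(z,w;s)=\sum_{n\in\mathbb{Z}}\frac{(z\overline{w})^n}{1+sq^{2n}}$, $z,w\in\mathbb{A}_q$ (weighted Szegő kernel). With $\{\zeta_n\}_{n\in\mathbb{Z}}$ i.i.d. standard complex Gaussian random variables with density $e^{-|z|^2}/\pi$, $X_{\mathbb{A}_q}^r(z)=\sum_{n\in\mathbb{Z}}\zeta_n z^n/\sqrt{1+rq^{2n}}$ is a random analytic function on $\mathbb{A}_q$ (with covariance kernel $S_{\mathbb{A}_q}(z,w;r)$), and $\mathcal{Z}_{X_{\mathbb{A}_q}^r}=\sum_{z\in\mathbb{A}_q:X_{\mathbb{A}_q}^r(z)=0}\delta_z$. Correlation functions: a point process $\Xi$ on $S$ has $n$-point correlation function $\rho^n$ with respect to a reference measure $\lambda$ if for all disjoint bounded (relatively compact) sets $\Lambda_1,\dots,\Lambda_m\subset S$ and nonnegative integers $k_1,\dots,k_m$ with $\sum k_i=n$, $\mathbf{E}\big[\prod_{i=1}^m\frac{\Xi(\Lambda_i)!}{(\Xi(\Lambda_i)-k_i)!}\big]=\int_{\Lambda_1^{k_1}\times\cdots\times\Lambda_m^{k_m}}\rho^n\,d\lambda^{\otimes n}$, with the convention that the factor is $0$ if $\Xi(\Lambda_i)<k_i$.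 *)

theory Defs
  imports "HOL-Probability.Probability" "Jordan_Normal_Form.Determinant"
begin

definition permanent :: "'a::comm_ring_1 mat \<Rightarrow> 'a" where
  "permanent A = (\<Sum>p | p permutes {0..<dim_row A}. \<Prod>i = 0..<dim_row A. A $$ (i, p i))"

definition perdet :: "'a::comm_ring_1 mat \<Rightarrow> 'a" where
  "perdet A = permanent A * Determinant.det A"

definition annulus :: "real \<Rightarrow> complex set" where
  "annulus q = {z. q < cmod z \<and> cmod z < 1}"

definition theta :: "real \<Rightarrow> complex \<Rightarrow> complex" where
  "theta q z = (\<Prod>n. (1 - z * of_real (q ^ (2 * n))) * (1 - of_real (q ^ (2 * n + 2)) / z))"

definition szego_kernel :: "real \<Rightarrow> complex \<Rightarrow> complex \<Rightarrow> real \<Rightarrow> complex" where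
  "szego_kernel q z w s =
     (\<Sum>\<^sub>\<infinity>n::int. (z * cnj w) powi n / of_real (1 + s * q powi (2 * n)))"

definition laurent_sum :: "real \<Rightarrow> real \<Rightarrow> (int \<Rightarrow> complex) \<Rightarrow> complex \<Rightarrow> complex" where
  "laurent_sum q r c z =
     (\<Sum>\<^sub>\<infinity>n::int. c n * z powi n / of_real (sqrt (1 + r * q powi (2 * n))))"

text \<open>The sum of the unit point masses at the zeros of \<open>f\<close> in \<open>S\<close> (each zero counted once), as
  the push-forward of the counting measure on the zero set.\<close>

definition zero_measure :: "complex set \<Rightarrow> (complex \<Rightarrow> complex) \<Rightarrow> complex measure" where
  "zero_measure S f = distr (count_space {z \<in> S. f z = 0}) (restrict_space borel S) (\<lambda>z. z)"

definition gaussian_zero_process ::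
    "real \<Rightarrow> real \<Rightarrow> (int \<Rightarrow> 'a \<Rightarrow> complex) \<Rightarrow> 'a \<Rightarrow> complex measure" where
  "gaussian_zero_process q r \<zeta> \<omega> = zero_measure (annulus q) (laurent_sum q r (\<lambda>n. \<zeta> n \<omega>))"

definition std_complex_gaussian :: "'a measure \<Rightarrow> ('a \<Rightarrow> complex) \<Rightarrow> bool" where
  "std_complex_gaussian M Z \<longleftrightarrow>
     distributed M lborel Z (\<lambda>z. ennreal (exp (- (cmod z)\<^sup>2) / pi))"

text \<open>Borel sets that are relatively compact in the subspace \<open>S\<close>: the compact hull has to lie
  inside \<open>S\<close>, so for an open annulus they stay away from the boundary.\<close>

definition bounded_sets_in :: "'b::topological_space set \<Rightarrow> 'b set set" where
  "bounded_sets_in S = {\<Lambda> \<in> sets borel. \<exists>K. compact K \<and> \<Lambda> \<subseteq> K \<and> K \<subseteq> S}"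

text \<open>A point process on \<open>S\<close>: a random Borel measure that is almost surely integer-valued and
  finite on bounded sets. Measurability refers to the completed probability space, so that
  realisations in a null set (such as those where a random series diverges) are irrelevant.\<close>

definition point_process ::
    "'a measure \<Rightarrow> 'b::topological_space set \<Rightarrow> ('a \<Rightarrow> 'b measure) \<Rightarrow> bool" where
  "point_process M S \<Xi> \<longleftrightarrow>
     (\<forall>\<omega>\<in>space M. sets (\<Xi> \<omega>) = sets (restrict_space borel S)) \<and>
     (\<forall>\<Lambda>\<in>bounded_sets_in S. (\<lambda>\<omega>. emeasure (\<Xi> \<omega>) \<Lambda>) \<in> borel_measurable (completion M)) \<and>
     (AE \<omega> in M. \<forall>\<Lambda>\<in>bounded_sets_in S. emeasure (\<Xi> \<omega>) \<Lambda> \<in> \<nat>)"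

text \<open>\<open>x! / (x - k)!\<close>; as subtraction on \<^typ>\<open>ennreal\<close> is truncated, the value is \<open>0\<close> for a
  natural number \<open>x < k\<close>.\<close>

definition falling_factorial :: "ennreal \<Rightarrow> nat \<Rightarrow> ennreal" where
  "falling_factorial x k = (\<Prod>i<k. x - of_nat i)"

text \<open>The product of the powers \<open>\<Lambda> i ^ k i\<close> for \<open>i < m\<close>, as a set of functions on
  \<open>{..<\<Sum>i<m. k i}\<close>: the first \<open>k 0\<close> coordinates range over \<open>\<Lambda> 0\<close>, the next \<open>k 1\<close> over \<open>\<Lambda> 1\<close>, and
  so on.\<close>

definition block_product :: "nat \<Rightarrow> (nat \<Rightarrow> 'b set) \<Rightarrow> (nat \<Rightarrow> nat) \<Rightarrow> (nat \<Rightarrow> 'b) set" where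
  "block_product m \<Lambda> k =
     (\<Pi>\<^sub>E j\<in>{..<\<Sum>i<m. k i}. concat (map (\<lambda>i. replicate (k i) (\<Lambda> i)) [0..<m]) ! j)"

text \<open>\<open>\<rho>\<close> is an \<open>n\<close>-point correlation function of \<open>\<Xi>\<close> with respect to the measure \<open>\<mu>\<close> on \<open>S\<close>.
  Both sides are integrals of nonnegative functions.\<close>

definition correlation_function ::
    "'a measure \<Rightarrow> 'b::topological_space set \<Rightarrow> ('a \<Rightarrow> 'b measure) \<Rightarrow> 'b measure \<Rightarrow>
      nat \<Rightarrow> ((nat \<Rightarrow> 'b) \<Rightarrow> real) \<Rightarrow> bool" where
  "correlation_function M S \<Xi> \<mu> n \<rho> \<longleftrightarrow>
     \<rho> \<in> borel_measurable (Pi\<^sub>M {..<n} (\<lambda>_. \<mu>)) \<and>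
     (\<forall>x \<in> {..<n} \<rightarrow>\<^sub>E S. 0 \<le> \<rho> x) \<and>
     (\<forall>m \<Lambda> k. (\<forall>i<m. \<Lambda> i \<in> bounded_sets_in S) \<and> disjoint_family_on \<Lambda> {..<m} \<and>
         (\<Sum>i<m. k i) = n \<longrightarrow>
       (\<integral>\<^sup>+\<omega>. (\<Prod>i<m. falling_factorial (emeasure (\<Xi> \<omega>) (\<Lambda> i)) (k i)) \<partial>completion M) =
       (\<integral>\<^sup>+x\<in>block_product m \<Lambda> k. ennreal (\<rho> x) \<partial>Pi\<^sub>M {..<n} (\<lambda>_. \<mu>)))"

end

theory Submission
  imports Defs "HOL-Complex_Analysis.Complex_Analysis"
begin

text \<open>The key is the identity, obtained from Weierstrass' addition formula for \<open>\<theta>\<close>,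
  \<open>K_r(z,w) - K_r(z,a) K_r(a,w) / K_r(a,a) = h_a(z) cnj (h_a(w)) K_(r|a|^2)(z,w)\<close> for the weighted Szego kernel \<open>K_r\<close>
  and \<open>h_a(z) = z \<theta>(a/z) / \<theta>(cnj a z)\<close>: conditioned on a zero at \<open>a\<close>, the series \<open>X_r\<close> is distributed
  as \<open>h_a X_(r|a|^2)\<close>. Solving \<open>X_r(z) = 0\<close> for the coefficient \<open>\<zeta> 0\<close> and changing variables turns this
  into a Palm formula for the zeros. Iterating it over \<open>n\<close> points leaves the moment \<open>E (\<Prod>i<n. |X_s(z_i)|^2)\<close> with
  \<open>s = r \<Prod>|z_l|^2\<close>, which is the permanent of the kernel by Wick's theorem, while the factors collected on the way
  multiply up to its determinant, by the same identity read as a Schur complement.\<close>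

section \<open>The theta function\<close>

text \<open>The kernel with parameter r reproduces the Hardy space of the annulus whose squared norm
  is the mean of |f|^2 over the outer circle plus r times its mean over the inner circle |z| = q,
  since z^n then has squared norm 1 + r q^(2n). The factor h_a has modulus 1 on the outer circle and
  |a| on the inner one. The functions vanishing at a are therefore the products h_a g with g
  measured by the weight r |a|^2: the family of processes is closed under conditioning, only the
  parameter moves, and every induction has to vary \<open>r\<close>. A zero at a prescribed point is
  a null event, so nothing is conditioned literally. The term of index 0 is the only constant one,
  which makes X the sum of a multiple of \<open>\<zeta> 0\<close> and an independent function Y.
  With Y fixed, zeros are the solutions of an equation in one complex unknown, and the density of
  \<open>\<zeta> 0\<close> at the required value acts as a Gaussian weight in Y(z). No joint density
  of X(z) and its derivative is involved. Laws are identified by characteristic functions of finite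
  linear forms, where everything reduces to inner products of coefficient sequences.\<close>

definition qpoch :: "real \<Rightarrow> complex \<Rightarrow> complex" where
  "qpoch p x = (\<Prod>n. 1 - x * of_real (p ^ n))"

lemma summable_qpoch:
  assumes "0 < p" "p < 1"
  shows "summable (\<lambda>n. norm ((1 - x * complex_of_real (p ^ n)) - 1))"
proof -
  have "(\<lambda>n. norm ((1 - x * complex_of_real (p ^ n)) - 1)) = (\<lambda>n. norm x * p ^ n)"
    using assms by (auto simp: norm_mult norm_power)
  then show ?thesis using assms by (simp add: summable_mult summable_geometric)
qed

lemma convergent_qpoch:
  assumes "0 < p" "p < 1"
  shows "convergent_prod (\<lambda>n. 1 - x * complex_of_real (p ^ n))"
  by (intro abs_convergent_prod_imp_convergent_prod summable_imp_abs_convergent_prod summable_qpoch assms)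

lemma qpoch_rec:
  assumes "0 < p" "p < 1"
  shows "qpoch p x = (1 - x) * qpoch p (of_real p * x)"
proof -
  have "(\<lambda>n. 1 - (of_real p * x) * complex_of_real (p ^ n)) has_prod qpoch p (of_real p * x)"
    unfolding qpoch_def using convergent_qpoch[OF assms] by (rule convergent_prod_has_prod)
  then have "(\<lambda>n. 1 - x * complex_of_real (p ^ Suc n)) has_prod qpoch p (of_real p * x)"
    by (simp add: mult_ac)
  from has_prod_Suc_imp[of "\<lambda>n. 1 - x * complex_of_real (p ^ n)", OF this]
  have "(\<lambda>n. 1 - x * complex_of_real (p ^ n)) has_prod (qpoch p (of_real p * x) * (1 - x))"
    by simp
  then show ?thesis unfolding qpoch_def by (simp add: has_prod_unique[symmetric] mult_ac)
qed

lemma qpoch_eq_0D: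
  assumes "0 < p" "p < 1" "qpoch p x = 0"
  shows "\<exists>n. x * of_real (p ^ n) = 1"
proof (rule ccontr)
  assume "\<not> ?thesis"
  then have "qpoch p x \<noteq> 0"
    unfolding qpoch_def by (intro prodinf_nonzero convergent_qpoch assms(1,2)) (metis right_minus_eq)
  with assms show False by simp
qed

lemma qpoch_nonzero:
  assumes "0 < p" "p < 1" "norm x < 1"
  shows "qpoch p x \<noteq> 0"
proof
  assume "qpoch p x = 0"
  then obtain n where "x * of_real (p ^ n) = 1" using qpoch_eq_0D assms by blast
  then have "norm x * p ^ n = 1" using assms(1) by (metis norm_mult norm_of_real norm_one abs_of_pos zero_less_power)
  moreover have "norm x * p ^ n \<le> norm x * 1" using assms by (intro mult_left_mono power_le_one) auto
  ultimately show False using assms by simp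
qed

lemma qpoch_nonzero_neg:
  assumes "0 < p" "p < 1" "0 < s"
  shows "qpoch p (- of_real s) \<noteq> 0"
proof
  assume "qpoch p (- of_real s) = 0"
  then obtain n where "- of_real s * of_real (p ^ n) = (1::complex)" using qpoch_eq_0D assms by blast
  then have "complex_of_real (- s * p ^ n) = of_real 1" by simp
  then have "- s * p ^ n = 1" by (simp only: of_real_eq_iff)
  moreover have "s * p ^ n > 0" using assms by simp
  ultimately show False by linarith
qed

lemma qpoch_cnj:
  assumes "0 < p" "p < 1"
  shows "qpoch p (cnj x) = cnj (qpoch p x)"
proof -
  have "(\<lambda>n. \<Prod>i\<le>n. 1 - x * complex_of_real (p ^ i)) \<longlonglongrightarrow> qpoch p x" for x
    unfolding qpoch_def by (rule convergent_prod_LIMSEQ[OF convergent_qpoch[OF assms]])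
  note lim = this
  have "(\<lambda>n. cnj (\<Prod>i\<le>n. 1 - x * complex_of_real (p ^ i))) \<longlonglongrightarrow> cnj (qpoch p x)"
    by (intro tendsto_cnj lim)
  then have "(\<lambda>n. \<Prod>i\<le>n. 1 - cnj x * complex_of_real (p ^ i)) \<longlonglongrightarrow> cnj (qpoch p x)"
    by simp
  with lim[of "cnj x"] show ?thesis by (rule LIMSEQ_unique)
qed

lemma qpoch_holomorphic:
  assumes "0 < p" "p < 1"
  shows "qpoch p holomorphic_on UNIV"
proof (rule holomorphic_uniform_sequence)
  show "(\<lambda>x. \<Prod>n<N. 1 - x * complex_of_real (p ^ n)) holomorphic_on UNIV" for N
    by (intro holomorphic_intros)
  fix x :: complex
  have "uniform_limit (cball x 1) (\<lambda>N x. \<Prod>n<N. 1 - x * complex_of_real (p ^ n)) (qpoch p) sequentially"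
  proof -
    have "uniformly_convergent_on (cball x 1) (\<lambda>N x. \<Prod>n<N. 1 - x * complex_of_real (p ^ n))"
    proof (rule uniformly_convergent_on_prod')
      show "continuous_on (cball x 1) (\<lambda>x. 1 - x * complex_of_real (p ^ n))" for n
        by (intro continuous_intros)
      show "compact (cball x 1)" by simp
      show "uniformly_convergent_on (cball x 1)
              (\<lambda>N x. \<Sum>n<N. norm ((1 - x * complex_of_real (p ^ n)) - 1))"
      proof (rule Weierstrass_m_test'[where M = "\<lambda>n. (norm x + 1) * p ^ n"])
        fix n y assume "y \<in> cball x 1"
        then have "norm y \<le> norm x + 1"
          using norm_triangle_ineq[of x "y - x"] by (simp add: dist_norm norm_minus_commute)
        then show "norm (norm ((1 - y * complex_of_real (p ^ n)) - 1)) \<le> (norm x + 1) * p ^ n"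
          using assms by (simp add: norm_mult norm_power mult_right_mono)
      next
        show "summable (\<lambda>n. (norm x + 1) * p ^ n)"
          using assms by (intro summable_mult summable_geometric) auto
      qed
    qed
    then obtain l where l: "uniform_limit (cball x 1) (\<lambda>N x. \<Prod>n<N. 1 - x * complex_of_real (p ^ n)) l sequentially"
      by (auto simp: uniformly_convergent_on_def)
    have "l y = qpoch p y" if "y \<in> cball x 1" for y
    proof -
      have "(\<lambda>N. \<Prod>n<N. 1 - y * complex_of_real (p ^ n)) \<longlonglongrightarrow> l y"
        using tendsto_uniform_limitI[OF l that] .
      moreover have "(\<lambda>N. \<Prod>n<N. 1 - y * complex_of_real (p ^ n)) \<longlonglongrightarrow> qpoch p y"
        unfolding qpoch_def using convergent_prod_LIMSEQ[OF convergent_qpoch[OF assms]]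
        by (subst filterlim_sequentially_Suc[symmetric]) (simp only: lessThan_Suc_atMost)
      ultimately show ?thesis by (rule LIMSEQ_unique)
    qed
    with l show ?thesis by (metis (no_types, lifting) uniform_limit_cong')
  qed
  then show "\<exists>d>0. cball x d \<subseteq> UNIV \<and> uniform_limit (cball x d) (\<lambda>N x. \<Prod>n<N. 1 - x * complex_of_real (p ^ n)) (qpoch p) sequentially"
    by (intro exI[of _ 1]) auto
qed simp

lemma qpoch_holomorphic_compose [holomorphic_intros]:
  assumes "0 < p" "p < 1" "f holomorphic_on A"
  shows "(\<lambda>x. qpoch p (f x)) holomorphic_on A"
  using holomorphic_on_compose_gen[OF assms(3) qpoch_holomorphic[OF assms(1,2)]] by (simp add: o_def)

text \<open>The theta function without its factor 1 - z, hence without its zero at 1. Its value at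
  1, the product of all (1 - q^(2n+2))^2, is minus the derivative of theta at 1 and becomes the
  constant in front of the theta quotient for the kernel.\<close>

definition theta_red :: "real \<Rightarrow> complex \<Rightarrow> complex" where
  "theta_red q z = qpoch (q\<^sup>2) (of_real (q\<^sup>2) * z) * qpoch (q\<^sup>2) (of_real (q\<^sup>2) / z)"

context
  fixes q :: real assumes q: "0 < q" "q < 1"
begin

lemma q2: "0 < q\<^sup>2" "q\<^sup>2 < 1" using q by (auto simp: power_less_one_iff)

lemma theta_qpoch: "theta q z = qpoch (q\<^sup>2) z * qpoch (q\<^sup>2) (of_real (q\<^sup>2) / z)"
  unfolding theta_def qpoch_def
  using prodinf_mult[OF convergent_qpoch[OF q2, of z] convergent_qpoch[OF q2, of "of_real (q\<^sup>2) / z"]]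
  by (simp add: power_mult[symmetric] power_add mult_ac flip: of_real_power)
     (simp add: power_mult[symmetric] power_mult_distrib power2_eq_square mult_ac)

lemma theta_factor: "theta q z = (1 - z) * theta_red q z"
  unfolding theta_qpoch theta_red_def using qpoch_rec[OF q2, of z] by simp

lemma theta_1 [simp]: "theta q 1 = 0" by (simp add: theta_factor)

lemma theta_shift:
  assumes "z \<noteq> 0" shows "theta q (of_real (q\<^sup>2) * z) = - theta q z / z"
proof -
  have "theta q (of_real (q\<^sup>2) * z) = qpoch (q\<^sup>2) (of_real (q\<^sup>2) * z) * qpoch (q\<^sup>2) (1 / z)"
    unfolding theta_qpoch using q by simp
  also have "qpoch (q\<^sup>2) (1 / z) = (1 - 1 / z) * qpoch (q\<^sup>2) (of_real (q\<^sup>2) / z)"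
    using qpoch_rec[OF q2, of "1 / z"] by simp
  finally show ?thesis unfolding theta_factor theta_red_def using assms by (simp add: field_simps)
qed

lemma theta_inverse:
  assumes "z \<noteq> 0" shows "theta q (1 / z) = - theta q z / z"
proof -
  have "theta q (1 / z) = qpoch (q\<^sup>2) (1 / z) * qpoch (q\<^sup>2) (of_real (q\<^sup>2) * z)"
    unfolding theta_qpoch using q by simp
  also have "qpoch (q\<^sup>2) (1 / z) = (1 - 1 / z) * qpoch (q\<^sup>2) (of_real (q\<^sup>2) / z)"
    using qpoch_rec[OF q2, of "1 / z"] by simp
  finally show ?thesis unfolding theta_factor theta_red_def using assms by (simp add: field_simps)
qed

lemma theta_eq_0D:
  assumes "theta q z = 0" "z \<noteq> 0"
  shows "\<exists>k::int. z = of_real (q\<^sup>2) powi k"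
proof -
  have "qpoch (q\<^sup>2) z = 0 \<or> qpoch (q\<^sup>2) (of_real (q\<^sup>2) / z) = 0"
    using assms theta_qpoch by simp
  then show ?thesis
  proof
    assume "qpoch (q\<^sup>2) z = 0"
    then obtain n where "z * of_real ((q\<^sup>2) ^ n) = 1" using qpoch_eq_0D q2 by blast
    then have "z = of_real (q\<^sup>2) powi (- int n)"
      using q by (simp add: power_int_minus field_simps)
    then show ?thesis by blast
  next
    assume "qpoch (q\<^sup>2) (of_real (q\<^sup>2) / z) = 0"
    then obtain n where "of_real (q\<^sup>2) / z * of_real ((q\<^sup>2) ^ n) = 1" using qpoch_eq_0D q2 by blast
    then have "z = of_real (q\<^sup>2) ^ Suc n" using assms(2) by (simp add: field_simps)
    then have "z = of_real (q\<^sup>2) powi int (Suc n)" by (simp only: power_int_of_nat)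
    then show ?thesis by blast
  qed
qed

lemma theta_cnj: "theta q (cnj z) = cnj (theta q z)"
  unfolding theta_qpoch using qpoch_cnj[OF q2] by (metis complex_cnj_complex_of_real complex_cnj_divide complex_cnj_mult)

lemma theta_red_holomorphic [holomorphic_intros]:
  assumes "f holomorphic_on A" "\<And>x. x \<in> A \<Longrightarrow> f x \<noteq> 0"
  shows "(\<lambda>x. theta_red q (f x)) holomorphic_on A"
  unfolding theta_red_def using assms q2 by (intro holomorphic_intros) auto

lemma theta_holomorphic [holomorphic_intros]:
  assumes "f holomorphic_on A" "\<And>x. x \<in> A \<Longrightarrow> f x \<noteq> 0"
  shows "(\<lambda>x. theta q (f x)) holomorphic_on A"
  unfolding theta_factor using assms by (intro holomorphic_intros) auto

lemma theta_red_nonzero: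
  assumes "q\<^sup>2 < norm x" "norm x < 1 / q\<^sup>2"
  shows "theta_red q x \<noteq> 0"
proof -
  have "norm x > 0" using assms q2 by linarith
  then have "norm (of_real (q\<^sup>2) * x) < 1" "norm (of_real (q\<^sup>2) / x) < 1"
    using assms q2 by (auto simp: norm_mult norm_divide norm_power field_simps)
  then show ?thesis unfolding theta_red_def using qpoch_nonzero[OF q2] by simp
qed

lemma theta_nonzero:
  assumes "q\<^sup>2 < norm x" "norm x < 1"
  shows "theta q x \<noteq> 0"
proof -
  have "1 < 1 / q\<^sup>2" using q2 by simp
  with assms have "norm x < 1 / q\<^sup>2" by linarith
  then show ?thesis unfolding theta_factor using theta_red_nonzero assms by auto
qed

lemma theta_nonzero_neg:
  assumes "0 < s" shows "theta q (- of_real s) \<noteq> 0"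
proof -
  have "of_real (q\<^sup>2) / - complex_of_real s = - of_real (q\<^sup>2 / s)" by simp
  then show ?thesis unfolding theta_qpoch
    using qpoch_nonzero_neg[OF q2 assms] qpoch_nonzero_neg[OF q2, of "q\<^sup>2 / s"] q assms
    by simp
qed

lemma theta_red_1_nonzero: "theta_red q 1 \<noteq> 0"
  using theta_red_nonzero[of 1] q2 by simp

lemma deriv_theta_1: "(theta q has_field_derivative - theta_red q 1) (at 1)"
proof -
  have "theta_red q holomorphic_on - {0}" using theta_red_holomorphic[of "\<lambda>x. x" "-{0}"] by auto
  then obtain d where d: "(theta_red q has_field_derivative d) (at 1)"
    by (metis ComplI field_differentiable_def holomorphic_on_imp_differentiable_at open_Compl closed_singleton insertE empty_iff one_neq_zero finite.emptyI finite_insert finite_imp_closed)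
  have "((\<lambda>z. (1 - z) * theta_red q z) has_field_derivative - theta_red q 1) (at 1)"
    by (rule derivative_eq_intros d refl | simp)+
  moreover have "(\<lambda>z. (1 - z) * theta_red q z) = theta q" by (auto simp: theta_factor)
  ultimately show ?thesis by simp
qed

lemma theta_has_deriv: "z \<noteq> 0 \<Longrightarrow> (theta q has_field_derivative deriv (theta q) z) (at z)"
proof -
  assume "z \<noteq> 0"
  have "theta q holomorphic_on - {0}" using theta_holomorphic[of "\<lambda>x. x" "-{0}"] by auto
  then show ?thesis using \<open>z \<noteq> 0\<close> by (intro holomorphic_derivI[of _ "- {0}"]) (auto simp: open_Compl)
qed

text \<open>Differentiating \<open>w * theta q (q^2 * w) = - theta q w\<close> at a zero kills the
  term without a derivative. Simplicity of the zero at 1 thus spreads along all powers of q^2, in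
  both directions.\<close>

lemma deriv_theta_shift:
  assumes "z \<noteq> 0" "theta q z = 0"
  shows "deriv (theta q) z = - (of_real (q\<^sup>2) * z) * deriv (theta q) (of_real (q\<^sup>2) * z)"
proof -
  let ?p = "complex_of_real (q\<^sup>2)"
  have nz: "?p * z \<noteq> 0" using q assms by simp
  have 1: "((\<lambda>w. w * theta q (?p * w)) has_field_derivative
       (theta q (?p * z) + z * (?p * deriv (theta q) (?p * z)))) (at z)"
  proof -
    have "((\<lambda>w. ?p * w) has_field_derivative ?p) (at z)"
      by (auto intro!: derivative_eq_intros)
    then have "((\<lambda>w. theta q (?p * w)) has_field_derivative deriv (theta q) (?p * z) * ?p) (at z)"
      by (rule DERIV_chain2[where g = "\<lambda>w. ?p * w", OF theta_has_deriv[OF nz]])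
    from DERIV_mult[OF DERIV_ident this] show ?thesis by (simp add: algebra_simps)
  qed
  have ev: "\<forall>\<^sub>F w in nhds z. - theta q w = w * theta q (?p * w)"
  proof -
    have "\<forall>\<^sub>F w in nhds z. w \<in> - {0}" using assms by (intro eventually_nhds_in_open) auto
    then show ?thesis by eventually_elim (use theta_shift in auto)
  qed
  have "((\<lambda>w. - theta q w) has_field_derivative
       (theta q (?p * z) + z * (?p * deriv (theta q) (?p * z)))) (at z)"
    using DERIV_cong_ev[OF refl ev refl] 1 by blast
  moreover have "((\<lambda>w. - theta q w) has_field_derivative - deriv (theta q) z) (at z)"
    using theta_has_deriv[OF assms(1)] by (rule DERIV_minus)
  ultimately have "- deriv (theta q) z = theta q (?p * z) + z * (?p * deriv (theta q) (?p * z))"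
    by (metis DERIV_unique)
  then show ?thesis using theta_shift[OF assms(1)] assms by (simp add: algebra_simps)
       (metis add.inverse_inverse mult.assoc)
qed

lemma theta_shift_powi: "theta q (of_real (q\<^sup>2) powi k) = 0"
proof (induction k rule: int_induct[of _ 0])
  case (step1 i)
  then show ?case using theta_shift[of "of_real (q\<^sup>2) powi i"] q by (simp add: power_int_add mult.commute)
next
  case (step2 i)
  have "of_real (q\<^sup>2) * complex_of_real (q\<^sup>2) powi (i - 1) = of_real (q\<^sup>2) powi i"
    using q by (simp add: power_int_diff)
  then show ?case using theta_shift[of "of_real (q\<^sup>2) powi (i - 1)"] q step2 by simp
qed simp

lemma deriv_theta_powi: "deriv (theta q) (of_real (q\<^sup>2) powi k) \<noteq> 0"
proof (induction k rule: int_induct[of _ 0])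
  case base
  then show ?case using DERIV_imp_deriv[OF deriv_theta_1] theta_red_1_nonzero by simp
next
  case (step1 i)
  then show ?case using deriv_theta_shift[of "of_real (q\<^sup>2) powi i"] theta_shift_powi[of i] q
    by (auto simp: power_int_add mult.commute)
next
  case (step2 i)
  have "of_real (q\<^sup>2) * complex_of_real (q\<^sup>2) powi (i - 1) = of_real (q\<^sup>2) powi i"
    using q by (simp add: power_int_diff)
  then show ?case using deriv_theta_shift[of "of_real (q\<^sup>2) powi (i - 1)"] theta_shift_powi[of "i - 1"] q step2 by simp
qed

lemma deriv_theta_zero: "theta q z = 0 \<Longrightarrow> z \<noteq> 0 \<Longrightarrow> deriv (theta q) z \<noteq> 0"
  using theta_eq_0D deriv_theta_powi by blast

end

section \<open>Division by functions with simple zeros, and quasi-periodic functions\<close>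

lemma holomorphic_division:
  assumes S: "open S" and f: "f holomorphic_on S" and g: "g holomorphic_on S"
    and zero: "\<And>z. z \<in> S \<Longrightarrow> g z = 0 \<Longrightarrow> f z = 0 \<and> deriv g z \<noteq> 0"
  obtains Q where "Q holomorphic_on S" "\<And>z. z \<in> S \<Longrightarrow> f z = Q z * g z"
proof
  \<comment> \<open>At a simple zero of \<open>g\<close>, where \<open>f\<close> vanishes too, the
    quotient receives the l'Hopital value; this makes \<open>Q\<close> continuous, so the
    singularity is removable.\<close>
  define Q where "Q z = (if g z = 0 then deriv f z / deriv g z else f z / g z)" for z
  show "f z = Q z * g z" if "z \<in> S" for z
    using zero[OF that] by (auto simp: Q_def)
  have an: "Q analytic_on {z}" if z: "z \<in> S" for z
  proof -
    have df: "(f has_field_derivative deriv f z) (at z)" and dg: "(g has_field_derivative deriv g z) (at z)"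
      using f g S z by (auto intro: holomorphic_derivI)
    have ev: "\<forall>\<^sub>F w in at z. g w \<noteq> 0"
    proof (cases "g z = 0")
      case True
      then have "deriv g z \<noteq> 0" using zero z by blast
      then have "\<forall>\<^sub>F w in at z. (g w - g z) / (w - z) \<noteq> 0"
        using dg by (intro tendsto_imp_eventually_ne) (auto simp: has_field_derivative_iff)
      then show ?thesis by eventually_elim (use True in auto)
    next
      case False
      have "isCont g z" using dg DERIV_isCont by blast
      then show ?thesis using False by (simp add: isCont_def tendsto_imp_eventually_ne)
    qed
    then obtain d0 where d0: "d0 > 0" "\<And>w. w \<noteq> z \<Longrightarrow> dist w z < d0 \<Longrightarrow> g w \<noteq> 0"
      by (auto simp: eventually_at)
    obtain d1 where d1: "d1 > 0" "ball z d1 \<subseteq> S" using S z open_contains_ball by blast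
    define d where "d = min d0 d1"
    have d: "d > 0" "ball z d \<subseteq> S" "\<And>w. w \<in> ball z d - {z} \<Longrightarrow> g w \<noteq> 0"
      using d0 d1 by (auto simp: d_def dist_commute)
    have "Q holomorphic_on ball z d"
    proof (rule no_isolated_singularity'[where K = "{z}"])
      have "(\<lambda>w. f w / g w) holomorphic_on ball z d - {z}"
        using d by (intro holomorphic_on_divide holomorphic_on_subset[OF f] holomorphic_on_subset[OF g]) auto
      then show "Q holomorphic_on ball z d - {z}"
        by (rule holomorphic_transform) (use d in \<open>auto simp: Q_def\<close>)
      show "(Q \<longlongrightarrow> Q w) (at w within ball z d)" if "w \<in> {z}" for w
      proof -
        have "((\<lambda>w. f w / g w) \<longlongrightarrow> Q z) (at z)"
        proof (cases "g z = 0")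
          case True
          then have "f z = 0" "deriv g z \<noteq> 0" using zero z by auto
          show ?thesis
            by (rule lhopital_complex_simple[OF df dg]) (use True \<open>f z = 0\<close> \<open>deriv g z \<noteq> 0\<close> in \<open>auto simp: Q_def\<close>)
        next
          case False
          have "isCont f z" "isCont g z" using df dg DERIV_isCont by blast+
          then show ?thesis using False unfolding Q_def isCont_def by (auto intro!: tendsto_divide)
        qed
        moreover have "\<forall>\<^sub>F w in at z. f w / g w = Q w"
          using ev by eventually_elim (simp add: Q_def)
        ultimately have "(Q \<longlongrightarrow> Q z) (at z)" using tendsto_cong by fastforce
        then show ?thesis using that by (auto intro: tendsto_within_subset)
      qed
    qed auto
    then show ?thesis using d(1) by (auto simp: analytic_at intro: exI[of _ "ball z d"])
  qed
  then have "Q analytic_on S" using analytic_on_analytic_at by blast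
  then show "Q holomorphic_on S" by (rule analytic_imp_holomorphic)
qed

text \<open>The exponent \<^term>\<open>\<alpha>\<close> makes \<^term>\<open>norm (E x) / norm x powr \<alpha>\<close> invariant under \<^term>\<open>\<lambda>x. p * x\<close>, so its
  maximum over a closed fundamental annulus is global; in the coordinate \<^term>\<open>exp t\<close> it is the modulus of a
  holomorphic function, which is therefore constant. The sign then excludes nonzero constants.\<close>

lemma quasi_periodic_zero:
  fixes p c :: real
  assumes p: "0 < p" "p < 1" and c: "0 < c"
    and hol: "E holomorphic_on {x. p < norm x \<and> norm x < 1 / p}"
    and per: "\<And>x. 1 < norm x \<Longrightarrow> norm x < 1 / p \<Longrightarrow> E (of_real p * x) = - of_real c * E x"
    and x: "p < norm x" "norm x < 1 / p"
  shows "E x = 0"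
proof -
  define D where "D = {x::complex. p < norm x \<and> norm x < 1 / p}"
  define \<alpha> where "\<alpha> = ln c / ln p"
  define S where "S = {t::complex. Re t > ln p \<and> Re t < - ln p}"
  define V where "V t = exp (- of_real \<alpha> * t) * E (exp t)" for t
  define u where "u x = norm (E x) * norm x powr (- \<alpha>)" for x
  \<comment> \<open>As 1 / a = a / p, the closed annulus \<open>R\<close> between the radii a and 1
    / a spans exactly one period of multiplication by p, and it is compactly contained in the open
    annulus on which \<open>E\<close> is holomorphic.\<close>
  define a where "a = sqrt p"
  have a: "0 < a" "a < 1" "a\<^sup>2 = p" "p < a" using p
    by (auto simp: a_def real_less_rsqrt power2_eq_square)
  have lnp: "ln p < 0" using p by simp
  have pa: "p powr \<alpha> = c" using p lnp c by (simp add: powr_def \<alpha>_def)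
  have expS: "exp t \<in> D" if "t \<in> S" for t
  proof -
    have "exp (ln p) < exp (Re t)" "exp (Re t) < exp (- ln p)" using that by (auto simp: S_def)
    then show ?thesis using p by (simp add: D_def exp_minus inverse_eq_divide)
  qed
  have nV: "norm (V t) = u (exp t)" for t
    by (simp add: V_def u_def norm_mult powr_def)
  have u_per: "u (of_real p * x) = u x" if "1 < norm x" "norm x < 1 / p" for x
  proof -
    have "u (of_real p * x) = c * norm (E x) * (p * norm x) powr (- \<alpha>)"
      using per[OF that] c p by (simp add: u_def norm_mult)
    also have "\<dots> = c * norm (E x) * (p powr (- \<alpha>) * norm x powr (- \<alpha>))"
      using p that by (simp add: powr_mult)
    also have "p powr (- \<alpha>) = 1 / c" using pa p by (simp add: powr_minus inverse_eq_divide)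
    finally show ?thesis using c by (simp add: u_def)
  qed
  define R where "R = {x::complex. a \<le> norm x \<and> norm x \<le> 1 / a}"
  have a1: "1 < 1 / a" "1 / a < 1 / p" "p = a * a"
    using a p by (auto simp: power2_eq_square intro: divide_strict_left_mono)
  have RD: "R \<subseteq> D"
  proof
    fix x assume "x \<in> R"
    then have "a \<le> norm x" "norm x \<le> 1 / a" by (auto simp: R_def)
    then have "p < norm x" "norm x < 1 / p" using a a1 by linarith+
    then show "x \<in> D" by (simp add: D_def)
  qed
  have "compact R"
  proof -
    have "R = cball 0 (1 / a) \<inter> {x. a \<le> norm x}" by (auto simp: R_def)
    moreover have "closed {x::complex. a \<le> norm x}" by (intro closed_Collect_le continuous_intros)
    ultimately show ?thesis by (metis compact_Int_closed compact_cball)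
  qed
  moreover have "R \<noteq> {}" using a by (auto simp: R_def intro!: exI[of _ 1])
  moreover have "continuous_on R u"
    unfolding u_def using a holomorphic_on_imp_continuous_on[OF hol] RD
    by (intro continuous_intros) (auto intro: continuous_on_subset simp: D_def R_def)
  ultimately obtain x0 where x0: "x0 \<in> R" "\<And>x. x \<in> R \<Longrightarrow> u x \<le> u x0"
    using continuous_attains_sup[of R u] by blast
  have max: "u x \<le> u x0" if "x \<in> D" for x
  proof -
    consider "norm x < a" | "x \<in> R" | "norm x > 1 / a" by (fastforce simp: R_def)
    then show ?thesis
    proof cases
      case 1
      define y where "y = x / of_real p"
      have ny: "norm y = norm x / p" using p by (simp add: y_def norm_divide)
      have "norm x < 1" using 1 a by linarith
      then have y: "1 < norm y" "norm y < 1 / p" using that 1 a p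
        by (auto simp: ny D_def divide_strict_right_mono)
      have "norm y < a / p" using 1 p by (simp add: ny divide_strict_right_mono)
      then have "norm y \<le> 1 / a" using a a1 by simp
      moreover have "a \<le> norm y" using y a by linarith
      ultimately have "y \<in> R" using a by (auto simp: R_def)
      moreover have "u x = u y" using u_per[OF y] p by (simp add: y_def)
      ultimately show ?thesis using x0 by simp
    next
      case 3
      have 1: "1 < norm x" "norm x < 1 / p" using 3 that a1 by (auto simp: D_def)
      have "norm (of_real p * x) = p * norm x" using p by (simp add: norm_mult)
      moreover have "p * norm x \<le> 1 / a"
      proof -
        have "p * norm x < p * (1 / p)" using 1 p by (intro mult_strict_left_mono) auto
        then have "p * norm x < 1" using p by simp
        with a1(1) show ?thesis by linarith
      qed
      moreover have "a \<le> p * norm x"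
      proof -
        have "p * (1 / a) < p * norm x" using 3 p by (intro mult_strict_left_mono) auto
        then show ?thesis using a a1(3) by simp
      qed
      ultimately have "of_real p * x \<in> R" by (simp add: R_def)
      then show ?thesis using x0 u_per[OF 1] by metis
    qed (use x0 in auto)
  qed
  have "open S" unfolding S_def by (intro open_Collect_conj open_Collect_less continuous_intros)
  have "convex S"
  proof -
    have "S = {t. Re t > ln p} \<inter> {t. Re t < - ln p}" by (auto simp: S_def)
    then show ?thesis by (simp add: convex_Int convex_halfspace_Re_gt convex_halfspace_Re_lt)
  qed
  have Vhol: "V holomorphic_on S"
    unfolding V_def using expS hol
    by (intro holomorphic_intros holomorphic_on_compose_gen[of exp _ E D, unfolded o_def]) (auto simp: D_def)
  have x0nz: "x0 \<noteq> 0" using x0 a by (auto simp: R_def)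
  have LnS: "Ln x \<in> S" if "x \<in> D" for x
  proof -
    have "x \<noteq> 0" using that p by (auto simp: D_def)
    moreover have "ln p < ln (norm x)" "ln (norm x) < ln (1 / p)"
      using that p \<open>x \<noteq> 0\<close> by (auto simp: D_def)
    ultimately show ?thesis using p by (simp add: S_def ln_div)
  qed
  have "V constant_on S"
  proof (rule maximum_modulus_principle[OF Vhol \<open>open S\<close> convex_connected[OF \<open>convex S\<close>] \<open>open S\<close> order_refl])
    show "Ln x0 \<in> S" using LnS x0 RD by auto
    show "norm (V z) \<le> norm (V (Ln x0))" if "z \<in> S" for z
      using nV max expS that x0nz by simp
  qed
  then obtain k where k: "\<And>t. t \<in> S \<Longrightarrow> V t = k" by (auto simp: constant_on_def)
  have E: "E (exp t) = k * exp (of_real \<alpha> * t)" if "t \<in> S" for t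
    using k[OF that] by (simp add: V_def exp_minus field_simps)
  \<comment> \<open>One test point suffices: \<tau> and \<tau> + ln p are symmetric about 0 and both
    lie in the strip. Comparing \<open>E\<close> there gives k * c = - c * k, whence k = 0.\<close>
  define \<tau> where "\<tau> = - ln p / 2"
  have \<tau>: "0 < \<tau>" "\<tau> < - ln p" using lnp by (auto simp: \<tau>_def)
  have S1: "complex_of_real \<tau> \<in> S" "complex_of_real (\<tau> + ln p) \<in> S" using \<tau> lnp by (auto simp: S_def)
  have ex: "exp (complex_of_real (\<tau> + ln p)) = of_real p * exp (of_real \<tau>)"
  proof -
    have "exp (complex_of_real (ln p)) = of_real p" using p by (metis exp_ln exp_of_real)
    then show ?thesis by (simp add: exp_add mult.commute)
  qed
  have "norm (exp (complex_of_real \<tau>)) = exp \<tau>" by simp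
  moreover have "exp \<tau> < 1 / p" using \<tau> p by (metis exp_less_cancel_iff exp_ln exp_minus inverse_eq_divide)
  ultimately have "E (of_real p * exp (of_real \<tau>)) = - of_real c * E (exp (of_real \<tau>))"
    using per[of "exp (of_real \<tau>)"] \<tau> by simp
  then have "k * exp (of_real \<alpha> * of_real (\<tau> + ln p)) = - of_real c * (k * exp (of_real \<alpha> * of_real \<tau>))"
    using E[OF S1(1)] E[OF S1(2)] ex by simp
  moreover have "exp (complex_of_real \<alpha> * of_real (\<tau> + ln p)) = of_real c * exp (of_real \<alpha> * of_real \<tau>)"
  proof -
    have "exp (\<alpha> * (\<tau> + ln p)) = c * exp (\<alpha> * \<tau>)"
      using pa p by (simp add: powr_def distrib_left exp_add mult.commute)
    then show ?thesis by (metis exp_of_real of_real_mult)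
  qed
  ultimately have "k = 0" using c by (simp add: eq_neg_iff_add_eq_0 flip: distrib_left)
  with E[OF LnS[of x]] x p show ?thesis
    by (metis (mono_tags, lifting) D_def exp_Ln mem_Collect_eq mult_zero_left norm_zero order_less_trans less_irrefl)
qed

lemma has_sum_int:
  fixes f :: "int \<Rightarrow> complex"
  assumes "summable (\<lambda>n. norm (f (int n)))" "summable (\<lambda>n. norm (f (- int (Suc n))))"
  shows "(f has_sum ((\<Sum>n. f (int n)) + (\<Sum>n. f (- int (Suc n))))) UNIV"
proof -
  have 1: "(f has_sum (\<Sum>n. f (int n))) {0..}"
  proof -
    have "((\<lambda>n. f (int n)) has_sum (\<Sum>n. f (int n))) UNIV"
      using assms(1) by (intro norm_summable_imp_has_sum summable_sums summable_norm_cancel[OF assms(1)])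
    moreover have "bij_betw int UNIV {0..}"
      by (rule bij_betwI[of _ _ _ nat]) auto
    ultimately show ?thesis using has_sum_reindex_bij_betw by blast
  qed
  have 2: "(f has_sum (\<Sum>n. f (- int (Suc n)))) {..<0}"
  proof -
    have "((\<lambda>n. f (- int (Suc n))) has_sum (\<Sum>n. f (- int (Suc n)))) UNIV"
      using assms(2) by (intro norm_summable_imp_has_sum summable_sums summable_norm_cancel[OF assms(2)])
    moreover have "bij_betw (\<lambda>n. - int (Suc n)) UNIV {..<0}"
      by (rule bij_betwI[of _ _ _ "\<lambda>k. nat (- k - 1)"]) auto
    ultimately show ?thesis using has_sum_reindex_bij_betw[of "\<lambda>n. - int (Suc n)" UNIV "{..<0}" f] by blast
  qed
  have "{0..} \<union> {..<0} = (UNIV::int set)" by auto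
  then show ?thesis using has_sum_Un_disjoint[OF 1 2] by (simp add: ivl_disj_int Int_commute disjoint_iff)
qed

section \<open>The weighted Szego kernel and Blaschke factors\<close>

lemma eventually_nonzero_simple:
  assumes "g holomorphic_on S" "open S" "z \<in> S" "g z = 0 \<Longrightarrow> deriv g z \<noteq> 0"
  shows "\<forall>\<^sub>F w in at z. g w \<noteq> 0"
proof -
  have dg: "(g has_field_derivative deriv g z) (at z)"
    using assms by (auto intro: holomorphic_derivI)
  show ?thesis
  proof (cases "g z = 0")
    case True
    then have "\<forall>\<^sub>F w in at z. (g w - g z) / (w - z) \<noteq> 0"
      using dg assms(4) by (intro tendsto_imp_eventually_ne) (auto simp: has_field_derivative_iff)
    then show ?thesis by eventually_elim (use True in auto)
  next
    case False
    have "isCont g z" using dg DERIV_isCont by blast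
    then show ?thesis using False by (simp add: isCont_def tendsto_imp_eventually_ne)
  qed
qed

text \<open>A zero of \<open>g\<close> at z is at worst simple, hence isolated, so the other factor
  vanishes on a punctured neighbourhood and, by continuity, at z itself. This allows a
  quasi-periodicity relation to be divided by a theta product that has zeros.\<close>

lemma mult_eq_0_cancel_simple:
  fixes \<phi> :: "complex \<Rightarrow> complex"
  assumes "g holomorphic_on S" "open S" "z \<in> S" "g z = 0 \<Longrightarrow> deriv g z \<noteq> 0"
    and "isCont \<phi> z" "\<And>w. w \<in> S \<Longrightarrow> \<phi> w * g w = 0"
  shows "\<phi> z = 0"
proof -
  have "\<forall>\<^sub>F w in at z. w \<in> S" using assms(2,3) by (rule eventually_at_in_open')
  moreover have "\<forall>\<^sub>F w in at z. g w \<noteq> 0"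
    using assms(1-4) by (intro eventually_nonzero_simple)
  ultimately have "\<forall>\<^sub>F w in at z. \<phi> w = 0"
    by eventually_elim (use assms(6) in auto)
  then have "(\<phi> \<longlongrightarrow> 0) (at z)" by (rule tendsto_eventually)
  moreover have "(\<phi> \<longlongrightarrow> \<phi> z) (at z)" using assms(5) by (simp add: isCont_def)
  ultimately show ?thesis by (metis LIM_unique)
qed

text \<open>For q = 0 this is (z - a) / (1 - cnj a * z), the Blaschke factor of the disc. In the
  annulus its only zero is again a.\<close>

definition blaschke :: "real \<Rightarrow> complex \<Rightarrow> complex \<Rightarrow> complex" where
  "blaschke q a z = z * theta q (a / z) / theta q (cnj a * z)"

context
  fixes q :: real assumes q: "0 < q" "q < 1"
begin

lemma annulus_mult:
  assumes "z \<in> annulus q" "w \<in> annulus q"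
  shows "q\<^sup>2 < norm (z * w)" "norm (z * w) < 1"
proof -
  have "q * q < norm z * norm w" using assms q by (intro mult_strict_mono) (auto simp: annulus_def)
  then show "q\<^sup>2 < norm (z * w)" by (simp add: norm_mult power2_eq_square)
  have "norm z * norm w < 1 * 1" using assms q by (intro mult_strict_mono) (auto simp: annulus_def)
  then show "norm (z * w) < 1" by (simp add: norm_mult)
qed

lemma annulus_cnj: "z \<in> annulus q \<Longrightarrow> cnj z \<in> annulus q" by (simp add: annulus_def)

lemma annulus_nonzero: "z \<in> annulus q \<Longrightarrow> z \<noteq> 0" using q by (auto simp: annulus_def)

text \<open>Both sides are read as functions of z. Replacing z by q^2 z multiplies them by the same
  factor, and their difference vanishes at z = a and z = 1 / y, hence on the orbits of these points.
  Dividing by the theta product \<open>g\<close>, which has exactly these zeros, gives a holomorphic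
  function on the punctured plane with multiplier - q^2 / (r a b). Since a * b is a positive real
  (later b = cnj a), this multiplier is a negative real, the situation of
  \<open>quasi_periodic_zero\<close>.\<close>

lemma weierstrass_addition:
  assumes r: "0 < r" and ann: "a \<in> annulus q" "b \<in> annulus q" "y \<in> annulus q" "z \<in> annulus q"
    and ab: "a * b = of_real t"  "0 < t"
  shows "theta q (- of_real r * z * y) * theta q (- of_real r * a * b) * theta q (z * b) * theta q (a * y) -
         theta q (- of_real r * z * b) * theta q (- of_real r * a * y) * theta q (z * y) * theta q (a * b) =
         theta q (- of_real r) * z * y * theta q (a / z) * theta q (b / y) * theta q (- of_real r * a * b * z * y)"
    (is "?L z = ?R z")
proof -
  let ?p = "complex_of_real (q\<^sup>2)" and ?r = "complex_of_real r"
  define D where "D z = ?L z - ?R z" for z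
  define g where "g z = theta q (a / z) * theta q (z * y)" for z
  have nz: "a \<noteq> 0" "b \<noteq> 0" "y \<noteq> 0" "?r \<noteq> 0" "?p \<noteq> 0" using ann annulus_nonzero r q by auto
  have pq: "0 < q\<^sup>2" "q\<^sup>2 < 1" using q2[OF q] .
  let ?S = "- {0::complex}"
  have S: "open ?S" by auto
  have Dhol: "D holomorphic_on ?S" unfolding D_def using nz q by (intro holomorphic_intros) auto
  have ghol: "g holomorphic_on ?S" unfolding g_def using nz q by (intro holomorphic_intros) auto
  have sh: "theta q (c * (?p * z)) = - theta q (c * z) / (c * z)" if "c \<noteq> 0" "z \<noteq> 0" for c z
    using theta_shift[OF q, of "c * z"] that by (simp add: mult_ac)
  have sh': "theta q (c / (?p * z)) = - (c / (?p * z)) * theta q (c / z)" if "c \<noteq> 0" "z \<noteq> 0" for c z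
    using theta_shift[OF q, of "c / (?p * z)"] that nz by (simp add: field_simps)
  have Dper: "D (?p * z) = - 1 / (?r * b * y * z\<^sup>2) * D z" if z: "z \<noteq> 0" for z
  proof -
    have e: "theta q (- ?r * (?p * z) * y) = theta q (- ?r * z * y) / (?r * z * y)"
      "theta q ((?p * z) * b) = - theta q (z * b) / (z * b)"
      "theta q (- ?r * (?p * z) * b) = theta q (- ?r * z * b) / (?r * z * b)"
      "theta q ((?p * z) * y) = - theta q (z * y) / (z * y)"
      "theta q (- ?r * a * b * (?p * z) * y) = theta q (- ?r * a * b * z * y) / (?r * a * b * z * y)"
      using sh[of "- ?r * y" z] sh[of b z] sh[of "- ?r * b" z] sh[of y z] sh[of "- ?r * a * b * y" z] z nz
      by (simp_all add: mult_ac)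
    show ?thesis unfolding D_def e sh'[OF nz(1) z] using z nz
      by (simp add: field_simps power2_eq_square)
  qed
  have gper: "g (?p * z) = a / (?p * z\<^sup>2 * y) * g z" if z: "z \<noteq> 0" for z
  proof -
    have e: "theta q ((?p * z) * y) = - theta q (z * y) / (z * y)"
      using sh[of y z] z nz by (simp_all add: mult_ac)
    show ?thesis unfolding g_def e sh'[OF nz(1) z] using z nz
      by (simp add: field_simps power2_eq_square)
  qed
  have Dz: "D (?p powi k * z) = 0" if "D z = 0" "z \<noteq> 0" for k z
  proof (induction k rule: int_induct[of _ 0])
    case base then show ?case using that by simp
  next
    case (step1 i)
    then show ?case using Dper[of "?p powi i * z"] nz that by (simp add: power_int_add mult_ac)
  next
    case (step2 i)
    have "?p * (?p powi (i - 1) * z) = ?p powi i * z" using nz by (simp add: power_int_diff)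
    then have "D (?p powi (i - 1) * z) = 0 \<or> - 1 / (?r * b * y * (?p powi (i - 1) * z)\<^sup>2) = 0"
      using Dper[of "?p powi (i - 1) * z"] step2 nz that by (metis mult_eq_0_iff power_int_eq_0_iff)
    then show ?case using nz that by auto
  qed
  have Da: "D a = 0" unfolding D_def using nz q by (simp add: mult_ac)
  have Dy: "D (1 / y) = 0" unfolding D_def using nz q by (simp add: mult_ac)
  have thay: "theta q (a * y) \<noteq> 0" using theta_nonzero[OF q] annulus_mult[OF ann(1,3)] by blast
  have zero: "D z = 0 \<and> deriv g z \<noteq> 0" if "z \<in> ?S" "g z = 0" for z
  proof -
    have z: "z \<noteq> 0" using that by simp
    have d1: "((\<lambda>z. theta q (a / z)) has_field_derivative deriv (theta q) (a / z) * (- a / z\<^sup>2)) (at z)"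
    proof -
      have "((\<lambda>z. a / z) has_field_derivative (- a / z\<^sup>2)) (at z)"
        using z by (auto intro!: derivative_eq_intros simp: power2_eq_square)
      moreover have "a / z \<noteq> 0" using z nz by simp
      ultimately show ?thesis using DERIV_chain2[where g = "\<lambda>z. a / z", OF theta_has_deriv[OF q]] by blast
    qed
    have d2: "((\<lambda>z. theta q (z * y)) has_field_derivative deriv (theta q) (z * y) * y) (at z)"
    proof -
      have "((\<lambda>z. z * y) has_field_derivative y) (at z)"
        by (auto intro!: derivative_eq_intros)
      moreover have "z * y \<noteq> 0" using z nz by simp
      ultimately show ?thesis using DERIV_chain2[where g = "\<lambda>z. z * y", OF theta_has_deriv[OF q]] by blast
    qed
    have dg: "deriv g z = deriv (theta q) (a / z) * (- a / z\<^sup>2) * theta q (z * y) + deriv (theta q) (z * y) * y * theta q (a / z)"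
      unfolding g_def using DERIV_imp_deriv[OF DERIV_mult[OF d1 d2]] by simp
    \<comment> \<open>The two zero orbits of \<open>g\<close> are disjoint: otherwise a * y would be
      a power of q^2, against q^2 < |a * y| < 1. Hence every zero of \<open>g\<close> is
      simple.\<close>
    have notboth: "\<not> (theta q (a / z) = 0 \<and> theta q (z * y) = 0)"
    proof
      assume "theta q (a / z) = 0 \<and> theta q (z * y) = 0"
      then obtain k j where "a / z = ?p powi k" "z * y = ?p powi j"
        using theta_eq_0D[OF q] z nz by (metis divide_eq_0_iff mult_eq_0_iff)
      then have "a * y = ?p powi (k + j)" using z nz by (simp add: power_int_add field_simps)
      then show False using thay theta_shift_powi[OF q] by simp
    qed
    from that have "theta q (a / z) = 0 \<or> theta q (z * y) = 0" by (auto simp: g_def)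
    then show ?thesis
    proof
      assume 0: "theta q (a / z) = 0"
      then obtain k where "a / z = ?p powi k" using theta_eq_0D[OF q] z nz by (metis divide_eq_0_iff)
      then have "z = ?p powi (- k) * a" using z nz by (simp add: power_int_minus field_simps)
      then have "D z = 0" using Dz[OF Da nz(1)] by simp
      moreover have "deriv (theta q) (a / z) \<noteq> 0" using 0 deriv_theta_zero[OF q] z nz by simp
      ultimately show ?thesis using dg 0 notboth z nz by simp
    next
      assume 0: "theta q (z * y) = 0"
      then obtain k where "z * y = ?p powi k" using theta_eq_0D[OF q] z nz by (metis mult_eq_0_iff)
      then have "z = ?p powi k * (1 / y)" using z nz by (simp add: field_simps)
      then have "D z = 0" using Dz[OF Dy] nz by simp
      moreover have "deriv (theta q) (z * y) \<noteq> 0" using 0 deriv_theta_zero[OF q] z nz by simp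
      ultimately show ?thesis using dg 0 notboth z nz by simp
    qed
  qed
  obtain Q where Q: "Q holomorphic_on ?S" "\<And>z. z \<in> ?S \<Longrightarrow> D z = Q z * g z"
    using holomorphic_division[OF S Dhol ghol zero] by blast
  define c where "c = q\<^sup>2 / (r * t)"
  have c: "c > 0" using r ab q by (simp add: c_def)
  have Qper: "Q (?p * z) = - of_real c * Q z" if z: "z \<noteq> 0" for z
  proof -
    have "Q (?p * z) + of_real c * Q z = 0"
    proof (rule mult_eq_0_cancel_simple[OF ghol S, where z = z and \<phi> = "\<lambda>z. Q (?p * z) + of_real c * Q z"])
      show "z \<in> ?S" using z by simp
      show "deriv g z \<noteq> 0" if "g z = 0" using zero[OF _ that] z by simp
      have h: "(\<lambda>z. Q (?p * z) + of_real c * Q z) holomorphic_on ?S"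
        using nz by (intro holomorphic_intros Q(1) holomorphic_on_compose_gen[of "\<lambda>z. ?p * z" _ Q ?S, unfolded o_def]) auto
      show "isCont (\<lambda>z. Q (?p * z) + of_real c * Q z) z"
        using continuous_on_interior[OF holomorphic_on_imp_continuous_on[OF h]] z S by (simp add: interior_open)
      fix w assume w: "w \<in> ?S"
      have "Q (?p * w) * (a / (?p * w\<^sup>2 * y) * g w) = - 1 / (?r * b * y * w\<^sup>2) * (Q w * g w)"
        using Q(2)[of "?p * w"] Q(2)[of w] w nz Dper[of w] gper[of w] by simp
      then have "Q (?p * w) * g w = - (?p / (?r * (a * b))) * (Q w * g w)"
        using w nz by (simp add: field_simps)
      then show "(Q (?p * w) + of_real c * Q w) * g w = 0"
        unfolding ab c_def by (simp add: algebra_simps)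
    qed
    then show ?thesis by (simp add: eq_neg_iff_add_eq_0)
  qed
  have "Q z = 0"
  proof (rule quasi_periodic_zero[where E = Q and x = z, OF pq c])
    show "Q holomorphic_on {x. q\<^sup>2 < norm x \<and> norm x < 1 / q\<^sup>2}"
      using pq by (intro holomorphic_on_subset[OF Q(1)]) auto
    show "Q (?p * x) = - of_real c * Q x" if "1 < norm x" for x
      using Qper[of x] that by fastforce
    have "q * q < q * 1" using q by (intro mult_strict_left_mono) auto
    then show "q\<^sup>2 < norm z" using ann(4) by (simp add: annulus_def power2_eq_square)
    have "1 < 1 / q\<^sup>2" using pq by simp
    then show "norm z < 1 / q\<^sup>2" using ann(4) by (simp add: annulus_def)
  qed
  then have "D z = 0" using Q(2)[of z] annulus_nonzero[OF ann(4)] by simp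
  then show ?thesis by (simp add: D_def)
qed

section \<open>The bilateral series of the kernel\<close>

context
  fixes s :: real assumes s: "0 < s"
begin

text \<open>The halves of the bilateral series. The negative indices, collected in
  \<open>lau_neg\<close>, are written in the variable q^2 / x after numerator and denominator have
  been multiplied by the matching power of q^2; both halves are then power series in the unit
  disc.\<close>

definition lau_pos :: "complex \<Rightarrow> complex" where
  "lau_pos y = (\<Sum>n. y ^ n / of_real (1 + s * (q\<^sup>2) ^ n))"
definition lau_neg :: "complex \<Rightarrow> complex" where
  "lau_neg y = y * (\<Sum>n. y ^ n / of_real (s + (q\<^sup>2) ^ Suc n))"

lemma summable_lau_pos:
  fixes y :: complex
  assumes "norm y < 1" shows "summable (\<lambda>n. norm (y ^ n / of_real (1 + s * (q\<^sup>2) ^ n)))"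
proof (rule summable_comparison_test')
  show "summable (\<lambda>n. norm y ^ n)" using assms by (simp add: summable_geometric)
  fix n :: nat
  have "1 \<le> 1 + s * (q\<^sup>2) ^ n" using s by simp
  then have "norm y ^ n / (1 + s * (q\<^sup>2) ^ n) \<le> norm y ^ n / 1" by (intro divide_left_mono) auto
  moreover have "1 + s * (q\<^sup>2) ^ n > 0" using s by (intro add_pos_nonneg) auto
  ultimately show "norm (norm (y ^ n / of_real (1 + s * (q\<^sup>2) ^ n))) \<le> norm y ^ n"
    using s by (simp add: norm_divide norm_power del: of_real_add of_real_mult)
qed

lemma summable_lau_neg:
  fixes y :: complex
  assumes "norm y < 1" shows "summable (\<lambda>n. norm (y ^ n / of_real (s + (q\<^sup>2) ^ Suc n)))"
proof (rule summable_comparison_test')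
  show "summable (\<lambda>n. norm y ^ n / s)" using assms by (simp add: summable_geometric summable_divide)
  fix n :: nat
  have 1: "s \<le> s + (q\<^sup>2) ^ Suc n" by simp
  have 2: "s + (q\<^sup>2) ^ Suc n > 0" using s by (intro add_pos_nonneg) auto
  have "norm y ^ n / (s + (q\<^sup>2) ^ Suc n) \<le> norm y ^ n / s" using s 1 2
    by (intro divide_left_mono mult_pos_pos) auto
  with 2 show "norm (norm (y ^ n / of_real (s + (q\<^sup>2) ^ Suc n))) \<le> norm y ^ n / s"
    using s by (simp add: norm_divide norm_power del: of_real_add of_real_mult power_Suc)
qed

lemma lau_pos_holomorphic: "lau_pos holomorphic_on ball 0 1"
proof -
  have "((\<lambda>n. (1 / of_real (1 + s * (q\<^sup>2) ^ n)) * (w - 0) ^ n) sums lau_pos w)" if "w \<in> ball 0 1" for w :: complex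
    unfolding lau_pos_def using summable_sums[OF summable_norm_cancel[OF summable_lau_pos[of w]]] that by simp
  then show ?thesis by (rule power_series_holomorphic)
qed

lemma lau_neg_holomorphic: "lau_neg holomorphic_on ball 0 1"
proof -
  have "((\<lambda>n. (1 / of_real (s + (q\<^sup>2) ^ Suc n)) * (w - 0) ^ n) sums (\<Sum>n. w ^ n / of_real (s + (q\<^sup>2) ^ Suc n)))" if "w \<in> ball 0 1" for w :: complex
    using summable_sums[OF summable_norm_cancel[OF summable_lau_neg[of w]]] that by simp
  then have "(\<lambda>w. \<Sum>n. w ^ n / complex_of_real (s + (q\<^sup>2) ^ Suc n)) holomorphic_on ball 0 1" by (rule power_series_holomorphic)
  then show ?thesis unfolding lau_neg_def by (intro holomorphic_intros)
qed

text \<open>The combination multiplies the n-th coefficient by 1 + s q^(2n), which cancels its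
  denominator and leaves a geometric series. Together with \<open>lau_neg_rec\<close> this continues
  the kernel beyond its annulus of convergence.\<close>

lemma lau_pos_rec:
  assumes "norm y < 1" shows "lau_pos y + of_real s * lau_pos (of_real (q\<^sup>2) * y) = 1 / (1 - y)"
proof -
  have py: "norm (of_real (q\<^sup>2) * y) < 1"
    using assms q2[OF q] mult_strict_mono'[of "q\<^sup>2" 1 "norm y" 1] by (simp add: norm_mult norm_power)
  note 1 = summable_norm_cancel[OF summable_lau_pos[OF assms]]
  note 2 = summable_norm_cancel[OF summable_lau_pos[OF py]]
  have "lau_pos y + of_real s * lau_pos (of_real (q\<^sup>2) * y) =
     (\<Sum>n. y ^ n / of_real (1 + s * (q\<^sup>2) ^ n) + of_real s * ((of_real (q\<^sup>2) * y) ^ n / of_real (1 + s * (q\<^sup>2) ^ n)))"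
    unfolding lau_pos_def suminf_mult[OF 2, of "of_real s", symmetric] by (rule suminf_add[OF 1 summable_mult[OF 2]])
  also have "(\<lambda>n. y ^ n / of_real (1 + s * (q\<^sup>2) ^ n) + of_real s * ((of_real (q\<^sup>2) * y) ^ n / of_real (1 + s * (q\<^sup>2) ^ n))) = (\<lambda>n. y ^ n)"
  proof
    fix n
    have "1 + s * (q\<^sup>2) ^ n \<noteq> 0" using s add_pos_nonneg[of 1 "s * (q\<^sup>2) ^ n"] by simp
    then have "complex_of_real (1 + s * (q\<^sup>2) ^ n) \<noteq> 0" unfolding of_real_eq_0_iff .
    moreover have "y ^ n / c + of_real s * ((of_real (q\<^sup>2) * y) ^ n / c) = y ^ n * (1 + of_real s * of_real (q\<^sup>2) ^ n) / c" for c
      by (simp add: power_mult_distrib algebra_simps add_divide_distrib)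
    ultimately show "y ^ n / of_real (1 + s * (q\<^sup>2) ^ n) + of_real s * ((of_real (q\<^sup>2) * y) ^ n / of_real (1 + s * (q\<^sup>2) ^ n)) = y ^ n"
      by simp
  qed
  finally show ?thesis using suminf_geometric[OF assms] by simp
qed

lemma lau_neg_rec:
  assumes "norm y < 1" shows "of_real s * lau_neg y + lau_neg (of_real (q\<^sup>2) * y) = y / (1 - y)"
proof -
  have py: "norm (of_real (q\<^sup>2) * y) < 1"
    using assms q2[OF q] mult_strict_mono'[of "q\<^sup>2" 1 "norm y" 1] by (simp add: norm_mult norm_power)
  note 1 = summable_norm_cancel[OF summable_lau_neg[OF assms]]
  note 2 = summable_norm_cancel[OF summable_lau_neg[OF py]]
  have "of_real s * lau_neg y + lau_neg (of_real (q\<^sup>2) * y) = y * (of_real s * (\<Sum>n. y ^ n / of_real (s + (q\<^sup>2) ^ Suc n))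
     + of_real (q\<^sup>2) * (\<Sum>n. (of_real (q\<^sup>2) * y) ^ n / of_real (s + (q\<^sup>2) ^ Suc n)))"
    unfolding lau_neg_def by (simp add: algebra_simps)
  also have "\<dots> = y * (\<Sum>n. of_real s * (y ^ n / of_real (s + (q\<^sup>2) ^ Suc n)) + of_real (q\<^sup>2) * ((of_real (q\<^sup>2) * y) ^ n / of_real (s + (q\<^sup>2) ^ Suc n)))"
    unfolding suminf_mult[OF 2, of "of_real (q\<^sup>2)", symmetric] suminf_mult[OF 1, of "of_real s", symmetric]
    by (subst suminf_add[OF summable_mult[OF 1] summable_mult[OF 2]]) (rule refl)
  also have "(\<lambda>n. of_real s * (y ^ n / of_real (s + (q\<^sup>2) ^ Suc n)) + of_real (q\<^sup>2) * ((of_real (q\<^sup>2) * y) ^ n / of_real (s + (q\<^sup>2) ^ Suc n))) = (\<lambda>n. y ^ n)"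
  proof
    fix n
    have "s + (q\<^sup>2) ^ Suc n \<noteq> 0" using s add_pos_nonneg[of s "(q\<^sup>2) ^ Suc n"] by simp
    then have "complex_of_real (s + (q\<^sup>2) ^ Suc n) \<noteq> 0" unfolding of_real_eq_0_iff .
    moreover have "of_real s * (y ^ n / c) + of_real (q\<^sup>2) * ((of_real (q\<^sup>2) * y) ^ n / c) = y ^ n * (of_real s + of_real (q\<^sup>2) ^ Suc n) / c" for c
      by (simp add: power_mult_distrib algebra_simps add_divide_distrib)
    ultimately show "of_real s * (y ^ n / of_real (s + (q\<^sup>2) ^ Suc n)) + of_real (q\<^sup>2) * ((of_real (q\<^sup>2) * y) ^ n / of_real (s + (q\<^sup>2) ^ Suc n)) = y ^ n"
      by simp
  qed
  finally show ?thesis using suminf_geometric[OF assms] by simp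
qed

lemma has_sum_szego:
  assumes "q\<^sup>2 < norm x" "norm x < 1"
  shows "((\<lambda>n::int. x powi n / of_real (1 + s * q powi (2 * n))) has_sum (lau_pos x + lau_neg (of_real (q\<^sup>2) / x))) UNIV"
proof -
  let ?f = "\<lambda>n::int. x powi n / complex_of_real (1 + s * q powi (2 * n))"
  let ?y = "of_real (q\<^sup>2) / x"
  have x: "x \<noteq> 0" using assms q2[OF q] by auto
  have y: "norm ?y < 1" using assms q2[OF q] by (simp add: norm_divide norm_power divide_less_eq)
  have f1: "?f (int n) = x ^ n / of_real (1 + s * (q\<^sup>2) ^ n)" for n
    by (simp add: power_int_def nat_mult_distrib power_mult)
  have f2: "?f (- int (Suc n)) = ?y * (?y ^ n / of_real (s + (q\<^sup>2) ^ Suc n))" for n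
  proof -
    have p: "(q\<^sup>2) ^ Suc n \<noteq> 0" "s + (q\<^sup>2) ^ Suc n \<noteq> 0"
      using q s add_pos_nonneg[of s "(q\<^sup>2) ^ Suc n"] by auto
    have "q powi (2 * (- int (Suc n))) = 1 / (q\<^sup>2) ^ Suc n"
    proof -
      have "2 * (- int (Suc n)) = - int (2 * Suc n)" by simp
      then have "q powi (2 * (- int (Suc n))) = inverse (q powi (int (2 * Suc n)))"
        by (simp only: power_int_minus)
      also have "q powi int (2 * Suc n) = (q\<^sup>2) ^ Suc n" by (simp only: power_int_of_nat power_mult)
      finally show ?thesis by (simp add: inverse_eq_divide)
    qed
    then have 1: "1 + s * q powi (2 * (- int (Suc n))) = (s + (q\<^sup>2) ^ Suc n) / (q\<^sup>2) ^ Suc n"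
      using p(1) by (simp add: field_simps del: power_Suc)
    have 2: "x powi (- int (Suc n)) = 1 / x ^ Suc n"
      by (simp only: power_int_minus power_int_of_nat inverse_eq_divide)
    show ?thesis unfolding 1 2 by (simp add: power_divide)
  qed
  have s1: "summable (\<lambda>n. norm (?f (int n)))" unfolding f1 using summable_lau_pos assms by blast
  have s2: "summable (\<lambda>n. norm (?f (- int (Suc n))))" unfolding f2 norm_mult[of ?y]
    by (intro summable_mult summable_lau_neg y)
  have "(\<Sum>n. ?f (- int (Suc n))) = lau_neg ?y"
    unfolding f2 lau_neg_def by (rule suminf_mult[OF summable_norm_cancel[OF summable_lau_neg[OF y]]])
  moreover have "(\<Sum>n. ?f (int n)) = lau_pos x" unfolding f1 lau_pos_def ..
  ultimately show ?thesis using has_sum_int[OF s1 s2] by simp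
qed

end

end

section \<open>The kernel as a quotient of theta functions\<close>

context
  fixes q :: real assumes q: "0 < q" "q < 1"
begin

context
  fixes s :: real assumes s: "0 < s"
begin

text \<open>The Jordan-Kronecker identity, a case of Ramanujan's bilateral summation. By
  \<open>lau_pos_rec\<close> the series equals 1 / (1 - x) + \<open>N x\<close>, and
  \<open>N\<close> is holomorphic on the larger annulus q^2 < |x| < 1 / q^2. There \<open>L\<close>
  and \<open>M\<close> are the two sides multiplied by theta. They agree at 1, the only zero of
  theta in this annulus, so (L - M) / theta is holomorphic, and its multiplier is -1 / s. Agreement
  at 1 is what fixes the constant \<open>theta_red q 1\<close>.\<close>

lemma lau_theta:
  assumes x: "q\<^sup>2 < norm x" "norm x < 1"
  shows "lau_pos q s x + lau_neg q s (of_real (q\<^sup>2) / x) =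
    theta_red q 1 * theta q (- of_real s * x) / (theta q (- of_real s) * theta q x)"
proof -
  let ?p = "complex_of_real (q\<^sup>2)"
  have pq: "0 < q\<^sup>2" "q\<^sup>2 < 1" "1 < 1 / q\<^sup>2" using q2[OF q] by auto
  define A where "A = {x::complex. q\<^sup>2 < norm x \<and> norm x < 1 / q\<^sup>2}"
  have A: "open A" unfolding A_def by (intro open_Collect_conj open_Collect_less continuous_intros)
  have Anz: "x \<noteq> 0" if "x \<in> A" for x using that pq by (auto simp: A_def)
  have th0: "theta q (- of_real s) \<noteq> 0" using theta_nonzero_neg[OF q s] .
  define N where "N x = lau_neg q s (?p / x) - of_real s * lau_pos q s (?p * x)" for x
  define L where "L x = theta_red q x * (1 + (1 - x) * N x)" for x
  define M where "M x = theta_red q 1 / theta q (- of_real s) * theta q (- of_real s * x)" for x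
  have i1: "?p / x \<in> ball 0 1" if "x \<in> A" for x
    using that pq Anz[OF that] by (auto simp: A_def norm_divide norm_power divide_less_eq)
  have i2: "?p * x \<in> ball 0 1" if "x \<in> A" for x
    using that pq by (auto simp: A_def norm_mult norm_power field_simps)
  have Nhol: "N holomorphic_on A"
    unfolding N_def using Anz i1 i2
    by (intro holomorphic_intros holomorphic_on_compose_gen[OF _ lau_neg_holomorphic[OF q s], unfolded o_def]
        holomorphic_on_compose_gen[OF _ lau_pos_holomorphic[OF q s], unfolded o_def]) auto
  have Lhol: "(\<lambda>x. L x - M x) holomorphic_on A"
    unfolding L_def M_def using Anz q s by (intro holomorphic_intros Nhol) auto
  have thol: "theta q holomorphic_on A"
    using theta_holomorphic[OF q, of "\<lambda>x. x" A] Anz by auto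
  have tz: "x = 1" if "theta q x = 0" "x \<in> A" for x
    using that theta_red_nonzero[OF q, of x] by (auto simp: A_def theta_factor[OF q])
  have zero: "L x - M x = 0 \<and> deriv (theta q) x \<noteq> 0" if "x \<in> A" "theta q x = 0" for x
    using tz[OF that(2,1)] th0 DERIV_imp_deriv[OF deriv_theta_1[OF q]] theta_red_1_nonzero[OF q]
    by (simp add: L_def M_def)
  obtain Q where Q: "Q holomorphic_on A" "\<And>x. x \<in> A \<Longrightarrow> L x - M x = Q x * theta q x"
    using holomorphic_division[OF A Lhol thol zero] by blast
  have Nl: "1 / (1 - x) + N x = lau_pos q s x + lau_neg q s (?p / x)" if "norm x < 1" for x
    using lau_pos_rec[OF q s that] by (simp add: N_def algebra_simps)
  have Lx: "L x = theta q x * (1 / (1 - x) + N x)" if "x \<noteq> 1" for x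
    unfolding L_def theta_factor[OF q] using that by (simp add: field_simps)
  have Qper: "Q (?p * x) = - of_real (1 / s) * Q x" if x: "1 < norm x" "norm x < 1 / q\<^sup>2" for x
  proof -
    have xA: "x \<in> A" using x pq by (simp add: A_def)
    have x0: "x \<noteq> 0" "x \<noteq> 1" using x by auto
    have npx: "norm (?p * x) = q\<^sup>2 * norm x" by (simp add: norm_mult norm_power)
    have npx1: "q\<^sup>2 * norm x < 1" using x pq by (simp add: field_simps)
    have pxA: "?p * x \<in> A" "?p * x \<noteq> 1" unfolding A_def using npx npx1 x pq by (auto simp: npx)
    have n1: "norm (1 / x) < 1" using x by (simp add: norm_divide divide_less_eq)
    have ne: "1 - 1 / x \<noteq> 0" using x0 by simp
    have "lau_pos q s (?p * x) + lau_neg q s (?p / (?p * x)) = - 1 / of_real s * (1 / (1 - x) + N x)"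
    proof -
      have "lau_neg q s (?p / (?p * x)) = lau_neg q s (1 / x)" using q by simp
      moreover have "of_real s * lau_neg q s (1 / x) + lau_neg q s (?p / x) = 1 / (x - 1)"
        using lau_neg_rec[OF q s n1] x0 by (simp add: field_simps)
      moreover have "1 / (x - 1) = - (1 / (1 - x))" by (simp add: minus_divide_right)
      ultimately have "of_real s * lau_neg q s (?p / (?p * x)) = - (1 / (1 - x)) - lau_neg q s (?p / x)"
        by (simp add: algebra_simps)
      then have "of_real s * (lau_pos q s (?p * x) + lau_neg q s (?p / (?p * x))) = - (1 / (1 - x) + N x)"
        by (simp add: N_def algebra_simps)
      then show ?thesis using s by (simp add: field_simps)
    qed
    then have N': "1 / (1 - ?p * x) + N (?p * x) = - 1 / of_real s * (1 / (1 - x) + N x)"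
      using Nl[of "?p * x"] npx npx1 by simp
    have L': "L (?p * x) = L x / (of_real s * x)"
      unfolding Lx[OF pxA(2)] Lx[OF x0(2)] N' theta_shift[OF q x0(1)] by simp
    have M': "M (?p * x) = M x / (of_real s * x)"
      unfolding M_def using theta_shift[OF q, of "- of_real s * x"] s x0 by (simp add: mult_ac)
    have "Q (?p * x) * theta q (?p * x) = (Q x * theta q x) / (of_real s * x)"
      using Q(2)[OF pxA(1)] Q(2)[OF xA] L' M' by (metis diff_divide_distrib)
    then have *: "Q x * theta q x = - (of_real s * (theta q x * Q (?p * x)))"
      unfolding theta_shift[OF q x0(1)] using s x0 by (simp add: field_simps)
    have "(Q (?p * x) + of_real (1 / s) * Q x) * theta q x =
        (of_real s * (theta q x * Q (?p * x)) + Q x * theta q x) / of_real s"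
      using s by (simp add: field_simps)
    then have "(Q (?p * x) + of_real (1 / s) * Q x) * theta q x = 0"
      unfolding * by simp
    moreover have "theta q x \<noteq> 0" using tz xA x0 by blast
    ultimately show ?thesis by (simp add: eq_neg_iff_add_eq_0)
  qed
  have x1: "norm x < 1 / q\<^sup>2" using x pq by linarith
  have "Q x = 0"
    by (rule quasi_periodic_zero[where E = Q and x = x, OF pq(1,2) _ _ Qper])
       (use s Q x x1 in \<open>auto simp: A_def\<close>)
  moreover have "x \<in> A" "x \<noteq> 1" using x x1 by (auto simp: A_def)
  ultimately have "L x = M x" using Q(2)[of x] by simp
  then have "theta q x * (lau_pos q s x + lau_neg q s (?p / x)) = M x"
    using Lx[OF \<open>x \<noteq> 1\<close>] Nl[OF x(2)] by simp
  moreover have "theta q x \<noteq> 0" using theta_nonzero[OF q x] .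
  ultimately show ?thesis unfolding M_def using th0 by (simp add: field_simps)
qed

lemma has_sum_szego_kernel:
  assumes "z \<in> annulus q" "w \<in> annulus q"
  shows "((\<lambda>n::int. (z * cnj w) powi n / of_real (1 + s * q powi (2 * n))) has_sum szego_kernel q z w s) UNIV"
  using has_sum_szego[OF q s, of "z * cnj w"] annulus_mult[OF q assms(1) annulus_cnj[OF q assms(2)]]
  unfolding szego_kernel_def by (metis (no_types, lifting) infsumI)

lemma szego_kernel_theta:
  assumes "z \<in> annulus q" "w \<in> annulus q"
  shows "szego_kernel q z w s =
    theta_red q 1 * theta q (- of_real s * z * cnj w) / (theta q (- of_real s) * theta q (z * cnj w))"
  using infsumI[OF has_sum_szego_kernel[OF assms]] lau_theta[of "z * cnj w"]
    infsumI[OF has_sum_szego[OF q s, of "z * cnj w"]] annulus_mult[OF q assms(1) annulus_cnj[OF q assms(2)]]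
  by (simp add: mult.assoc)

end

text \<open>Divided by the diagonal entry at a, the left side is the reproducing kernel of the
  functions vanishing at a. Clearing denominators in the theta quotients leaves exactly
  \<open>weierstrass_addition\<close> with b = cnj a and y = cnj w.\<close>

lemma szego_kernel_schur:
  assumes s: "0 < s" and ann: "z \<in> annulus q" "w \<in> annulus q" "a \<in> annulus q"
  shows "szego_kernel q z w s * szego_kernel q a a s - szego_kernel q z a s * szego_kernel q a w s =
    szego_kernel q a a s * blaschke q a z * cnj (blaschke q a w) * szego_kernel q z w (s * (norm a)\<^sup>2)"
proof -
  have a0: "a \<noteq> 0" "z \<noteq> 0" "w \<noteq> 0" using ann annulus_nonzero[OF q] by auto
  have aa: "a * cnj a = of_real ((norm a)\<^sup>2)" by (metis complex_norm_square of_real_power)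
  have sa: "0 < s * (norm a)\<^sup>2" using s a0 by simp
  note c = annulus_cnj[OF q]
  note nzm = theta_nonzero[OF q annulus_mult[OF q]]
  have nz: "theta q (z * cnj w) \<noteq> 0" "theta q (a * cnj a) \<noteq> 0" "theta q (z * cnj a) \<noteq> 0" "theta q (a * cnj w) \<noteq> 0"
    using nzm ann c by blast+
  have nz2: "theta q (- of_real s) \<noteq> 0" "theta q (- (of_real s * of_real ((norm a)\<^sup>2))) \<noteq> 0"
    using theta_nonzero_neg[OF q s] theta_nonzero_neg[OF q sa] by simp_all
  have cb: "cnj (blaschke q a w) = cnj w * theta q (cnj a / cnj w) / theta q (a * cnj w)"
    by (simp add: blaschke_def flip: theta_cnj[OF q])
  have add: "theta q (- of_real s * z * cnj w) * theta q (- of_real s * a * cnj a) * theta q (z * cnj a) * theta q (a * cnj w) -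
         theta q (- of_real s * z * cnj a) * theta q (- of_real s * a * cnj w) * theta q (z * cnj w) * theta q (a * cnj a) =
         theta q (- of_real s) * z * cnj w * theta q (a / z) * theta q (cnj a / cnj w) * theta q (- of_real s * a * cnj a * z * cnj w)"
    by (rule weierstrass_addition[OF q s ann(3) c[OF ann(3)] c[OF ann(2)] ann(1) aa]) (use a0 in simp)
  define A where "A = theta q (- of_real s * a * cnj a)"
  have A: "A \<noteq> 0" "theta q (- of_real (s * (norm a)\<^sup>2)) = A" unfolding A_def using nz2(2) aa by (simp_all add: mult.assoc)
  have B: "theta q (- of_real (s * (norm a)\<^sup>2) * z * cnj w) = theta q (- of_real s * a * cnj a * z * cnj w)"
    using aa by (simp add: mult.assoc)
  have K': "szego_kernel q z w (s * (norm a)\<^sup>2) = theta_red q 1 * theta q (- of_real s * a * cnj a * z * cnj w) / (A * theta q (z * cnj w))"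
    unfolding szego_kernel_theta[OF sa ann(1,2)] A(2) B ..
  have "szego_kernel q z w s * szego_kernel q a a s - szego_kernel q z a s * szego_kernel q a w s =
     (theta_red q 1 / theta q (- of_real s))\<^sup>2 *
     (theta q (- of_real s * z * cnj w) * A * theta q (z * cnj a) * theta q (a * cnj w) -
         theta q (- of_real s * z * cnj a) * theta q (- of_real s * a * cnj w) * theta q (z * cnj w) * theta q (a * cnj a)) /
     (theta q (z * cnj w) * theta q (a * cnj a) * theta q (z * cnj a) * theta q (a * cnj w))"
    unfolding szego_kernel_theta[OF s ann(1,2)] szego_kernel_theta[OF s ann(3,3)]
      szego_kernel_theta[OF s ann(1,3)] szego_kernel_theta[OF s ann(3,2)] A_def[symmetric]
    using nz nz2 by (simp add: field_simps power2_eq_square)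
  also have "\<dots> = (theta_red q 1 / theta q (- of_real s))\<^sup>2 *
     (theta q (- of_real s) * z * cnj w * theta q (a / z) * theta q (cnj a / cnj w) * theta q (- of_real s * a * cnj a * z * cnj w)) /
     (theta q (z * cnj w) * theta q (a * cnj a) * theta q (z * cnj a) * theta q (a * cnj w))"
    unfolding A_def add ..
  also have "\<dots> = szego_kernel q a a s * blaschke q a z * cnj (blaschke q a w) * szego_kernel q z w (s * (norm a)\<^sup>2)"
    unfolding K' cb szego_kernel_theta[OF s ann(3,3)] A_def[symmetric] unfolding blaschke_def
    using nz nz2 A a0 by (simp add: field_simps power2_eq_square)
  finally show ?thesis .
qed

end

section \<open>Determinants by elimination of the last point\<close>

lemma det_Suc_schur:
  fixes A :: "nat \<Rightarrow> nat \<Rightarrow> 'a::field"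
  assumes "A n n \<noteq> 0"
  shows "Determinant.det (mat (Suc n) (Suc n) (\<lambda>(i, j). A i j)) =
    A n n * Determinant.det (mat n n (\<lambda>(i, j). A i j - A i n * A n j / A n n))"
proof -
  define S where "S = mat n n (\<lambda>(i, j). A i j - A i n * A n j / A n n)"
  define B where "B = mat n 1 (\<lambda>(i, j). A i n / A n n)"
  define R where "R = mat 1 n (\<lambda>(i, j). A n j)"
  define D where "D = mat 1 1 (\<lambda>(i, j). A n n)"
  have car: "S \<in> carrier_mat n n" "B \<in> carrier_mat n 1" "R \<in> carrier_mat 1 n" "D \<in> carrier_mat 1 1"
    by (auto simp: S_def B_def R_def D_def)
  have "four_block_mat (1\<^sub>m n) B (0\<^sub>m 1 n) (1\<^sub>m 1) * four_block_mat S (0\<^sub>m n 1) R D =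
    four_block_mat (1\<^sub>m n * S + B * R) (1\<^sub>m n * 0\<^sub>m n 1 + B * D) (0\<^sub>m 1 n * S + 1\<^sub>m 1 * R) (0\<^sub>m 1 n * 0\<^sub>m n 1 + 1\<^sub>m 1 * D)"
    using car by (intro mult_four_block_mat) auto
  also have "\<dots> = mat (Suc n) (Suc n) (\<lambda>(i, j). A i j)"
  proof (rule eq_matI)
    fix i j assume "i < dim_row (mat (Suc n) (Suc n) (\<lambda>(i, j). A i j))" "j < dim_col (mat (Suc n) (Suc n) (\<lambda>(i, j). A i j))"
    then have ij: "i < Suc n" "j < Suc n" by auto
    show "four_block_mat (1\<^sub>m n * S + B * R) (1\<^sub>m n * 0\<^sub>m n 1 + B * D) (0\<^sub>m 1 n * S + 1\<^sub>m 1 * R) (0\<^sub>m 1 n * 0\<^sub>m n 1 + 1\<^sub>m 1 * D) $$ (i, j) =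
      mat (Suc n) (Suc n) (\<lambda>(i, j). A i j) $$ (i, j)"
      using ij car assms by (cases "i < n"; cases "j < n")
        (auto simp: S_def B_def R_def D_def scalar_prod_def less_Suc_eq)
  qed (use car in auto)
  finally have eq: "mat (Suc n) (Suc n) (\<lambda>(i, j). A i j) =
     four_block_mat (1\<^sub>m n) B (0\<^sub>m 1 n) (1\<^sub>m 1) * four_block_mat S (0\<^sub>m n 1) R D" ..
  have "Determinant.det (mat (Suc n) (Suc n) (\<lambda>(i, j). A i j)) =
     Determinant.det (four_block_mat (1\<^sub>m n) B (0\<^sub>m 1 n) (1\<^sub>m 1)) * Determinant.det (four_block_mat S (0\<^sub>m n 1) R D)"
    unfolding eq using car by (intro det_mult[where n = "n + 1"]) (auto intro!: four_block_carrier_mat)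
  also have "Determinant.det (four_block_mat (1\<^sub>m n) B (0\<^sub>m 1 n) (1\<^sub>m 1)) = (1::'a)"
    using car by (subst det_four_block_mat_lower_left_zero[where n = n and m = 1]) auto
  also have "Determinant.det (four_block_mat S (0\<^sub>m n 1) R D) = Determinant.det S * Determinant.det D"
    using car by (intro det_four_block_mat_upper_right_zero_col) auto
  also have "Determinant.det D = A n n" using det_single[OF car(4)] by (simp add: D_def)
  finally show ?thesis by (simp add: S_def mult.commute)
qed

lemma det_scale_rows_cols:
  fixes A :: "nat \<Rightarrow> nat \<Rightarrow> 'a::comm_ring_1"
  shows "Determinant.det (mat n n (\<lambda>(i, j). u i * v j * A i j)) =
    (\<Prod>i<n. u i * v i) * Determinant.det (mat n n (\<lambda>(i, j). A i j))"
proof -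
  have "(\<Prod>i=0..<n. u i * v (p i) * A i (p i)) = (\<Prod>i<n. u i * v i) * (\<Prod>i=0..<n. A i (p i))"
    if "p permutes {0..<n}" for p
    using prod.permute[OF that, of v] by (simp add: prod.distrib atLeast0LessThan)
  moreover have "p i < n" if "p permutes {0..<n}" "i < n" for p i
    using permutes_in_image[OF that(1), of i] that by simp
  ultimately show ?thesis unfolding det_def by (simp add: sum_distrib_left mult_ac)
qed

context
  fixes q :: real assumes q: "0 < q" "q < 1"
begin

lemma annulus_div:
  assumes "z \<in> annulus q" "w \<in> annulus q"
  shows "q\<^sup>2 < norm (z / w)" "norm (z / w) < 1 / q\<^sup>2"
proof -
  have 1: "q < norm z" "norm z < 1" "q < norm w" "norm w < 1" using assms by (auto simp: annulus_def)
  have "norm z * q < 1 * norm w" using 1 q by (intro mult_strict_mono) auto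
  then have "norm z < norm w / q" using q by (simp add: pos_less_divide_eq)
  moreover have "0 < norm w" using 1 q by linarith
  ultimately have a: "norm (z / w) < 1 / q" by (simp add: norm_divide pos_divide_less_eq)
  have "q * norm w < norm z * 1" using 1 q by (intro mult_strict_mono) auto
  then have b: "q < norm (z / w)" using \<open>0 < norm w\<close> unfolding norm_divide by (subst pos_less_divide_eq) auto
  have "q\<^sup>2 < q" using q by (simp add: power2_eq_square)
  moreover from this have "1 / q < 1 / q\<^sup>2" using q by (simp add: frac_less2)
  ultimately show "q\<^sup>2 < norm (z / w)" "norm (z / w) < 1 / q\<^sup>2" using a b by linarith+
qed

lemma annulus_open: "open (annulus q)"
  unfolding annulus_def by (intro open_Collect_conj open_Collect_less continuous_intros)

lemma blaschke_denom: "a \<in> annulus q \<Longrightarrow> z \<in> annulus q \<Longrightarrow> theta q (cnj a * z) \<noteq> 0"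
  using theta_nonzero[OF q] annulus_mult[OF q annulus_cnj[OF q]] by blast

lemma blaschke_holomorphic:
  assumes "a \<in> annulus q" shows "blaschke q a holomorphic_on annulus q"
  unfolding blaschke_def[abs_def] using assms annulus_nonzero[OF q] blaschke_denom q
  by (intro holomorphic_intros) auto

lemma blaschke_self [simp]: "a \<in> annulus q \<Longrightarrow> blaschke q a a = 0"
  using annulus_nonzero[OF q] by (simp add: blaschke_def theta_1[OF q])

lemma blaschke_nonzero:
  assumes "a \<in> annulus q" "z \<in> annulus q" "z \<noteq> a"
  shows "blaschke q a z \<noteq> 0"
proof -
  have "theta_red q (a / z) \<noteq> 0" using theta_red_nonzero[OF q annulus_div[OF assms(1,2)]] .
  then show ?thesis
    using assms annulus_nonzero[OF q] blaschke_denom by (auto simp: blaschke_def theta_factor[OF q])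
qed

lemma deriv_blaschke_self:
  assumes a: "a \<in> annulus q"
  shows "(blaschke q a has_field_derivative theta_red q 1 / theta q (cnj a * a)) (at a)"
proof -
  have a0: "a \<noteq> 0" using annulus_nonzero[OF q a] .
  define G where "G z = z * theta_red q (a / z) / (z * theta q (cnj a * z))" for z
  have G: "isCont G a"
  proof -
    have "G holomorphic_on annulus q"
      unfolding G_def[abs_def] using a annulus_nonzero[OF q] blaschke_denom q
      by (intro holomorphic_intros) auto
    then show ?thesis
      using annulus_open a by (metis continuous_on_eq_continuous_at holomorphic_on_imp_continuous_on)
  qed
  have "(blaschke q a z - blaschke q a a) / (z - a) = G z" if "z \<noteq> a" "z \<noteq> 0" for z
    using that a0 a by (simp add: blaschke_def theta_factor[OF q, of "a / z"] G_def divide_simps theta_1[OF q])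
  moreover have "\<forall>\<^sub>F z in at a. z \<noteq> a \<and> z \<noteq> 0"
    using a0 t1_space_nhds[of a 0] by (auto simp: eventually_at_filter elim: eventually_mono)
  ultimately have "\<forall>\<^sub>F z in at a. G z = (blaschke q a z - blaschke q a a) / (z - a)"
    by (auto elim!: eventually_mono)
  moreover have "(G \<longlongrightarrow> G a) (at a)" using G by (simp add: isCont_def)
  ultimately have "((\<lambda>z. (blaschke q a z - blaschke q a a) / (z - a)) \<longlongrightarrow> G a) (at a)"
    using tendsto_cong by fastforce
  then show ?thesis using a0 by (simp add: has_field_derivative_iff G_def)
qed

text \<open>The two factors differ by a phase only: inverting the theta argument exchanges the
  prefactors up to sign, and the denominators are conjugate. The symmetry matters because the Palm
  iteration meets each pair of points with its arguments in the opposite order to the elimination in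
  \<open>det_szego_kernel\<close>.\<close>

lemma norm_blaschke_commute:
  assumes "a \<in> annulus q" "b \<in> annulus q"
  shows "norm (blaschke q a b) = norm (blaschke q b a)"
proof -
  have nz: "a \<noteq> 0" "b \<noteq> 0" using assms annulus_nonzero[OF q] by auto
  have "theta q (b / a) = - theta q (a / b) / (a / b)" using theta_inverse[OF q, of "a / b"] nz by simp
  moreover have "norm (theta q (cnj b * a)) = norm (theta q (cnj a * b))"
    by (metis theta_cnj[OF q] complex_cnj_cnj complex_cnj_mult complex_mod_cnj mult.commute)
  ultimately show ?thesis using nz by (simp add: blaschke_def norm_mult norm_divide)
qed

lemma szego_kernel_diag_nonzero:
  assumes "0 < s" "z \<in> annulus q" shows "szego_kernel q z z s \<noteq> 0"
proof -
  have "- of_real s * z * cnj z = - complex_of_real (s * (norm z)\<^sup>2)"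
    by (simp add: mult.assoc complex_norm_square[symmetric])
  moreover have "0 < s * (norm z)\<^sup>2" using assms annulus_nonzero[OF q] by simp
  ultimately have "theta q (- of_real s * z * cnj z) \<noteq> 0" using theta_nonzero_neg[OF q] by metis
  then show ?thesis
    unfolding szego_kernel_theta[OF q assms(1) assms(2) assms(2)]
    using theta_nonzero_neg[OF q assms(1)] theta_red_1_nonzero[OF q] blaschke_denom[OF assms(2,2)]
    by (simp add: mult.commute)
qed

lemma szego_kernel_diag:
  assumes "0 < s" "z \<in> annulus q"
  shows "szego_kernel q z z s = theta_red q 1 * theta q (- of_real (s * (norm z)\<^sup>2)) /
     (theta q (- of_real s) * theta q (cnj z * z))"
  unfolding szego_kernel_theta[OF q assms(1) assms(2) assms(2)]
  by (simp add: mult.assoc complex_norm_square[symmetric] mult.commute[of "cnj z" z])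

text \<open>An elliptic Cauchy determinant in the manner of Frobenius. Eliminating the last point
  turns the matrix, by \<open>szego_kernel_schur\<close>, into the kernel matrix for the parameter s
  |x n|^2, with rows and columns scaled by Blaschke factors. The pivots contribute theta (- s |x
  n|^2) / theta (- s), and these quotients telescope; the scaling gives one factor for each pair of
  points.\<close>

lemma det_szego_kernel:
  assumes "0 < s" "\<And>i. i < n \<Longrightarrow> x i \<in> annulus q"
  shows "Determinant.det (mat n n (\<lambda>(i, j). szego_kernel q (x i) (x j) s)) =
    (\<Prod>k<n. theta_red q 1 / theta q (cnj (x k) * x k)) *
    (theta q (- of_real (s * (\<Prod>k<n. (norm (x k))\<^sup>2))) / theta q (- of_real s)) *
    of_real (\<Prod>k<n. \<Prod>i<k. (norm (blaschke q (x k) (x i)))\<^sup>2)"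
  using assms
proof (induction n arbitrary: s)
  case 0
  then show ?case using theta_nonzero_neg[OF q, of s] by simp
next
  case (Suc n)
  note s = Suc.prems(1)
  have x: "x i \<in> annulus q" if "i \<le> n" for i using Suc.prems(2) that by simp
  define c where "c = szego_kernel q (x n) (x n) s"
  define h where "h = blaschke q (x n)"
  have c: "c \<noteq> 0" unfolding c_def using szego_kernel_diag_nonzero s x by blast
  have s': "0 < s * (norm (x n))\<^sup>2" using s x[of n] annulus_nonzero[OF q] by auto
  have "Determinant.det (mat (Suc n) (Suc n) (\<lambda>(i, j). szego_kernel q (x i) (x j) s)) =
     c * Determinant.det (mat n n (\<lambda>(i, j). szego_kernel q (x i) (x j) s -
       szego_kernel q (x i) (x n) s * szego_kernel q (x n) (x j) s / szego_kernel q (x n) (x n) s))"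
    unfolding c_def using c c_def by (intro det_Suc_schur) auto
  also have "mat n n (\<lambda>(i, j). szego_kernel q (x i) (x j) s -
       szego_kernel q (x i) (x n) s * szego_kernel q (x n) (x j) s / szego_kernel q (x n) (x n) s) =
     mat n n (\<lambda>(i, j). h (x i) * cnj (h (x j)) * szego_kernel q (x i) (x j) (s * (norm (x n))\<^sup>2))"
  proof (intro cong_mat refl, clarsimp)
    fix i j assume ij: "i < n" "j < n"
    show "szego_kernel q (x i) (x j) s - szego_kernel q (x i) (x n) s * szego_kernel q (x n) (x j) s / szego_kernel q (x n) (x n) s =
      h (x i) * cnj (h (x j)) * szego_kernel q (x i) (x j) (s * (norm (x n))\<^sup>2)"
      using szego_kernel_schur[OF q s x[of i] x[of j] x[of n]] ij c
      unfolding c_def h_def by (simp add: field_simps)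
  qed
  also have "Determinant.det \<dots> = (\<Prod>i<n. h (x i) * cnj (h (x i))) *
      Determinant.det (mat n n (\<lambda>(i, j). szego_kernel q (x i) (x j) (s * (norm (x n))\<^sup>2)))"
    by (rule det_scale_rows_cols)
  also have "(\<Prod>i<n. h (x i) * cnj (h (x i))) = of_real (\<Prod>i<n. (norm (h (x i)))\<^sup>2)"
    by (simp add: complex_norm_square[symmetric])
  also have "Determinant.det (mat n n (\<lambda>(i, j). szego_kernel q (x i) (x j) (s * (norm (x n))\<^sup>2))) =
     (\<Prod>k<n. theta_red q 1 / theta q (cnj (x k) * x k)) *
    (theta q (- of_real (s * (norm (x n))\<^sup>2 * (\<Prod>k<n. (norm (x k))\<^sup>2))) / theta q (- of_real (s * (norm (x n))\<^sup>2))) *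
    of_real (\<Prod>k<n. \<Prod>i<k. (norm (blaschke q (x k) (x i)))\<^sup>2)"
    using Suc.IH[OF s'] x by auto
  finally show ?case
    unfolding c_def szego_kernel_diag[OF s x[OF order_refl]] h_def
    using theta_nonzero_neg[OF q s'] by (simp add: mult_ac)
qed

end

section \<open>Laws of complex processes and characteristic functions\<close>

text \<open>At t = 0 the hypothesis says that the total masses agree. Normalising by this mass
  reduces the claim to Levy's theorem for probability laws; mass 0 cannot be normalised and is
  treated apart.\<close>

lemma finite_measure_char_unique:
  fixes \<mu> \<nu> :: "real measure"
  assumes \<mu>: "finite_measure \<mu>" "sets \<mu> = sets borel" and \<nu>: "finite_measure \<nu>" "sets \<nu> = sets borel"
    and eq: "\<And>t. (CLINT x|\<mu>. iexp (t * x)) = (CLINT x|\<nu>. iexp (t * x))"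
  shows "\<mu> = \<nu>"
proof -
  interpret \<mu>: finite_measure \<mu> by fact
  interpret \<nu>: finite_measure \<nu> by fact
  note [measurable_cong] = \<mu>(2) \<nu>(2)
  have sp: "space \<mu> = UNIV" "space \<nu> = UNIV" using sets_eq_imp_space_eq[OF \<mu>(2)] sets_eq_imp_space_eq[OF \<nu>(2)] by auto
  define m where "m = measure \<mu> (space \<mu>)"
  have "complex_of_real (measure \<mu> (space \<mu>)) = complex_of_real (measure \<nu> (space \<nu>))"
    using eq[of 0] by (simp add: scaleR_conv_of_real)
  then have m: "m = measure \<nu> (space \<nu>)" unfolding m_def of_real_eq_iff .
  show ?thesis
  proof (cases "m = 0")
    case True
    then have "emeasure \<mu> (space \<mu>) = 0" "emeasure \<nu> (space \<nu>) = 0"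
      using m by (simp_all add: m_def \<mu>.emeasure_eq_measure \<nu>.emeasure_eq_measure)
    then have "emeasure \<mu> A = 0 \<and> emeasure \<nu> A = 0" for A
      using emeasure_space[of \<mu> A] emeasure_space[of \<nu> A] by simp
    then show ?thesis using \<mu>(2) \<nu>(2) by (intro measure_eqI) auto
  next
    case False
    then have m0: "m > 0" using measure_nonneg[of \<mu>] by (simp add: m_def less_le)
    let ?f = "\<lambda>_::real. ennreal (1 / m)"
    have d: "real_distribution (density \<rho> ?f)"
      if "sets \<rho> = sets borel" "measure \<rho> (space \<rho>) = m" "finite_measure \<rho>" for \<rho> :: "real measure"
    proof -
      interpret \<rho>: finite_measure \<rho> by fact
      have "emeasure (density \<rho> ?f) (space \<rho>) = ennreal (1 / m) * emeasure \<rho> (space \<rho>)"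
        by (subst emeasure_density) (auto simp: nn_integral_cmult)
      also have "\<dots> = 1" using that(2) m0 by (simp add: \<rho>.emeasure_eq_measure flip: ennreal_mult)
      finally have "prob_space (density \<rho> ?f)" by (intro prob_spaceI) simp
      then show ?thesis using that(1) by (simp add: real_distribution_def real_distribution_axioms_def)
    qed
    have c: "char (density \<rho> ?f) t = (1 / m) *\<^sub>R (CLINT x|\<rho>. iexp (t * x))"
      if [measurable_cong]: "sets \<rho> = sets borel" for \<rho> :: "real measure" and t
      unfolding char_def using m0 by (subst integral_density) (auto simp: scaleR_conv_of_real)
    have "density \<mu> ?f = density \<nu> ?f"
    proof (rule Levy_uniqueness[OF d d])
      show "char (density \<mu> ?f) = char (density \<nu> ?f)"
        by (intro ext) (simp only: c[OF \<mu>(2)] c[OF \<nu>(2)] eq)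
    qed (use \<mu> \<nu> m in \<open>auto simp: m_def\<close>)
    then have "density (density \<mu> ?f) (\<lambda>_. ennreal m) = density (density \<nu> ?f) (\<lambda>_. ennreal m)" by simp
    then show ?thesis using m0 by (simp add: density_density_eq density_1 flip: ennreal_mult)
  qed
qed

lemma weighted_char_unique:
  fixes X :: "'a \<Rightarrow> real" and Y :: "'b \<Rightarrow> real" and w :: "'a \<Rightarrow> real" and v :: "'b \<Rightarrow> real"
  assumes "finite_measure M" "finite_measure N"
    and [measurable]: "X \<in> borel_measurable M" "Y \<in> borel_measurable N" "w \<in> borel_measurable M" "v \<in> borel_measurable N"
    and w: "\<And>x. 0 \<le> w x" "\<And>x. w x \<le> b" and v: "\<And>x. 0 \<le> v x" "\<And>x. v x \<le> b"
    and eq: "\<And>t. (CLINT x|M. of_real (w x) * iexp (t * X x)) = (CLINT y|N. of_real (v y) * iexp (t * Y y))"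
    and [measurable]: "B \<in> sets borel"
  shows "(LINT x|M. w x * indicator B (X x)) = (LINT y|N. v y * indicator B (Y y))"
proof -
  interpret M: finite_measure M by fact
  interpret N: finite_measure N by fact
  let ?\<mu> = "distr (density M w) borel X" and ?\<nu> = "distr (density N v) borel Y"
  have fin: "finite_measure (distr (density L u) borel Z)"
    if "finite_measure L" "Z \<in> borel_measurable L" "u \<in> borel_measurable L" "\<And>x. 0 \<le> u x" "\<And>x. u x \<le> b" for L :: "'c measure" and u and Z :: "'c \<Rightarrow> real"
  proof -
    interpret L: finite_measure L by fact
    note [measurable] = that(2,3)
    have "emeasure (density L u) (space L) = (\<integral>\<^sup>+x. ennreal (u x) \<partial>L)"
      by (subst emeasure_density) (auto intro!: nn_integral_cong)
    also have "\<dots> \<le> (\<integral>\<^sup>+x. ennreal b \<partial>L)" using that by (intro nn_integral_mono ennreal_leI) auto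
    also have "\<dots> < \<top>" using L.emeasure_finite by (simp add: ennreal_mult_eq_top_iff less_top[symmetric])
    finally have "finite_measure (density L u)" by (intro finite_measureI) auto
    then show ?thesis by (rule finite_measure.finite_measure_distr) simp
  qed
  have "?\<mu> = ?\<nu>"
  proof (rule finite_measure_char_unique)
    show "finite_measure ?\<mu>" using assms by (intro fin) auto
    show "finite_measure ?\<nu>" using assms by (intro fin) auto
    fix t
    have "(CLINT x|?\<mu>. iexp (t * x)) = (CLINT x|M. w x *\<^sub>R iexp (t * X x))"
      using w by (subst integral_distr) (auto simp: integral_density)
    moreover have "(CLINT x|?\<nu>. iexp (t * x)) = (CLINT x|N. v x *\<^sub>R iexp (t * Y x))"
      using v by (subst integral_distr) (auto simp: integral_density)
    ultimately show "(CLINT x|?\<mu>. iexp (t * x)) = (CLINT x|?\<nu>. iexp (t * x))"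
      using eq[of t] by (simp add: scaleR_conv_of_real)
  qed auto
  then have "(LINT x|?\<mu>. indicator B x :: real) = (LINT x|?\<nu>. indicator B x)" by simp
  moreover have "(LINT x|?\<mu>. indicator B x :: real) = (LINT x|M. w x * indicator B (X x))"
    using w by (subst integral_distr) (auto simp: integral_density)
  moreover have "(LINT x|?\<nu>. indicator B x :: real) = (LINT x|N. v x * indicator B (Y x))"
    using v by (subst integral_distr) (auto simp: integral_density)
  ultimately show ?thesis by simp
qed

lemma integrable_bounded_cmod:
  fixes f :: "'a \<Rightarrow> 'b::{banach, second_countable_topology}"
  assumes "finite_measure M" "f \<in> borel_measurable M" "\<And>x. norm (f x) \<le> b"
  shows "integrable M f"
  by (intro finite_measure.integrable_const_bound[of M f b] AE_I2 assms)

lemma integrable_weight_iexp: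
  fixes V Z :: "'a \<Rightarrow> real"
  assumes "finite_measure K" "V \<in> borel_measurable K" "Z \<in> borel_measurable K" "\<And>x. 0 \<le> V x" "\<And>x. V x \<le> 1"
  shows "integrable K (\<lambda>x. of_real (V x) * iexp (Z x))"
proof (rule integrable_bounded_cmod[where b = 1])
  note [measurable] = assms(2,3)
  show "(\<lambda>x. of_real (V x) * iexp (Z x)) \<in> borel_measurable K" by measurable
  show "norm (of_real (V x) * iexp (Z x)) \<le> 1" for x using assms(4,5) by (simp add: norm_mult)
qed (rule assms)

text \<open>Writing the cosine as two exponentials expresses the transform of the weight
  \<open>V * (1 + cos (Z + c))\<close> by three joint transforms, with the coefficients 0, 1 and -1
  in front of \<open>Z\<close>. These are the values of \<sigma> demanded in
  \<open>phase_char_unique\<close>.\<close>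

lemma integral_weight_cos_phase:
  fixes V Z U :: "'a \<Rightarrow> real"
  assumes K: "finite_measure K" and [measurable]: "V \<in> borel_measurable K" "Z \<in> borel_measurable K" "U \<in> borel_measurable K"
     and V: "\<And>x. 0 \<le> V x" "\<And>x. V x \<le> 1"
  shows "(CLINT x|K. of_real (V x * (1 + cos (Z x + c))) * iexp (t * U x)) =
     (CLINT x|K. of_real (V x) * iexp (t * U x + 0 * Z x)) +
     iexp c / 2 * (CLINT x|K. of_real (V x) * iexp (t * U x + 1 * Z x)) +
     iexp (- c) / 2 * (CLINT x|K. of_real (V x) * iexp (t * U x + (-1) * Z x))"
  proof -
    have "(CLINT x|K. of_real (V x * (1 + cos (Z x + c))) * iexp (t * U x)) =
      (CLINT x|K. of_real (V x) * iexp (t * U x + 0 * Z x) +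
        (iexp c / 2 * (of_real (V x) * iexp (t * U x + 1 * Z x)) +
        iexp (- c) / 2 * (of_real (V x) * iexp (t * U x + (-1) * Z x))))"
    proof (intro Bochner_Integration.integral_cong refl)
      fix x
      have e: "iexp (a + b) = iexp a * iexp b" for a b by (simp add: ring_distribs exp_add)
      have "complex_of_real (cos (Z x + c)) = (iexp (c + Z x) + iexp ((- c) + (- Z x))) / 2"
        using cos_exp_eq[of "complex_of_real (Z x + c)"] unfolding cos_of_real by (simp add: algebra_simps)
      then have cos: "complex_of_real (cos (Z x + c)) = (iexp c * iexp (Z x) + iexp (- c) * iexp (- Z x)) / 2"
        unfolding e .
      have *: "v * (1 + (C * E + C' * E') / 2) * T = v * T + (C / 2 * (v * (T * E)) + C' / 2 * (v * (T * E')))"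
        for v C E C' E' T :: complex by (simp add: algebra_simps add_divide_distrib)
      have e': "iexp (t * U x + 0 * Z x) = iexp (t * U x)"
        "iexp (t * U x + 1 * Z x) = iexp (t * U x) * iexp (Z x)"
        "iexp (t * U x + (-1) * Z x) = iexp (t * U x) * iexp (- Z x)"
        by (simp_all only: e mult_1_left mult_minus1 mult_zero_left add_0_right)
      show "of_real (V x * (1 + cos (Z x + c))) * iexp (t * U x) = of_real (V x) * iexp (t * U x + 0 * Z x) +
        (iexp c / 2 * (of_real (V x) * iexp (t * U x + 1 * Z x)) +
        iexp (- c) / 2 * (of_real (V x) * iexp (t * U x + (-1) * Z x)))"
        unfolding of_real_mult[of "V x"] of_real_add[of 1] of_real_1 cos e' by (rule *)
    qed
    also have "\<dots> = (CLINT x|K. of_real (V x) * iexp (t * U x + 0 * Z x)) +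
       ((CLINT x|K. iexp c / 2 * (of_real (V x) * iexp (t * U x + 1 * Z x))) +
       (CLINT x|K. iexp (- c) / 2 * (of_real (V x) * iexp (t * U x + (-1) * Z x))))"
    proof -
      have i: "integrable K (\<lambda>x. of_real (V x) * iexp (t * U x + \<sigma> * Z x))" for \<sigma>
        using K V by (intro integrable_weight_iexp) auto
      show ?thesis
        by (simp only: Bochner_Integration.integral_add[OF i Bochner_Integration.integrable_add[OF integrable_mult_right[OF i] integrable_mult_right[OF i]]]
          Bochner_Integration.integral_add[OF integrable_mult_right[OF i] integrable_mult_right[OF i]])
    qed
    finally show ?thesis by (simp only: integral_mult_right_zero add.assoc)
  qed

text \<open>The shifts 0 and - pi / 2 turn the cosine into the real and the imaginary part of the
  phase; this recovers a complex integral from integrals against nonnegative weights.\<close>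

lemma integral_weight_indicator:
  fixes V Z U :: "'a \<Rightarrow> real"
  assumes K: "finite_measure K" and [measurable]: "V \<in> borel_measurable K" "Z \<in> borel_measurable K" "U \<in> borel_measurable K" "B \<in> sets borel"
     and V: "\<And>x. 0 \<le> V x" "\<And>x. V x \<le> 1"
  shows "(LINT x|K. V x * (1 + cos (Z x + c)) * indicator B (U x)) =
     (LINT x|K. V x * indicator B (U x)) + (LINT x|K. V x * indicator B (U x) * cos (Z x + c))"
    and "(CLINT x|K. of_real (V x * indicator B (U x)) * iexp (Z x)) =
     of_real (LINT x|K. V x * indicator B (U x) * cos (Z x + 0)) + \<i> * of_real (LINT x|K. V x * indicator B (U x) * cos (Z x + (- pi/2)))"
  proof -
    have i1: "integrable K (\<lambda>x. V x * indicator B (U x))"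
      using K V by (intro integrable_bounded_cmod[where b = 1]) (auto simp: indicator_def)
    have i2: "integrable K (\<lambda>x. V x * indicator B (U x) * cos (Z x + c))" for c
    proof (intro integrable_bounded_cmod[where b = 1] K)
      fix x
      have "V x * \<bar>cos (Z x + c)\<bar> \<le> 1 * 1" using V by (intro mult_mono) auto
      then show "norm (V x * indicator B (U x) * cos (Z x + c)) \<le> 1"
        using V by (auto simp: indicator_def abs_mult)
    qed auto
    show "(LINT x|K. V x * (1 + cos (Z x + c)) * indicator B (U x)) =
     (LINT x|K. V x * indicator B (U x)) + (LINT x|K. V x * indicator B (U x) * cos (Z x + c))"
      unfolding Bochner_Integration.integral_add[OF i1 i2, symmetric]
      by (intro Bochner_Integration.integral_cong refl) (simp only: distrib_left distrib_right mult_1_right mult.assoc mult.commute[of "cos _"])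
    have "(CLINT x|K. of_real (V x * indicator B (U x)) * iexp (Z x)) =
      (CLINT x|K. of_real (V x * indicator B (U x) * cos (Z x + 0)) + \<i> * of_real (V x * indicator B (U x) * cos (Z x + (- pi/2))))"
    proof (intro Bochner_Integration.integral_cong refl)
      fix x
      have "iexp (Z x) = of_real (cos (Z x)) + \<i> * of_real (sin (Z x))"
        by (simp add: exp_Euler cos_of_real sin_of_real)
      moreover have "cos (Z x + (- pi/2)) = sin (Z x)" by (simp add: cos_diff)
      ultimately show "of_real (V x * indicator B (U x)) * iexp (Z x) =
        of_real (V x * indicator B (U x) * cos (Z x + 0)) + \<i> * of_real (V x * indicator B (U x) * cos (Z x + (- pi/2)))"
        by (simp add: algebra_simps)
    qed
    also have "\<dots> = of_real (LINT x|K. V x * indicator B (U x) * cos (Z x + 0)) + \<i> * of_real (LINT x|K. V x * indicator B (U x) * cos (Z x + (- pi/2)))"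
    proof -
      have j: "complex_integrable K (\<lambda>x. of_real (V x * indicator B (U x) * cos (Z x + c)))" for c
        by (rule integrable_of_real[OF i2])
      show ?thesis
        unfolding Bochner_Integration.integral_add[OF j integrable_mult_right[OF j]] integral_mult_right_zero integral_complex_of_real ..
    qed
    finally show "(CLINT x|K. of_real (V x * indicator B (U x)) * iexp (Z x)) =
     of_real (LINT x|K. V x * indicator B (U x) * cos (Z x + 0)) + \<i> * of_real (LINT x|K. V x * indicator B (U x) * cos (Z x + (- pi/2)))" .
  qed

text \<open>A complex weight \<^term>\<open>W * iexp L\<close> is reduced to the nonnegative weights \<^term>\<open>W * (1 + cos (L + c))\<close>,
  to which Levy's uniqueness theorem on the line applies.\<close>

lemma phase_char_unique:
  fixes X :: "'a \<Rightarrow> real" and Y :: "'b \<Rightarrow> real" and W L :: "'a \<Rightarrow> real" and W' L' :: "'b \<Rightarrow> real"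
  assumes fin: "finite_measure M" "finite_measure N"
    and [measurable]: "X \<in> borel_measurable M" "Y \<in> borel_measurable N" "W \<in> borel_measurable M" "W' \<in> borel_measurable N"
      "L \<in> borel_measurable M" "L' \<in> borel_measurable N"
    and w: "\<And>x. 0 \<le> W x" "\<And>x. W x \<le> 1" and v: "\<And>x. 0 \<le> W' x" "\<And>x. W' x \<le> 1"
    and eq: "\<And>t \<sigma>. \<sigma> \<in> {0, 1, -1} \<Longrightarrow> (CLINT x|M. of_real (W x) * iexp (t * X x + \<sigma> * L x)) =
       (CLINT y|N. of_real (W' y) * iexp (t * Y y + \<sigma> * L' y))"
    and B[measurable]: "B \<in> sets borel"
  shows "(CLINT x|M. of_real (W x * indicator B (X x)) * iexp (L x)) = (CLINT y|N. of_real (W' y * indicator B (Y y)) * iexp (L' y))"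
proof -
  have wc: "(LINT x|M. W x * (1 + cos (L x + c)) * indicator B (X x)) = (LINT y|N. W' y * (1 + cos (L' y + c)) * indicator B (Y y))" for c
  proof (rule weighted_char_unique[where b = 2, OF fin])
    have "0 \<le> 1 + cos a" "1 + cos a \<le> 2" for a :: real using cos_ge_minus_one[of a] cos_le_one[of a] by linarith+
    then show "0 \<le> W x * (1 + cos (L x + c))" "W x * (1 + cos (L x + c)) \<le> 2" 
       "0 \<le> W' y * (1 + cos (L' y + c))" "W' y * (1 + cos (L' y + c)) \<le> 2" for x y
      using w v mult_mono[of "W x" 1 "1 + cos (L x + c)" 2] mult_mono[of "W' y" 1 "1 + cos (L' y + c)" 2] by auto
    show "(CLINT x|M. of_real (W x * (1 + cos (L x + c))) * iexp (t * X x)) = (CLINT y|N. of_real (W' y * (1 + cos (L' y + c))) * iexp (t * Y y))" for t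
      using w v by (simp only: integral_weight_cos_phase[OF fin(1)] integral_weight_cos_phase[OF fin(2)] assms eq[of 0] eq[of 1] eq[of "-1"] insertI1 insertI2)
  qed auto
  have w0: "(LINT x|M. W x * indicator B (X x)) = (LINT y|N. W' y * indicator B (Y y))"
    by (rule weighted_char_unique[where b = 1, OF fin]) (use eq[of 0] w v in auto)
  have "(LINT x|M. W x * indicator B (X x) * cos (L x + c)) = (LINT y|N. W' y * indicator B (Y y) * cos (L' y + c))" for c
    using wc[of c] w0 integral_weight_indicator(1)[OF fin(1), of W L X B c] integral_weight_indicator(1)[OF fin(2), of W' L' Y B c] w v by simp
  note eqc = this
  have "(CLINT x|M. of_real (W x * indicator B (X x)) * iexp (L x)) =
     of_real (LINT x|M. W x * indicator B (X x) * cos (L x + 0)) + \<i> * of_real (LINT x|M. W x * indicator B (X x) * cos (L x + (- pi/2)))"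
    by (rule integral_weight_indicator(2)[OF fin(1)]) (use w in auto)
  moreover have "(CLINT x|N. of_real (W' x * indicator B (Y x)) * iexp (L' x)) =
     of_real (LINT x|N. W' x * indicator B (Y x) * cos (L' x + 0)) + \<i> * of_real (LINT x|N. W' x * indicator B (Y x) * cos (L' x + (- pi/2)))"
    by (rule integral_weight_indicator(2)[OF fin(2)]) (use v in auto)
  ultimately show ?thesis unfolding eqc by (rule trans[OF _ sym])
qed

text \<open>A Cramer-Wold argument in which the coordinates pass one at a time from the exponent
  into an indicator. The linear form over \<open>T\<close> survives as the phase in
  \<open>phase_char_unique\<close>, and because it stays arbitrary, the induction hypothesis can be
  used with the coordinate k added to it.\<close>

lemma multi_char_unique:
  fixes X :: "'i \<Rightarrow> 'a \<Rightarrow> real" and Y :: "'i \<Rightarrow> 'b \<Rightarrow> real"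
  assumes fin: "finite_measure M" "finite_measure N"
    and mX: "\<And>i. i \<in> I \<Longrightarrow> X i \<in> borel_measurable M" and mY: "\<And>i. i \<in> I \<Longrightarrow> Y i \<in> borel_measurable N"
    and eq: "\<And>J c. finite J \<Longrightarrow> J \<subseteq> I \<Longrightarrow>
      (CLINT x|M. iexp (\<Sum>j\<in>J. c j * X j x)) = (CLINT y|N. iexp (\<Sum>j\<in>J. c j * Y j y))"
    and S: "finite S" "S \<subseteq> I" and T: "finite T" "T \<subseteq> I" and A: "\<And>i. i \<in> S \<Longrightarrow> A i \<in> sets borel"
  shows "(CLINT x|M. of_real (\<Prod>i\<in>S. indicator (A i) (X i x)) * iexp (\<Sum>j\<in>T. c j * X j x)) =
    (CLINT y|N. of_real (\<Prod>i\<in>S. indicator (A i) (Y i y)) * iexp (\<Sum>j\<in>T. c j * Y j y))"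
  using S A T
proof (induction S arbitrary: T c rule: finite_induct)
  case empty
  then show ?case using eq[of T c] by simp
next
  case (insert k S)
  have k: "k \<in> I" "S \<subseteq> I" and A: "\<And>i. i \<in> S \<Longrightarrow> A i \<in> sets borel" "A k \<in> sets borel" using insert.prems by auto
  \<comment> \<open>The frequency t of the new coordinate is added to a coefficient that may be
    present already, as \<open>T\<close> may contain k; hence the sum of two conditionals.\<close>
  have comb: "t * Z k + \<sigma> * (\<Sum>j\<in>T. c j * Z j) = (\<Sum>j\<in>insert k T. ((if j = k then t else 0) + (if j \<in> T then \<sigma> * c j else 0)) * Z j)"
    for Z :: "'i \<Rightarrow> real" and t \<sigma>
  proof -
    have "(\<Sum>j\<in>insert k T. ((if j = k then t else 0) + (if j \<in> T then \<sigma> * c j else 0)) * Z j) =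
      (\<Sum>j\<in>insert k T. if j = k then t * Z j else 0) + (\<Sum>j\<in>insert k T. if j \<in> T then \<sigma> * c j * Z j else 0)"
      unfolding sum.distrib[symmetric] by (intro sum.cong refl) (simp add: distrib_right)
    also have "(\<Sum>j\<in>insert k T. if j = k then t * Z j else 0) = t * Z k"
      using insert.prems by simp
    also have "(\<Sum>j\<in>insert k T. if j \<in> T then \<sigma> * c j * Z j else 0) = (\<Sum>j\<in>T. \<sigma> * c j * Z j)"
      using insert.prems by (intro sum.mono_neutral_cong_right) auto
    finally show ?thesis by (simp add: sum_distrib_left mult.assoc)
  qed
  have mL: "(\<lambda>x. \<Sum>j\<in>T. c j * X j x) \<in> borel_measurable M" "(\<lambda>x. \<Sum>j\<in>T. c j * Y j x) \<in> borel_measurable N"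
    by (intro borel_measurable_sum borel_measurable_times borel_measurable_const, use mX mY insert.prems in blast)+
  have mi: "(\<lambda>x. indicator (A i) (X i x) :: real) \<in> borel_measurable M" "(\<lambda>x. indicator (A i) (Y i x) :: real) \<in> borel_measurable N" if "i \<in> S" for i
  proof -
    have [measurable]: "X i \<in> borel_measurable M" "Y i \<in> borel_measurable N" "A i \<in> sets borel" using that k mX mY A by auto
    show "(\<lambda>x. indicator (A i) (X i x) :: real) \<in> borel_measurable M" "(\<lambda>x. indicator (A i) (Y i x) :: real) \<in> borel_measurable N"
      by measurable
  qed
  have mW: "(\<lambda>x. \<Prod>i\<in>S. indicator (A i) (X i x) :: real) \<in> borel_measurable M" "(\<lambda>x. \<Prod>i\<in>S. indicator (A i) (Y i x) :: real) \<in> borel_measurable N"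
    by (rule borel_measurable_prod, erule mi)+
  have pr: "(\<Prod>i\<in>insert k S. indicator (A i) (Z i)) = (\<Prod>i\<in>S. indicator (A i) (Z i)) * (indicator (A k) (Z k) :: real)" for Z :: "'i \<Rightarrow> real"
    using insert.hyps by simp
  show ?case unfolding pr
  proof (rule phase_char_unique[OF fin mX[OF k(1)] mY[OF k(1)] mW mL])
    fix t \<sigma>
    show "(CLINT x|M. of_real (\<Prod>i\<in>S. indicator (A i) (X i x)) * iexp (t * X k x + \<sigma> * (\<Sum>j\<in>T. c j * X j x))) =
      (CLINT y|N. of_real (\<Prod>i\<in>S. indicator (A i) (Y i y)) * iexp (t * Y k y + \<sigma> * (\<Sum>j\<in>T. c j * Y j y)))"
    proof -
      have eX: "t * X k x + \<sigma> * (\<Sum>j\<in>T. c j * X j x) = (\<Sum>j\<in>insert k T. ((if j = k then t else 0) + (if j \<in> T then \<sigma> * c j else 0)) * X j x)" for x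
        by (rule comb)
      have eY: "t * Y k x + \<sigma> * (\<Sum>j\<in>T. c j * Y j x) = (\<Sum>j\<in>insert k T. ((if j = k then t else 0) + (if j \<in> T then \<sigma> * c j else 0)) * Y j x)" for x
        by (rule comb)
      show ?thesis unfolding eX eY using insert.prems k A by (intro insert.IH) auto
    qed
    show "A k \<in> sets borel" by (rule A)
    fix x
    show "0 \<le> (\<Prod>i\<in>S. indicator (A i) (X i x) :: real)" by (intro prod_nonneg) simp
    show "(\<Prod>i\<in>S. indicator (A i) (X i x) :: real) \<le> 1" by (intro prod_le_1) simp
  next
    fix x
    show "0 \<le> (\<Prod>i\<in>S. indicator (A i) (Y i x) :: real)" by (intro prod_nonneg) simp
    show "(\<Prod>i\<in>S. indicator (A i) (Y i x) :: real) \<le> 1" by (intro prod_le_1) simp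
  qed
qed

text \<open>Real and imaginary parts form a real process indexed by \<open>I \<times> bool\<close>.
  There \<open>multi_char_unique\<close> with an empty linear form gives the probabilities of
  cylinder sets, which determine a law on the product space. The index set may be uncountable, as it
  is for processes indexed by the points of the annulus.\<close>

theorem complex_process_law_unique:
  fixes X :: "'i \<Rightarrow> 'a \<Rightarrow> complex" and Y :: "'i \<Rightarrow> 'b \<Rightarrow> complex"
  assumes M: "prob_space M" and N: "prob_space N"
    and mX: "\<And>i. i \<in> I \<Longrightarrow> X i \<in> borel_measurable M" and mY: "\<And>i. i \<in> I \<Longrightarrow> Y i \<in> borel_measurable N"
    and eq: "\<And>J c. finite J \<Longrightarrow> J \<subseteq> I \<Longrightarrow>
      (CLINT x|M. iexp (Re (\<Sum>j\<in>J. c j * X j x))) = (CLINT y|N. iexp (Re (\<Sum>j\<in>J. c j * Y j y)))"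
  shows "distr M (PiM I (\<lambda>_. borel)) (\<lambda>x. \<lambda>i\<in>I. X i x) = distr N (PiM I (\<lambda>_. borel)) (\<lambda>x. \<lambda>i\<in>I. Y i x)"
proof -
  interpret M: prob_space M by fact
  interpret N: prob_space N by fact
  define I2 where "I2 = I \<times> (UNIV :: bool set)"
  define X2 where "X2 p x = (if snd p then Im (X (fst p) x) else Re (X (fst p) x))" for p x
  define Y2 where "Y2 p x = (if snd p then Im (Y (fst p) x) else Re (Y (fst p) x))" for p x
  have mX2: "X2 p \<in> borel_measurable M" if "p \<in> I2" for p
    using mX[of "fst p"] that unfolding X2_def I2_def by (cases "snd p") auto
  have mY2: "Y2 p \<in> borel_measurable N" if "p \<in> I2" for p
    using mY[of "fst p"] that unfolding Y2_def I2_def by (cases "snd p") auto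
  \<comment> \<open>A real combination \<alpha> Re z + \<beta> Im z is the real part of (\<alpha> -
    \<i> \<beta>) z, which accounts for the minus sign in the second component.\<close>
  have comb: "(\<Sum>p\<in>J. c p * (if snd p then Im (Z (fst p)) else Re (Z (fst p)))) =
      Re (\<Sum>i\<in>fst ` J. (Complex (if (i, False) \<in> J then c (i, False) else 0) (- (if (i, True) \<in> J then c (i, True) else 0))) * Z i)"
    if J: "finite J" for J and c :: "'i \<times> bool \<Rightarrow> real" and Z :: "'i \<Rightarrow> complex"
  proof -
    have "(\<Sum>p\<in>J. c p * (if snd p then Im (Z (fst p)) else Re (Z (fst p)))) =
      (\<Sum>p\<in>fst ` J \<times> UNIV. if p \<in> J then c p * (if snd p then Im (Z (fst p)) else Re (Z (fst p))) else 0)"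
      using J by (intro sum.mono_neutral_cong_left) (auto simp: image_iff Bex_def)
    also have "\<dots> = (\<Sum>i\<in>fst ` J. \<Sum>b\<in>UNIV. if (i, b) \<in> J then c (i, b) * (if b then Im (Z i) else Re (Z i)) else 0)"
      by (subst sum.cartesian_product) (auto intro!: sum.cong)
    also have "\<dots> = (\<Sum>i\<in>fst ` J. Re ((Complex (if (i, False) \<in> J then c (i, False) else 0) (- (if (i, True) \<in> J then c (i, True) else 0))) * Z i))"
      by (intro sum.cong refl) (simp add: UNIV_bool)
    finally show ?thesis by simp
  qed
  have eq2: "(CLINT x|M. iexp (\<Sum>j\<in>J. c j * X2 j x)) = (CLINT y|N. iexp (\<Sum>j\<in>J. c j * Y2 j y))"
    if "finite J" "J \<subseteq> I2" for J c
  proof -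
    have "(\<Sum>j\<in>J. c j * X2 j x) = Re (\<Sum>i\<in>fst ` J. (Complex (if (i, False) \<in> J then c (i, False) else 0) (- (if (i, True) \<in> J then c (i, True) else 0))) * X i x)" for x
      unfolding X2_def using comb[OF that(1), of c "\<lambda>i. X i x"] .
    moreover have "(\<Sum>j\<in>J. c j * Y2 j x) = Re (\<Sum>i\<in>fst ` J. (Complex (if (i, False) \<in> J then c (i, False) else 0) (- (if (i, True) \<in> J then c (i, True) else 0))) * Y i x)" for x
      unfolding Y2_def using comb[OF that(1), of c "\<lambda>i. Y i x"] .
    ultimately show ?thesis using that by (simp only:) (rule eq, auto simp: I2_def)
  qed
  let ?P = "distr M (PiM I2 (\<lambda>_. borel)) (\<lambda>x. \<lambda>i\<in>I2. X2 i x)" and ?Q = "distr N (PiM I2 (\<lambda>_. borel)) (\<lambda>x. \<lambda>i\<in>I2. Y2 i x)"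
  have mX2': "(\<lambda>x. \<lambda>i\<in>I2. X2 i x) \<in> measurable M (PiM I2 (\<lambda>_. borel))" by (intro measurable_restrict mX2)
  have mY2': "(\<lambda>x. \<lambda>i\<in>I2. Y2 i x) \<in> measurable N (PiM I2 (\<lambda>_. borel))" by (intro measurable_restrict mY2)
  have PQ: "?P = ?Q"
  proof (rule measure_eqI_PiM_infinite)
    show "finite_measure ?P" by (rule M.finite_measure_distr[OF mX2'])
    fix A J assume J: "finite J" "J \<subseteq> I2" and A: "\<And>i. i \<in> J \<Longrightarrow> A i \<in> sets (borel :: real measure)"
    let ?E = "prod_emb I2 (\<lambda>_. borel :: real measure) J (Pi\<^sub>E J A)"
    have E: "?E \<in> sets (PiM I2 (\<lambda>_. borel))" using J A by (intro sets_PiM_I) auto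
    have em: "emeasure (distr L (PiM I2 (\<lambda>_. borel)) (\<lambda>x. \<lambda>i\<in>I2. Z i x)) ?E = ennreal (LINT x|L. (\<Prod>i\<in>J. indicator (A i) (Z i x)))"
      if "prob_space L" and mZ: "\<And>i. i \<in> I2 \<Longrightarrow> Z i \<in> borel_measurable L" for L :: "'c measure" and Z
    proof -
      interpret L: prob_space L by fact
      have m: "(\<lambda>x. \<lambda>i\<in>I2. Z i x) \<in> measurable L (PiM I2 (\<lambda>_. borel))" by (intro measurable_restrict mZ)
      define B where "B = (\<lambda>x. \<lambda>i\<in>I2. Z i x) -` ?E \<inter> space L"
      have B: "B \<in> sets L" unfolding B_def using m E by (rule measurable_sets)
      have ind: "indicator B x = (\<Prod>i\<in>J. indicator (A i) (Z i x) :: real)" if "x \<in> space L" for x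
      proof -
        have "x \<in> B \<longleftrightarrow> (\<forall>i\<in>J. Z i x \<in> A i)"
          using that J by (auto simp: B_def prod_emb_def PiE_def Pi_def extensional_def subset_iff)
        then show ?thesis using J(1) by (cases "x \<in> B") (auto simp: indicator_def)
      qed
      have "emeasure (distr L (PiM I2 (\<lambda>_. borel)) (\<lambda>x. \<lambda>i\<in>I2. Z i x)) ?E = emeasure L B"
        unfolding B_def by (rule emeasure_distr[OF m E])
      also have "\<dots> = ennreal (LINT x|L. indicator B x)" using B by (simp add: L.emeasure_eq_measure)
      also have "(LINT x|L. indicator B x :: real) = (LINT x|L. (\<Prod>i\<in>J. indicator (A i) (Z i x)))"
        by (intro Bochner_Integration.integral_cong refl ind)
      finally show ?thesis .
    qed
    have "(CLINT x|M. of_real (\<Prod>i\<in>J. indicator (A i) (X2 i x)) * iexp (\<Sum>j\<in>{}. 0 * X2 j x)) =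
      (CLINT y|N. of_real (\<Prod>i\<in>J. indicator (A i) (Y2 i y)) * iexp (\<Sum>j\<in>{}. 0 * Y2 j y))"
      by (rule multi_char_unique[OF M.finite_measure_axioms N.finite_measure_axioms mX2 mY2 eq2 J]) (use A in auto)
    then have "complex_of_real (LINT x|M. (\<Prod>i\<in>J. indicator (A i) (X2 i x))) = of_real (LINT x|N. (\<Prod>i\<in>J. indicator (A i) (Y2 i x)))"
      by (simp only: sum.empty of_real_0 mult_zero_right exp_zero mult_1_right integral_complex_of_real)
    then have "(LINT x|M. (\<Prod>i\<in>J. indicator (A i) (X2 i x))) = (LINT x|N. (\<Prod>i\<in>J. indicator (A i) (Y2 i x) :: real))"
      by (simp only: of_real_eq_iff)
    then show "emeasure ?P ?E = emeasure ?Q ?E"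
      using em[OF M mX2] em[OF N mY2] by simp
  qed auto
  define \<Phi> where "\<Phi> f = (\<lambda>i\<in>I. Complex (f (i, False)) (f (i, True)))" for f :: "'i \<times> bool \<Rightarrow> real"
  have mC: "(\<lambda>f. Complex (f (i, False)) (f (i, True))) \<in> borel_measurable (PiM I2 (\<lambda>_. borel))" if "i \<in> I" for i
  proof -
    have "(\<lambda>f. of_real (f (i, False)) + \<i> * of_real (f (i, True))) \<in> borel_measurable (PiM I2 (\<lambda>_. borel))"
      using that by (intro borel_measurable_add borel_measurable_times borel_measurable_of_real measurable_component_singleton) (auto simp: I2_def)
    then show ?thesis by (simp add: Complex_eq)
  qed
  have m\<Phi>: "\<Phi> \<in> measurable (PiM I2 (\<lambda>_. borel)) (PiM I (\<lambda>_. borel))"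
    unfolding \<Phi>_def by (intro measurable_restrict mC)
  have "distr ?P (PiM I (\<lambda>_. borel)) \<Phi> = distr M (PiM I (\<lambda>_. borel)) (\<Phi> \<circ> (\<lambda>x. \<lambda>i\<in>I2. X2 i x))"
    by (rule distr_distr[OF m\<Phi> mX2'])
  moreover have "\<Phi> \<circ> (\<lambda>x. \<lambda>i\<in>I2. X2 i x) = (\<lambda>x. \<lambda>i\<in>I. X i x)"
    by (auto simp: \<Phi>_def I2_def X2_def fun_eq_iff complex_eq_iff)
  moreover have "distr ?Q (PiM I (\<lambda>_. borel)) \<Phi> = distr N (PiM I (\<lambda>_. borel)) (\<Phi> \<circ> (\<lambda>x. \<lambda>i\<in>I2. Y2 i x))"
    by (rule distr_distr[OF m\<Phi> mY2'])
  moreover have "\<Phi> \<circ> (\<lambda>x. \<lambda>i\<in>I2. Y2 i x) = (\<lambda>x. \<lambda>i\<in>I. Y i x)"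
    by (auto simp: \<Phi>_def I2_def Y2_def fun_eq_iff complex_eq_iff)
  ultimately show ?thesis using PQ by simp
qed

section \<open>Zeros of random holomorphic functions\<close>

text \<open>Only point evaluations are made measurable, so that laws on this space are determined by
  their finite-dimensional marginals. Holomorphy makes the sigma-algebra rich enough nevertheless:
  the values on a countable dense set determine the function, its derivative and the number of its
  zeros.\<close>

definition hol_space :: "complex set \<Rightarrow> (complex \<Rightarrow> complex) measure" where
  "hol_space A = restrict_space (PiM A (\<lambda>_. borel)) {u. u holomorphic_on A}"

text \<open>The function vanishing on all of \<open>A\<close> is assigned no zeros, which keeps the zero set locally finite.\<close>

definition zeros_in :: "complex set \<Rightarrow> (complex \<Rightarrow> complex) \<Rightarrow> complex set" where
  "zeros_in A u = (if \<forall>z\<in>A. u z = 0 then {} else {z \<in> A. u z = 0})"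

lemma space_hol_space: "space (hol_space A) = {u \<in> extensional A. u holomorphic_on A}"
  by (auto simp: hol_space_def space_restrict_space space_PiM PiE_def)

lemma zeros_in_restrict [simp]: "zeros_in A (restrict u A) = zeros_in A u"
  by (auto simp: zeros_in_def)

lemma zeros_in_subset: "zeros_in A u \<subseteq> {z \<in> A. u z = 0}"
  by (auto simp: zeros_in_def)

lemma measurable_hol_spaceI:
  assumes "\<And>z. z \<in> A \<Longrightarrow> (\<lambda>y. u y z) \<in> borel_measurable Y" "\<And>y. y \<in> space Y \<Longrightarrow> u y holomorphic_on A"
  shows "(\<lambda>y. restrict (u y) A) \<in> measurable Y (hol_space A)"
  unfolding hol_space_def
proof (rule measurable_restrict_space2)
  show "(\<lambda>y. restrict (u y) A) \<in> space Y \<rightarrow> {u. u holomorphic_on A}"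
  proof -
    have "restrict (u y) A holomorphic_on A" if "y \<in> space Y" for y
      by (rule holomorphic_transform[OF assms(2)[OF that]]) simp
    then show ?thesis by blast
  qed
  show "(\<lambda>y. restrict (u y) A) \<in> measurable Y (PiM A (\<lambda>_. borel))"
    using assms(1) by (intro measurable_restrict)
qed

lemma measurable_hol_space_component:
  assumes "u \<in> measurable Y (hol_space A)" "z \<in> A"
  shows "(\<lambda>y. u y z) \<in> borel_measurable Y"
proof -
  have "u \<in> measurable Y (PiM A (\<lambda>_. borel))"
    using assms(1) unfolding hol_space_def measurable_restrict_space2_iff by blast
  from measurable_compose[OF this measurable_component_singleton[OF assms(2)]] show ?thesis .
qed

lemma hol_space_holomorphic:
  assumes "u \<in> measurable Y (hol_space A)" "y \<in> space Y" shows "u y holomorphic_on A"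
  using measurable_space[OF assms] by (simp add: space_hol_space)

text \<open>The random point is replaced by the first member of a dense sequence within 1 / (n + 1)
  of it. This approximation takes countably many values, and continuity of \<open>u y\<close> passes
  to the limit.\<close>

lemma measurable_hol_space_eval:
  assumes A: "open A" and u: "u \<in> measurable Y (hol_space A)"
    and f[measurable]: "f \<in> borel_measurable Y" and fA: "\<And>y. y \<in> space Y \<Longrightarrow> f y \<in> A"
  shows "(\<lambda>y. u y (f y)) \<in> borel_measurable Y"
proof (cases "space Y = {}")
  case True
  then show ?thesis by (simp add: measurable_def)
next
  case False
  then have "A \<noteq> {}" using fA by auto
  obtain T where T: "countable T" "T \<subseteq> A" "A \<subseteq> closure T" by (rule separable)
  then have "T \<noteq> {}" using \<open>A \<noteq> {}\<close> by auto
  define d where "d = from_nat_into T"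
  have d: "range d = T" using T(1) \<open>T \<noteq> {}\<close> by (simp add: d_def range_from_nat_into)
  have ex: "\<exists>k. dist (d k) z < 1 / real (Suc n)" if "z \<in> A" for z n
  proof -
    have "z \<in> closure T" using T that by auto
    then obtain t where "t \<in> T" "dist t z < 1 / real (Suc n)"
      unfolding closure_approachable by (metis of_nat_0_less_iff zero_less_Suc zero_less_divide_1_iff)
    then show ?thesis using d by (metis rangeE)
  qed
  define k where "k n y = (LEAST k. dist (d k) (f y) < 1 / real (Suc n))" for n y
  have [measurable]: "k n \<in> measurable Y (count_space UNIV)" for n
    unfolding k_def by measurable
  have dk: "dist (d (k n y)) (f y) < 1 / real (Suc n)" if "y \<in> space Y" for n y
    unfolding k_def using ex[OF fA[OF that]] by (rule LeastI_ex)
  have lim: "(\<lambda>n. u y (d (k n y))) \<longlonglongrightarrow> u y (f y)" if y: "y \<in> space Y" for y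
  proof -
    have "(\<lambda>n. d (k n y)) \<longlonglongrightarrow> f y"
    proof (rule metric_LIMSEQ_I)
      fix e :: real assume "0 < e"
      then obtain N where "1 / real (Suc N) < e" using nat_approx_posE by blast
      then have "dist (d (k n y)) (f y) < e" if "n \<ge> N" for n
        using dk[OF y, of n] that by (meson frac_le of_nat_0_less_iff of_nat_mono order_less_le_trans order_less_trans zero_less_Suc zero_le_one order_refl Suc_le_mono le_less_trans less_le_trans)
      then show "\<exists>no. \<forall>n\<ge>no. dist (d (k n y)) (f y) < e" by blast
    qed
    moreover have "isCont (u y) (f y)"
      using hol_space_holomorphic[OF u y] A fA[OF y]
      by (metis continuous_on_eq_continuous_at holomorphic_on_imp_continuous_on)
    ultimately show ?thesis by (rule isCont_tendsto_compose[rotated])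
  qed
  have "(\<lambda>y. u y (d (k n y))) \<in> borel_measurable Y" for n
    by (rule measurable_compose_countable[of "\<lambda>i y. u y (d i)", OF measurable_hol_space_component[OF u]]) (use d T in auto)
  then show ?thesis using lim by (rule borel_measurable_LIMSEQ_metric)
qed

lemma zeros_in_compact_finite:
  assumes "open A" "connected A" "u holomorphic_on A" "compact C" "C \<subseteq> A"
  shows "finite (zeros_in A u \<inter> C)"
proof (cases "u constant_on A")
  case True
  then have "zeros_in A u = {}" by (auto simp: zeros_in_def constant_on_def)
  then show ?thesis by simp
next
  case False
  from holomorphic_compact_finite_zeros[OF assms(3,1,2,4,5) False] show ?thesis
    by (rule finite_subset[rotated]) (auto simp: zeros_in_def)
qed

lemma pred_congI:
  "Measurable.pred M P \<Longrightarrow> (\<And>x. x \<in> space M \<Longrightarrow> Q x \<longleftrightarrow> P x) \<Longrightarrow> Measurable.pred M Q"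
  by (subst measurable_cong[of M Q P]) auto

text \<open>On a compact set a continuous function has a zero iff its modulus has infimum 0, and the
  infimum can be taken over a countable dense subset.\<close>

lemma measurable_hit_compact:
  assumes C: "compact C" "C \<subseteq> A"
  shows "Measurable.pred (hol_space A) (\<lambda>u. \<exists>z\<in>C. u z = 0)"
proof (cases "C = {}")
  case False
  obtain T where T: "countable T" "T \<subseteq> C" "C \<subseteq> closure T" by (rule separable)
  have [measurable]: "(\<lambda>u. u z) \<in> borel_measurable (hol_space A)" if "z \<in> T" for z
    using T C that by (intro measurable_hol_space_component[where A = A and u = "\<lambda>u. u"]) auto
  have "Measurable.pred (hol_space A) (\<lambda>u. \<forall>n. \<exists>d\<in>T. norm (u d) < 1 / real (Suc n))"
    using T(1) by measurable
  moreover have "(\<exists>z\<in>C. u z = 0) \<longleftrightarrow> (\<forall>n. \<exists>d\<in>T. norm (u d) < 1 / real (Suc n))"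
    if "u \<in> space (hol_space A)" for u
  proof
    have hol: "u holomorphic_on A" using that by (simp add: space_hol_space)
    have cont: "continuous_on C u" using hol C by (meson continuous_on_subset holomorphic_on_imp_continuous_on)
    show "\<forall>n. \<exists>d\<in>T. norm (u d) < 1 / real (Suc n)" if "\<exists>z\<in>C. u z = 0"
    proof
      fix n
      from that obtain z where z: "z \<in> C" "u z = 0" by blast
      have "0 < 1 / real (Suc n)" by simp
      with cont z(1) obtain \<delta> where \<delta>: "\<delta> > 0" "\<And>x. x \<in> C \<Longrightarrow> dist x z < \<delta> \<Longrightarrow> dist (u x) (u z) < 1 / real (Suc n)"
        unfolding continuous_on_iff by blast
      obtain t where "t \<in> T" "dist t z < \<delta>" using T z \<delta>(1) unfolding closure_approachable by (metis closure_approachable subsetD)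
      then show "\<exists>d\<in>T. norm (u d) < 1 / real (Suc n)" using \<delta>(2)[of t] T z by (auto simp: dist_norm)
    qed
    show "\<exists>z\<in>C. u z = 0" if H: "\<forall>n. \<exists>d\<in>T. norm (u d) < 1 / real (Suc n)"
    proof -
      obtain z0 where z0: "z0 \<in> C" "\<And>z. z \<in> C \<Longrightarrow> norm (u z0) \<le> norm (u z)"
        using continuous_attains_inf[OF C(1) False continuous_on_norm[OF cont]] by blast
      have "u z0 = 0"
      proof (rule ccontr)
        assume "u z0 \<noteq> 0"
        then obtain n where "1 / real (Suc n) < norm (u z0)" using nat_approx_posE[of "norm (u z0)"] by auto
        moreover obtain d where "d \<in> T" "norm (u d) < 1 / real (Suc n)" using H by blast
        ultimately show False using z0(2)[of d] T by auto
      qed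
      then show ?thesis using z0 by blast
    qed
  qed
  ultimately show ?thesis by (rule pred_congI)
qed simp

lemma measurable_zero_function:
  assumes "open A"
  shows "Measurable.pred (hol_space A) (\<lambda>u. \<forall>z\<in>A. u z = 0)"
proof -
  obtain T where T: "countable T" "T \<subseteq> A" "A \<subseteq> closure T" by (rule separable)
  have [measurable]: "(\<lambda>u. u z) \<in> borel_measurable (hol_space A)" if "z \<in> T" for z
    using T that by (intro measurable_hol_space_component[where A = A and u = "\<lambda>u. u"]) auto
  have "Measurable.pred (hol_space A) (\<lambda>u. \<forall>d\<in>T. u d = 0)"
    using T(1) by measurable
  moreover have "(\<forall>z\<in>A. u z = 0) \<longleftrightarrow> (\<forall>d\<in>T. u d = 0)" if "u \<in> space (hol_space A)" for u
  proof
    have hol: "continuous_on A u" using that by (auto simp: space_hol_space holomorphic_on_imp_continuous_on)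
    show "\<forall>z\<in>A. u z = 0" if "\<forall>d\<in>T. u d = 0"
    proof
      fix z assume z: "z \<in> A"
      show "u z = 0"
      proof (rule ccontr)
        assume "u z \<noteq> 0"
        then have "0 < norm (u z)" by simp
        with hol z obtain \<delta> where \<delta>: "\<delta> > 0" "\<And>x. x \<in> A \<Longrightarrow> dist x z < \<delta> \<Longrightarrow> dist (u x) (u z) < norm (u z)"
          unfolding continuous_on_iff by blast
        obtain t where "t \<in> T" "dist t z < \<delta>" using T z \<delta>(1) by (metis closure_approachable subsetD)
        then show False using \<delta>(2)[of t] T that by (auto simp: dist_norm)
      qed
    qed
  qed (use T in auto)
  ultimately show ?thesis by (rule pred_congI)
qed

text \<open>The factor 5 leaves room for the balls in \<open>measurable_zero_count_ge\<close>: their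
  radius is below e and each centre is less than one radius away from its point, so two balls that
  meet would put their points within 4 e of each other.\<close>

lemma finite_separated_by_balls:
  fixes W :: "'a::metric_space set"
  assumes "finite W"
  obtains e where "0 < e" "\<And>x y. x \<in> W \<Longrightarrow> y \<in> W \<Longrightarrow> x \<noteq> y \<Longrightarrow> 5 * e < dist x y"
proof -
  have "\<exists>e>0. \<forall>x\<in>W. \<forall>y\<in>W. x \<noteq> y \<longrightarrow> 5 * e < dist x y"
  proof -
    define P where "P = {p \<in> W \<times> W. fst p \<noteq> snd p}"
    have fin: "finite P" unfolding P_def using assms by simp
    define m where "m = Min (insert 1 ((\<lambda>p. dist (fst p) (snd p)) ` P))"
    have m: "m > 0" unfolding m_def using fin by (subst Min_gr_iff) (auto simp: P_def)
    have "m \<le> dist x y" if "x \<in> W" "y \<in> W" "x \<noteq> y" for x y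
      unfolding m_def using fin that by (intro Min_le) (auto simp: P_def image_iff intro!: bexI[of _ "(x, y)"])
    then show ?thesis using m by (intro exI[of _ "m / 6"]) (auto, fastforce)
  qed
  then show ?thesis using that by blast
qed

text \<open>At least k zeros lie in \<open>C\<close> iff some k pairwise disjoint closed balls, with
  centres in a countable dense set and rational radii, each contain one. Counting thereby becomes a
  countable union of hitting events. The zero function hits everything but has no zeros by the
  convention in \<open>zeros_in\<close>, so it is excluded explicitly for positive k.\<close>

lemma measurable_zero_count_ge:
  assumes A: "open A" "connected A" and C: "compact C" "C \<subseteq> A"
  shows "Measurable.pred (hol_space A) (\<lambda>u. k \<le> card (zeros_in A u \<inter> C))"
proof -
  obtain D :: "complex set" where D: "countable D" "D \<subseteq> UNIV" "UNIV \<subseteq> closure D" by (rule separable)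
  define \<B> where "\<B> = (\<lambda>(x, e). cball x e) ` (D \<times> (\<rat> \<inter> {0<..} :: real set))"
  have \<B>: "countable \<B>" unfolding \<B>_def using D by (intro countable_image countable_SIGMA) (auto simp: countable_rat)
  have cb: "closed b" if "b \<in> \<B>" for b using that by (auto simp: \<B>_def)
  define FF where "FF = {F. finite F \<and> F \<subseteq> \<B> \<and> card F = k \<and> disjoint F}"
  have FF: "countable FF" unfolding FF_def using countable_Collect_finite_subset[OF \<B>] by (rule countable_subset[rotated]) auto
  have hit: "Measurable.pred (hol_space A) (\<lambda>u. \<exists>z\<in>C \<inter> b. u z = 0)" if "b \<in> \<B>" for b
    using C cb[OF that] by (intro measurable_hit_compact) (auto intro: compact_Int_closed)
  have hitF: "Measurable.pred (hol_space A) (\<lambda>u. \<forall>b\<in>F. \<exists>z\<in>C \<inter> b. u z = 0)" if "F \<in> FF" for F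
  proof -
    have "countable F" using that by (auto simp: FF_def countable_finite)
    moreover have [measurable]: "Measurable.pred (hol_space A) (\<lambda>u. \<exists>z\<in>C \<inter> b. u z = 0)" if "b \<in> F" for b
      by (rule hit) (use that \<open>F \<in> FF\<close> in \<open>auto simp: FF_def\<close>)
    ultimately show ?thesis by measurable
  qed
  have "Measurable.pred (hol_space A) (\<lambda>u. k = 0 \<or> (\<not> (\<forall>z\<in>A. u z = 0) \<and> (\<exists>F\<in>FF. \<forall>b\<in>F. \<exists>z\<in>C \<inter> b. u z = 0)))"
    using FF measurable_zero_function[OF A(1), measurable] hitF[measurable] by measurable
  moreover have "k \<le> card (zeros_in A u \<inter> C) \<longleftrightarrow> k = 0 \<or> (\<not> (\<forall>z\<in>A. u z = 0) \<and> (\<exists>F\<in>FF. \<forall>b\<in>F. \<exists>z\<in>C \<inter> b. u z = 0))"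
    if "u \<in> space (hol_space A)" for u
  proof (cases "\<forall>z\<in>A. u z = 0")
    case True
    then have "zeros_in A u = {}" by (simp add: zeros_in_def)
    then show ?thesis using True by simp
  next
    case False
    have hol: "u holomorphic_on A" using that by (simp add: space_hol_space)
    have fin: "finite (zeros_in A u \<inter> C)" by (rule zeros_in_compact_finite[OF A hol C])
    have Z: "zeros_in A u \<inter> C = {z \<in> C. u z = 0}" using False C by (auto simp: zeros_in_def)
    have "k \<le> card (zeros_in A u \<inter> C) \<longleftrightarrow> (\<exists>F\<in>FF. \<forall>b\<in>F. \<exists>z\<in>C \<inter> b. u z = 0)"
    proof
      assume "k \<le> card (zeros_in A u \<inter> C)"
      then obtain W where W: "W \<subseteq> zeros_in A u \<inter> C" "card W = k" "finite W"
        by (meson obtain_subset_with_card_n fin finite_subset)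
      obtain e where e: "0 < e" "\<And>x y. x \<in> W \<Longrightarrow> y \<in> W \<Longrightarrow> x \<noteq> y \<Longrightarrow> 5 * e < dist x y"
        using finite_separated_by_balls[OF W(3)] by blast
      obtain e' where e': "e' \<in> \<rat>" "0 < e'" "e' < e" using Rats_dense_in_real[OF e(1)] by auto
      have "\<exists>x\<in>D. dist x w < e'" for w using D e' closure_approachable by (metis UNIV_I subsetD)
      then obtain c where c: "\<And>w. c w \<in> D" "\<And>w. dist (c w) w < e'" by metis
      define b where "b w = cball (c w) e'" for w
      have wb: "w \<in> b w" for w using c(2)[of w] by (simp add: b_def)
      have dis: "b w \<inter> b v = {}" if "w \<in> W" "v \<in> W" "w \<noteq> v" for w v
      proof (rule ccontr)
        assume "b w \<inter> b v \<noteq> {}"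
        then obtain x where "dist (c w) x \<le> e'" "dist (c v) x \<le> e'" by (auto simp: b_def)
        moreover have "dist w v \<le> dist w (c w) + dist (c w) v" "dist (c w) v \<le> dist (c w) x + dist x v"
          "dist x v \<le> dist x (c v) + dist (c v) v" by (rule dist_triangle)+
        moreover have "dist w (c w) = dist (c w) w" "dist x (c v) = dist (c v) x" by (rule dist_commute)+
        ultimately have "dist w v < 4 * e'" using c(2)[of w] c(2)[of v] by linarith
        then show False using e(2)[OF that] e' by linarith
      qed
      have "inj_on b W" using dis wb by (intro inj_onI) (metis disjoint_iff)
      then have "card (b ` W) = k" using W by (simp add: card_image)
      moreover have "disjoint (b ` W)" using dis by (auto simp: disjoint_def)
      moreover have "b ` W \<subseteq> \<B>" using c e' by (auto simp: b_def \<B>_def)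
      ultimately have "b ` W \<in> FF" using W by (simp add: FF_def)
      moreover have "\<forall>c\<in>b ` W. \<exists>z\<in>C \<inter> c. u z = 0" using W wb Z by auto
      ultimately show "\<exists>F\<in>FF. \<forall>b\<in>F. \<exists>z\<in>C \<inter> b. u z = 0" by blast
    next
      assume "\<exists>F\<in>FF. \<forall>b\<in>F. \<exists>z\<in>C \<inter> b. u z = 0"
      then obtain F where F: "F \<in> FF" "\<forall>b\<in>F. \<exists>z. z \<in> C \<inter> b \<and> u z = 0" by blast
      then obtain g where g: "\<And>b. b \<in> F \<Longrightarrow> g b \<in> C \<inter> b \<and> u (g b) = 0"
        using bchoice[of F "\<lambda>b z. z \<in> C \<inter> b \<and> u z = 0"] by blast
      have "inj_on g F"
      proof (rule inj_onI)
        fix b c assume bc: "b \<in> F" "c \<in> F" "g b = g c"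
        then have "g b \<in> b \<inter> c" using g by (metis Int_iff)
        then show "b = c" using F bc unfolding FF_def disjoint_def by blast
      qed
      then have "card (g ` F) = k" using F by (simp add: card_image FF_def)
      moreover have "g ` F \<subseteq> zeros_in A u \<inter> C" unfolding Z using g by auto
      ultimately show "k \<le> card (zeros_in A u \<inter> C)" using card_mono[OF fin] by metis
    qed
    then show ?thesis using False by auto
  qed
  ultimately show ?thesis by (rule pred_congI)
qed

lemma measurable_zero_count:
  assumes A: "open A" "connected A" and C: "compact C" "C \<subseteq> A"
  shows "(\<lambda>u. card (zeros_in A u \<inter> C)) \<in> measurable (hol_space A) (count_space UNIV)"
proof -
  note [measurable] = measurable_zero_count_ge[OF A C]
  have "Measurable.pred (hol_space A) (\<lambda>u. card (zeros_in A u \<inter> C) = k)" for k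
  proof -
    have "Measurable.pred (hol_space A) (\<lambda>u. k \<le> card (zeros_in A u \<inter> C) \<and> \<not> Suc k \<le> card (zeros_in A u \<inter> C))"
      by measurable
    then show ?thesis by (rule measurable_cong[THEN iffD1, rotated]) auto
  qed
  moreover have "(\<lambda>u. card (zeros_in A u \<inter> C)) -` {k} \<inter> space (hol_space A) = {u \<in> space (hol_space A). card (zeros_in A u \<inter> C) = k}" for k
    by auto
  moreover have "{u \<in> space (hol_space A). card (zeros_in A u \<inter> C) = k} \<in> sets (hol_space A)" for k
    using \<open>Measurable.pred (hol_space A) (\<lambda>u. card (zeros_in A u \<inter> C) = k)\<close> by (rule predE)
  ultimately show ?thesis by (subst measurable_count_space_eq2_countable) simp_all
qed

text \<open>Division by the number of zeros makes this a subprobability kernel, for which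
  parametrised integrals are measurable; the count is multiplied back in
  \<open>measurable_zero_sum\<close>. Without zeros in \<open>C\<close> it is the null
  measure.\<close>

definition zero_kernel :: "complex set \<Rightarrow> complex set \<Rightarrow> (complex \<Rightarrow> complex) \<Rightarrow> complex measure" where
  "zero_kernel A C u = distr (density (count_space (zeros_in A u \<inter> C)) (\<lambda>_. 1 / of_nat (card (zeros_in A u \<inter> C)))) borel (\<lambda>z. z)"

lemma nn_integral_zero_kernel:
  assumes A: "open A" "connected A" and C: "compact C" "C \<subseteq> A" and u: "u holomorphic_on A"
    and f: "f \<in> borel_measurable borel"
  shows "(\<integral>\<^sup>+z. f z \<partial>zero_kernel A C u) = (\<Sum>z\<in>zeros_in A u \<inter> C. f z) / of_nat (card (zeros_in A u \<inter> C))"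
proof -
  have fin: "finite (zeros_in A u \<inter> C)" by (rule zeros_in_compact_finite[OF A u C])
  show ?thesis
    unfolding zero_kernel_def using fin f
    by (subst nn_integral_distr, simp, simp, subst nn_integral_density)
       (auto simp: nn_integral_count_space_finite divide_ennreal_def sum_distrib_left[symmetric] sum_distrib_right[symmetric] mult.commute)
qed

text \<open>Closed sets suffice as a generator, and their intersection with \<open>C\<close> is
  compact again, so that numerator and denominator are both covered by
  \<open>measurable_zero_count\<close>.\<close>

lemma measurable_zero_kernel:
  assumes A: "open A" "connected A" and C: "compact C" "C \<subseteq> A"
  shows "zero_kernel A C \<in> measurable (hol_space A) (subprob_algebra borel)"
proof (rule measurable_subprob_algebra_generated[where \<Omega> = UNIV and G = "Collect closed"])
  show "sets (borel :: complex measure) = sigma_sets UNIV (Collect closed)"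
    by (simp add: borel_eq_closed)
  show "Int_stable (Collect closed :: complex set set)" by (auto simp: Int_stable_def)
  have UNIV_borel: "(UNIV :: complex set) \<in> sets borel" by simp
  have em: "emeasure (zero_kernel A C u) B = of_nat (card (zeros_in A u \<inter> (C \<inter> B))) / of_nat (card (zeros_in A u \<inter> C))"
    if "u \<in> space (hol_space A)" "B \<in> sets borel" for u B
  proof -
    have u: "u holomorphic_on A" using that by (simp add: space_hol_space)
    have fin: "finite (zeros_in A u \<inter> C)" by (rule zeros_in_compact_finite[OF A u C])
    have "emeasure (zero_kernel A C u) B = (\<integral>\<^sup>+z. indicator B z \<partial>zero_kernel A C u)"
      using that by (subst nn_integral_indicator) (auto simp: zero_kernel_def)
    also have "\<dots> = (\<Sum>z\<in>zeros_in A u \<inter> C. indicator B z) / of_nat (card (zeros_in A u \<inter> C))"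
      using that by (intro nn_integral_zero_kernel[OF A C u]) auto
    also have "(\<Sum>z\<in>zeros_in A u \<inter> C. indicator B z :: ennreal) = of_nat (card (zeros_in A u \<inter> (C \<inter> B)))"
    proof -
      have "(\<Sum>z\<in>zeros_in A u \<inter> C. indicator B z :: ennreal) = (\<Sum>z\<in>zeros_in A u \<inter> (C \<inter> B). 1)"
        using fin by (intro sum.mono_neutral_cong_right) auto
      then show ?thesis by simp
    qed
    finally show ?thesis .
  qed
  note [measurable] = measurable_zero_count[OF A]
  show "(\<lambda>u. emeasure (zero_kernel A C u) B) \<in> borel_measurable (hol_space A)" if "B \<in> Collect closed" for B
  proof -
    have "compact (C \<inter> B)" "C \<inter> B \<subseteq> A" using C that by (auto intro: compact_Int_closed)
    note [measurable] = measurable_zero_count[OF A this] measurable_zero_count[OF A C]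
    have "(\<lambda>u. of_nat (card (zeros_in A u \<inter> (C \<inter> B))) / of_nat (card (zeros_in A u \<inter> C)) :: ennreal) \<in> borel_measurable (hol_space A)"
      by measurable
    then show ?thesis by (rule measurable_cong[THEN iffD1, rotated]) (use em that in auto)
  qed
  then show "(\<lambda>u. emeasure (zero_kernel A C u) UNIV) \<in> borel_measurable (hol_space A)" by auto
  show "subprob_space (zero_kernel A C u)" if "u \<in> space (hol_space A)" for u
  proof (rule subprob_spaceI)
    have "emeasure (zero_kernel A C u) UNIV \<le> 1"
      unfolding em[OF that UNIV_borel]
    proof (cases "card (zeros_in A u \<inter> C) = 0")
      case False
      then have "(of_nat (card (zeros_in A u \<inter> C)) :: ennreal) \<noteq> 0" by simp
      then show "of_nat (card (zeros_in A u \<inter> (C \<inter> UNIV))) / of_nat (card (zeros_in A u \<inter> C)) \<le> (1 :: ennreal)"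
        by (simp add: ennreal_divide_self ennreal_of_nat_eq_real_of_nat del: of_nat_0_less_iff)
    qed simp
    then show "emeasure (zero_kernel A C u) (space (zero_kernel A C u)) \<le> 1" by (simp add: zero_kernel_def)
    show "space (zero_kernel A C u) \<noteq> {}" by (simp add: zero_kernel_def)
  qed
qed (auto simp: zero_kernel_def)

text \<open>The zero set moves with y and may be infinite. On each member of a compact exhaustion
  the sum is the number of zeros times an integral against \<open>zero_kernel\<close>, and monotone
  convergence removes the cut-off.\<close>

lemma measurable_zero_sum:
  assumes A: "open A" "connected A"
    and u: "u \<in> measurable Y (hol_space A)" and \<psi>: "(\<lambda>(y, z). \<psi> y z) \<in> borel_measurable (Y \<Otimes>\<^sub>M borel)"
  shows "(\<lambda>y. \<integral>\<^sup>+z. \<psi> y z \<partial>count_space (zeros_in A (u y))) \<in> borel_measurable Y"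
proof -
  obtain C where C: "\<And>n. compact (C n)" "\<And>n. C n \<subseteq> A" "\<And>n. C n \<subseteq> interior (C (Suc n))" "\<Union>(range C) = A"
    using open_Union_compact_subsets[OF A(1)] by metis
  have inc: "incseq C" using C(3) interior_subset by (intro incseq_SucI) blast
  have \<psi>y: "\<psi> y \<in> borel_measurable borel" if "y \<in> space Y" for y
    using measurable_Pair2[OF \<psi> that] by simp
  have hol: "u y holomorphic_on A" if "y \<in> space Y" for y using hol_space_holomorphic[OF u that] .
  have part: "(\<lambda>y. \<integral>\<^sup>+z. \<psi> y z * indicator (C n) z \<partial>count_space (zeros_in A (u y))) \<in> borel_measurable Y" for n
  proof -
    have k: "(\<lambda>y. zero_kernel A (C n) (u y)) \<in> measurable Y (subprob_algebra borel)"
      using measurable_compose[OF u measurable_zero_kernel[OF A C(1,2)]] .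
    have [measurable]: "(\<lambda>y. \<integral>\<^sup>+z. \<psi> y z \<partial>zero_kernel A (C n) (u y)) \<in> borel_measurable Y"
      by (rule nn_integral_measurable_subprob_algebra2[OF \<psi> k])
    have [measurable]: "(\<lambda>y. card (zeros_in A (u y) \<inter> C n)) \<in> measurable Y (count_space UNIV)"
      using measurable_compose[OF u measurable_zero_count[OF A C(1,2)]] .
    have "(\<lambda>y. of_nat (card (zeros_in A (u y) \<inter> C n)) * (\<integral>\<^sup>+z. \<psi> y z \<partial>zero_kernel A (C n) (u y))) \<in> borel_measurable Y"
      by measurable
    moreover have "of_nat (card (zeros_in A (u y) \<inter> C n)) * (\<integral>\<^sup>+z. \<psi> y z \<partial>zero_kernel A (C n) (u y)) =
        (\<integral>\<^sup>+z. \<psi> y z * indicator (C n) z \<partial>count_space (zeros_in A (u y)))" if y: "y \<in> space Y" for y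
    proof -
      have fin: "finite (zeros_in A (u y) \<inter> C n)" by (rule zeros_in_compact_finite[OF A hol[OF y] C(1,2)])
      have "(\<integral>\<^sup>+z. \<psi> y z * indicator (C n) z \<partial>count_space (zeros_in A (u y))) =
        (\<Sum>z\<in>zeros_in A (u y) \<inter> C n. \<psi> y z * indicator (C n) z)"
        using fin by (intro nn_integral_count_space') (auto simp: indicator_def)
      also have "\<dots> = (\<Sum>z\<in>zeros_in A (u y) \<inter> C n. \<psi> y z)" by (intro sum.cong) auto
      finally have 1: "(\<integral>\<^sup>+z. \<psi> y z * indicator (C n) z \<partial>count_space (zeros_in A (u y))) = (\<Sum>z\<in>zeros_in A (u y) \<inter> C n. \<psi> y z)" .
      show ?thesis
      proof (cases "card (zeros_in A (u y) \<inter> C n) = 0")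
        case True
        then show ?thesis using 1 fin by simp
      next
        case False
        then have "(of_nat (card (zeros_in A (u y) \<inter> C n)) :: ennreal) \<noteq> 0" by simp
        then show ?thesis unfolding 1 nn_integral_zero_kernel[OF A C(1,2) hol[OF y] \<psi>y[OF y]]
          by (simp add: ennreal_times_divide mult.commute[of "of_nat _"] ennreal_mult_divide_eq)
      qed
    qed
    ultimately show ?thesis by (rule measurable_cong[THEN iffD1, rotated]) auto
  qed
  have "(\<lambda>y. SUP n. \<integral>\<^sup>+z. \<psi> y z * indicator (C n) z \<partial>count_space (zeros_in A (u y))) \<in> borel_measurable Y"
    using part by (intro borel_measurable_SUP) auto
  moreover have "(SUP n. \<integral>\<^sup>+z. \<psi> y z * indicator (C n) z \<partial>count_space (zeros_in A (u y))) = (\<integral>\<^sup>+z. \<psi> y z \<partial>count_space (zeros_in A (u y)))" for y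
  proof -
    have "(SUP n. \<integral>\<^sup>+z. \<psi> y z * indicator (C n) z \<partial>count_space (zeros_in A (u y))) =
      (\<integral>\<^sup>+z. (SUP n. \<psi> y z * indicator (C n) z) \<partial>count_space (zeros_in A (u y)))"
      using inc by (intro nn_integral_monotone_convergence_SUP[symmetric])
        (auto simp: incseq_def le_fun_def indicator_def dest: subsetD)
    also have "\<dots> = (\<integral>\<^sup>+z. \<psi> y z \<partial>count_space (zeros_in A (u y)))"
    proof (intro nn_integral_cong)
      fix z assume "z \<in> space (count_space (zeros_in A (u y)))"
      then have "z \<in> A" using zeros_in_subset by auto
      then obtain n where n: "z \<in> C n" using C(4) by blast
      show "(SUP n. \<psi> y z * indicator (C n) z) = \<psi> y z"
      proof (rule antisym)
        show "(SUP n. \<psi> y z * indicator (C n) z) \<le> \<psi> y z" by (intro SUP_least) (auto simp: indicator_def)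
        show "\<psi> y z \<le> (SUP n. \<psi> y z * indicator (C n) z)" by (rule SUP_upper2[of n]) (use n in auto)
      qed
    qed
    finally show ?thesis .
  qed
  ultimately show ?thesis by simp
qed

section \<open>The area formula for holomorphic functions\<close>

text \<open>Coordinates in which the change of variables theorem on \<open>real^2\<close> applies;
  multiplication by d acquires the Jacobian determinant |d|^2 there.\<close>

definition r2c :: "real^2 \<Rightarrow> complex" where "r2c v = Complex (v $ 1) (v $ 2)"
definition c2r :: "complex \<Rightarrow> real^2" where "c2r z = (\<chi> i. if i = 1 then Re z else Im z)"

lemma r2c_c2r [simp]: "r2c (c2r z) = z" by (simp add: r2c_def c2r_def)
lemma c2r_r2c [simp]: "c2r (r2c v) = v"
  by (simp add: r2c_def c2r_def Finite_Cartesian_Product.vec_eq_iff forall_2)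

lemma linear_r2c: "linear r2c"
  by (rule linearI) (simp_all add: r2c_def complex_eq_iff)
lemma linear_c2r: "linear c2r"
  by (rule linearI) (simp_all add: c2r_def Finite_Cartesian_Product.vec_eq_iff)

lemma r2c_measurable [measurable]: "r2c \<in> borel_measurable borel"
  by (intro borel_measurable_continuous_onI linear_continuous_on linear_r2c[unfolded linear_conv_bounded_linear])
lemma c2r_measurable [measurable]: "c2r \<in> borel_measurable borel"
  by (intro borel_measurable_continuous_onI linear_continuous_on linear_c2r[unfolded linear_conv_bounded_linear])

lemma distr_lborel_r2c: "distr lborel borel r2c = (lborel :: complex measure)"
proof (rule lborel_eqI[symmetric])
  fix l u :: complex assume le: "\<And>b. b \<in> Basis \<Longrightarrow> l \<bullet> b \<le> u \<bullet> b"
  have le': "Re l \<le> Re u" "Im l \<le> Im u" using le[of 1] le[of \<i>] by (auto simp: Basis_complex_def)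
  have "r2c -` box l u = box (c2r l) (c2r u)"
    by (auto simp: mem_box_cart r2c_def c2r_def in_box_complex_iff forall_2)
  then have "emeasure (distr lborel borel r2c) (box l u) = emeasure lborel (box (c2r l) (c2r u))"
    by (simp add: emeasure_distr)
  also have "\<dots> = (\<Prod>b\<in>Basis. (c2r u - c2r l) \<bullet> b)"
    using le' by (intro emeasure_lborel_box) (auto simp: Basis_vec_def inner_axis c2r_def)
  also have "(\<Prod>b\<in>Basis. (c2r u - c2r l) \<bullet> b) = (\<Prod>i\<in>UNIV. (c2r u - c2r l) $ i)"
  proof -
    have "(Basis :: (real^2) set) = (\<lambda>i. axis i 1) ` UNIV" by (auto simp: Basis_vec_def)
    moreover have "inj (\<lambda>i::2. axis i (1::real))" by (auto simp: inj_def axis_eq_axis)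
    ultimately have "prod f (Basis :: (real^2) set) = (\<Prod>i\<in>UNIV. f (axis i 1))" for f :: "real^2 \<Rightarrow> real"
      by (metis (no_types, lifting) prod.reindex_cong)
    then show ?thesis by (simp add: inner_axis)
  qed
  also have "\<dots> = (Re u - Re l) * (Im u - Im l)"
    by (simp add: UNIV_2 c2r_def)
  also have "\<dots> = (\<Prod>b\<in>Basis. (u - l) \<bullet> b)"
    by (simp add: Basis_complex_def)
  finally show "emeasure (distr lborel borel r2c) (box l u) = (\<Prod>b\<in>Basis. (u - l) \<bullet> b)" .
qed simp

lemma det_matrix_complex_mult:
  "Determinants.det (matrix (\<lambda>h. c2r (d * r2c h))) = (norm d)\<^sup>2"
proof -
  have "matrix (\<lambda>h. c2r (d * r2c h)) $ i $ j = c2r (d * r2c (axis j 1)) $ i" for i j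
    by (simp add: matrix_def)
  then show ?thesis
    unfolding det_2 cmod_power2 by (simp add: c2r_def r2c_def axis_def power2_eq_square)
qed

text \<open>Compactness of \<open>C\<close> bounds the derivative, so the integral on the right is
  finite. This permits its transfer to the Henstock-Kurzweil integral, in which the measure of a
  differentiable image is expressed.\<close>

lemma emeasure_holomorphic_image_compact:
  assumes U: "open U" "T holomorphic_on U" "inj_on T U" and B: "B \<in> sets borel" "B \<subseteq> C" "compact C" "C \<subseteq> U"
    and img: "T ` B \<in> sets borel"
  shows "emeasure lborel (T ` B) = (\<integral>\<^sup>+z. ennreal ((norm (deriv T z))\<^sup>2) * indicator B z \<partial>lborel)"
proof -
  define S where "S = r2c -` B"
  have S: "S \<in> sets borel" unfolding S_def using measurable_sets[OF r2c_measurable B(1)] by simp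
  define f where "f x = c2r (T (r2c x))" for x
  define D where "D z = (if z \<in> C then (norm (deriv T z))\<^sup>2 else 0)" for z
  have "deriv T holomorphic_on U" using U by (simp add: holomorphic_deriv)
  then have cD: "continuous_on C (deriv T)"
    using B by (meson continuous_on_subset holomorphic_on_imp_continuous_on)
  have Cb: "C \<in> sets borel" using B(3) by (simp add: borel_compact)
  have Dm [measurable]: "D \<in> borel_measurable borel"
  proof -
    have "D = (\<lambda>z. indicator C z *\<^sub>R (norm (deriv T z))\<^sup>2)" by (auto simp: D_def)
    moreover have "(\<lambda>z. indicator C z *\<^sub>R (norm (deriv T z))\<^sup>2) \<in> borel_measurable borel"
      using Cb cD by (intro borel_measurable_continuous_on_indicator continuous_intros)
    ultimately show ?thesis by simp
  qed
  obtain b where b: "\<And>z. D z \<le> b" "0 \<le> b"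
  proof -
    have "bounded (deriv T ` C)" using compact_continuous_image[OF cD B(3)] compact_imp_bounded by blast
    then obtain c where c: "\<forall>z\<in>C. norm (deriv T z) \<le> c" "c > 0" by (auto simp: bounded_pos)
    show thesis
      by (rule that[of "c\<^sup>2"]) (use c in \<open>auto simp: D_def power_mono\<close>)
  qed
  have fin: "(\<integral>\<^sup>+z. ennreal (D z) * indicator B z \<partial>lborel) < \<top>"
  proof -
    have "(\<integral>\<^sup>+z. ennreal (D z) * indicator B z \<partial>lborel) \<le> (\<integral>\<^sup>+z. ennreal b * indicator C z \<partial>lborel)"
      using b B(2) by (intro nn_integral_mono) (auto simp: indicator_def ennreal_leI)
    also have "\<dots> = ennreal b * emeasure lborel C" using Cb by (simp add: nn_integral_cmult_indicator)
    also have "\<dots> < \<top>"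
      using emeasure_bounded_finite[OF compact_imp_bounded[OF B(3)]] by (simp add: ennreal_mult_less_top)
    finally show ?thesis .
  qed
  define m where "m = enn2real (\<integral>\<^sup>+z. ennreal (D z) * indicator B z \<partial>lborel)"
  have m: "(\<integral>\<^sup>+z. ennreal (D z) * indicator B z \<partial>lborel) = ennreal m" "0 \<le> m"
    using fin by (auto simp: m_def)
  have "(\<integral>\<^sup>+x. ennreal (D (r2c x) * indicator S x) \<partial>lborel) = (\<integral>\<^sup>+z. ennreal (D z) * indicator B z \<partial>distr lborel borel r2c)"
    using B(1) by (subst nn_integral_distr) (auto intro!: nn_integral_cong simp: S_def indicator_def)
  then have "(\<integral>\<^sup>+x. ennreal (D (r2c x) * indicator S x) \<partial>lborel) = ennreal m"
    unfolding distr_lborel_r2c m .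
  then have "((\<lambda>x. D (r2c x) * indicator S x) has_integral m) UNIV"
  proof (intro nn_integral_has_integral m)
    note [measurable] = S
    show "(\<lambda>x. D (r2c x) * indicator S x) \<in> borel_measurable borel" by measurable
    show "0 \<le> D (r2c x) * indicator S x" for x by (auto simp: D_def)
  qed
  moreover have "(\<lambda>x. D (r2c x) * indicator S x) = (\<lambda>x. if x \<in> S then (norm (deriv T (r2c x)))\<^sup>2 else 0)"
    using B(2) by (auto simp: D_def S_def indicator_def fun_eq_iff)
  ultimately have hi: "((\<lambda>x. (norm (deriv T (r2c x)))\<^sup>2) has_integral m) S"
    by (simp add: has_integral_restrict_UNIV)
  have der: "(f has_derivative (\<lambda>h. c2r (deriv T (r2c x) * r2c h))) (at x within S)" if "x \<in> S" for x
  proof -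
    have "r2c x \<in> U" using that B by (auto simp: S_def)
    then have "(T has_field_derivative deriv T (r2c x)) (at (r2c x))"
      using U by (intro holomorphic_derivI) auto
    then have 1: "(T has_derivative (*) (deriv T (r2c x))) (at (r2c x))"
      by (rule has_field_derivative_imp_has_derivative)
    have 2: "(r2c has_derivative r2c) (at x)"
      using linear_r2c by (simp add: bounded_linear_imp_has_derivative linear_conv_bounded_linear)
    have 3: "(c2r has_derivative c2r) (at (T (r2c x)))"
      using linear_c2r by (simp add: bounded_linear_imp_has_derivative linear_conv_bounded_linear)
    from diff_chain_at[OF diff_chain_at[OF 2 1] 3[folded o_apply[of T r2c]]] show ?thesis
      unfolding f_def by (auto simp: o_def intro: has_derivative_at_withinI)
  qed
  have inj: "inj_on f S"
  proof (rule inj_onI)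
    fix x y assume xy: "x \<in> S" "y \<in> S" "f x = f y"
    then have "T (r2c x) = T (r2c y)" unfolding f_def by (metis r2c_c2r)
    then have "r2c x = r2c y" using xy U(3) B by (auto simp: S_def inj_on_def)
    then show "x = y" by (metis c2r_r2c)
  qed
  have "f ` S \<in> lmeasurable \<and> measure lebesgue (f ` S) = m"
    by (subst has_measure_differentiable_image[OF _ der inj]) (use S hi det_matrix_complex_mult in auto)
  moreover have fS: "f ` S = r2c -` (T ` B)"
  proof (rule equalityI; rule subsetI)
    fix y assume "y \<in> r2c -` T ` B"
    then obtain z where z: "z \<in> B" "r2c y = T z" by auto
    then have "y = f (c2r z)" unfolding f_def by (metis c2r_r2c r2c_c2r)
    moreover have "c2r z \<in> S" using z by (simp add: S_def)
    ultimately show "y \<in> f ` S" by blast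
  qed (auto simp: f_def S_def)
  moreover have fSb: "f ` S \<in> sets borel" unfolding fS using measurable_sets[OF r2c_measurable img] by simp
  ultimately have "emeasure lborel (f ` S) = ennreal m"
    using emeasure_eq_measure2[of "f ` S" lebesgue] emeasure_completion[of "f ` S" lborel] by simp
  moreover have "emeasure lborel (T ` B) = emeasure lborel (f ` S)"
  proof -
    have "emeasure (distr lborel borel r2c) (T ` B) = emeasure lborel (r2c -` (T ` B))"
      using img by (subst emeasure_distr) auto
    then show ?thesis unfolding fS distr_lborel_r2c .
  qed
  moreover have "(\<integral>\<^sup>+z. ennreal (D z) * indicator B z \<partial>lborel) = (\<integral>\<^sup>+z. ennreal ((norm (deriv T z))\<^sup>2) * indicator B z \<partial>lborel)"
    using B(2) by (intro nn_integral_cong) (auto simp: D_def indicator_def)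
  ultimately show ?thesis using m by simp
qed

text \<open>Two measures on the domain are compared: the image under \<open>g\<close> of Lebesgue
  measure on the range of \<open>T\<close>, and the measure with density |T'|^2. They agree on Borel
  subsets of compact sets, and a compact exhaustion of \<open>U\<close> gives all Borel
  sets.\<close>

lemma nn_integral_holomorphic_injective:
  assumes U: "open U" "T holomorphic_on U" "inj_on T U" and g: "g holomorphic_on T ` U" "\<And>z. z \<in> U \<Longrightarrow> g (T z) = z"
    and \<psi>: "\<psi> \<in> borel_measurable borel"
  shows "(\<integral>\<^sup>+w. \<psi> (g w) * indicator (T ` U) w \<partial>lborel) =
     (\<integral>\<^sup>+z. ennreal ((norm (deriv T z))\<^sup>2) * \<psi> z * indicator U z \<partial>lborel)"
    and "(\<lambda>w. \<psi> (g w) * indicator (T ` U) w) \<in> borel_measurable borel"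
proof -
  have TU: "open (T ` U)" by (rule open_mapping_thm3[OF U(2,1,3)])
  define g' where "g' w = (if w \<in> T ` U then g w else 0)" for w
  have cg: "continuous_on (T ` U) g" using g(1) by (rule holomorphic_on_imp_continuous_on)
  have g'm [measurable]: "g' \<in> borel_measurable borel"
  proof -
    have "(\<lambda>w. indicator (T ` U) w *\<^sub>R g w) \<in> borel_measurable borel"
      using TU cg by (intro borel_measurable_continuous_on_indicator) auto
    moreover have "g' = (\<lambda>w. indicator (T ` U) w *\<^sub>R g w)" by (auto simp: g'_def)
    ultimately show ?thesis by simp
  qed
  define D where "D z = (if z \<in> U then (norm (deriv T z))\<^sup>2 else 0)" for z
  have "deriv T holomorphic_on U" using U by (simp add: holomorphic_deriv)
  then have cD: "continuous_on U (deriv T)" by (rule holomorphic_on_imp_continuous_on)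
  have Dm [measurable]: "D \<in> borel_measurable borel"
  proof -
    have "D = (\<lambda>z. indicator U z *\<^sub>R (norm (deriv T z))\<^sup>2)" by (auto simp: D_def)
    moreover have "(\<lambda>z. indicator U z *\<^sub>R (norm (deriv T z))\<^sup>2) \<in> borel_measurable borel"
      using U cD by (intro borel_measurable_continuous_on_indicator continuous_intros) auto
    ultimately show ?thesis by simp
  qed
  have TUb [measurable]: "T ` U \<in> sets borel" using TU by simp
  let ?\<nu>1 = "distr (density lborel (indicator (T ` U))) borel g'" and ?\<nu>2 = "density lborel (\<lambda>z. ennreal (D z))"
  obtain C where C: "\<And>n. compact (C n)" "\<And>n. C n \<subseteq> U" "\<And>n. C n \<subseteq> interior (C (Suc n))" "\<Union>(range C) = U"
    using open_Union_compact_subsets[OF U(1)] by metis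
  have inc: "incseq C" using C(3) interior_subset by (intro incseq_SucI) blast
  have "?\<nu>1 = ?\<nu>2"
  proof (rule measure_eqI)
    fix B assume "B \<in> sets ?\<nu>1"
    then have B [measurable]: "B \<in> sets borel" by simp
    have im: "T ` (B \<inter> V) = g' -` (B \<inter> V) \<inter> T ` U" if "V \<subseteq> U" for V
    proof (rule equalityI; rule subsetI)
      fix w assume "w \<in> T ` (B \<inter> V)"
      then obtain z where z: "z \<in> B" "z \<in> V" "w = T z" by blast
      then have "z \<in> U" using that by blast
      then have "g' w = z" using z g(2) by (simp add: g'_def)
      then show "w \<in> g' -` (B \<inter> V) \<inter> T ` U" using z \<open>z \<in> U\<close> by blast
    next
      fix w assume w: "w \<in> g' -` (B \<inter> V) \<inter> T ` U"
      then obtain z where z: "z \<in> U" "w = T z" by blast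
      then have "g' w = z" using g(2) by (simp add: g'_def)
      then show "w \<in> T ` (B \<inter> V)" using w z by blast
    qed
    have imb: "T ` (B \<inter> V) \<in> sets borel" if "V \<subseteq> U" "V \<in> sets borel" for V
      unfolding im[OF that(1)] using measurable_sets[OF g'm, of "B \<inter> V"] that by auto
    have part: "emeasure lborel (T ` (B \<inter> C n)) = (\<integral>\<^sup>+z. ennreal (D z) * indicator (B \<inter> C n) z \<partial>lborel)" for n
    proof -
      have Cn: "C n \<in> sets borel" using C(1) by (simp add: borel_compact)
      have "emeasure lborel (T ` (B \<inter> C n)) = (\<integral>\<^sup>+z. ennreal ((norm (deriv T z))\<^sup>2) * indicator (B \<inter> C n) z \<partial>lborel)"
        using B Cn imb[OF C(2) Cn] by (intro emeasure_holomorphic_image_compact[OF U _ _ C(1,2)]) auto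
      also have "\<dots> = (\<integral>\<^sup>+z. ennreal (D z) * indicator (B \<inter> C n) z \<partial>lborel)"
        using C(2) by (intro nn_integral_cong) (auto simp: D_def indicator_def)
      finally show ?thesis .
    qed
    have dB: "emeasure ?\<nu>2 X = (\<integral>\<^sup>+z. ennreal (D z) * indicator X z \<partial>lborel)" if "X \<in> sets borel" for X
      using that by (simp add: emeasure_density)
    have Cb: "C n \<in> sets borel" for n using C(1) by (simp add: borel_compact)
    have "emeasure ?\<nu>1 B = emeasure (density lborel (indicator (T ` U))) (g' -` B)"
      by (subst emeasure_distr) auto
    also have "\<dots> = emeasure lborel (g' -` B \<inter> T ` U)"
      using measurable_sets[OF g'm B]
      by (subst emeasure_density) (auto simp: indicator_inter_arith[symmetric] Int_commute)
    also have "g' -` B \<inter> T ` U = T ` (B \<inter> U)"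
    proof -
      have "g' w \<in> U" if "w \<in> T ` U" for w using that g(2) by (auto simp: g'_def)
      then show ?thesis unfolding im[OF order_refl] by blast
    qed
    also have "\<dots> = (\<Union>n. T ` (B \<inter> C n))" using C(4) by auto
    also have "emeasure lborel \<dots> = (SUP n. emeasure lborel (T ` (B \<inter> C n)))"
      using inc imb[OF C(2) Cb] by (intro SUP_emeasure_incseq[symmetric]) (auto simp: incseq_def intro!: image_mono)
    also have "\<dots> = (SUP n. emeasure ?\<nu>2 (B \<inter> C n))"
      using Cb by (simp add: part dB)
    also have "\<dots> = emeasure ?\<nu>2 (\<Union>n. B \<inter> C n)"
      using inc Cb by (intro SUP_emeasure_incseq) (auto simp: incseq_def)
    also have "(\<Union>n. B \<inter> C n) = B \<inter> U" using C(4) by auto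
    also have "emeasure ?\<nu>2 (B \<inter> U) = emeasure ?\<nu>2 B"
      using U(1) B by (subst (1 2) dB) (auto intro!: nn_integral_cong simp: D_def indicator_def)
    finally show "emeasure ?\<nu>1 B = emeasure ?\<nu>2 B" .
  qed simp
  then have "(\<integral>\<^sup>+z. \<psi> z \<partial>?\<nu>1) = (\<integral>\<^sup>+z. \<psi> z \<partial>?\<nu>2)" by simp
  moreover have "(\<integral>\<^sup>+z. \<psi> z \<partial>?\<nu>1) = (\<integral>\<^sup>+w. \<psi> (g w) * indicator (T ` U) w \<partial>lborel)"
  proof -
    note [measurable] = \<psi>
    have "(\<integral>\<^sup>+z. \<psi> z \<partial>?\<nu>1) = (\<integral>\<^sup>+w. \<psi> (g' w) \<partial>density lborel (indicator (T ` U)))"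
      by (rule nn_integral_distr) measurable
    also have "\<dots> = (\<integral>\<^sup>+w. indicator (T ` U) w * \<psi> (g' w) \<partial>lborel)"
      by (rule nn_integral_density) measurable
    also have "\<dots> = (\<integral>\<^sup>+w. \<psi> (g w) * indicator (T ` U) w \<partial>lborel)"
      by (intro nn_integral_cong) (simp add: g'_def indicator_def)
    finally show ?thesis .
  qed
  moreover have "(\<integral>\<^sup>+z. \<psi> z \<partial>?\<nu>2) = (\<integral>\<^sup>+z. ennreal ((norm (deriv T z))\<^sup>2) * \<psi> z * indicator U z \<partial>lborel)"
  proof -
    note [measurable] = \<psi>
    have "(\<integral>\<^sup>+z. \<psi> z \<partial>?\<nu>2) = (\<integral>\<^sup>+z. ennreal (D z) * \<psi> z \<partial>lborel)"
      by (rule nn_integral_density) measurable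
    also have "\<dots> = (\<integral>\<^sup>+z. ennreal ((norm (deriv T z))\<^sup>2) * \<psi> z * indicator U z \<partial>lborel)"
      by (intro nn_integral_cong) (simp add: D_def indicator_def)
    finally show ?thesis .
  qed
  ultimately show "(\<integral>\<^sup>+w. \<psi> (g w) * indicator (T ` U) w \<partial>lborel) =
     (\<integral>\<^sup>+z. ennreal ((norm (deriv T z))\<^sup>2) * \<psi> z * indicator U z \<partial>lborel)" by simp
  have "(\<lambda>w. \<psi> (g' w) * indicator (T ` U) w) \<in> borel_measurable borel"
    using \<psi> by measurable
  moreover have "(\<lambda>w. \<psi> (g' w) * indicator (T ` U) w) = (\<lambda>w. \<psi> (g w) * indicator (T ` U) w)"
    by (auto simp: g'_def indicator_def)
  ultimately show "(\<lambda>w. \<psi> (g w) * indicator (T ` U) w) \<in> borel_measurable borel" by simp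
qed

lemma zeros_in_diff_eq:
  assumes "\<not> T constant_on A" shows "zeros_in A (\<lambda>z. T z - w) = {z \<in> A. T z = w}"
proof -
  have "\<not> (\<forall>z\<in>A. T z - w = 0)"
  proof
    assume "\<forall>z\<in>A. T z - w = 0"
    then have "\<forall>z\<in>A. T z = w" by simp
    then show False using assms unfolding constant_on_def by blast
  qed
  then show ?thesis unfolding zeros_in_def by (subst if_not_P) simp_all
qed

lemma zeros_in_countable:
  assumes "open A" "connected A" "u holomorphic_on A"
  shows "countable (zeros_in A u)"
proof -
  obtain C where C: "\<And>n. compact (C n)" "\<And>n. C n \<subseteq> A" "\<And>n. C n \<subseteq> interior (C (Suc n))" "\<Union>(range C) = A"
    using open_Union_compact_subsets[OF assms(1)] by metis
  have "zeros_in A u = (\<Union>n::nat. zeros_in A u \<inter> C n)"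
    using zeros_in_subset[of A u] C(4) by blast
  moreover have "countable (\<Union>n. zeros_in A u \<inter> C n)"
    using zeros_in_compact_finite[OF assms C(1,2)] by (intro countable_UN) (auto intro: countable_finite)
  ultimately show ?thesis by simp
qed

text \<open>The one-point change of variables \<^term>\<open>w = T z\<close> behind the Kac--Rice formula; critical values form a
  countable set.\<close>

theorem holomorphic_area_formula:
  assumes A: "open A" "connected A" and T: "T holomorphic_on A" and \<psi>: "\<psi> \<in> borel_measurable borel"
  shows "(\<integral>\<^sup>+w. (\<integral>\<^sup>+z. \<psi> z \<partial>count_space (zeros_in A (\<lambda>z. T z - w))) \<partial>lborel) =
    (\<integral>\<^sup>+z. ennreal ((norm (deriv T z))\<^sup>2) * \<psi> z * indicator A z \<partial>lborel)"
proof (cases "T constant_on A")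
  \<comment> \<open>A constant \<open>T\<close> has derivative 0, and the convention in
    \<open>zeros_in\<close> makes the left side vanish as well, even at the single value
    attained.\<close>
  case True
  then obtain c where c: "\<And>z. z \<in> A \<Longrightarrow> T z = c" by (auto simp: constant_on_def)
  have "zeros_in A (\<lambda>z. T z - w) = {}" for w using c by (auto simp: zeros_in_def)
  moreover have "deriv T z = 0" if "z \<in> A" for z
  proof -
    have "\<forall>\<^sub>F w in nhds z. T w = c" using eventually_nhds_in_open[OF A(1) that] by eventually_elim (rule c)
    then have "deriv T z = deriv (\<lambda>_. c) z" by (rule deriv_cong_ev) simp
    then show ?thesis by simp
  qed
  moreover have "(\<integral>\<^sup>+z. \<psi> z \<partial>count_space {}) = 0" by (rule nn_integral_empty) simp
  moreover have "(\<integral>\<^sup>+z. ennreal ((norm (deriv T z))\<^sup>2) * \<psi> z * indicator A z \<partial>lborel) = (\<integral>\<^sup>+z. 0 \<partial>(lborel :: complex measure))"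
  proof (intro nn_integral_cong)
    show "ennreal ((norm (deriv T z))\<^sup>2) * \<psi> z * indicator A z = 0" for z
      using \<open>\<And>z. z \<in> A \<Longrightarrow> deriv T z = 0\<close>[of z] by (cases "z \<in> A") auto
  qed
  ultimately show ?thesis by simp
next
  case False
  have dT: "deriv T holomorphic_on A" by (rule holomorphic_deriv[OF T A(1)])
  define E where "E = {z \<in> A. deriv T z \<noteq> 0}"
  have E: "open E"
  proof -
    have eq: "E = A \<inter> deriv T -` (- {0})" by (auto simp: E_def)
    show ?thesis unfolding eq
      by (rule continuous_open_preimage[OF holomorphic_on_imp_continuous_on[OF dT] A(1)]) auto
  qed
  have crit: "countable (A - E)"
  proof (cases "\<forall>z\<in>A. deriv T z = 0")
    case all: True
    have "T constant_on A"
    proof (rule DERIV_zero_connected_constant_on[OF A(2,1) finite.emptyI holomorphic_on_imp_continuous_on[OF T]])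
      show "\<forall>z\<in>A - {}. (T has_field_derivative 0) (at z)"
        using holomorphic_derivI[OF T A(1)] all by (metis DiffE)
    qed
    then show ?thesis using False by simp
  next
    case no: False
    then have "A - E = zeros_in A (deriv T)" by (auto simp: E_def zeros_in_def)
    then show ?thesis using zeros_in_countable[OF A dT] by simp
  qed
  define \<U> where "\<U> = {U. open U \<and> U \<subseteq> E \<and> inj_on T U}"
  have "\<Union>\<U> = E"
  proof
    show "E \<subseteq> \<Union>\<U>"
    proof
      fix z assume z: "z \<in> E"
      obtain r where "r > 0" "ball z r \<subseteq> E" "inj_on T (ball z r)"
        using has_complex_derivative_locally_injective[OF holomorphic_on_subset[OF T, of E] z E] z by (auto simp: E_def)
      then show "z \<in> \<Union>\<U>" unfolding \<U>_def by (intro UnionI[of "ball z r"]) auto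
    qed
  qed (auto simp: \<U>_def)
  moreover obtain \<V> where \<V>: "\<V> \<subseteq> \<U>" "countable \<V>" "\<Union>\<V> = \<Union>\<U>"
    using Lindelof[of \<U>] by (auto simp: \<U>_def)
  ultimately have cov: "\<Union>\<V> = E" by simp
  \<comment> \<open>The empty set is inserted so that the enumeration makes sense for an empty cover
    too; its range is then exactly the cover together with the empty set.\<close>
  define U where "U n = from_nat_into (insert {} \<V>) n" for n
  have rU: "range U = insert {} \<V>" unfolding U_def using \<V>(2) by (simp add: range_from_nat_into)
  have "{} \<in> \<U>" by (simp add: \<U>_def)
  then have "U n \<in> \<U>" for n using rU \<V>(1) by (metis insertE rangeI subsetD)
  then have U: "open (U n)" "U n \<subseteq> E" "inj_on T (U n)" for n by (auto simp: \<U>_def)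
  have UE: "\<Union>(range U) = E" using rU cov by simp
  \<comment> \<open>Disjoint pieces count each preimage of w once, while injectivity and the local
    inverse are inherited from the open sets \<open>U n\<close>.\<close>
  define V where "V = disjointed U"
  have V: "V n \<subseteq> U n" "V n \<in> sets borel" "disjoint_family V" "(\<Union>n. V n) = E" for n
    using U(1) UE by (auto simp: V_def disjointed_subset disjoint_family_disjointed UN_disjointed_eq
        intro!: sets.range_disjointed_sets' range_subsetD[OF sets.range_disjointed_sets'])
  have hU: "T holomorphic_on U n" for n
    using U(2)[of n] by (intro holomorphic_on_subset[OF T]) (auto simp: E_def)
  have "\<exists>g. g holomorphic_on T ` U n \<and> (\<forall>z\<in>U n. g (T z) = z)" for n
    using holomorphic_has_inverse[OF hU U(1,3)] by metis
  then obtain g where g: "\<And>n. g n holomorphic_on T ` U n" "\<And>n z. z \<in> U n \<Longrightarrow> g n (T z) = z" by metis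
  define F where "F n w = (\<psi> (g n w) * indicator (V n) (g n w)) * indicator (T ` U n) w" for n w
  have \<psi>V: "(\<lambda>z. \<psi> z * indicator (V n) z) \<in> borel_measurable borel" for n
    using \<psi> V(2) by measurable
  have F: "F n \<in> borel_measurable borel"
    "(\<integral>\<^sup>+w. F n w \<partial>lborel) = (\<integral>\<^sup>+z. ennreal ((norm (deriv T z))\<^sup>2) * (\<psi> z * indicator (V n) z) * indicator (U n) z \<partial>lborel)" for n
    unfolding F_def using nn_integral_holomorphic_injective[OF U(1) hU U(3) g(1) g(2) \<psi>V] by simp_all
  have "AE w in lborel. w \<notin> T ` (A - E)"
    using crit by (intro AE_not_in countable_imp_null_set_lborel) auto
  then have "AE w in lborel. (\<integral>\<^sup>+z. \<psi> z \<partial>count_space (zeros_in A (\<lambda>z. T z - w))) = (\<Sum>n. F n w)"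
  proof eventually_elim
    fix w assume w: "w \<notin> T ` (A - E)"
    define Z where "Z = {z \<in> A. T z = w}"
    have ZE: "Z \<subseteq> E" using w by (auto simp: Z_def)
    have "(\<integral>\<^sup>+z. \<psi> z \<partial>count_space Z) = (\<integral>\<^sup>+z. (\<Sum>n. \<psi> z * indicator (V n) z) \<partial>count_space Z)"
    proof (intro nn_integral_cong)
      fix z assume "z \<in> space (count_space Z)"
      then obtain n where n: "z \<in> V n" using ZE V(4) by auto
      have "(\<Sum>n. \<psi> z * indicator (V n) z) = \<psi> z * (\<Sum>n. indicator (V n) z)" by (rule ennreal_suminf_cmult)
      also have "(\<Sum>n. indicator (V n) z :: ennreal) = indicator (\<Union>n. V n) z" by (rule suminf_indicator[OF V(3)])
      also have "\<dots> = 1" using n by (intro indicator_simps(1)) blast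
      finally show "\<psi> z = (\<Sum>n. \<psi> z * indicator (V n) z)" by simp
    qed
    also have "\<dots> = (\<Sum>n. \<integral>\<^sup>+z. \<psi> z * indicator (V n) z \<partial>count_space Z)"
      by (rule nn_integral_suminf) simp
    also have "(\<lambda>n. \<integral>\<^sup>+z. \<psi> z * indicator (V n) z \<partial>count_space Z) = (\<lambda>n. F n w)"
    proof
      fix n
      show "(\<integral>\<^sup>+z. \<psi> z * indicator (V n) z \<partial>count_space Z) = F n w"
      proof (cases "\<exists>z\<in>V n. T z = w")
        case True
        then obtain z where z: "z \<in> V n" "T z = w" by blast
        have zU: "z \<in> U n" using z V(1) by blast
        have "z' = z" if "z' \<in> Z" "z' \<in> V n" for z'
          using U(3)[of n] zU that V(1)[of n] z by (auto simp: inj_on_def Z_def)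
        moreover have "z \<in> Z" using z zU U(2)[of n] by (auto simp: Z_def E_def)
        ultimately have "(\<integral>\<^sup>+z. \<psi> z * indicator (V n) z \<partial>count_space Z) = (\<Sum>z\<in>{z}. \<psi> z * indicator (V n) z)"
          by (intro nn_integral_count_space') (auto simp: indicator_def)
        also have "\<dots> = F n w" using z zU g(2)[OF zU] by (auto simp: F_def indicator_def)
        finally show ?thesis .
      next
        case False
        then have "(\<integral>\<^sup>+z. \<psi> z * indicator (V n) z \<partial>count_space Z) = (\<integral>\<^sup>+z. 0 \<partial>count_space Z)"
          by (intro nn_integral_cong) (auto simp: Z_def indicator_def)
        moreover have "F n w = 0" using False g(2) by (auto simp: F_def indicator_def)
        ultimately show ?thesis by simp
      qed
    qed
    finally show "(\<integral>\<^sup>+z. \<psi> z \<partial>count_space (zeros_in A (\<lambda>z. T z - w))) = (\<Sum>n. F n w)"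
      unfolding zeros_in_diff_eq[OF False] Z_def .
  qed
  then have "(\<integral>\<^sup>+w. (\<integral>\<^sup>+z. \<psi> z \<partial>count_space (zeros_in A (\<lambda>z. T z - w))) \<partial>lborel) = (\<integral>\<^sup>+w. (\<Sum>n. F n w) \<partial>lborel)"
    by (rule nn_integral_cong_AE)
  also have "\<dots> = (\<Sum>n. \<integral>\<^sup>+w. F n w \<partial>lborel)" using F(1) by (intro nn_integral_suminf) simp
  also have "\<dots> = (\<Sum>n. \<integral>\<^sup>+z. ennreal ((norm (deriv T z))\<^sup>2) * \<psi> z * indicator (V n) z \<partial>lborel)"
    unfolding F(2) using V(1) by (intro arg_cong[where f = suminf] ext nn_integral_cong) (auto simp: indicator_def)
  also have "\<dots> = (\<integral>\<^sup>+z. ennreal ((norm (deriv T z))\<^sup>2) * \<psi> z * indicator A z \<partial>lborel)"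
  proof -
    have dm: "(\<lambda>z. indicator A z *\<^sub>R deriv T z) \<in> borel_measurable borel"
      using A(1) holomorphic_on_imp_continuous_on[OF dT] by (intro borel_measurable_continuous_on_indicator) auto
    define d where "d z = ennreal ((norm (indicator A z *\<^sub>R deriv T z))\<^sup>2)" for z
    have [measurable]: "d \<in> borel_measurable borel" unfolding d_def using dm by measurable
    note [measurable] = \<psi> V(2)
    have "(\<integral>\<^sup>+z. ennreal ((norm (deriv T z))\<^sup>2) * \<psi> z * indicator (V n) z \<partial>lborel) = (\<integral>\<^sup>+z. d z * \<psi> z * indicator (V n) z \<partial>lborel)" for n
      using V(4) by (intro nn_integral_cong) (auto simp: d_def indicator_def E_def)
    then have "(\<Sum>n. \<integral>\<^sup>+z. ennreal ((norm (deriv T z))\<^sup>2) * \<psi> z * indicator (V n) z \<partial>lborel) =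
       (\<Sum>n. \<integral>\<^sup>+z. d z * \<psi> z * indicator (V n) z \<partial>lborel)" by simp
    also have "\<dots> = (\<integral>\<^sup>+z. (\<Sum>n. d z * \<psi> z * indicator (V n) z) \<partial>lborel)"
      by (intro nn_integral_suminf[symmetric]) measurable
    also have "\<dots> = (\<integral>\<^sup>+z. ennreal ((norm (deriv T z))\<^sup>2) * \<psi> z * indicator A z \<partial>lborel)"
    proof (intro nn_integral_cong)
      fix z
      have "(\<Sum>n. d z * \<psi> z * indicator (V n) z) = d z * \<psi> z * (\<Sum>n. indicator (V n) z)" by (rule ennreal_suminf_cmult)
      also have "(\<Sum>n. indicator (V n) z :: ennreal) = indicator E z"
      proof (cases "z \<in> E")
        case True
        show ?thesis unfolding suminf_indicator[OF V(3)] V(4) by (rule refl)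
      next
        case False
        then have "z \<notin> V n" for n using V(4) by auto
        then show ?thesis using False by simp
      qed
      also have "d z * \<psi> z * indicator E z = ennreal ((norm (deriv T z))\<^sup>2) * \<psi> z * indicator A z"
        by (cases "z \<in> A"; cases "deriv T z = 0") (simp_all add: d_def E_def)
      finally show "(\<Sum>n. d z * \<psi> z * indicator (V n) z) = ennreal ((norm (deriv T z))\<^sup>2) * \<psi> z * indicator A z" .
    qed
    finally show ?thesis .
  qed
  finally show ?thesis .
qed

section \<open>Complex Gaussian series\<close>

definition cgauss :: "complex measure" where
  "cgauss = density lborel (\<lambda>z. ennreal (exp (- (cmod z)\<^sup>2) / pi))"

lemma sets_cgauss [simp, measurable_cong]: "sets cgauss = sets borel" by (simp add: cgauss_def)
lemma space_cgauss [simp]: "space cgauss = UNIV" by (simp add: cgauss_def)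

lemma measurable_Complex [measurable]:
  "(\<lambda>p. Complex (fst p) (snd p)) \<in> borel_measurable (borel \<Otimes>\<^sub>M borel)"
proof -
  have "(\<lambda>p. of_real (fst p) + \<i> * of_real (snd p)) \<in> borel_measurable (borel \<Otimes>\<^sub>M borel :: (real \<times> real) measure)"
    by measurable
  then show ?thesis by (simp add: Complex_eq)
qed

lemma lborel_complex_eq_pair: "lborel = distr (lborel \<Otimes>\<^sub>M lborel) borel (\<lambda>p. Complex (fst p) (snd p))"
proof (rule lborel_eqI)
  have m: "(\<lambda>p. Complex (fst p) (snd p)) \<in> measurable (lborel \<Otimes>\<^sub>M lborel) borel"
    using measurable_Complex by (simp cong: measurable_cong_sets)
  fix l u :: complex assume le: "\<And>b. b \<in> Basis \<Longrightarrow> l \<bullet> b \<le> u \<bullet> b"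
  have le': "Re l \<le> Re u" "Im l \<le> Im u" using le[of 1] le[of \<i>] by (auto simp: Basis_complex_def)
  have "(\<lambda>p. Complex (fst p) (snd p)) -` box l u = box (Re l) (Re u) \<times> box (Im l) (Im u)"
    by (auto simp: in_box_complex_iff)
  then have "emeasure (distr (lborel \<Otimes>\<^sub>M lborel) borel (\<lambda>p. Complex (fst p) (snd p))) (box l u) =
     emeasure (lborel \<Otimes>\<^sub>M lborel) (box (Re l) (Re u) \<times> box (Im l) (Im u))"
    by (subst emeasure_distr[OF m]) (auto simp: space_pair_measure)
  also have "\<dots> = ennreal (Re u - Re l) * ennreal (Im u - Im l)"
    using le' by (subst lborel.emeasure_pair_measure_Times) auto
  also have "\<dots> = ennreal (\<Prod>b\<in>Basis. (u - l) \<bullet> b)"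
    using le' by (simp add: Basis_complex_def ennreal_mult)
  finally show "emeasure (distr (lborel \<Otimes>\<^sub>M lborel) borel (\<lambda>p. Complex (fst p) (snd p))) (box l u) = ennreal (\<Prod>b\<in>Basis. (u - l) \<bullet> b)" .
qed simp

text \<open>Real and imaginary part are independent centred normals of variance 1 / 2; hence the
  scaling by sqrt 2 here and the quarter in \<open>char_cgauss\<close>.\<close>

lemma nn_integral_cgauss:
  assumes [measurable]: "f \<in> borel_measurable borel"
  shows "(\<integral>\<^sup>+z. f z \<partial>cgauss) =
    (\<integral>\<^sup>+x. \<integral>\<^sup>+y. f (Complex (x / sqrt 2) (y / sqrt 2)) \<partial>std_normal_distribution \<partial>std_normal_distribution)"
proof -
  let ?c = "1 / sqrt 2 :: real"
  define F where "F x y = ennreal (exp (- (x\<^sup>2 + y\<^sup>2)) / pi) * f (Complex x y)" for x y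
  have mC [measurable]: "(\<lambda>p. f (Complex (fst p) (snd p))) \<in> borel_measurable (borel \<Otimes>\<^sub>M borel)"
    using measurable_compose[OF measurable_Complex assms] .
  have mF [measurable]: "(\<lambda>p. F (fst p) (snd p)) \<in> borel_measurable (borel \<Otimes>\<^sub>M borel)"
    unfolding F_def by measurable
  have mF1 [measurable]: "(\<lambda>y. F x y) \<in> borel_measurable borel" for x
    using measurable_compose[OF measurable_Pair1'[of x borel borel] mF] by simp
  have mF2: "(\<lambda>x. \<integral>\<^sup>+y. F x y \<partial>lborel) \<in> borel_measurable borel"
  proof -
    have "(\<lambda>p. F (fst p) (snd p)) \<in> borel_measurable (borel \<Otimes>\<^sub>M lborel)" using mF by (simp cong: measurable_cong_sets)
    then show ?thesis by (intro lborel.borel_measurable_nn_integral) (simp add: case_prod_beta')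
  qed
  have mfx: "(\<lambda>y. f (Complex (x / sqrt 2) (y / sqrt 2))) \<in> borel_measurable borel" for x
  proof -
    have "(\<lambda>y. (x / sqrt 2, y / sqrt 2)) \<in> measurable borel (borel \<Otimes>\<^sub>M borel)" by measurable
    from measurable_compose[OF this mC] show ?thesis by simp
  qed
  interpret N: prob_space std_normal_distribution by (rule prob_space_normal_density) simp
  define g where "g x = (\<integral>\<^sup>+y. f (Complex (x / sqrt 2) (y / sqrt 2)) \<partial>std_normal_distribution)" for x
  have g [measurable]: "g \<in> borel_measurable borel"
  proof -
    have "(\<lambda>p. (fst p / sqrt 2, snd p / sqrt 2)) \<in> measurable (borel \<Otimes>\<^sub>M std_normal_distribution) (borel \<Otimes>\<^sub>M borel)" by measurable
    from measurable_compose[OF this mC] show ?thesis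
      unfolding g_def by (intro N.borel_measurable_nn_integral) (simp add: case_prod_beta')
  qed
  have "(\<integral>\<^sup>+z. f z \<partial>cgauss) = (\<integral>\<^sup>+z. ennreal (exp (- (cmod z)\<^sup>2) / pi) * f z \<partial>lborel)"
    unfolding cgauss_def by (subst nn_integral_density) auto
  also have "\<dots> = (\<integral>\<^sup>+p. F (fst p) (snd p) \<partial>(lborel \<Otimes>\<^sub>M lborel))"
    unfolding F_def by (subst lborel_complex_eq_pair, subst nn_integral_distr) (auto simp: cmod_power2)
  also have "\<dots> = (\<integral>\<^sup>+x. \<integral>\<^sup>+y. F x y \<partial>lborel \<partial>lborel)"
    using mF by (subst lborel.nn_integral_fst[symmetric]) (auto cong: measurable_cong_sets)
  also have "\<dots> = ennreal ?c * (\<integral>\<^sup>+x. \<integral>\<^sup>+y. F (?c * x) y \<partial>lborel \<partial>lborel)"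
    using nn_integral_real_affine[OF mF2, of ?c 0] by simp
  also have "(\<lambda>x. \<integral>\<^sup>+y. F (?c * x) y \<partial>lborel) = (\<lambda>x. ennreal ?c * (\<integral>\<^sup>+y. F (?c * x) (?c * y) \<partial>lborel))"
    using nn_integral_real_affine[OF mF1, of ?c _ 0] by (intro ext) simp
  also have "(\<integral>\<^sup>+x. ennreal ?c * (\<integral>\<^sup>+y. F (?c * x) (?c * y) \<partial>lborel) \<partial>lborel) =
     (\<integral>\<^sup>+x. ennreal ?c * (ennreal (std_normal_density x) * (\<integral>\<^sup>+y. ennreal (std_normal_density y) * (ennreal 2 * f (Complex (x / sqrt 2) (y / sqrt 2))) \<partial>lborel)) \<partial>lborel)"
  proof (intro nn_integral_cong arg_cong2[where f = "(*)"] refl)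
    fix x :: real
    have [measurable]: "(\<lambda>y. f (Complex (x / sqrt 2) (y / sqrt 2))) \<in> borel_measurable borel"
    proof -
      have "(\<lambda>y. (x / sqrt 2, y / sqrt 2)) \<in> measurable borel (borel \<Otimes>\<^sub>M borel)" by measurable
      from measurable_compose[OF this mC] show ?thesis by simp
    qed
    have "F (?c * x) (?c * y) = ennreal (std_normal_density x) * (ennreal (std_normal_density y) * (ennreal 2 * f (Complex (x / sqrt 2) (y / sqrt 2))))" for y
    proof -
      have e: "exp (- ((?c * x)\<^sup>2 + (?c * y)\<^sup>2)) / pi = std_normal_density x * (std_normal_density y * 2)"
      proof -
        have "exp (- ((?c * x)\<^sup>2 + (?c * y)\<^sup>2)) = exp (- x\<^sup>2 / 2) * exp (- y\<^sup>2 / 2)"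
          by (simp add: power_mult_distrib power_divide flip: exp_add)
        then show ?thesis by (simp add: std_normal_density_def field_simps flip: real_sqrt_mult)
      qed
      show ?thesis unfolding F_def e by (simp add: ennreal_mult mult.assoc)
    qed
    then show "(\<integral>\<^sup>+y. F (?c * x) (?c * y) \<partial>lborel) = ennreal (std_normal_density x) * (\<integral>\<^sup>+y. ennreal (std_normal_density y) * (ennreal 2 * f (Complex (x / sqrt 2) (y / sqrt 2))) \<partial>lborel)"
      by (simp add: nn_integral_cmult)
  qed
  also have "ennreal ?c * \<dots> = (\<integral>\<^sup>+x. ennreal (std_normal_density x) * g x \<partial>lborel)"
  proof -
    have "(\<integral>\<^sup>+y. ennreal (std_normal_density y) * (ennreal 2 * f (Complex (x / sqrt 2) (y / sqrt 2))) \<partial>lborel) = ennreal 2 * g x" for x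
    proof -
      have [measurable]: "(\<lambda>y. f (Complex (x / sqrt 2) (y / sqrt 2))) \<in> borel_measurable borel"
        by (rule mfx)
      have "(\<integral>\<^sup>+y. ennreal (std_normal_density y) * (ennreal 2 * f (Complex (x / sqrt 2) (y / sqrt 2))) \<partial>lborel) =
        (\<integral>\<^sup>+y. ennreal 2 * f (Complex (x / sqrt 2) (y / sqrt 2)) \<partial>std_normal_distribution)"
        by (subst nn_integral_density) auto
      also have "\<dots> = ennreal 2 * g x" unfolding g_def by (rule nn_integral_cmult) simp
      finally show ?thesis .
    qed
    then have "(\<integral>\<^sup>+x. ennreal ?c * (ennreal (std_normal_density x) * (\<integral>\<^sup>+y. ennreal (std_normal_density y) * (ennreal 2 * f (Complex (x / sqrt 2) (y / sqrt 2))) \<partial>lborel)) \<partial>lborel)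
       = (\<integral>\<^sup>+x. ennreal ?c * ennreal 2 * (ennreal (std_normal_density x) * g x) \<partial>lborel)"
      by (simp add: mult_ac)
    also have "\<dots> = ennreal ?c * ennreal 2 * (\<integral>\<^sup>+x. ennreal (std_normal_density x) * g x \<partial>lborel)"
      by (rule nn_integral_cmult) simp
    finally have "ennreal ?c * (\<integral>\<^sup>+x. ennreal ?c * (ennreal (std_normal_density x) * (\<integral>\<^sup>+y. ennreal (std_normal_density y) * (ennreal 2 * f (Complex (x / sqrt 2) (y / sqrt 2))) \<partial>lborel)) \<partial>lborel)
       = (ennreal ?c * (ennreal ?c * ennreal 2)) * (\<integral>\<^sup>+x. ennreal (std_normal_density x) * g x \<partial>lborel)" by (simp only: mult.assoc)
    also have "ennreal ?c * (ennreal ?c * ennreal 2) = ennreal (?c * (?c * 2))"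
    proof -
      have "ennreal (?c * (?c * 2)) = ennreal ?c * ennreal (?c * 2)" by (rule ennreal_mult) auto
      moreover have "ennreal (?c * 2) = ennreal ?c * ennreal 2" by (rule ennreal_mult) auto
      ultimately show ?thesis by simp
    qed
    also have "?c * (?c * 2) = 1" by (simp flip: real_sqrt_mult)
    finally show ?thesis by simp
  qed
  also have "\<dots> = (\<integral>\<^sup>+x. g x \<partial>std_normal_distribution)" by (subst nn_integral_density) auto
  finally show ?thesis unfolding g_def .
qed

lemma cgauss_eq_distr:
  "cgauss = distr (std_normal_distribution \<Otimes>\<^sub>M std_normal_distribution) borel (\<lambda>p. Complex (fst p / sqrt 2) (snd p / sqrt 2))"
proof (rule measure_eqI)
  interpret N: prob_space std_normal_distribution by (rule prob_space_normal_density) simp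
  fix A assume "A \<in> sets cgauss"
  then have A [measurable]: "A \<in> sets borel" by simp
  have m: "(\<lambda>p. Complex (fst p / sqrt 2) (snd p / sqrt 2)) \<in> measurable (std_normal_distribution \<Otimes>\<^sub>M std_normal_distribution) borel"
  proof -
    have "(\<lambda>p. (fst p / sqrt 2, snd p / sqrt 2)) \<in> measurable (std_normal_distribution \<Otimes>\<^sub>M std_normal_distribution) (borel \<Otimes>\<^sub>M borel)" by measurable
    from measurable_compose[OF this measurable_Complex] show ?thesis by simp
  qed
  have "emeasure cgauss A = (\<integral>\<^sup>+z. indicator A z \<partial>cgauss)" by (rule nn_integral_indicator[symmetric]) simp
  also have "\<dots> = (\<integral>\<^sup>+x. \<integral>\<^sup>+y. indicator A (Complex (x / sqrt 2) (y / sqrt 2)) \<partial>std_normal_distribution \<partial>std_normal_distribution)"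
    by (rule nn_integral_cgauss) simp
  also have "\<dots> = (\<integral>\<^sup>+p. indicator A (Complex (fst p / sqrt 2) (snd p / sqrt 2)) \<partial>(std_normal_distribution \<Otimes>\<^sub>M std_normal_distribution))"
    by (subst N.nn_integral_fst[symmetric]) (use measurable_compose[OF m borel_measurable_indicator[OF A]] in auto)
  also have "\<dots> = (\<integral>\<^sup>+z. indicator A z \<partial>distr (std_normal_distribution \<Otimes>\<^sub>M std_normal_distribution) borel (\<lambda>p. Complex (fst p / sqrt 2) (snd p / sqrt 2)))"
    by (rule nn_integral_distr[symmetric, OF m]) simp
  also have "\<dots> = emeasure (distr (std_normal_distribution \<Otimes>\<^sub>M std_normal_distribution) borel (\<lambda>p. Complex (fst p / sqrt 2) (snd p / sqrt 2))) A"
    by (rule nn_integral_indicator) simp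
  finally show "emeasure cgauss A = emeasure (distr (std_normal_distribution \<Otimes>\<^sub>M std_normal_distribution) borel (\<lambda>p. Complex (fst p / sqrt 2) (snd p / sqrt 2))) A" .
qed simp

lemma prob_space_cgauss: "prob_space cgauss"
proof (rule prob_spaceI)
  interpret N: prob_space std_normal_distribution by (rule prob_space_normal_density) simp
  have "emeasure cgauss (space cgauss) = (\<integral>\<^sup>+z. 1 \<partial>cgauss)" by simp
  also have "\<dots> = 1" using N.emeasure_space_1 by (subst nn_integral_cgauss) simp_all
  finally show "emeasure cgauss (space cgauss) = 1" .
qed

lemma char_cgauss: "(CLINT z|cgauss. iexp (Re (c * z))) = exp (- of_real ((norm c)\<^sup>2) / 4)"
proof -
  interpret N: prob_space std_normal_distribution by (rule prob_space_normal_density) simp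
  interpret P: pair_prob_space std_normal_distribution std_normal_distribution ..
  have m: "(\<lambda>p. Complex (fst p / sqrt 2) (snd p / sqrt 2)) \<in> measurable (std_normal_distribution \<Otimes>\<^sub>M std_normal_distribution) borel"
  proof -
    have "(\<lambda>p. (fst p / sqrt 2, snd p / sqrt 2)) \<in> measurable (std_normal_distribution \<Otimes>\<^sub>M std_normal_distribution) (borel \<Otimes>\<^sub>M borel)" by measurable
    from measurable_compose[OF this measurable_Complex] show ?thesis by simp
  qed
  define a where "a = Re c / sqrt 2"
  define b where "b = - Im c / sqrt 2"
  have [measurable]: "Re \<in> borel_measurable borel" by (intro borel_measurable_continuous_onI continuous_intros)
  have "(CLINT z|cgauss. iexp (Re (c * z))) =
     (CLINT p|std_normal_distribution \<Otimes>\<^sub>M std_normal_distribution. iexp (Re (c * Complex (fst p / sqrt 2) (snd p / sqrt 2))))"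
    by (subst cgauss_eq_distr, rule integral_distr[OF m]) measurable
  also have "\<dots> = (CLINT p|std_normal_distribution \<Otimes>\<^sub>M std_normal_distribution. iexp (a * fst p) * iexp (b * snd p))"
  proof (intro Bochner_Integration.integral_cong refl)
    fix p :: "real \<times> real"
    have "Re (c * Complex (fst p / sqrt 2) (snd p / sqrt 2)) = a * fst p + b * snd p" by (simp add: a_def b_def)
    then show "iexp (Re (c * Complex (fst p / sqrt 2) (snd p / sqrt 2))) = iexp (a * fst p) * iexp (b * snd p)"
      by (simp only: of_real_add distrib_left exp_add)
  qed
  also have "\<dots> = (CLINT x|std_normal_distribution. (CLINT y|std_normal_distribution. iexp (a * x) * iexp (b * y)))"
  proof -
    have "integrable (std_normal_distribution \<Otimes>\<^sub>M std_normal_distribution) (\<lambda>p. iexp (a * fst p) * iexp (b * snd p))"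
      by (rule P.integrable_const_bound[of _ 1]) (auto simp: norm_mult)
    from P.integral_fst'[OF this] show ?thesis by simp
  qed
  also have "\<dots> = char std_normal_distribution a * char std_normal_distribution b"
    unfolding char_def by simp
  also have "\<dots> = of_real (exp (- a\<^sup>2 / 2) * exp (- b\<^sup>2 / 2))"
    unfolding char_std_normal_distribution by simp
  also have "exp (- a\<^sup>2 / 2) * exp (- b\<^sup>2 / 2) = exp (- (norm c)\<^sup>2 / 4)"
    unfolding exp_add[symmetric] by (simp add: a_def b_def cmod_power2 power_divide field_simps)
  finally show ?thesis by (simp flip: exp_of_real)
qed

lemma nn_integral_norm_cgauss: "(\<integral>\<^sup>+z. ennreal (norm z) \<partial>cgauss) < \<top>"
proof -
  interpret N: prob_space std_normal_distribution by (rule prob_space_normal_density) simp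
  have ia: "(\<integral>\<^sup>+x. ennreal \<bar>x\<bar> \<partial>std_normal_distribution) < \<top>"
    using integrable_std_normal_distribution_moment[of 1] by (simp add: integrable_iff_bounded)
  have "(\<integral>\<^sup>+z. ennreal (norm z) \<partial>cgauss) \<le> (\<integral>\<^sup>+z. ennreal \<bar>Re z\<bar> + ennreal \<bar>Im z\<bar> \<partial>cgauss)"
    using cmod_le by (intro nn_integral_mono) (simp flip: ennreal_plus)
  also have "\<dots> = (\<integral>\<^sup>+x. \<integral>\<^sup>+y. ennreal \<bar>x / sqrt 2\<bar> + ennreal \<bar>y / sqrt 2\<bar> \<partial>std_normal_distribution \<partial>std_normal_distribution)"
  proof -
    have [measurable]: "Re \<in> borel_measurable borel" "Im \<in> borel_measurable borel" by (intro borel_measurable_continuous_onI continuous_intros)+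
    show ?thesis by (subst nn_integral_cgauss) simp_all
  qed
  also have "\<dots> \<le> (\<integral>\<^sup>+x. \<integral>\<^sup>+y. ennreal \<bar>x\<bar> + ennreal \<bar>y\<bar> \<partial>std_normal_distribution \<partial>std_normal_distribution)"
    by (intro nn_integral_mono add_mono ennreal_leI) (simp_all add: abs_divide divide_le_eq mult_left_le_one_le mult_le_cancel_left1)
  also have "\<dots> = (\<integral>\<^sup>+x. ennreal \<bar>x\<bar> \<partial>std_normal_distribution) + (\<integral>\<^sup>+x. ennreal \<bar>x\<bar> \<partial>std_normal_distribution)"
    using N.emeasure_space_1 by (simp add: nn_integral_add)
  also have "\<dots> < \<top>" using ia by simp
  finally show ?thesis .
qed

text \<open>Completing the square, followed by an affine substitution.\<close>

lemma integral_cgauss_quadratic: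
  assumes \<kappa>: "0 < \<kappa>"
  shows "(LINT z|cgauss. exp ((1 - \<kappa>) * (norm z)\<^sup>2 + Re (b * z))) = exp ((norm b)\<^sup>2 / (4 * \<kappa>)) / \<kappa>"
proof -
  interpret G: prob_space cgauss by (rule prob_space_cgauss)
  have [measurable]: "Re \<in> borel_measurable borel" by (intro borel_measurable_continuous_onI continuous_intros)
  define f where "f z = exp (- \<kappa> * (norm z)\<^sup>2 + Re (b * z)) / pi" for z :: complex
  have [measurable]: "f \<in> borel_measurable borel" unfolding f_def by measurable
  define t where "t = cnj b / of_real (2 * \<kappa>)"
  define c where "c = 1 / sqrt \<kappa>"
  have c: "c \<noteq> 0" "c\<^sup>2 = 1 / \<kappa>" using \<kappa> by (auto simp: c_def power_divide)
  have sq: "f (t + c *\<^sub>R z) = exp ((norm b)\<^sup>2 / (4 * \<kappa>)) * (exp (- (norm z)\<^sup>2) / pi)" for z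
  proof -
    have n: "(norm (t + c *\<^sub>R z))\<^sup>2 = (norm t)\<^sup>2 + 2 * c * Re (cnj t * z) + c\<^sup>2 * (norm z)\<^sup>2"
      unfolding cmod_power2 by (simp add: algebra_simps power2_eq_square)
    have t1: "(norm t)\<^sup>2 = (norm b)\<^sup>2 / (4 * \<kappa>\<^sup>2)"
      using \<kappa> by (simp add: t_def norm_divide power_divide power_mult_distrib)
    have ct: "cnj t * z = of_real (1 / (2 * \<kappa>)) * (b * z)" by (simp add: t_def)
    have t2: "Re (cnj t * z) = Re (b * z) / (2 * \<kappa>)" unfolding ct Re_complex_of_real[symmetric] by (simp add: field_simps)
    have bt: "b * t = of_real ((norm b)\<^sup>2 / (2 * \<kappa>))" unfolding t_def by (simp add: complex_norm_square[symmetric])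
    have t3: "Re (b * (t + c *\<^sub>R z)) = (norm b)\<^sup>2 / (2 * \<kappa>) + c * Re (b * z)"
    proof -
      have "b * (t + c *\<^sub>R z) = of_real ((norm b)\<^sup>2 / (2 * \<kappa>)) + c *\<^sub>R (b * z)"
        unfolding distrib_left mult_scaleR_right bt ..
      then have "Re (b * (t + c *\<^sub>R z)) = Re (of_real ((norm b)\<^sup>2 / (2 * \<kappa>)) + c *\<^sub>R (b * z))" by (rule arg_cong)
      then show ?thesis by (simp only: plus_complex.sel scaleR_complex.sel Re_complex_of_real)
    qed
    have "- \<kappa> * (norm (t + c *\<^sub>R z))\<^sup>2 + Re (b * (t + c *\<^sub>R z)) = (norm b)\<^sup>2 / (4 * \<kappa>) - (norm z)\<^sup>2"
    proof -
      have "- \<kappa> * (B / (4 * \<kappa>\<^sup>2) + 2 * c * (x / (2 * \<kappa>)) + 1 / \<kappa> * y) + (B / (2 * \<kappa>) + c * x) = B / (4 * \<kappa>) - y" for B x y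
        using \<kappa> by (simp add: field_simps power2_eq_square)
      then show ?thesis unfolding n t1 t2 t3 c(2) .
    qed
    then have "f (t + c *\<^sub>R z) = exp ((norm b)\<^sup>2 / (4 * \<kappa>) + (- (norm z)\<^sup>2)) / pi" unfolding f_def by simp
    then show ?thesis unfolding exp_add by simp
  qed
  have "(\<integral>\<^sup>+z. ennreal (exp ((1 - \<kappa>) * (norm z)\<^sup>2 + Re (b * z))) \<partial>cgauss) = (\<integral>\<^sup>+z. ennreal (f z) \<partial>lborel)"
  proof -
    have "(\<integral>\<^sup>+z. ennreal (exp ((1 - \<kappa>) * (norm z)\<^sup>2 + Re (b * z))) \<partial>cgauss) =
       (\<integral>\<^sup>+z. ennreal (exp (- (norm z)\<^sup>2) / pi) * ennreal (exp ((1 - \<kappa>) * (norm z)\<^sup>2 + Re (b * z))) \<partial>lborel)"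
      unfolding cgauss_def by (subst nn_integral_density) simp_all
    also have "\<dots> = (\<integral>\<^sup>+z. ennreal (f z) \<partial>lborel)"
    proof (intro nn_integral_cong)
      fix z :: complex
      have "exp (- (norm z)\<^sup>2) * exp ((1 - \<kappa>) * (norm z)\<^sup>2 + Re (b * z)) = exp (- \<kappa> * (norm z)\<^sup>2 + Re (b * z))"
        unfolding exp_add[symmetric] by (simp add: algebra_simps)
      then show "ennreal (exp (- (norm z)\<^sup>2) / pi) * ennreal (exp ((1 - \<kappa>) * (norm z)\<^sup>2 + Re (b * z))) = ennreal (f z)"
        unfolding f_def by (simp flip: ennreal_mult)
    qed
    finally show ?thesis .
  qed
  also have "\<dots> = ennreal (c\<^sup>2) * (\<integral>\<^sup>+z. ennreal (f (t + c *\<^sub>R z)) \<partial>lborel)"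
  proof -
    have "(\<integral>\<^sup>+z. ennreal (f z) \<partial>lborel) = (\<integral>\<^sup>+z. ennreal (f z) \<partial>density (distr lborel borel (\<lambda>x. t + c *\<^sub>R x)) (\<lambda>_. ennreal (\<bar>c\<bar> ^ DIM(complex))))"
      by (subst lborel_affine[OF c(1), of t]) simp
    also have "\<dots> = (\<integral>\<^sup>+z. ennreal (c\<^sup>2) * ennreal (f z) \<partial>distr lborel borel (\<lambda>x. t + c *\<^sub>R x))"
      by (subst nn_integral_density) simp_all
    also have "\<dots> = (\<integral>\<^sup>+z. ennreal (c\<^sup>2) * ennreal (f (t + c *\<^sub>R z)) \<partial>lborel)"
      by (subst nn_integral_distr) simp_all
    also have "\<dots> = ennreal (c\<^sup>2) * (\<integral>\<^sup>+z. ennreal (f (t + c *\<^sub>R z)) \<partial>lborel)"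
      by (rule nn_integral_cmult) simp
    finally show ?thesis .
  qed
  also have "(\<integral>\<^sup>+z. ennreal (f (t + c *\<^sub>R z)) \<partial>lborel) = ennreal (exp ((norm b)\<^sup>2 / (4 * \<kappa>))) * (\<integral>\<^sup>+z. ennreal (exp (- (norm z)\<^sup>2) / pi) \<partial>(lborel :: complex measure))"
    unfolding sq by (subst nn_integral_cmult[symmetric]) (simp_all flip: ennreal_mult)
  also have "(\<integral>\<^sup>+z. ennreal (exp (- (norm z)\<^sup>2) / pi) \<partial>(lborel :: complex measure)) = 1"
  proof -
    have "emeasure cgauss UNIV = 1" using G.emeasure_space_1 by simp
    then show ?thesis unfolding cgauss_def by (subst (asm) emeasure_density) simp_all
  qed
  also have "ennreal (c\<^sup>2) * (ennreal (exp ((norm b)\<^sup>2 / (4 * \<kappa>))) * 1) = ennreal (exp ((norm b)\<^sup>2 / (4 * \<kappa>)) / \<kappa>)"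
    unfolding c(2) using \<kappa> by (simp flip: ennreal_mult)
  finally have "(\<integral>\<^sup>+z. ennreal (exp ((1 - \<kappa>) * (norm z)\<^sup>2 + Re (b * z))) \<partial>cgauss) = ennreal (exp ((norm b)\<^sup>2 / (4 * \<kappa>)) / \<kappa>)" .
  then show ?thesis using \<kappa> by (subst integral_eq_nn_integral) simp_all
qed

section \<open>Coefficient sequences of geometric decay and their inner product\<close>

definition geo_weight :: "nat \<Rightarrow> int \<Rightarrow> real" where
  "geo_weight k n = (1 - 1 / (real k + 2)) ^ nat \<bar>n\<bar>"

definition geo_decay :: "(int \<Rightarrow> complex) \<Rightarrow> bool" where
  "geo_decay a \<longleftrightarrow> (\<exists>C k. \<forall>n. norm (a n) \<le> C * geo_weight k n)"

text \<open>The covariance form of the Gaussian series \<open>gs\<close> below. Enumerating the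
  integers by \<open>int_decode\<close> makes it an ordinary series, absolutely convergent under
  geometric decay.\<close>

definition seq_ip :: "(int \<Rightarrow> complex) \<Rightarrow> (int \<Rightarrow> complex) \<Rightarrow> complex" where
  "seq_ip a b = (\<Sum>i. a (int_decode i) * cnj (b (int_decode i)))"

lemma geo_weight_base: "0 < 1 - 1 / (real k + 2)" "1 - 1 / (real k + 2) < 1"
  by (auto simp: field_simps)

lemma geo_weight_pos: "0 < geo_weight k n" unfolding geo_weight_def by (intro zero_less_power geo_weight_base)

lemma geo_weight_le_1: "geo_weight k n \<le> 1"
  unfolding geo_weight_def using geo_weight_base[of k] by (intro power_le_one) auto

lemma geo_weight_mono: "k \<le> l \<Longrightarrow> geo_weight k n \<le> geo_weight l n"
  unfolding geo_weight_def using geo_weight_base[of k] by (intro power_mono) (auto intro!: divide_left_mono)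

text \<open>Every rate below 1 lies under some 1 - 1 / (k + 2). The rates in
  \<open>geo_weight\<close> thus form a countable cofinal family, so that one almost sure event
  serves all sequences of geometric decay at once.\<close>

lemma geo_decayI:
  assumes "\<tau> < 1" "0 \<le> \<tau>" "\<And>n. norm (a n) \<le> C * \<tau> ^ nat \<bar>n\<bar>"
  shows "geo_decay a"
proof -
  obtain k where k: "1 / real (Suc k) < 1 - \<tau>" using nat_approx_posE[of "1 - \<tau>"] assms(1) by auto
  have "1 / (real k + 2) \<le> 1 / real (Suc k)" by (intro divide_left_mono) auto
  then have "\<tau> \<le> 1 - 1 / (real k + 2)" using k by linarith
  then have "\<tau> ^ nat \<bar>n\<bar> \<le> geo_weight k n" for n unfolding geo_weight_def using assms(2) by (intro power_mono) auto
  moreover have "0 \<le> C" using assms(3)[of 0] norm_ge_zero[of "a 0"] by (simp del: norm_ge_zero)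
  ultimately have "norm (a n) \<le> C * geo_weight k n" for n using assms(3)[of n] mult_left_mono order_trans by blast
  then show ?thesis unfolding geo_decay_def by blast
qed

lemma geo_decay_zero: "geo_decay (\<lambda>_. 0)"
  unfolding geo_decay_def by (intro exI[of _ 0]) simp

lemma geo_decay_add:
  assumes "geo_decay a" "geo_decay b" shows "geo_decay (\<lambda>n. a n + b n)"
proof -
  obtain C k D l where 1: "\<And>n. norm (a n) \<le> C * geo_weight k n" "\<And>n. norm (b n) \<le> D * geo_weight l n"
    using assms by (auto simp: geo_decay_def)
  have "norm (a n + b n) \<le> (\<bar>C\<bar> + \<bar>D\<bar>) * geo_weight (max k l) n" for n
  proof -
    have "norm (a n) \<le> \<bar>C\<bar> * geo_weight (max k l) n"
      using 1(1)[of n] geo_weight_mono[of k "max k l" n] geo_weight_pos[of k n]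
      by (meson abs_ge_self abs_ge_zero less_imp_le max.cobounded1 mult_mono order_trans)
    moreover have "norm (b n) \<le> \<bar>D\<bar> * geo_weight (max k l) n"
      using 1(2)[of n] geo_weight_mono[of l "max k l" n] geo_weight_pos[of l n]
      by (meson abs_ge_self abs_ge_zero less_imp_le max.cobounded2 mult_mono order_trans)
    ultimately show ?thesis using norm_triangle_ineq[of "a n" "b n"] by (simp add: distrib_right)
  qed
  then show ?thesis unfolding geo_decay_def by blast
qed

lemma geo_decay_cmult:
  assumes "geo_decay a" shows "geo_decay (\<lambda>n. c * a n)"
proof -
  obtain C k where 1: "\<And>n. norm (a n) \<le> C * geo_weight k n" using assms by (auto simp: geo_decay_def)
  have "norm (c * a n) \<le> (norm c * C) * geo_weight k n" for n
    using mult_left_mono[OF 1[of n] norm_ge_zero[of c]] by (simp add: norm_mult mult.assoc)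
  then show ?thesis unfolding geo_decay_def by blast
qed

lemma geo_decay_sum:
  "finite J \<Longrightarrow> (\<And>j. j \<in> J \<Longrightarrow> geo_decay (a j)) \<Longrightarrow> geo_decay (\<lambda>n. \<Sum>j\<in>J. c j * a j n)"
proof (induction J rule: finite_induct)
  case (insert x F)
  then show ?case
    using geo_decay_add[OF geo_decay_cmult[of "a x" "c x"], of "\<lambda>n. \<Sum>j\<in>F. c j * a j n"] by simp
qed (simp add: geo_decay_zero)

lemma geo_decay_fun_upd:
  assumes "geo_decay a" shows "geo_decay (a(0 := x))"
proof -
  obtain C k where 1: "\<And>n. norm (a n) \<le> C * geo_weight k n" using assms by (auto simp: geo_decay_def)
  have "0 \<le> C" using 1[of 0] norm_ge_zero[of "a 0"] unfolding geo_weight_def by (simp del: norm_ge_zero)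
  have "norm ((a(0 := x)) n) \<le> (C + norm x) * geo_weight k n" for n
  proof (cases "n = 0")
    case True
    then show ?thesis using \<open>0 \<le> C\<close> by (simp add: geo_weight_def)
  next
    case False
    have "C * geo_weight k n \<le> (C + norm x) * geo_weight k n" using geo_weight_pos[of k n] by (intro mult_right_mono) auto
    then show ?thesis using 1[of n] False by simp
  qed
  then show ?thesis unfolding geo_decay_def by blast
qed

lemma summable_int_decode:
  fixes f :: "int \<Rightarrow> real"
  assumes "summable (\<lambda>n. f (int n))" "summable (\<lambda>n. f (- int (Suc n)))" "\<And>n. 0 \<le> f n"
  shows "summable (\<lambda>i. f (int_decode i))"
proof -
  have "summable (\<lambda>n. norm (complex_of_real (f (int n))))" "summable (\<lambda>n. norm (complex_of_real (f (- int (Suc n)))))"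
    using assms by simp_all
  from has_sum_int[OF this] have "(\<lambda>n. complex_of_real (f n)) summable_on UNIV" by (rule has_sum_imp_summable)
  then have "(\<lambda>i. complex_of_real (f (int_decode i))) summable_on UNIV"
    using summable_on_reindex_bij_betw[OF bij_int_decode, of "\<lambda>n. complex_of_real (f n)"] by simp
  then have "summable (\<lambda>i. complex_of_real (f (int_decode i)))" by (rule summable_on_imp_summable)
  then show ?thesis by (simp add: summable_of_real_iff)
qed

lemma summable_geo_weight: "summable (\<lambda>i. geo_weight k (int_decode i))"
proof (rule summable_int_decode)
  have g: "summable (\<lambda>n. (1 - 1 / (real k + 2)) ^ n)" using geo_weight_base[of k] by (simp add: summable_geometric)
  then show "summable (\<lambda>n. geo_weight k (int n))" by (simp add: geo_weight_def)
  have "(\<lambda>n. geo_weight k (- int (Suc n))) = (\<lambda>n. (1 - 1 / (real k + 2)) ^ Suc n)"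
    unfolding geo_weight_def by (intro ext arg_cong2[where f = power] refl) simp
  then show "summable (\<lambda>n. geo_weight k (- int (Suc n)))" using g by (simp only: summable_Suc_iff)
qed (use geo_weight_pos less_imp_le in blast)

lemma summable_geo_decay_mult:
  assumes "geo_decay a" "geo_decay b"
  shows "summable (\<lambda>i. norm (a (int_decode i) * cnj (b (int_decode i))))"
proof -
  obtain C k where 1: "\<And>n. norm (a n) \<le> C * geo_weight k n" using assms by (auto simp: geo_decay_def)
  obtain D l where 2: "\<And>n. norm (b n) \<le> D * geo_weight l n" using assms by (auto simp: geo_decay_def)
  have "norm (a n * cnj (b n)) \<le> (C * \<bar>D\<bar>) * geo_weight k n" for n
  proof -
    have "D * geo_weight l n \<le> \<bar>D\<bar> * 1" using geo_weight_le_1[of l n] geo_weight_pos[of l n] by (intro mult_mono) auto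
    then have "norm (b n) \<le> \<bar>D\<bar>" using 2[of n] by simp
    then have "norm (a n) * norm (b n) \<le> (C * geo_weight k n) * \<bar>D\<bar>" using 1[of n] by (intro mult_mono) (auto intro: order_trans[OF norm_ge_zero])
    then show ?thesis by (simp add: norm_mult mult_ac)
  qed
  then show ?thesis
    by (intro summable_comparison_test'[OF summable_mult[OF summable_geo_weight[of k]], where N = 0]) auto
qed

section \<open>Gaussian series with independent coefficients\<close>

locale iid_gauss = prob_space +
  fixes \<zeta> :: "int \<Rightarrow> 'a \<Rightarrow> complex"
  assumes indep: "indep_vars (\<lambda>_. borel) \<zeta> UNIV"
    and gauss: "\<And>n. distributed M lborel (\<zeta> n) (\<lambda>z. ennreal (exp (- (cmod z)\<^sup>2) / pi))"
begin

lemma measurable_zeta [measurable]: "\<zeta> n \<in> borel_measurable M"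
  using distributed_measurable[OF gauss[of n]] by simp

lemma distr_zeta: "distr M borel (\<zeta> n) = cgauss"
  unfolding cgauss_def distributed_distr_eq_density[OF gauss[of n], symmetric] by (rule distr_cong) simp_all

definition tail_sum :: "nat \<Rightarrow> 'a \<Rightarrow> ennreal" where
  "tail_sum k \<omega> = (\<Sum>i. ennreal (norm (\<zeta> (int_decode i) \<omega>) * geo_weight k (int_decode i) * of_bool (int_decode i \<noteq> 0)))"

definition good :: "'a \<Rightarrow> bool" where "good \<omega> \<longleftrightarrow> (\<forall>k. tail_sum k \<omega> < \<top>)"

text \<open>The coefficients other than \<open>\<zeta> 0\<close> are replaced by \<open>0\<close> off the almost sure event of subexponential growth, so that every
  realisation is holomorphic and \<open>\<zeta> 0\<close> still splits off everywhere.\<close>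

definition Z :: "int \<Rightarrow> 'a \<Rightarrow> complex" where "Z n \<omega> = (if n = 0 \<or> good \<omega> then \<zeta> n \<omega> else 0)"

definition gs :: "(int \<Rightarrow> complex) \<Rightarrow> 'a \<Rightarrow> complex" where
  "gs a \<omega> = (\<Sum>i. a (int_decode i) * Z (int_decode i) \<omega>)"

lemma measurable_good [measurable]: "Measurable.pred M good"
  unfolding good_def tail_sum_def by measurable

lemma measurable_Z [measurable]: "Z n \<in> borel_measurable M"
  unfolding Z_def by measurable

text \<open>Each weighted sum has finite expectation because a Gaussian coefficient has a finite
  first moment; countably many weights leave a single null set.\<close>

lemma AE_good: "AE \<omega> in M. good \<omega>"
proof -
  define m where "m = (\<integral>\<^sup>+z. ennreal (norm z) \<partial>cgauss)"
  have m: "m < \<top>" unfolding m_def by (rule nn_integral_norm_cgauss)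
  have E: "(\<integral>\<^sup>+\<omega>. ennreal (norm (\<zeta> n \<omega>)) \<partial>M) = m" for n
    unfolding m_def distr_zeta[of n, symmetric] by (subst nn_integral_distr) simp_all
  have "AE \<omega> in M. tail_sum k \<omega> \<noteq> \<infinity>" for k
  proof (rule nn_integral_noteq_infinite)
    show "tail_sum k \<in> borel_measurable M" unfolding tail_sum_def by measurable
    have "(\<integral>\<^sup>+\<omega>. tail_sum k \<omega> \<partial>M) = (\<Sum>i. \<integral>\<^sup>+\<omega>. ennreal (norm (\<zeta> (int_decode i) \<omega>) * geo_weight k (int_decode i) * of_bool (int_decode i \<noteq> 0)) \<partial>M)"
      unfolding tail_sum_def by (rule nn_integral_suminf) measurable
    also have "\<dots> \<le> (\<Sum>i. m * ennreal (geo_weight k (int_decode i)))"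
    proof (rule suminf_le)
      fix i
      have "(\<integral>\<^sup>+\<omega>. ennreal (norm (\<zeta> (int_decode i) \<omega>) * geo_weight k (int_decode i) * of_bool (int_decode i \<noteq> 0)) \<partial>M)
        \<le> (\<integral>\<^sup>+\<omega>. ennreal (norm (\<zeta> (int_decode i) \<omega>)) * ennreal (geo_weight k (int_decode i)) \<partial>M)"
      proof (intro nn_integral_mono)
        fix \<omega>
        have "norm (\<zeta> (int_decode i) \<omega>) * geo_weight k (int_decode i) * of_bool (int_decode i \<noteq> 0) \<le> norm (\<zeta> (int_decode i) \<omega>) * geo_weight k (int_decode i)"
          using less_imp_le[OF geo_weight_pos[of k "int_decode i"]] by (cases "int_decode i = 0") (simp_all add: less_imp_le[OF geo_weight_pos])
        then show "ennreal (norm (\<zeta> (int_decode i) \<omega>) * geo_weight k (int_decode i) * of_bool (int_decode i \<noteq> 0)) \<le> ennreal (norm (\<zeta> (int_decode i) \<omega>)) * ennreal (geo_weight k (int_decode i))"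
          using less_imp_le[OF geo_weight_pos[of k "int_decode i"]]
          by (subst ennreal_mult[symmetric]) (auto intro: ennreal_leI simp del: of_bool_eq_0_iff)
      qed
      also have "\<dots> = m * ennreal (geo_weight k (int_decode i))"
        by (subst nn_integral_multc) (simp_all add: E)
      finally show "(\<integral>\<^sup>+\<omega>. ennreal (norm (\<zeta> (int_decode i) \<omega>) * geo_weight k (int_decode i) * of_bool (int_decode i \<noteq> 0)) \<partial>M) \<le> m * ennreal (geo_weight k (int_decode i))" .
    qed simp_all
    also have "\<dots> = m * (\<Sum>i. ennreal (geo_weight k (int_decode i)))" by (rule ennreal_suminf_cmult)
    also have "(\<Sum>i. ennreal (geo_weight k (int_decode i))) = ennreal (\<Sum>i. geo_weight k (int_decode i))"
      using summable_geo_weight geo_weight_pos by (intro suminf_ennreal2) (auto intro: less_imp_le)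
    also have "m * \<dots> < \<top>" using m by (simp add: ennreal_mult_less_top)
    finally show "(\<integral>\<^sup>+\<omega>. tail_sum k \<omega> \<partial>M) \<noteq> \<infinity>" by simp
  qed
  then have "AE \<omega> in M. \<forall>k. tail_sum k \<omega> \<noteq> \<infinity>" by (simp add: AE_all_countable)
  then show ?thesis by eventually_elim (simp add: good_def less_top)
qed

lemma summable_Z_weight: "summable (\<lambda>i. norm (Z (int_decode i) \<omega>) * geo_weight k (int_decode i))"
proof -
  define f where "f i = norm (Z (int_decode i) \<omega>) * geo_weight k (int_decode i) * of_bool (int_decode i \<noteq> 0)" for i
  have "summable f"
  proof (cases "good \<omega>")
    case True
    have "(\<Sum>i. ennreal (f i)) \<noteq> \<top>" using True by (auto simp: f_def good_def tail_sum_def Z_def less_top)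
    then show ?thesis by (intro summable_suminf_not_top) (simp_all add: f_def less_imp_le[OF geo_weight_pos])
  next
    case False
    then have "f = (\<lambda>_. 0)" by (auto simp: f_def Z_def fun_eq_iff)
    then show ?thesis by simp
  qed
  moreover have "summable (\<lambda>i. if i \<in> {int_encode 0} then norm (Z (int_decode i) \<omega>) * geo_weight k (int_decode i) else 0)"
    by (rule summable_If_finite_set) simp
  ultimately have "summable (\<lambda>i. f i + (if i \<in> {int_encode 0} then norm (Z (int_decode i) \<omega>) * geo_weight k (int_decode i) else 0))"
    by (rule summable_add)
  moreover have "f i + (if i \<in> {int_encode 0} then norm (Z (int_decode i) \<omega>) * geo_weight k (int_decode i) else 0) = norm (Z (int_decode i) \<omega>) * geo_weight k (int_decode i)" for i
  proof (cases "int_decode i = 0")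
    case True
    then have "i = int_encode 0" by (metis int_decode_inverse)
    then show ?thesis using True by (simp add: f_def)
  next
    case False
    then have "i \<noteq> int_encode 0" by auto
    then show ?thesis using False by (simp add: f_def)
  qed
  ultimately show ?thesis by simp
qed

lemma summable_gs:
  assumes "geo_decay a" shows "summable (\<lambda>i. norm (a (int_decode i) * Z (int_decode i) \<omega>))"
proof -
  obtain C k where 1: "\<And>n. norm (a n) \<le> C * geo_weight k n" using assms by (auto simp: geo_decay_def)
  have "norm (a n * Z n \<omega>) \<le> C * (norm (Z n \<omega>) * geo_weight k n)" for n
    using mult_right_mono[OF 1[of n] norm_ge_zero[of "Z n \<omega>"]] by (simp add: norm_mult mult_ac)
  then show ?thesis
    by (intro summable_comparison_test'[OF summable_mult[OF summable_Z_weight[of \<omega> k]], where N = 0]) auto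
qed

lemma measurable_gs:
  assumes "geo_decay a" shows "gs a \<in> borel_measurable M"
proof (rule borel_measurable_LIMSEQ_metric)
  show "(\<lambda>\<omega>. \<Sum>i<N. a (int_decode i) * Z (int_decode i) \<omega>) \<in> borel_measurable M" for N by measurable
  show "(\<lambda>N. \<Sum>i<N. a (int_decode i) * Z (int_decode i) \<omega>) \<longlonglongrightarrow> gs a \<omega>" for \<omega>
    unfolding gs_def by (rule summable_LIMSEQ[OF summable_norm_cancel[OF summable_gs[OF assms]]])
qed

lemma gs_zero: "gs (\<lambda>_. 0) \<omega> = 0" by (simp add: gs_def)

lemma gs_add: "geo_decay a \<Longrightarrow> geo_decay b \<Longrightarrow> gs (\<lambda>n. a n + b n) \<omega> = gs a \<omega> + gs b \<omega>"
  unfolding gs_def distrib_right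
  by (rule suminf_add[symmetric]) (rule summable_norm_cancel[OF summable_gs], assumption)+

lemma gs_cmult: "geo_decay a \<Longrightarrow> gs (\<lambda>n. c * a n) \<omega> = c * gs a \<omega>"
  unfolding gs_def mult.assoc by (rule suminf_mult) (rule summable_norm_cancel[OF summable_gs])

lemma gs_sum: "finite J \<Longrightarrow> (\<And>j. j \<in> J \<Longrightarrow> geo_decay (a j)) \<Longrightarrow> gs (\<lambda>n. \<Sum>j\<in>J. c j * a j n) \<omega> = (\<Sum>j\<in>J. c j * gs (a j) \<omega>)"
proof (induction J rule: finite_induct)
  case (insert x F)
  then show ?case using gs_add[of "\<lambda>n. c x * a x n" "\<lambda>n. \<Sum>j\<in>F. c j * a j n" \<omega>]
    by (simp add: geo_decay_cmult geo_decay_sum gs_cmult)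
qed (simp add: gs_zero)

lemma gs_fun_upd:
  assumes "geo_decay a" shows "gs a \<omega> = a 0 * \<zeta> 0 \<omega> + gs (a(0 := 0)) \<omega>"
proof -
  define e where "e n = (if n = 0 then a 0 else 0)" for n :: int
  have e: "geo_decay e" unfolding e_def using geo_decay_fun_upd[OF geo_decay_zero, of "a 0"] by (simp add: fun_upd_def)
  have "a = (\<lambda>n. e n + (a(0 := 0)) n)" by (auto simp: e_def)
  then have "gs a \<omega> = gs (\<lambda>n. e n + (a(0 := 0)) n) \<omega>" by simp
  also have "\<dots> = gs e \<omega> + gs (a(0 := 0)) \<omega>" by (rule gs_add[OF e geo_decay_fun_upd[OF assms]])
  also have "gs e \<omega> = (\<Sum>i\<in>{int_encode 0}. e (int_decode i) * Z (int_decode i) \<omega>)"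
    unfolding gs_def by (rule suminf_finite) (auto simp: e_def, metis int_decode_inverse)
  also have "\<dots> = a 0 * \<zeta> 0 \<omega>" by (simp add: e_def Z_def)
  finally show ?thesis .
qed

text \<open>Partial sums factorise by independence, which enters at this place alone; the limit is
  taken under the integral because the exponentials are bounded. Later statements about laws are
  read off from this formula.\<close>

lemma char_gs:
  assumes a: "geo_decay a"
  shows "(CLINT \<omega>|M. iexp (Re (gs a \<omega>))) = exp (- seq_ip a a / 4)"
proof -
  have fin: "(CLINT \<omega>|M. iexp (Re (\<Sum>i<N. a (int_decode i) * \<zeta> (int_decode i) \<omega>))) = exp (- (\<Sum>i<N. a (int_decode i) * cnj (a (int_decode i))) / 4)" for N
  proof -
    have "iexp (Re (\<Sum>i<N. a (int_decode i) * \<zeta> (int_decode i) \<omega>)) = (\<Prod>n\<in>int_decode ` {..<N}. iexp (Re (a n * \<zeta> n \<omega>)))" for \<omega>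
    proof -
      have "iexp (Re (\<Sum>i<N. a (int_decode i) * \<zeta> (int_decode i) \<omega>)) = (\<Prod>i<N. iexp (Re (a (int_decode i) * \<zeta> (int_decode i) \<omega>)))"
        unfolding Re_sum of_real_sum sum_distrib_left by (rule exp_sum) simp
      then show ?thesis by (subst prod.reindex) (simp_all only: inj_int_decode o_def)
    qed
    then have "(CLINT \<omega>|M. iexp (Re (\<Sum>i<N. a (int_decode i) * \<zeta> (int_decode i) \<omega>))) = (CLINT \<omega>|M. (\<Prod>n\<in>int_decode ` {..<N}. iexp (Re (a n * \<zeta> n \<omega>))))"
      by simp
    also have "\<dots> = (\<Prod>n\<in>int_decode ` {..<N}. (CLINT \<omega>|M. iexp (Re (a n * \<zeta> n \<omega>))))"
    proof (rule indep_vars_lebesgue_integral)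
      have "indep_vars (\<lambda>_. borel) \<zeta> (int_decode ` {..<N})" by (rule indep_vars_subset[OF indep]) auto
      moreover have "(\<lambda>z. iexp (Re (a n * z))) \<in> borel_measurable borel" for n
        by (intro borel_measurable_continuous_onI continuous_intros)
      ultimately show "indep_vars (\<lambda>_. borel) (\<lambda>n \<omega>. iexp (Re (a n * \<zeta> n \<omega>))) (int_decode ` {..<N})"
        by (rule indep_vars_compose2)
      fix n
      have "(\<lambda>\<omega>. iexp (Re (a n * \<zeta> n \<omega>))) \<in> borel_measurable M" by measurable
      then show "integrable M (\<lambda>\<omega>. iexp (Re (a n * \<zeta> n \<omega>)))" by (intro integrable_const_bound[of _ 1]) auto
    qed simp
    also have "\<dots> = (\<Prod>n\<in>int_decode ` {..<N}. exp (- (a n * cnj (a n)) / 4))"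
    proof (intro prod.cong refl)
      fix n
      have "(CLINT \<omega>|M. iexp (Re (a n * \<zeta> n \<omega>))) = (CLINT z|cgauss. iexp (Re (a n * z)))"
        unfolding distr_zeta[of n, symmetric]
        by (rule integral_distr[symmetric]) (auto intro!: borel_measurable_continuous_onI continuous_intros)
      also have "\<dots> = exp (- (a n * cnj (a n)) / 4)" unfolding char_cgauss complex_norm_square ..
      finally show "(CLINT \<omega>|M. iexp (Re (a n * \<zeta> n \<omega>))) = exp (- (a n * cnj (a n)) / 4)" .
    qed
    also have "\<dots> = exp (- (\<Sum>i<N. a (int_decode i) * cnj (a (int_decode i))) / 4)"
      by (subst prod.reindex) (simp_all add: inj_int_decode exp_sum[symmetric] sum_negf sum_divide_distrib)
    finally show ?thesis .
  qed
  have "(\<lambda>N. CLINT \<omega>|M. iexp (Re (\<Sum>i<N. a (int_decode i) * \<zeta> (int_decode i) \<omega>))) \<longlonglongrightarrow> (CLINT \<omega>|M. iexp (Re (gs a \<omega>)))"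
  proof (rule integral_dominated_convergence[where w = "\<lambda>_. 1"])
    have [measurable]: "gs a \<in> borel_measurable M" by (rule measurable_gs[OF a])
    show "(\<lambda>\<omega>. iexp (Re (gs a \<omega>))) \<in> borel_measurable M" by measurable
    show "(\<lambda>\<omega>. iexp (Re (\<Sum>i<N. a (int_decode i) * \<zeta> (int_decode i) \<omega>))) \<in> borel_measurable M" for N by measurable
    show "AE \<omega> in M. (\<lambda>N. iexp (Re (\<Sum>i<N. a (int_decode i) * \<zeta> (int_decode i) \<omega>))) \<longlonglongrightarrow> iexp (Re (gs a \<omega>))"
      using AE_good
    proof eventually_elim
      fix \<omega> assume "good \<omega>"
      then have "Z n \<omega> = \<zeta> n \<omega>" for n by (simp add: Z_def)
      then have "(\<lambda>N. \<Sum>i<N. a (int_decode i) * \<zeta> (int_decode i) \<omega>) \<longlonglongrightarrow> gs a \<omega>"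
        unfolding gs_def using summable_LIMSEQ[OF summable_norm_cancel[OF summable_gs[OF a, of \<omega>]]] by simp
      then show "(\<lambda>N. iexp (Re (\<Sum>i<N. a (int_decode i) * \<zeta> (int_decode i) \<omega>))) \<longlonglongrightarrow> iexp (Re (gs a \<omega>))"
        by (intro tendsto_intros)
    qed
  qed auto
  moreover have "(\<lambda>N. exp (- (\<Sum>i<N. a (int_decode i) * cnj (a (int_decode i))) / 4)) \<longlonglongrightarrow> exp (- seq_ip a a / 4)"
    unfolding seq_ip_def
    by (intro tendsto_intros summable_LIMSEQ[OF summable_norm_cancel[OF summable_geo_decay_mult[OF a a]]]) simp
  ultimately show ?thesis unfolding fin by (rule LIMSEQ_unique)
qed

lemma seq_ip_sum:
  assumes "finite J" "\<And>j. j \<in> J \<Longrightarrow> geo_decay (a j)"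
  shows "seq_ip (\<lambda>n. \<Sum>j\<in>J. c j * a j n) (\<lambda>n. \<Sum>j\<in>J. c j * a j n) = (\<Sum>i\<in>J. \<Sum>j\<in>J. c i * cnj (c j) * seq_ip (a i) (a j))"
proof -
  have s: "summable (\<lambda>i. a j (int_decode i) * cnj (a k (int_decode i)))" if "j \<in> J" "k \<in> J" for j k
    by (rule summable_norm_cancel[OF summable_geo_decay_mult]) (use assms that in auto)
  have "seq_ip (\<lambda>n. \<Sum>j\<in>J. c j * a j n) (\<lambda>n. \<Sum>j\<in>J. c j * a j n) =
    (\<Sum>i. \<Sum>j\<in>J. \<Sum>k\<in>J. (c j * cnj (c k)) * (a j (int_decode i) * cnj (a k (int_decode i))))"
    unfolding seq_ip_def by (simp add: cnj_sum sum_product mult_ac)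
  also have "\<dots> = (\<Sum>j\<in>J. \<Sum>i. \<Sum>k\<in>J. (c j * cnj (c k)) * (a j (int_decode i) * cnj (a k (int_decode i))))"
    by (rule suminf_sum) (intro summable_sum summable_mult s)
  also have "\<dots> = (\<Sum>j\<in>J. \<Sum>k\<in>J. \<Sum>i. (c j * cnj (c k)) * (a j (int_decode i) * cnj (a k (int_decode i))))"
    by (intro sum.cong refl suminf_sum summable_mult s)
  also have "\<dots> = (\<Sum>j\<in>J. \<Sum>k\<in>J. c j * cnj (c k) * seq_ip (a j) (a k))"
    unfolding seq_ip_def by (intro sum.cong refl suminf_mult s)
  finally show ?thesis .
qed

lemma char_gs_sum:
  assumes "finite J" "\<And>j. j \<in> J \<Longrightarrow> geo_decay (a j)"
  shows "(CLINT \<omega>|M. iexp (Re (\<Sum>j\<in>J. c j * gs (a j) \<omega>))) =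
     exp (- (\<Sum>i\<in>J. \<Sum>j\<in>J. c i * cnj (c j) * seq_ip (a i) (a j)) / 4)"
proof -
  have g: "geo_decay (\<lambda>n. \<Sum>j\<in>J. c j * a j n)" by (rule geo_decay_sum[OF assms])
  have 1: "gs (\<lambda>n. \<Sum>j\<in>J. c j * a j n) \<omega> = (\<Sum>j\<in>J. c j * gs (a j) \<omega>)" for \<omega> by (rule gs_sum[OF assms])
  have 2: "seq_ip (\<lambda>n. \<Sum>j\<in>J. c j * a j n) (\<lambda>n. \<Sum>j\<in>J. c j * a j n) = (\<Sum>i\<in>J. \<Sum>j\<in>J. c i * cnj (c j) * seq_ip (a i) (a j))"
    by (rule seq_ip_sum[OF assms])
  show ?thesis using char_gs[OF g] unfolding 1 2 .
qed

end

lemma seq_ip_add_left: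
  assumes "geo_decay a" "geo_decay b" "geo_decay c"
  shows "seq_ip (\<lambda>n. a n + b n) c = seq_ip a c + seq_ip b c"
  unfolding seq_ip_def distrib_right
  by (intro suminf_add[symmetric] summable_norm_cancel[OF summable_geo_decay_mult] assms)

lemma seq_ip_cmult_left:
  assumes "geo_decay a" "geo_decay c"
  shows "seq_ip (\<lambda>n. x * a n) c = x * seq_ip a c"
  unfolding seq_ip_def mult.assoc
  by (intro suminf_mult summable_norm_cancel[OF summable_geo_decay_mult] assms)

lemma seq_ip_cnj:
  assumes "geo_decay a" "geo_decay b" shows "cnj (seq_ip a b) = seq_ip b a"
proof -
  have "(\<lambda>i. a (int_decode i) * cnj (b (int_decode i))) sums seq_ip a b"
    unfolding seq_ip_def by (intro summable_sums summable_norm_cancel[OF summable_geo_decay_mult] assms)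
  then have "(\<lambda>i. cnj (a (int_decode i) * cnj (b (int_decode i)))) sums cnj (seq_ip a b)"
    by (simp only: sums_cnj)
  then show ?thesis unfolding seq_ip_def by (simp add: sums_iff mult.commute)
qed

lemma seq_ip_add_right:
  assumes "geo_decay a" "geo_decay b" "geo_decay c"
  shows "seq_ip c (\<lambda>n. a n + b n) = seq_ip c a + seq_ip c b"
proof -
  have "seq_ip c (\<lambda>n. a n + b n) = cnj (seq_ip (\<lambda>n. a n + b n) c)"
    by (rule seq_ip_cnj[symmetric, OF geo_decay_add[OF assms(1,2)] assms(3)])
  also have "\<dots> = seq_ip c a + seq_ip c b"
    unfolding seq_ip_add_left[OF assms] complex_cnj_add seq_ip_cnj[OF assms(1,3)] seq_ip_cnj[OF assms(2,3)] ..
  finally show ?thesis .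
qed

lemma seq_ip_cmult_right:
  assumes "geo_decay a" "geo_decay c"
  shows "seq_ip c (\<lambda>n. x * a n) = cnj x * seq_ip c a"
proof -
  have "seq_ip c (\<lambda>n. x * a n) = cnj (seq_ip (\<lambda>n. x * a n) c)"
    by (rule seq_ip_cnj[symmetric, OF geo_decay_cmult[OF assms(1)] assms(2)])
  also have "\<dots> = cnj x * seq_ip c a"
    unfolding seq_ip_cmult_left[OF assms] complex_cnj_mult seq_ip_cnj[OF assms] ..
  finally show ?thesis .
qed

lemma seq_ip_self:
  assumes "geo_decay a" shows "seq_ip a a = of_real (Re (seq_ip a a))" "0 \<le> Re (seq_ip a a)"
proof -
  have s: "(\<lambda>i. a (int_decode i) * cnj (a (int_decode i))) sums seq_ip a a"
    unfolding seq_ip_def by (intro summable_sums summable_norm_cancel[OF summable_geo_decay_mult] assms)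
  show "seq_ip a a = of_real (Re (seq_ip a a))"
    using seq_ip_cnj[OF assms assms] by (simp add: complex_eq_iff)
  have "(\<lambda>i. Re (a (int_decode i) * cnj (a (int_decode i)))) sums Re (seq_ip a a)" using s by (rule sums_Re)
  then have "(\<Sum>i. Re (a (int_decode i) * cnj (a (int_decode i)))) = Re (seq_ip a a)" "summable (\<lambda>i. Re (a (int_decode i) * cnj (a (int_decode i))))"
    by (simp_all only: sums_iff)
  moreover have "0 \<le> Re (a n * cnj (a n))" for n by simp
  ultimately show "0 \<le> Re (seq_ip a a)" using suminf_nonneg[of "\<lambda>i. Re (a (int_decode i) * cnj (a (int_decode i)))"] by presburger
qed

lemma seq_ip_fun_upd:
  assumes "geo_decay a" "geo_decay b"
  shows "seq_ip (a(0 := 0)) (b(0 := 0)) = seq_ip a b - a 0 * cnj (b 0)"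
proof -
  let ?f = "\<lambda>i. a (int_decode i) * cnj (b (int_decode i))"
  have "(\<lambda>i. if i = int_encode 0 then ?f i else 0) sums ?f (int_encode 0)" by (rule sums_single)
  moreover have "?f sums seq_ip a b"
    unfolding seq_ip_def by (intro summable_sums summable_norm_cancel[OF summable_geo_decay_mult] assms)
  ultimately have "(\<lambda>i. ?f i - (if i = int_encode 0 then ?f i else 0)) sums (seq_ip a b - ?f (int_encode 0))"
    by (intro sums_diff)
  moreover have "?f i - (if i = int_encode 0 then ?f i else 0) = (a(0 := 0)) (int_decode i) * cnj ((b(0 := 0)) (int_decode i))" for i
  proof (cases "int_decode i = 0")
    case True
    then have "i = int_encode 0" by (metis int_decode_inverse)
    then show ?thesis by simp
  next
    case False
    then have "i \<noteq> int_encode 0" by auto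
    then show ?thesis using False by simp
  qed
  ultimately show ?thesis unfolding seq_ip_def by (simp add: sums_iff)
qed

section \<open>Laurent coefficient vectors and the process on the annulus\<close>

definition lau :: "real \<Rightarrow> real \<Rightarrow> complex \<Rightarrow> int \<Rightarrow> complex" where
  "lau q r z n = z powi n / of_real (sqrt (1 + r * q powi (2 * n)))"

context
  fixes q :: real assumes q: "0 < q" "q < 1"
begin

lemma lau_denom_pos: "0 < r \<Longrightarrow> 0 < 1 + r * q powi k"
  using q by (intro add_pos_nonneg mult_nonneg_nonneg) (auto intro: less_imp_le)

text \<open>For the index - m the weight contributes at least sqrt r / q^m to the denominator, which
  turns |z|^(-m) into (q / |z|)^m up to a constant. The bound is uniform on closed subannuli and so
  serves both the decay at a point and the uniform convergence in
  \<open>Xf_holomorphic\<close>.\<close>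

lemma lau_bound:
  assumes r: "0 < r" and z: "0 < \<rho>1" "\<rho>1 \<le> norm z" "norm z \<le> \<rho>2"
  shows "norm (lau q r z n) \<le> max 1 (1 / sqrt r) * (max \<rho>2 (q / \<rho>1)) ^ nat \<bar>n\<bar>"
proof (cases "n \<ge> 0")
  case True
  then obtain m where n: "n = int m" using nonneg_int_cases by blast
  have "norm (lau q r z n) = norm z ^ m / sqrt (1 + r * q powi (2 * n))"
    unfolding lau_def n using r q by (simp add: norm_divide norm_power power_int_def)
  also have "\<dots> \<le> norm z ^ m / 1"
    using r q lau_denom_pos[OF r, of "2 * n"] by (intro divide_left_mono) (auto simp: less_imp_le)
  also have "\<dots> \<le> (max \<rho>2 (q / \<rho>1)) ^ m" using z by (simp add: power_mono)
  also have "\<dots> \<le> max 1 (1 / sqrt r) * (max \<rho>2 (q / \<rho>1)) ^ m"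
  proof -
    have "0 \<le> max \<rho>2 (q / \<rho>1)" using z q by (simp add: le_max_iff_disj)
    then have "1 * (max \<rho>2 (q / \<rho>1)) ^ m \<le> max 1 (1 / sqrt r) * (max \<rho>2 (q / \<rho>1)) ^ m" by (intro mult_right_mono) auto
    then show ?thesis by simp
  qed
  finally show ?thesis using n by simp
next
  case False
  define m where "m = nat (- n)"
  have n: "n = - int m" "m > 0" using False by (simp_all add: m_def)
  have z0: "norm z > 0" using z by linarith
  have qm: "q powi (2 * n) = 1 / (q ^ m)\<^sup>2"
  proof -
    have "2 * n = - int (m * 2)" using n by simp
    then show ?thesis by (simp only: power_int_minus power_int_of_nat power_mult inverse_eq_divide)
  qed
  have "sqrt r / q ^ m = sqrt (r * (1 / (q ^ m)\<^sup>2))" using q r by (simp add: real_sqrt_mult real_sqrt_divide)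
  also have "\<dots> \<le> sqrt (1 + r * q powi (2 * n))" unfolding qm by (rule real_sqrt_le_mono) simp
  finally have s: "sqrt r / q ^ m \<le> sqrt (1 + r * q powi (2 * n))" .
  have sp: "0 < sqrt r / q ^ m" using r q by simp
  have "norm (lau q r z n) = (1 / norm z ^ m) / sqrt (1 + r * q powi (2 * n))"
  proof -
    have "norm (z powi n) = 1 / norm z ^ m"
      unfolding norm_power_int n(1) power_int_minus power_int_of_nat by (simp add: inverse_eq_divide norm_divide norm_power)
    moreover have "norm (complex_of_real (sqrt (1 + r * q powi (2 * n)))) = sqrt (1 + r * q powi (2 * n))"
      unfolding norm_of_real using lau_denom_pos[OF r, of "2 * n"] by (intro abs_of_nonneg real_sqrt_ge_zero) simp
    ultimately show ?thesis unfolding lau_def norm_divide by simp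
  qed
  also have "\<dots> \<le> (1 / norm z ^ m) / (sqrt r / q ^ m)" using s sp by (intro divide_left_mono mult_pos_pos order.strict_trans2[OF sp s]) (auto simp: zero_le_divide_iff)
  also have "\<dots> = 1 / sqrt r * (q / norm z) ^ m" by (simp add: power_divide)
  also have "\<dots> \<le> max 1 (1 / sqrt r) * (max \<rho>2 (q / \<rho>1)) ^ m"
  proof (intro mult_mono)
    have "q / norm z \<le> q / \<rho>1" using z q z0 by (intro divide_left_mono) auto
    then show "(q / norm z) ^ m \<le> (max \<rho>2 (q / \<rho>1)) ^ m" using q z0 by (intro power_mono) (auto simp: le_max_iff_disj)
  qed (use q z0 in auto)
  finally show ?thesis using n by simp
qed

lemma lau_decay: "0 < r \<Longrightarrow> z \<in> annulus q \<Longrightarrow> geo_decay (lau q r z)"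
proof (rule geo_decayI[of "max (norm z) (q / norm z)" _ "max 1 (1 / sqrt r)"])
  assume r: "0 < r" and "z \<in> annulus q"
  then have z: "q < norm z" "norm z < 1" by (auto simp: annulus_def)
  have "0 < norm z" using z q by linarith
  then have "q / norm z < 1" using z(1) by (subst pos_divide_less_eq) simp_all
  then show "max (norm z) (q / norm z) < 1" using z by simp
  show "0 \<le> max (norm z) (q / norm z)" by (simp add: le_max_iff_disj)
  show "norm (lau q r z n) \<le> max 1 (1 / sqrt r) * (max (norm z) (q / norm z)) ^ nat \<bar>n\<bar>" for n
    using \<open>0 < norm z\<close> by (intro lau_bound r) auto
qed

lemma seq_ip_lau:
  assumes r: "0 < r" and z: "z \<in> annulus q" "w \<in> annulus q"
  shows "seq_ip (lau q r z) (lau q r w) = szego_kernel q z w r"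
proof -
  have "lau q r z n * cnj (lau q r w n) = (z * cnj w) powi n / of_real (1 + r * q powi (2 * n))" for n
  proof -
    have "0 \<le> 1 + r * q powi (2 * n)" using r q by simp
    then have "complex_of_real (sqrt (1 + r * q powi (2 * n))) * of_real (sqrt (1 + r * q powi (2 * n))) = of_real (1 + r * q powi (2 * n))"
      unfolding of_real_mult[symmetric] by simp
    then show ?thesis unfolding lau_def
      by (simp add: power_int_mult_distrib)
  qed
  then have "((\<lambda>n. lau q r z n * cnj (lau q r w n)) has_sum szego_kernel q z w r) UNIV"
    using has_sum_szego_kernel[OF q r z] by simp
  then have "((\<lambda>i. lau q r z (int_decode i) * cnj (lau q r w (int_decode i))) has_sum szego_kernel q z w r) UNIV"
    using has_sum_reindex_bij_betw[OF bij_int_decode, of "\<lambda>n. lau q r z n * cnj (lau q r w n)"] by simp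
  then have "(\<lambda>i. lau q r z (int_decode i) * cnj (lau q r w (int_decode i))) sums szego_kernel q z w r" by (rule has_sum_imp_sums)
  then show ?thesis unfolding seq_ip_def by (simp add: sums_iff)
qed

lemma szego_kernel_cnj:
  assumes "0 < r" "z \<in> annulus q" "w \<in> annulus q" shows "cnj (szego_kernel q z w r) = szego_kernel q w z r"
  using seq_ip_cnj[OF lau_decay lau_decay, of r z r w] assms by (simp add: seq_ip_lau)

text \<open>An inner product of a vector with itself is real and nonnegative, and the theta quotient
  shows that it does not vanish.\<close>

lemma szego_kernel_diag_pos:
  assumes "0 < r" "z \<in> annulus q"
  shows "0 < Re (szego_kernel q z z r)" "szego_kernel q z z r = of_real (Re (szego_kernel q z z r))"
proof -
  note ip = seq_ip_self[OF lau_decay[OF assms], unfolded seq_ip_lau[OF assms(1,2,2)]]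
  show 2: "szego_kernel q z z r = of_real (Re (szego_kernel q z z r))" by (rule ip(1))
  have "Re (szego_kernel q z z r) \<noteq> 0" using 2 szego_kernel_diag_nonzero[OF q assms] by (metis of_real_0)
  then show "0 < Re (szego_kernel q z z r)" using ip(2) by linarith
qed

end

locale iid_gauss_annulus = iid_gauss +
  fixes q :: real assumes q: "0 < q" "q < 1"
begin

abbreviation A where "A \<equiv> annulus q"

definition Xf :: "real \<Rightarrow> 'a \<Rightarrow> complex \<Rightarrow> complex" where "Xf r \<omega> = (\<lambda>z. gs (lau q r z) \<omega>)"

lemma A_open: "open A" by (rule annulus_open[OF q])

lemma A_connected: "connected A"
proof -
  have "annulus q = (\<lambda>p. of_real (fst p) * exp (\<i> * of_real (snd p))) ` ({q<..<1} \<times> UNIV)"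
  proof (intro equalityI subsetI)
    fix z assume "z \<in> annulus q"
    then have "z \<noteq> 0" "norm z \<in> {q<..<1}" using annulus_nonzero[OF q] by (auto simp: annulus_def)
    moreover from this have "z = of_real (norm z) * exp (\<i> * of_real (Arg z))" by (intro Arg_eq)
    ultimately have "z = of_real (norm z) * exp (\<i> * of_real (Arg z))" "norm z \<in> {q<..<1}" by blast+
    then show "z \<in> (\<lambda>p. of_real (fst p) * exp (\<i> * of_real (snd p))) ` ({q<..<1} \<times> UNIV)"
      by (intro image_eqI[of _ _ "(norm z, Arg z)"]) simp_all
  qed (use q in \<open>auto simp: annulus_def norm_mult\<close>)
  moreover have "connected ((\<lambda>p. complex_of_real (fst p) * exp (\<i> * of_real (snd p))) ` ({q<..<1} \<times> UNIV))"
    by (intro connected_continuous_image continuous_intros connected_Times) auto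
  ultimately show ?thesis by simp
qed

lemma Xf_holomorphic:
  assumes r: "0 < r" shows "Xf r \<omega> holomorphic_on A"
proof (rule holomorphic_uniform_sequence[OF A_open])
  show "(\<lambda>z. \<Sum>i<N. lau q r z (int_decode i) * Z (int_decode i) \<omega>) holomorphic_on A" for N
    unfolding lau_def using r q annulus_nonzero[OF q]
    by (intro holomorphic_intros) (simp_all add: less_imp_neq[OF lau_denom_pos[OF q r], symmetric])
  fix z0 assume z0: "z0 \<in> A"
  define d where "d = min (norm z0 - q) (1 - norm z0) / 2"
  define \<rho>1 where "\<rho>1 = norm z0 - d"
  define \<rho>2 where "\<rho>2 = norm z0 + d"
  have "d > 0" "2 * d \<le> norm z0 - q" "2 * d \<le> 1 - norm z0" using z0 by (auto simp: d_def annulus_def)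
  then have d: "d > 0" "q < \<rho>1" "\<rho>2 < 1" "0 \<le> \<rho>2" unfolding \<rho>1_def \<rho>2_def using norm_ge_zero[of z0] by linarith+
  have b: "\<rho>1 \<le> norm z" "norm z \<le> \<rho>2" if "z \<in> cball z0 d" for z
    using that norm_triangle_ineq2[of z0 z] norm_triangle_ineq2[of z z0] by (auto simp: \<rho>1_def \<rho>2_def dist_norm norm_minus_commute)
  have sub: "cball z0 d \<subseteq> A"
    using b d by (auto simp: annulus_def) (meson le_less_trans less_le_trans)+
  define \<tau> where "\<tau> = max \<rho>2 (q / \<rho>1)"
  define C where "C = max 1 (1 / sqrt r)"
  have \<tau>: "\<tau> < 1" "0 \<le> \<tau>" using d q by (auto simp: \<tau>_def le_max_iff_disj)
  have g: "geo_decay (\<lambda>n. complex_of_real (C * \<tau> ^ nat \<bar>n\<bar>))"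
  proof (rule geo_decayI[OF \<tau>])
    show "norm (complex_of_real (C * \<tau> ^ nat \<bar>n\<bar>)) \<le> C * \<tau> ^ nat \<bar>n\<bar>" for n
      unfolding norm_of_real using \<tau> by (subst abs_of_nonneg) (simp_all add: C_def)
  qed
  have "uniform_limit (cball z0 d) (\<lambda>N z. \<Sum>i<N. lau q r z (int_decode i) * Z (int_decode i) \<omega>)
     (\<lambda>z. \<Sum>i. lau q r z (int_decode i) * Z (int_decode i) \<omega>) sequentially"
  proof (rule Weierstrass_m_test)
    show "summable (\<lambda>i. norm (complex_of_real (C * \<tau> ^ nat \<bar>int_decode i\<bar>) * Z (int_decode i) \<omega>))"
      by (rule summable_gs[OF g])
    fix i z assume z: "z \<in> cball z0 d"
    have "norm (lau q r z (int_decode i)) \<le> C * \<tau> ^ nat \<bar>int_decode i\<bar>"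
      unfolding C_def \<tau>_def using d q b[OF z] by (intro lau_bound[OF q r]) auto
    then show "norm (lau q r z (int_decode i) * Z (int_decode i) \<omega>) \<le> norm (complex_of_real (C * \<tau> ^ nat \<bar>int_decode i\<bar>) * Z (int_decode i) \<omega>)"
      using \<tau> by (simp add: norm_mult norm_power C_def mult_right_mono abs_mult)
  qed
  then show "\<exists>d>0. cball z0 d \<subseteq> A \<and> uniform_limit (cball z0 d) (\<lambda>N z. \<Sum>i<N. lau q r z (int_decode i) * Z (int_decode i) \<omega>) (Xf r \<omega>) sequentially"
    unfolding Xf_def gs_def using d(1) sub by blast
qed

lemma measurable_Xf: "0 < r \<Longrightarrow> z \<in> A \<Longrightarrow> (\<lambda>\<omega>. Xf r \<omega> z) \<in> borel_measurable M"
  unfolding Xf_def by (intro measurable_gs lau_decay[OF q])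

lemma laurent_sum_eq_Xf:
  assumes r: "0 < r" and "good \<omega>" "z \<in> A"
  shows "laurent_sum q r (\<lambda>n. \<zeta> n \<omega>) z = Xf r \<omega> z"
proof -
  have s: "summable (\<lambda>i. norm (lau q r z (int_decode i) * Z (int_decode i) \<omega>))"
    by (rule summable_gs[OF lau_decay[OF q r assms(3)]])
  have "((\<lambda>i. lau q r z (int_decode i) * Z (int_decode i) \<omega>) has_sum Xf r \<omega> z) UNIV"
    unfolding Xf_def gs_def by (rule norm_summable_imp_has_sum[OF s summable_sums[OF summable_norm_cancel[OF s]]])
  then have "((\<lambda>n. lau q r z n * Z n \<omega>) has_sum Xf r \<omega> z) UNIV"
    using has_sum_reindex_bij_betw[OF bij_int_decode, of "\<lambda>n. lau q r z n * Z n \<omega>"] by simp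
  moreover have "lau q r z n * Z n \<omega> = \<zeta> n \<omega> * z powi n / of_real (sqrt (1 + r * q powi (2 * n)))" for n
    using assms(2) by (simp add: lau_def Z_def)
  ultimately show ?thesis unfolding laurent_sum_def by (simp add: infsumI)
qed

lemma char_Xf:
  assumes r: "0 < r" and J: "finite J" "\<And>j. j \<in> J \<Longrightarrow> w j \<in> A"
  shows "(CLINT \<omega>|M. iexp (Re (\<Sum>j\<in>J. c j * Xf r \<omega> (w j)))) =
     exp (- (\<Sum>i\<in>J. \<Sum>j\<in>J. c i * cnj (c j) * szego_kernel q (w i) (w j) r) / 4)"
proof -
  have "(CLINT \<omega>|M. iexp (Re (\<Sum>j\<in>J. c j * gs (lau q r (w j)) \<omega>))) =
     exp (- (\<Sum>i\<in>J. \<Sum>j\<in>J. c i * cnj (c j) * seq_ip (lau q r (w i)) (lau q r (w j))) / 4)"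
    using J by (intro char_gs_sum lau_decay[OF q r]) auto
  also have "(\<Sum>i\<in>J. \<Sum>j\<in>J. c i * cnj (c j) * seq_ip (lau q r (w i)) (lau q r (w j))) = (\<Sum>i\<in>J. \<Sum>j\<in>J. c i * cnj (c j) * szego_kernel q (w i) (w j) r)"
    using J by (intro sum.cong refl arg_cong2[where f = "(*)"] seq_ip_lau[OF q r]) auto
  finally show ?thesis unfolding Xf_def .
qed

end

text \<open>\<open>hol_space\<close> carries the trace of the product sigma-algebra. Equality of the
  laws of all evaluations, obtained from characteristic functions, therefore passes to every
  measurable functional of the random function, in particular to sums over its zeros.\<close>

lemma hol_law_eq:
  assumes M: "prob_space M" and N: "prob_space N"
    and X: "X \<in> measurable M (hol_space A)" and Y: "Y \<in> measurable N (hol_space A)"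
    and eq: "\<And>J c. finite J \<Longrightarrow> J \<subseteq> A \<Longrightarrow>
      (CLINT x|M. iexp (Re (\<Sum>j\<in>J. c j * X x j))) = (CLINT y|N. iexp (Re (\<Sum>j\<in>J. c j * Y y j)))"
    and F: "F \<in> borel_measurable (hol_space A)"
  shows "(\<integral>\<^sup>+x. F (X x) \<partial>M) = (\<integral>\<^sup>+y. F (Y y) \<partial>N)"
proof -
  let ?P = "PiM A (\<lambda>_. borel) :: (complex \<Rightarrow> complex) measure"
  have law: "distr M ?P (\<lambda>x. \<lambda>i\<in>A. X x i) = distr N ?P (\<lambda>x. \<lambda>i\<in>A. Y x i)"
    by (intro complex_process_law_unique[OF M N] measurable_hol_space_component[OF X] measurable_hol_space_component[OF Y] eq)
  have mr: "(\<lambda>x. \<lambda>i\<in>A. X x i) \<in> measurable M ?P" "(\<lambda>x. \<lambda>i\<in>A. Y x i) \<in> measurable N ?P"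
    by (intro measurable_restrict measurable_hol_space_component[OF X] measurable_hol_space_component[OF Y], assumption)+
  have ext: "(\<lambda>i\<in>A. X x i) = X x" "X x holomorphic_on A" if "x \<in> space M" for x
    using measurable_space[OF X that] by (simp_all add: space_hol_space extensional_restrict)
  have ext': "(\<lambda>i\<in>A. Y x i) = Y x" "Y x holomorphic_on A" if "x \<in> space N" for x
    using measurable_space[OF Y that] by (simp_all add: space_hol_space extensional_restrict)
  have "distr M (hol_space A) X = distr N (hol_space A) Y"
  proof (rule measure_eqI)
    fix S assume "S \<in> sets (distr M (hol_space A) X)"
    then have S: "S \<in> sets (hol_space A)" by simp
    then obtain S' where S': "S' \<in> sets ?P" "S = {u. u holomorphic_on A} \<inter> S'"
      unfolding hol_space_def sets_restrict_space by auto
    have 1: "X -` S \<inter> space M = (\<lambda>x. \<lambda>i\<in>A. X x i) -` S' \<inter> space M"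
      unfolding S'(2) using ext by auto
    have 2: "Y -` S \<inter> space N = (\<lambda>x. \<lambda>i\<in>A. Y x i) -` S' \<inter> space N"
      unfolding S'(2) using ext' by auto
    have "emeasure M ((\<lambda>x. \<lambda>i\<in>A. X x i) -` S' \<inter> space M) = emeasure N ((\<lambda>x. \<lambda>i\<in>A. Y x i) -` S' \<inter> space N)"
      unfolding emeasure_distr[OF mr(1) S'(1), symmetric] emeasure_distr[OF mr(2) S'(1), symmetric] law ..
    then show "emeasure (distr M (hol_space A) X) S = emeasure (distr N (hol_space A) Y) S"
      unfolding emeasure_distr[OF X S] emeasure_distr[OF Y S] 1 2 .
  qed simp
  moreover have "F \<in> borel_measurable (distr M (hol_space A) X)" "F \<in> borel_measurable (distr N (hol_space A) Y)"
    using F by simp_all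
  ultimately show ?thesis using nn_integral_distr[OF X] nn_integral_distr[OF Y] by metis
qed

lemma geo_decay_diff: "geo_decay a \<Longrightarrow> geo_decay b \<Longrightarrow> geo_decay (\<lambda>n. a n - b n)"
  using geo_decay_add[of a "\<lambda>n. (-1) * b n"] geo_decay_cmult[of b "-1"] by simp

lemma seq_ip_diff_left:
  assumes "geo_decay a" "geo_decay b" "geo_decay c"
  shows "seq_ip (\<lambda>n. a n - b n) c = seq_ip a c - seq_ip b c"
  using seq_ip_add_left[OF assms(1) geo_decay_cmult[OF assms(2), of "-1"] assms(3)] seq_ip_cmult_left[OF assms(2,3), of "-1"] by simp

lemma seq_ip_diff_right:
  assumes "geo_decay a" "geo_decay b" "geo_decay c"
  shows "seq_ip c (\<lambda>n. a n - b n) = seq_ip c a - seq_ip c b"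
  using seq_ip_add_right[OF assms(1) geo_decay_cmult[OF assms(2), of "-1"] assms(3)] seq_ip_cmult_right[OF assms(2,3), of "-1"] by simp

lemma seq_ip_project:
  assumes d: "geo_decay a" "geo_decay b" "geo_decay v" and v: "seq_ip v v = 1"
  shows "seq_ip (\<lambda>n. a n - seq_ip a v * v n) (\<lambda>n. b n - seq_ip b v * v n) = seq_ip a b - seq_ip a v * cnj (seq_ip b v)"
proof -
  note c = geo_decay_cmult[OF d(3)]
  have "seq_ip (\<lambda>n. a n - seq_ip a v * v n) (\<lambda>n. b n - seq_ip b v * v n) =
    seq_ip a b - cnj (seq_ip b v) * seq_ip a v - seq_ip a v * (seq_ip v b - cnj (seq_ip b v) * seq_ip v v)"
    by (simp only: seq_ip_diff_left[OF d(1) c geo_decay_diff[OF d(2) c]] seq_ip_cmult_left[OF d(3) geo_decay_diff[OF d(2) c]]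
        seq_ip_diff_right[OF d(2) c d(1)] seq_ip_diff_right[OF d(2) c d(3)] seq_ip_cmult_right[OF d(3) d(1)] seq_ip_cmult_right[OF d(3) d(3)])
  then show ?thesis unfolding v using seq_ip_cnj[OF d(2,3)] by (simp add: mult.commute)
qed

lemma sum_mult_cnj_sum:
  fixes c :: "'i \<Rightarrow> complex"
  shows "(\<Sum>i\<in>J. c i * x i) * cnj (\<Sum>j\<in>J. c j * y j) = (\<Sum>i\<in>J. \<Sum>j\<in>J. c i * cnj (c j) * (x i * cnj (y j)))"
  unfolding cnj_sum sum_product by (intro sum.cong refl) (simp add: mult_ac)

section \<open>Orthogonal splitting and Gaussian weights\<close>

context iid_gauss
begin

lemma iexp_measurable: "f \<in> borel_measurable K \<Longrightarrow> (\<lambda>x. iexp (Re (f x))) \<in> borel_measurable K"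
proof -
  assume [measurable]: "f \<in> borel_measurable K"
  show ?thesis by measurable
qed

text \<open>The component along the unit vector v is replaced by a fresh Gaussian on a product
  space; this expresses its independence of the orthogonal remainder. The products of the
  projections and the Gram matrix from \<open>seq_ip_project\<close> add up to the original Gram
  matrix. It is applied to the unit vector of index 0 and to normalised coefficient vectors.\<close>

lemma char_split:
  assumes v: "geo_decay v" "seq_ip v v = 1" and J: "finite J" "\<And>j. j \<in> J \<Longrightarrow> geo_decay (a j)"
  shows "(CLINT p|cgauss \<Otimes>\<^sub>M M. iexp (Re (\<Sum>j\<in>J. c j * (seq_ip (a j) v * fst p + gs (\<lambda>n. a j n - seq_ip (a j) v * v n) (snd p))))) =
    (CLINT \<omega>|M. iexp (Re (\<Sum>j\<in>J. c j * gs (a j) \<omega>)))"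
proof -
  interpret C: prob_space cgauss by (rule prob_space_cgauss)
  interpret CM: pair_prob_space cgauss M ..
  define b where "b j = (\<lambda>n. a j n - seq_ip (a j) v * v n)" for j
  define \<beta> where "\<beta> = (\<Sum>j\<in>J. c j * seq_ip (a j) v)"
  define G where "G \<omega> = (\<Sum>j\<in>J. c j * gs (b j) \<omega>)" for \<omega>
  have db: "geo_decay (b j)" if "j \<in> J" for j unfolding b_def by (intro geo_decay_diff geo_decay_cmult J(2) that v)
  have [measurable]: "G \<in> borel_measurable M" unfolding G_def
    by (intro borel_measurable_sum borel_measurable_times measurable_gs db) auto
  have e: "(\<Sum>j\<in>J. c j * (seq_ip (a j) v * fst p + gs (\<lambda>n. a j n - seq_ip (a j) v * v n) (snd p))) = \<beta> * fst p + G (snd p)" for p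
    unfolding \<beta>_def G_def b_def sum_distrib_right sum.distrib[symmetric] by (intro sum.cong refl) (simp add: algebra_simps)
  have m: "(\<lambda>p. iexp (Re (\<beta> * fst p + G (snd p)))) \<in> borel_measurable (cgauss \<Otimes>\<^sub>M M)"
    by (rule iexp_measurable) measurable
  have i: "integrable (cgauss \<Otimes>\<^sub>M M) (\<lambda>p. iexp (Re (\<beta> * fst p + G (snd p))))"
    by (rule CM.P.integrable_const_bound[of _ 1]) (use m in simp_all)
  have "(CLINT p|cgauss \<Otimes>\<^sub>M M. iexp (Re (\<beta> * fst p + G (snd p)))) = (CLINT x|cgauss. CLINT \<omega>|M. iexp (Re (\<beta> * x + G \<omega>)))"
    using CM.integral_fst'[OF i] by simp
  also have "\<dots> = (CLINT x|cgauss. iexp (Re (\<beta> * x)) * (CLINT \<omega>|M. iexp (Re (G \<omega>))))"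
  proof (intro Bochner_Integration.integral_cong refl)
    fix x
    have "iexp (Re (\<beta> * x + G \<omega>)) = iexp (Re (\<beta> * x)) * iexp (Re (G \<omega>))" for \<omega>
      unfolding plus_complex.simps of_real_add distrib_left exp_add ..
    then show "(CLINT \<omega>|M. iexp (Re (\<beta> * x + G \<omega>))) = iexp (Re (\<beta> * x)) * (CLINT \<omega>|M. iexp (Re (G \<omega>)))" by simp
  qed
  also have "\<dots> = exp (- of_real ((norm \<beta>)\<^sup>2) / 4) * exp (- (\<Sum>i\<in>J. \<Sum>j\<in>J. c i * cnj (c j) * seq_ip (b i) (b j)) / 4)"
  proof -
    have "(CLINT \<omega>|M. iexp (Re (G \<omega>))) = exp (- (\<Sum>i\<in>J. \<Sum>j\<in>J. c i * cnj (c j) * seq_ip (b i) (b j)) / 4)"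
      unfolding G_def using J(1) db by (rule char_gs_sum)
    moreover have "(CLINT x|cgauss. iexp (Re (\<beta> * x))) = exp (- of_real ((norm \<beta>)\<^sup>2) / 4)" by (rule char_cgauss)
    ultimately show ?thesis by (simp only: integral_mult_left_zero)
  qed
  also have "\<dots> = exp (- (\<Sum>i\<in>J. \<Sum>j\<in>J. c i * cnj (c j) * seq_ip (a i) (a j)) / 4)"
  proof -
    have n: "of_real ((norm \<beta>)\<^sup>2) = (\<Sum>i\<in>J. \<Sum>j\<in>J. c i * cnj (c j) * (seq_ip (a i) v * cnj (seq_ip (a j) v)))"
      unfolding complex_norm_square \<beta>_def sum_mult_cnj_sum ..
    have s: "seq_ip (b i) (b j) = seq_ip (a i) (a j) - seq_ip (a i) v * cnj (seq_ip (a j) v)" if "i \<in> J" "j \<in> J" for i j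
      unfolding b_def using J(2) that v by (intro seq_ip_project)
    have "of_real ((norm \<beta>)\<^sup>2) + (\<Sum>i\<in>J. \<Sum>j\<in>J. c i * cnj (c j) * seq_ip (b i) (b j)) = (\<Sum>i\<in>J. \<Sum>j\<in>J. c i * cnj (c j) * seq_ip (a i) (a j))"
      unfolding n sum.distrib[symmetric] by (intro sum.cong refl) (simp add: s algebra_simps)
    moreover have "- x / 4 + - y / 4 = - (x + y) / 4" for x y :: complex by (simp add: field_simps)
    ultimately show ?thesis unfolding exp_add[symmetric] by presburger
  qed
  also have "\<dots> = (CLINT \<omega>|M. iexp (Re (\<Sum>j\<in>J. c j * gs (a j) \<omega>)))"
    using J by (intro char_gs_sum[symmetric])
  finally show ?thesis unfolding e .
qed

text \<open>With U = \<open>gs u \<omega>\<close>, the weight exp (-|U|^2 / a^2) is itself a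
  characteristic function, that of an auxiliary complex Gaussian x at 2 U / a. After the integrals
  are exchanged, the inner one is the transform of the combination of u and l with coefficients 2 x
  / a and 1, and a Gaussian quadratic integral in x remains. As K is a^2 plus the squared norm of u,
  the result is a Schur complement with pivot K and the normalisation a^2 / K.\<close>

lemma char_gauss_weight:
  assumes u: "geo_decay u" and l: "geo_decay l" and a: "0 < a" and K: "0 < K" "seq_ip u u = of_real (K - a\<^sup>2)"
  shows "(CLINT \<omega>|M. of_real (exp (- (norm (gs u \<omega>))\<^sup>2 / a\<^sup>2)) * iexp (Re (gs l \<omega>))) =
    of_real (a\<^sup>2 / K) * exp (- (seq_ip l l - seq_ip l u * cnj (seq_ip l u) / of_real K) / 4)"
proof -
  interpret C: prob_space cgauss by (rule prob_space_cgauss)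
  interpret CM: pair_prob_space cgauss M ..
  define \<beta> where "\<beta> = seq_ip l u"
  define V where "V = Re (seq_ip l l)"
  have V: "seq_ip l l = of_real V" unfolding V_def by (rule seq_ip_self[OF l])
  note [measurable] = measurable_gs[OF u] measurable_gs[OF l]
  define f where "f p = iexp (Re (2 / of_real a * gs u (snd p) * fst p + gs l (snd p)))" for p
  have m: "f \<in> borel_measurable (cgauss \<Otimes>\<^sub>M M)" unfolding f_def by (rule iexp_measurable) measurable
  have i: "integrable (cgauss \<Otimes>\<^sub>M M) f"
    by (rule CM.P.integrable_const_bound[of _ 1]) (use m in \<open>simp_all add: f_def\<close>)
  have sp: "f (x, \<omega>) = iexp (Re (2 / of_real a * gs u \<omega> * x)) * iexp (Re (gs l \<omega>))" for x :: complex and \<omega>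
    unfolding f_def fst_conv snd_conv plus_complex.simps of_real_add distrib_left exp_add ..
  have "(CLINT \<omega>|M. of_real (exp (- (norm (gs u \<omega>))\<^sup>2 / a\<^sup>2)) * iexp (Re (gs l \<omega>))) = (CLINT \<omega>|M. CLINT x|cgauss. f (x, \<omega>))"
  proof (intro Bochner_Integration.integral_cong refl)
    fix \<omega>
    have "(CLINT x|cgauss. f (x, \<omega>)) = exp (- of_real ((norm (2 / of_real a * gs u \<omega>))\<^sup>2) / 4) * iexp (Re (gs l \<omega>))"
      unfolding sp integral_mult_left_zero char_cgauss ..
    also have "- complex_of_real ((norm (2 / of_real a * gs u \<omega>))\<^sup>2) / 4 = of_real (- (norm (gs u \<omega>))\<^sup>2 / a\<^sup>2)"
      using a by (simp add: norm_mult norm_divide power_mult_distrib power_divide)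
    finally show "of_real (exp (- (norm (gs u \<omega>))\<^sup>2 / a\<^sup>2)) * iexp (Re (gs l \<omega>)) = (CLINT x|cgauss. f (x, \<omega>))"
      by (simp only: exp_of_real)
  qed
  also have "\<dots> = (CLINT x|cgauss. CLINT \<omega>|M. f (x, \<omega>))"
    using CM.Fubini_integral[of "\<lambda>x \<omega>. f (x, \<omega>)"] i by simp
  also have "\<dots> = (CLINT x|cgauss. of_real (exp (- V / 4) * exp ((1 - K / a\<^sup>2) * (norm x)\<^sup>2 + Re (- cnj \<beta> / of_real a * x))))"
  proof (intro Bochner_Integration.integral_cong refl)
    fix x :: complex
    define s where "s = 2 * x / of_real a"
    have "f (x, \<omega>) = iexp (Re (gs (\<lambda>n. s * u n + l n) \<omega>))" for \<omega>
      unfolding f_def fst_conv snd_conv gs_add[OF geo_decay_cmult[OF u] l] gs_cmult[OF u] s_def by (simp add: mult_ac)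
    then have "(CLINT \<omega>|M. f (x, \<omega>)) = exp (- seq_ip (\<lambda>n. s * u n + l n) (\<lambda>n. s * u n + l n) / 4)"
      using char_gs[OF geo_decay_add[OF geo_decay_cmult[OF u] l]] by simp
    also have "seq_ip (\<lambda>n. s * u n + l n) (\<lambda>n. s * u n + l n) = s * cnj s * of_real (K - a\<^sup>2) + (s * cnj \<beta> + cnj s * \<beta>) + of_real V"
      by (simp only: seq_ip_add_left[OF geo_decay_cmult[OF u] l geo_decay_add[OF geo_decay_cmult[OF u] l]]
        seq_ip_add_right[OF geo_decay_cmult[OF u] l u] seq_ip_add_right[OF geo_decay_cmult[OF u] l l] seq_ip_cmult_left[OF u geo_decay_add[OF geo_decay_cmult[OF u] l]]
        seq_ip_cmult_right[OF u u] seq_ip_cmult_right[OF u l] K(2) V \<beta>_def seq_ip_cnj[OF l u]) (simp add: algebra_simps)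
    also have "s * cnj \<beta> + cnj s * \<beta> = of_real (2 * Re (s * cnj \<beta>))"
      using complex_add_cnj[of "s * cnj \<beta>"] by simp
    also have "s * cnj s = of_real (4 * (norm x)\<^sup>2 / a\<^sup>2)"
    proof -
      have "s * cnj s = of_real ((norm s)\<^sup>2)" by (rule complex_norm_square[symmetric])
      also have "(norm s)\<^sup>2 = 4 * (norm x)\<^sup>2 / a\<^sup>2" unfolding s_def by (simp add: norm_mult norm_divide power_mult_distrib power_divide)
      finally show ?thesis .
    qed
    also have "- (complex_of_real (4 * (norm x)\<^sup>2 / a\<^sup>2) * of_real (K - a\<^sup>2) + of_real (2 * Re (s * cnj \<beta>)) + of_real V) / 4 =
      of_real (- V / 4 + ((1 - K / a\<^sup>2) * (norm x)\<^sup>2 + Re (- cnj \<beta> / of_real a * x)))"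
    proof -
      have "Re (s * cnj \<beta>) = - 2 * Re (- cnj \<beta> / of_real a * x)"
      proof -
        have "s * cnj \<beta> = of_real (- 2) * (- cnj \<beta> / of_real a * x)" unfolding s_def by simp
        moreover have "Re (of_real (- 2) * w) = - 2 * Re w" for w :: complex by simp
        ultimately show ?thesis by metis
      qed
      moreover have "4 * (norm x)\<^sup>2 / a\<^sup>2 * (K - a\<^sup>2) / 4 = - ((1 - K / a\<^sup>2) * (norm x)\<^sup>2)" using a by (simp add: field_simps)
      ultimately have "- (4 * (norm x)\<^sup>2 / a\<^sup>2 * (K - a\<^sup>2) + 2 * Re (s * cnj \<beta>) + V) / 4 = - V / 4 + ((1 - K / a\<^sup>2) * (norm x)\<^sup>2 + Re (- cnj \<beta> / of_real a * x))"
        by argo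
      then have "complex_of_real (- (4 * (norm x)\<^sup>2 / a\<^sup>2 * (K - a\<^sup>2) + 2 * Re (s * cnj \<beta>) + V) / 4) =
        of_real (- V / 4 + ((1 - K / a\<^sup>2) * (norm x)\<^sup>2 + Re (- cnj \<beta> / of_real a * x)))" by (rule arg_cong)
      moreover have "complex_of_real (- (p * k + e + v) / 4) = - (of_real p * of_real k + of_real e + of_real v) / 4" for p k e v :: real
        by simp
      ultimately show ?thesis by (simp only:)
    qed
    finally show "(CLINT \<omega>|M. f (x, \<omega>)) = of_real (exp (- V / 4) * exp ((1 - K / a\<^sup>2) * (norm x)\<^sup>2 + Re (- cnj \<beta> / of_real a * x)))"
      by (simp only: exp_of_real exp_add)
  qed
  also have "\<dots> = of_real (exp (- V / 4) * (exp ((norm (- cnj \<beta> / of_real a))\<^sup>2 / (4 * (K / a\<^sup>2))) / (K / a\<^sup>2)))"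
    unfolding integral_complex_of_real integral_mult_right_zero using K a by (subst integral_cgauss_quadratic) simp_all
  also have "(norm (- cnj \<beta> / of_real a))\<^sup>2 / (4 * (K / a\<^sup>2)) = (norm \<beta>)\<^sup>2 / K / 4"
    using a by (simp add: norm_divide power_divide)
  also have "exp (- V / 4) * (exp ((norm \<beta>)\<^sup>2 / K / 4) / (K / a\<^sup>2)) = (a\<^sup>2 / K) * exp (- (V - (norm \<beta>)\<^sup>2 / K) / 4)"
  proof -
    have "exp (- (V - (norm \<beta>)\<^sup>2 / K) / 4) = exp (- V / 4) * exp ((norm \<beta>)\<^sup>2 / K / 4)"
      unfolding exp_add[symmetric] by (rule arg_cong[where f = exp]) argo
    then show ?thesis by simp
  qed
  also have "complex_of_real ((a\<^sup>2 / K) * exp (- (V - (norm \<beta>)\<^sup>2 / K) / 4)) = of_real (a\<^sup>2 / K) * exp (- (seq_ip l l - \<beta> * cnj \<beta> / of_real K) / 4)"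
    unfolding V complex_norm_square[symmetric] by (simp only: of_real_mult exp_of_real[symmetric] of_real_minus of_real_diff of_real_divide of_real_numeral)
  finally show ?thesis unfolding \<beta>_def .
qed

end

section \<open>The Palm formula for the zeros\<close>

lemma measurable_hol_space_deriv:
  assumes A: "open A"
  shows "(\<lambda>u. \<lambda>z\<in>A. deriv u z) \<in> measurable (hol_space A) (hol_space A)"
proof (rule measurable_hol_spaceI)
  have [measurable]: "(\<lambda>u. u z) \<in> borel_measurable (hol_space A)" if "z \<in> A" for z
    by (rule measurable_hol_space_component[OF measurable_ident_sets[OF refl] that])
  fix z assume z: "z \<in> A"
  obtain d where d: "0 < d" "ball z d \<subseteq> A" using A z open_contains_ball by blast
  define h where "h n = complex_of_real (d / real (n + 2))" for n
  have h0: "h n \<noteq> 0" for n unfolding h_def of_real_eq_0_iff using d by simp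
  have zh: "z + h n \<in> A" for n
  proof -
    have "norm (h n) < d" unfolding h_def norm_of_real using d by (simp add: divide_less_eq)
    then have "z + h n \<in> ball z d" by (simp add: dist_norm)
    then show ?thesis using d by blast
  qed
  have hl: "h \<longlonglongrightarrow> 0"
  proof -
    have "(\<lambda>n. d / real (n + 2)) \<longlonglongrightarrow> 0" by real_asymp
    then have "h \<longlonglongrightarrow> of_real 0" unfolding h_def by (rule tendsto_of_real)
    then show ?thesis by simp
  qed
  show "(\<lambda>u. deriv u z) \<in> borel_measurable (hol_space A)"
  proof (rule borel_measurable_LIMSEQ_metric)
    show "(\<lambda>u. (u (z + h n) - u z) / h n) \<in> borel_measurable (hol_space A)" for n
      using z zh[of n] by measurable
    fix u :: "complex \<Rightarrow> complex" assume "u \<in> space (hol_space A)"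
    then have "u holomorphic_on A" by (simp add: space_hol_space)
    then have "(u has_field_derivative deriv u z) (at z)" using A z by (rule holomorphic_derivI)
    then have *: "(\<lambda>h. (u (z + h) - u z) / h) \<midarrow>0\<rightarrow> deriv u z" by (rule DERIV_D)
    have "filterlim h (at 0) sequentially"
      using hl h0 by (auto simp: filterlim_at)
    then show "(\<lambda>n. (u (z + h n) - u z) / h n) \<longlonglongrightarrow> deriv u z"
      by (rule filterlim_compose[OF *])
  qed
next
  fix u assume "u \<in> space (hol_space A)"
  then show "deriv u holomorphic_on A" using A by (intro holomorphic_deriv) (simp_all add: space_hol_space)
qed

lemma deriv_restrict: "open A \<Longrightarrow> z \<in> A \<Longrightarrow> deriv (restrict f A) z = deriv f z"
  by (intro deriv_cong_ev) (auto simp: eventually_nhds)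

lemma sqrt_mem_annulus: "0 < q \<Longrightarrow> q < 1 \<Longrightarrow> complex_of_real (sqrt q) \<in> annulus q"
  by (simp add: annulus_def real_less_rsqrt power2_eq_square)

lemma geo_decay_unit: "geo_decay ((\<lambda>_. 0)(0 := 1))" by (rule geo_decay_fun_upd[OF geo_decay_zero])

lemma seq_ip_unit: "seq_ip a ((\<lambda>_. 0)(0 := 1)) = a 0"
proof -
  have "(\<lambda>i. if i = int_encode 0 then a (int_decode i) else 0) sums a (int_decode (int_encode 0))" by (rule sums_single)
  moreover have "a (int_decode i) * cnj (((\<lambda>_. 0)(0 := 1)) (int_decode i)) = (if i = int_encode 0 then a (int_decode i) else 0)" for i
    using int_decode_inverse[of i] by (cases "int_decode i = 0") auto
  ultimately show ?thesis unfolding seq_ip_def by (simp add: sums_iff)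
qed

context iid_gauss_annulus
begin

definition Xh :: "real \<Rightarrow> 'a \<Rightarrow> complex \<Rightarrow> complex" where "Xh r \<omega> = restrict (Xf r \<omega>) A"

text \<open>The series without its term of index \<open>0\<close>, which is the constant \<open>a0 r * \<zeta> 0 \<omega>\<close>.\<close>

definition Yf :: "real \<Rightarrow> 'a \<Rightarrow> complex \<Rightarrow> complex" where "Yf r \<omega> = (\<lambda>z. gs ((lau q r z)(0 := 0)) \<omega>)"

definition Kd :: "real \<Rightarrow> complex \<Rightarrow> real" where "Kd r z = Re (szego_kernel q z z r)"

definition a0 :: "real \<Rightarrow> real" where "a0 r = 1 / sqrt (1 + r)"

lemma lau_0: "lau q r z 0 = of_real (a0 r)" by (simp add: lau_def a0_def)

lemma a0_pos: "0 < r \<Longrightarrow> 0 < a0 r" by (simp add: a0_def)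

lemma Kd: "0 < r \<Longrightarrow> z \<in> A \<Longrightarrow> 0 < Kd r z" "0 < r \<Longrightarrow> z \<in> A \<Longrightarrow> szego_kernel q z z r = of_real (Kd r z)"
  unfolding Kd_def using szego_kernel_diag_pos[OF q] by blast+

lemma Xf_eq_Yf: "0 < r \<Longrightarrow> z \<in> A \<Longrightarrow> Xf r \<omega> z = of_real (a0 r) * \<zeta> 0 \<omega> + Yf r \<omega> z"
  unfolding Xf_def Yf_def using gs_fun_upd[OF lau_decay[OF q]] lau_0 by simp

lemma Yf_holomorphic: assumes r: "0 < r" shows "Yf r \<omega> holomorphic_on A"
proof -
  have "(\<lambda>z. Xf r \<omega> z - of_real (a0 r) * \<zeta> 0 \<omega>) holomorphic_on A"
    by (intro holomorphic_intros Xf_holomorphic r)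
  then show ?thesis by (rule holomorphic_transform) (simp add: Xf_eq_Yf[OF r])
qed

lemma measurable_Yf: "0 < r \<Longrightarrow> z \<in> A \<Longrightarrow> (\<lambda>\<omega>. Yf r \<omega> z) \<in> borel_measurable M"
  unfolding Yf_def by (intro measurable_gs geo_decay_fun_upd lau_decay[OF q])

lemma measurable_Xh: "0 < r \<Longrightarrow> Xh r \<in> measurable M (hol_space A)"
  unfolding Xh_def by (intro measurable_hol_spaceI measurable_Xf Xf_holomorphic)

text \<open>\<open>char_split\<close> along the unit vector of index 0: the inner product with it is
  the coefficient \<open>a0 r\<close>, the same at every point of the annulus.\<close>

lemma split_law:
  assumes r: "0 < r" and F: "F \<in> borel_measurable (hol_space A)"
  shows "(\<integral>\<^sup>+\<omega>. F (Xh r \<omega>) \<partial>M) = (\<integral>\<^sup>+p. F (\<lambda>w\<in>A. of_real (a0 r) * fst p + Yf r (snd p) w) \<partial>(cgauss \<Otimes>\<^sub>M M))"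
proof (rule hol_law_eq[OF _ _ measurable_Xh[OF r] _ _ F])
  interpret C: prob_space cgauss by (rule prob_space_cgauss)
  interpret CM: pair_prob_space cgauss M ..
  show "prob_space M" "prob_space (cgauss \<Otimes>\<^sub>M M)" by (rule prob_space_axioms, rule CM.P.prob_space_axioms)
  show "(\<lambda>p. \<lambda>w\<in>A. of_real (a0 r) * fst p + Yf r (snd p) w) \<in> measurable (cgauss \<Otimes>\<^sub>M M) (hol_space A)"
  proof (rule measurable_hol_spaceI)
    fix z assume "z \<in> A"
    note [measurable] = measurable_Yf[OF r this]
    show "(\<lambda>p. of_real (a0 r) * fst p + Yf r (snd p) z) \<in> borel_measurable (cgauss \<Otimes>\<^sub>M M)" by measurable
  next
    show "(\<lambda>w. of_real (a0 r) * fst p + Yf r (snd p) w) holomorphic_on A" for p by (intro holomorphic_intros Yf_holomorphic r)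
  qed
  fix J :: "complex set" and c :: "complex \<Rightarrow> complex" assume J: "finite J" "J \<subseteq> A"
  let ?v = "(\<lambda>_. 0)(0 := 1) :: int \<Rightarrow> complex"
  have "(\<lambda>n. lau q r j n - seq_ip (lau q r j) ?v * ?v n) = (lau q r j)(0 := 0)" for j
    unfolding seq_ip_unit by auto
  then have e: "seq_ip (lau q r j) ?v * fst p + gs (\<lambda>n. lau q r j n - seq_ip (lau q r j) ?v * ?v n) (snd p)
    = of_real (a0 r) * fst p + Yf r (snd p) j" for j p
    unfolding seq_ip_unit lau_0 Yf_def by simp
  have "(CLINT p|cgauss \<Otimes>\<^sub>M M. iexp (Re (\<Sum>j\<in>J. c j * (of_real (a0 r) * fst p + Yf r (snd p) j)))) =
    (CLINT \<omega>|M. iexp (Re (\<Sum>j\<in>J. c j * Xf r \<omega> j)))"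
    using char_split[OF geo_decay_unit _ J(1), of "lau q r" c] lau_decay[OF q r] J(2) seq_ip_unit[of ?v] unfolding e Xf_def by auto
  moreover have "(\<Sum>j\<in>J. c j * (\<lambda>w\<in>A. of_real (a0 r) * fst p + Yf r (snd p) w) j) = (\<Sum>j\<in>J. c j * (of_real (a0 r) * fst p + Yf r (snd p) j))" for p
    using J(2) by (intro sum.cong refl) auto
  moreover have "(\<Sum>j\<in>J. c j * Xh r \<omega> j) = (\<Sum>j\<in>J. c j * Xf r \<omega> j)" for \<omega>
    unfolding Xh_def using J(2) by (intro sum.cong refl) auto
  ultimately show "(CLINT \<omega>|M. iexp (Re (\<Sum>j\<in>J. c j * Xh r \<omega> j))) =
    (CLINT p|cgauss \<Otimes>\<^sub>M M. iexp (Re (\<Sum>j\<in>J. c j * (\<lambda>w\<in>A. of_real (a0 r) * fst p + Yf r (snd p) w) j)))" by simp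
qed

text \<open>At a zero z the value of \<open>\<zeta> 0\<close> is forced to be - Y(z) / a0, which
  turns X into Y - Y(z); the Gaussian density there is, up to the factor 1 / pi, the weight on the
  left. So this is the law of X given a zero at z, tested by linear forms:
  \<open>char_gauss_weight\<close> computes it and \<open>szego_kernel_schur\<close> recognises the
  covariance.\<close>

lemma conditional_char:
  assumes r: "0 < r" and z: "z \<in> A" and J: "finite J" "J \<subseteq> A"
  shows "(CLINT \<omega>|M. of_real (exp (- (norm (Yf r \<omega> z))\<^sup>2 / (a0 r)\<^sup>2)) * iexp (Re (\<Sum>j\<in>J. c j * (Yf r \<omega> j - Yf r \<omega> z)))) =
    of_real ((a0 r)\<^sup>2 / Kd r z) * (CLINT \<omega>|M. iexp (Re (\<Sum>j\<in>J. c j * (blaschke q z j * Xf (r * (norm z)\<^sup>2) \<omega> j))))"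
proof -
  let ?r = "r * (norm z)\<^sup>2"
  have r': "0 < ?r" using r z annulus_nonzero[OF q z] by simp
  \<comment> \<open>The constant terms cancel in these differences, so \<open>l\<close> has no
    component of index 0 and may be paired with the full coefficient vector of z instead of the
    truncated \<open>u\<close>.\<close>
  define l where "l n = (\<Sum>j\<in>J. c j * (lau q r j n - lau q r z n))" for n
  define u where "u = (lau q r z)(0 := 0)"
  let ?K = "\<lambda>x y. szego_kernel q x y r"
  have L: "geo_decay (lau q r w)" if "w \<in> A" for w using lau_decay[OF q r that] .
  have dj: "geo_decay (\<lambda>n. lau q r j n - lau q r z n)" if "j \<in> J" for j using J that z by (intro geo_decay_diff L) auto
  have dl: "geo_decay l" unfolding l_def using dj by (intro geo_decay_sum J(1))
  have du: "geo_decay u" unfolding u_def by (intro geo_decay_fun_upd L z)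
  have l0: "l 0 = 0" unfolding l_def by (simp add: lau_0)
  have uu: "seq_ip u u = of_real (Kd r z - (a0 r)\<^sup>2)"
    unfolding u_def seq_ip_fun_upd[OF L[OF z] L[OF z]] seq_ip_lau[OF q r z z] lau_0 Kd(2)[OF r z] by (simp add: power2_eq_square)
  have gl: "gs l \<omega> = (\<Sum>j\<in>J. c j * (Yf r \<omega> j - Yf r \<omega> z))" for \<omega>
  proof -
    have "gs l \<omega> = (\<Sum>j\<in>J. c j * gs (\<lambda>n. lau q r j n - lau q r z n) \<omega>)"
      unfolding l_def using dj by (rule gs_sum[OF J(1)])
    also have "\<dots> = (\<Sum>j\<in>J. c j * (Yf r \<omega> j - Yf r \<omega> z))"
    proof (intro sum.cong refl arg_cong2[where f = "(*)"])
      fix j assume "j \<in> J"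
      then have j: "j \<in> A" using J by blast
      have "gs (\<lambda>n. lau q r j n - lau q r z n) \<omega> = gs (lau q r j) \<omega> + gs (\<lambda>n. (-1) * lau q r z n) \<omega>"
        using gs_add[OF L[OF j] geo_decay_cmult[OF L[OF z], of "-1"]] by simp
      also have "\<dots> = Xf r \<omega> j - Xf r \<omega> z" unfolding gs_cmult[OF L[OF z]] Xf_def by simp
      also have "\<dots> = Yf r \<omega> j - Yf r \<omega> z" using Xf_eq_Yf[OF r j] Xf_eq_Yf[OF r z] by simp
      finally show "gs (\<lambda>n. lau q r j n - lau q r z n) \<omega> = Yf r \<omega> j - Yf r \<omega> z" .
    qed
    finally show ?thesis .
  qed
  have ipl: "seq_ip l v = (\<Sum>j\<in>J. c j * (seq_ip (lau q r j) v - seq_ip (lau q r z) v))" if "geo_decay v" for v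
  proof -
    have "seq_ip l v = (\<Sum>j\<in>J. c j * seq_ip (\<lambda>n. lau q r j n - lau q r z n) v)"
      unfolding l_def using J(1) dj
    proof (induction J rule: finite_induct)
      case empty
      show ?case by (simp add: seq_ip_def)
    next
      case (insert x F)
      have d: "geo_decay (\<lambda>n. \<Sum>j\<in>F. c j * (lau q r j n - lau q r z n))" using insert by (intro geo_decay_sum) auto
      have dx: "geo_decay (\<lambda>n. lau q r x n - lau q r z n)" using insert by auto
      have "seq_ip (\<lambda>n. c x * (lau q r x n - lau q r z n) + (\<Sum>j\<in>F. c j * (lau q r j n - lau q r z n))) v =
         c x * seq_ip (\<lambda>n. lau q r x n - lau q r z n) v + seq_ip (\<lambda>n. \<Sum>j\<in>F. c j * (lau q r j n - lau q r z n)) v"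
        by (simp only: seq_ip_add_left[OF geo_decay_cmult[OF dx] d that] seq_ip_cmult_left[OF dx that])
      then show ?case using insert by simp
    qed
    also have "\<dots> = (\<Sum>j\<in>J. c j * (seq_ip (lau q r j) v - seq_ip (lau q r z) v))"
      using J z that by (intro sum.cong refl arg_cong2[where f = "(*)"] seq_ip_diff_left L) auto
    finally show ?thesis .
  qed
  have "l(0 := 0) = l" using l0 by auto
  then have lu: "seq_ip l u = (\<Sum>j\<in>J. c j * (?K j z - ?K z z))"
  proof -
    have "seq_ip l u = seq_ip (l(0 := 0)) u" using \<open>l(0 := 0) = l\<close> by simp
    also have "\<dots> = seq_ip l (lau q r z)" unfolding u_def seq_ip_fun_upd[OF dl L[OF z]] l0 by simp
    also have "\<dots> = (\<Sum>j\<in>J. c j * (?K j z - ?K z z))"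
      unfolding ipl[OF L[OF z]] using J z by (intro sum.cong refl) (auto simp: seq_ip_lau[OF q r] subset_iff)
    finally show ?thesis .
  qed
  have ll: "seq_ip l l = (\<Sum>i\<in>J. \<Sum>j\<in>J. c i * cnj (c j) * (?K i j - ?K i z - ?K z j + ?K z z))"
  proof -
    have lw: "seq_ip (lau q r w) l = (\<Sum>j\<in>J. cnj (c j) * (?K w j - ?K w z))" if w: "w \<in> A" for w
    proof -
      have "seq_ip (lau q r w) l = cnj (seq_ip l (lau q r w))" by (rule seq_ip_cnj[OF dl L[OF w], symmetric])
      also have "\<dots> = (\<Sum>j\<in>J. cnj (c j) * (?K w j - ?K w z))"
        unfolding ipl[OF L[OF w]] cnj_sum using J z w
        by (intro sum.cong refl) (auto simp: seq_ip_lau[OF q r] szego_kernel_cnj[OF q r] subset_iff)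
      finally show ?thesis .
    qed
    have "seq_ip l l = (\<Sum>i\<in>J. c i * ((\<Sum>j\<in>J. cnj (c j) * (?K i j - ?K i z)) - (\<Sum>j\<in>J. cnj (c j) * (?K z j - ?K z z))))"
      unfolding ipl[OF dl] using J z by (intro sum.cong refl) (auto simp: lw subset_iff)
    also have "\<dots> = (\<Sum>i\<in>J. \<Sum>j\<in>J. c i * cnj (c j) * (?K i j - ?K i z - ?K z j + ?K z z))"
      unfolding sum_subtractf[symmetric] sum_distrib_left by (intro sum.cong refl) (simp add: algebra_simps)
    finally show ?thesis .
  qed
  have K0: "complex_of_real (Kd r z) \<noteq> 0" using Kd(1)[OF r z] by simp
  \<comment> \<open>When the product is expanded, the additional entries K i z, K z j and K z z
    cancel: centring at z does not change the Schur complement with pivot z.\<close>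
  have S: "(?K i j - ?K i z - ?K z j + ?K z z) - (?K i z - ?K z z) * cnj (?K j z - ?K z z) / of_real (Kd r z)
     = blaschke q z i * cnj (blaschke q z j) * szego_kernel q i j ?r" if "i \<in> J" "j \<in> J" for i j
  proof -
    have ij: "i \<in> A" "j \<in> A" using that J by auto
    have "cnj (?K j z - ?K z z) = ?K z j - ?K z z" using szego_kernel_cnj[OF q r] ij z by simp
    moreover have "?K i j * of_real (Kd r z) - ?K i z * ?K z j = of_real (Kd r z) * (blaschke q z i * cnj (blaschke q z j) * szego_kernel q i j ?r)"
      using szego_kernel_schur[OF q r ij(1,2) z] unfolding Kd(2)[OF r z] by (simp add: mult.assoc)
    ultimately show ?thesis using K0 unfolding Kd(2)[OF r z] by (simp add: field_simps)
  qed
  have "seq_ip l l - seq_ip l u * cnj (seq_ip l u) / of_real (Kd r z) =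
    (\<Sum>i\<in>J. \<Sum>j\<in>J. c i * cnj (c j) * ((?K i j - ?K i z - ?K z j + ?K z z) - (?K i z - ?K z z) * cnj (?K j z - ?K z z) / of_real (Kd r z)))"
    unfolding ll lu sum_mult_cnj_sum sum_divide_distrib sum_subtractf[symmetric]
    by (intro sum.cong refl) (simp only: right_diff_distrib times_divide_eq_right)
  also have "\<dots> = (\<Sum>i\<in>J. \<Sum>j\<in>J. (c i * blaschke q z i) * cnj (c j * blaschke q z j) * szego_kernel q i j ?r)"
    by (intro sum.cong refl) (simp only: S complex_cnj_mult, simp add: mult_ac)
  finally have Q: "seq_ip l l - seq_ip l u * cnj (seq_ip l u) / of_real (Kd r z) =
    (\<Sum>i\<in>J. \<Sum>j\<in>J. (c i * blaschke q z i) * cnj (c j * blaschke q z j) * szego_kernel q i j ?r)" .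
  have "(CLINT \<omega>|M. iexp (Re (\<Sum>j\<in>J. (c j * blaschke q z j) * Xf ?r \<omega> j))) =
    exp (- (\<Sum>i\<in>J. \<Sum>j\<in>J. (c i * blaschke q z i) * cnj (c j * blaschke q z j) * szego_kernel q i j ?r) / 4)"
    using J by (intro char_Xf[OF r', of J "\<lambda>j. j"]) auto
  moreover have "Yf r \<omega> z = gs u \<omega>" for \<omega> by (simp add: Yf_def u_def)
  ultimately show ?thesis
    using char_gauss_weight[OF du dl a0_pos[OF r] Kd(1)[OF r z] uu] unfolding gl Q by (simp only: mult.assoc)
qed

end

section \<open>From conditional laws to the Palm formula\<close>

context iid_gauss_annulus
begin

definition Uf :: "real \<Rightarrow> complex \<Rightarrow> 'a \<Rightarrow> complex \<Rightarrow> complex" where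
  "Uf r z \<omega> = (\<lambda>w\<in>A. blaschke q z w * Xf (r * (norm z)\<^sup>2) \<omega> w)"

lemma r_norm_pos: "0 < r \<Longrightarrow> z \<in> A \<Longrightarrow> 0 < r * (norm z)\<^sup>2"
  using annulus_nonzero[OF q] by simp

lemma measurable_Uf:
  assumes r: "0 < r" and z: "z \<in> A" shows "Uf r z \<in> measurable M (hol_space A)"
  unfolding Uf_def
proof (rule measurable_hol_spaceI)
  fix w assume w: "w \<in> A"
  note [measurable] = measurable_Xf[OF r_norm_pos[OF r z] w]
  show "(\<lambda>\<omega>. blaschke q z w * Xf (r * (norm z)\<^sup>2) \<omega> w) \<in> borel_measurable M" by measurable
next
  show "(\<lambda>w. blaschke q z w * Xf (r * (norm z)\<^sup>2) \<omega> w) holomorphic_on A" for \<omega>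
    by (intro holomorphic_intros Xf_holomorphic r_norm_pos r z blaschke_holomorphic[OF q])
qed

lemma conditional_law:
  assumes r: "0 < r" and z: "z \<in> A" and F: "F \<in> borel_measurable (hol_space A)"
  shows "(\<integral>\<^sup>+\<omega>. ennreal (exp (- (norm (Yf r \<omega> z))\<^sup>2 / (a0 r)\<^sup>2)) * F (\<lambda>w\<in>A. Yf r \<omega> w - Yf r \<omega> z) \<partial>M) =
    ennreal ((a0 r)\<^sup>2 / Kd r z) * (\<integral>\<^sup>+\<omega>. F (Uf r z \<omega>) \<partial>M)"
proof -
  \<comment> \<open>The reciprocal of the total mass of the weight, as the empty linear form in
    \<open>conditional_char\<close> shows; it makes the weight a probability density, as
    \<open>hol_law_eq\<close> requires.\<close>
  define c where "c = Kd r z / (a0 r)\<^sup>2"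
  have c: "0 < c" unfolding c_def using Kd(1)[OF r z] a0_pos[OF r] by simp
  define W where "W \<omega> = c * exp (- (norm (Yf r \<omega> z))\<^sup>2 / (a0 r)\<^sup>2)" for \<omega>
  have W0: "0 \<le> W \<omega>" for \<omega> using c by (simp add: W_def)
  define N where "N = density M (\<lambda>\<omega>. ennreal (W \<omega>))"
  note [measurable] = measurable_Yf[OF r z]
  have mW [measurable]: "W \<in> borel_measurable M" unfolding W_def by measurable
  define Y where "Y \<omega> = (\<lambda>w\<in>A. Yf r \<omega> w - Yf r \<omega> z)" for \<omega>
  have mY: "Y \<in> measurable M (hol_space A)" unfolding Y_def
  proof (rule measurable_hol_spaceI)
    fix w assume w: "w \<in> A"
    note [measurable] = measurable_Yf[OF r w]
    show "(\<lambda>\<omega>. Yf r \<omega> w - Yf r \<omega> z) \<in> borel_measurable M" by measurable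
  next
    show "(\<lambda>w. Yf r \<omega> w - Yf r \<omega> z) holomorphic_on A" for \<omega> by (intro holomorphic_intros Yf_holomorphic r)
  qed
  have ch: "(CLINT \<omega>|M. of_real (W \<omega>) * iexp (Re (\<Sum>j\<in>J. d j * Y \<omega> j))) = (CLINT \<omega>|M. iexp (Re (\<Sum>j\<in>J. d j * Uf r z \<omega> j)))"
    if J: "finite J" "J \<subseteq> A" for J d
  proof -
    have e: "(\<Sum>j\<in>J. d j * Y \<omega> j) = (\<Sum>j\<in>J. d j * (Yf r \<omega> j - Yf r \<omega> z))"
      "(\<Sum>j\<in>J. d j * Uf r z \<omega> j) = (\<Sum>j\<in>J. d j * (blaschke q z j * Xf (r * (norm z)\<^sup>2) \<omega> j))" for \<omega>
      unfolding Y_def Uf_def using J by (auto intro!: sum.cong)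
    have "complex_of_real c * of_real ((a0 r)\<^sup>2 / Kd r z) = 1"
      unfolding of_real_mult[symmetric] c_def using Kd(1)[OF r z] a0_pos[OF r] by simp
    then show ?thesis
      unfolding e W_def of_real_mult mult.assoc integral_mult_right_zero conditional_char[OF r z J]
      by (simp add: mult.assoc[symmetric])
  qed
  have pN: "prob_space N"
  proof
    have "(CLINT \<omega>|M. of_real (W \<omega>)) = 1" using ch[of "{}"] prob_space by simp
    then have "(LINT \<omega>|M. W \<omega>) = 1" unfolding integral_complex_of_real by (metis of_real_eq_1_iff)
    moreover have "integrable M W"
    proof (rule integrable_const_bound[of _ c])
      show "AE \<omega> in M. norm (W \<omega>) \<le> c" using c by (simp add: W_def)
    qed (rule mW)
    ultimately have "(\<integral>\<^sup>+\<omega>. ennreal (W \<omega>) \<partial>M) = 1" using W0 by (subst nn_integral_eq_integral) simp_all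
    then show "emeasure N (space N) = 1" unfolding N_def by (subst emeasure_density) (simp_all add: nn_integral_set_ennreal)
  qed
  have "(\<integral>\<^sup>+\<omega>. F (Y \<omega>) \<partial>N) = (\<integral>\<^sup>+\<omega>. F (Uf r z \<omega>) \<partial>M)"
  proof (rule hol_law_eq[OF pN prob_space_axioms _ measurable_Uf[OF r z] _ F])
    show "Y \<in> measurable N (hol_space A)" using mY unfolding N_def by simp
    fix J :: "complex set" and d :: "complex \<Rightarrow> complex" assume J: "finite J" "J \<subseteq> A"
    have m: "(\<lambda>\<omega>. iexp (Re (\<Sum>j\<in>J. d j * Y \<omega> j))) \<in> borel_measurable M"
    proof (rule iexp_measurable, rule borel_measurable_sum)
      fix j assume "j \<in> J"
      note [measurable] = measurable_hol_space_component[OF mY subsetD[OF J(2) this]]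
      show "(\<lambda>\<omega>. d j * Y \<omega> j) \<in> borel_measurable M" by measurable
    qed
    have "(CLINT \<omega>|N. iexp (Re (\<Sum>j\<in>J. d j * Y \<omega> j))) = (CLINT \<omega>|M. W \<omega> *\<^sub>R iexp (Re (\<Sum>j\<in>J. d j * Y \<omega> j)))"
      unfolding N_def using W0 by (intro integral_density m mW) simp
    then show "(CLINT \<omega>|N. iexp (Re (\<Sum>j\<in>J. d j * Y \<omega> j))) = (CLINT \<omega>|M. iexp (Re (\<Sum>j\<in>J. d j * Uf r z \<omega> j)))"
      using ch[OF J, of d] by (simp only: scaleR_conv_of_real)
  qed
  moreover have FY: "(\<lambda>\<omega>. F (Y \<omega>)) \<in> borel_measurable M" by (rule measurable_compose[OF mY F])
  moreover have "(\<integral>\<^sup>+\<omega>. F (Y \<omega>) \<partial>N) = (\<integral>\<^sup>+\<omega>. ennreal (W \<omega>) * F (Y \<omega>) \<partial>M)"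
    unfolding N_def using FY by (intro nn_integral_density) measurable
  moreover have "(\<integral>\<^sup>+\<omega>. ennreal (W \<omega>) * F (Y \<omega>) \<partial>M) = ennreal c * (\<integral>\<^sup>+\<omega>. ennreal (exp (- (norm (Yf r \<omega> z))\<^sup>2 / (a0 r)\<^sup>2)) * F (Y \<omega>) \<partial>M)"
    using c FY unfolding W_def by (subst nn_integral_cmult[symmetric]) (auto simp: ennreal_mult mult.assoc)
  moreover have "ennreal ((a0 r)\<^sup>2 / Kd r z) * ennreal c = 1"
    unfolding c_def using Kd(1)[OF r z] a0_pos[OF r] by (subst ennreal_mult[symmetric]) simp_all
  ultimately have "(\<integral>\<^sup>+\<omega>. F (Uf r z \<omega>) \<partial>M) = ennreal c * (\<integral>\<^sup>+\<omega>. ennreal (exp (- (norm (Yf r \<omega> z))\<^sup>2 / (a0 r)\<^sup>2)) * F (Y \<omega>) \<partial>M)"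
    and 1: "ennreal ((a0 r)\<^sup>2 / Kd r z) * ennreal c = 1" by (simp_all only:)
  then show ?thesis unfolding Y_def[symmetric] by (simp only: mult.assoc[symmetric] 1 mult_1)
qed

lemma zeros_in_scale:
  assumes "c \<noteq> 0" "\<And>z. z \<in> S \<Longrightarrow> u z = c * v z" shows "zeros_in S u = zeros_in S v"
  using assms unfolding zeros_in_def by auto

text \<open>A zero z of a x + g determines x = - g z / a. There the whole function equals g - g z,
  and the integrand no longer involves x: what remains is a function of z alone, to which
  \<open>holomorphic_area_formula\<close> applies with T = - g / a.\<close>

lemma zeros_of_affine:
  fixes S :: "complex set"
  assumes a: "0 < a" and A: "open S" "connected S" and g: "g holomorphic_on S"
    and H: "(\<lambda>z. indicator S z * H z (\<lambda>w\<in>S. g w - g z)) \<in> borel_measurable borel"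
    and HX: "(\<lambda>x. \<integral>\<^sup>+z. H z (\<lambda>w\<in>S. of_real a * x + g w) \<partial>count_space (zeros_in S (\<lambda>w\<in>S. of_real a * x + g w))) \<in> borel_measurable borel"
  shows "(\<integral>\<^sup>+x. (\<integral>\<^sup>+z. H z (\<lambda>w\<in>S. of_real a * x + g w) \<partial>count_space (zeros_in S (\<lambda>w\<in>S. of_real a * x + g w))) \<partial>cgauss) =
    (\<integral>\<^sup>+z. indicator S z * (ennreal ((norm (deriv g z))\<^sup>2 / (pi * a\<^sup>2)) * (ennreal (exp (- (norm (g z))\<^sup>2 / a\<^sup>2)) * H z (\<lambda>w\<in>S. g w - g z))) \<partial>lborel)"
proof -
  define T where "T z = - g z / of_real a" for z
  have T: "T holomorphic_on S" unfolding T_def using a by (intro holomorphic_intros g) auto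
  define \<psi> where "\<psi> z = indicator S z * (ennreal (exp (- (norm (g z))\<^sup>2 / a\<^sup>2) / pi) * H z (\<lambda>w\<in>S. g w - g z))" for z
  have mS: "S \<in> sets borel" using A by simp
  have gm: "(\<lambda>z. indicator S z *\<^sub>R g z) \<in> borel_measurable borel"
    by (rule borel_measurable_continuous_on_indicator[OF mS holomorphic_on_imp_continuous_on[OF g]])
  have \<psi>m: "\<psi> \<in> borel_measurable borel"
  proof -
    have "\<psi> = (\<lambda>z. ennreal (exp (- (norm (indicator S z *\<^sub>R g z))\<^sup>2 / a\<^sup>2) / pi) * (indicator S z * H z (\<lambda>w\<in>S. g w - g z)))"
      unfolding \<psi>_def by (auto simp: indicator_def)
    also have "\<dots> \<in> borel_measurable borel" using gm H by measurable
    finally show ?thesis .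
  qed
  have z: "zeros_in S (\<lambda>w\<in>S. of_real a * x + g w) = zeros_in S (\<lambda>z. T z - x)" for x
    using a unfolding zeros_in_restrict by (intro zeros_in_scale[of "- of_real a"]) (auto simp: T_def field_simps)
  have p: "ennreal (exp (- (norm x)\<^sup>2) / pi) * (\<integral>\<^sup>+z. H z (\<lambda>w\<in>S. of_real a * x + g w) \<partial>count_space (zeros_in S (\<lambda>w\<in>S. of_real a * x + g w)))
    = (\<integral>\<^sup>+z. \<psi> z \<partial>count_space (zeros_in S (\<lambda>z. T z - x)))" for x
  proof -
    have "ennreal (exp (- (norm x)\<^sup>2) / pi) * (\<integral>\<^sup>+z. H z (\<lambda>w\<in>S. of_real a * x + g w) \<partial>count_space (zeros_in S (\<lambda>z. T z - x)))
      = (\<integral>\<^sup>+z. ennreal (exp (- (norm x)\<^sup>2) / pi) * H z (\<lambda>w\<in>S. of_real a * x + g w) \<partial>count_space (zeros_in S (\<lambda>z. T z - x)))"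
      by (rule nn_integral_cmult[symmetric]) simp
    also have "\<dots> = (\<integral>\<^sup>+z. \<psi> z \<partial>count_space (zeros_in S (\<lambda>z. T z - x)))"
    proof (intro nn_integral_cong)
      fix y assume "y \<in> space (count_space (zeros_in S (\<lambda>z. T z - x)))"
      then have y: "y \<in> S" "T y = x" using zeros_in_subset[of S "\<lambda>z. T z - x"] by auto
      have "- g y = of_real a * x" using y(2) a unfolding T_def by (auto simp: field_simps)
      then have gy: "g y = - of_real a * x" by (metis minus_minus mult_minus_left)
      then have "(norm (g y))\<^sup>2 / a\<^sup>2 = (norm x)\<^sup>2" using a by (simp add: norm_mult power_mult_distrib)
      moreover have "(\<lambda>w\<in>S. of_real a * x + g w) = (\<lambda>w\<in>S. g w - g y)" using gy by auto
      ultimately show "ennreal (exp (- (norm x)\<^sup>2) / pi) * H y (\<lambda>w\<in>S. of_real a * x + g w) = \<psi> y"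
        unfolding \<psi>_def using y(1) by simp
    qed
    finally show ?thesis unfolding z .
  qed
  have "(\<integral>\<^sup>+x. (\<integral>\<^sup>+z. H z (\<lambda>w\<in>S. of_real a * x + g w) \<partial>count_space (zeros_in S (\<lambda>w\<in>S. of_real a * x + g w))) \<partial>cgauss) =
    (\<integral>\<^sup>+x. (\<integral>\<^sup>+z. \<psi> z \<partial>count_space (zeros_in S (\<lambda>z. T z - x))) \<partial>lborel)"
    unfolding cgauss_def p[symmetric] using HX by (intro nn_integral_density) measurable
  also have "\<dots> = (\<integral>\<^sup>+z. ennreal ((norm (deriv T z))\<^sup>2) * \<psi> z * indicator S z \<partial>lborel)"
    by (rule holomorphic_area_formula[OF A T \<psi>m])
  also have "\<dots> = (\<integral>\<^sup>+z. indicator S z * (ennreal ((norm (deriv g z))\<^sup>2 / (pi * a\<^sup>2)) * (ennreal (exp (- (norm (g z))\<^sup>2 / a\<^sup>2)) * H z (\<lambda>w\<in>S. g w - g z))) \<partial>lborel)"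
  proof (intro nn_integral_cong)
    fix z :: complex
    show "ennreal ((norm (deriv T z))\<^sup>2) * \<psi> z * indicator S z =
      indicator S z * (ennreal ((norm (deriv g z))\<^sup>2 / (pi * a\<^sup>2)) * (ennreal (exp (- (norm (g z))\<^sup>2 / a\<^sup>2)) * H z (\<lambda>w\<in>S. g w - g z)))"
    proof (cases "z \<in> S")
      case True
      have "(g has_field_derivative deriv g z) (at z)" by (rule holomorphic_derivI[OF g A(1) True])
      then have "(T has_field_derivative - deriv g z / of_real a) (at z)" unfolding T_def using a by (auto intro!: derivative_eq_intros)
      then have d: "deriv T z = - deriv g z / of_real a" by (rule DERIV_imp_deriv)
      have "ennreal ((norm (deriv T z))\<^sup>2) * ennreal (exp (- (norm (g z))\<^sup>2 / a\<^sup>2) / pi) = ennreal ((norm (deriv g z))\<^sup>2 / (pi * a\<^sup>2)) * ennreal (exp (- (norm (g z))\<^sup>2 / a\<^sup>2))"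
        unfolding d by (simp add: ennreal_mult[symmetric] norm_divide power_divide mult.commute)
      then show ?thesis using True unfolding \<psi>_def by (simp add: mult.assoc[symmetric])
    qed simp
  qed
  finally show ?thesis .
qed

text \<open>For fixed values of the other coefficients, \<open>z\<close> is a zero iff \<open>\<zeta> 0\<close> takes the value \<open>- Yf r \<omega> z / a0 r\<close>; the area formula
  in \<open>\<zeta> 0\<close> then produces the Gaussian weight of the conditional law.\<close>

theorem palm_formula:
  assumes r: "0 < r" and H: "(\<lambda>(z, u). H z u) \<in> borel_measurable (borel \<Otimes>\<^sub>M hol_space A)"
  shows "(\<integral>\<^sup>+\<omega>. (\<integral>\<^sup>+z. H z (Xh r \<omega>) \<partial>count_space (zeros_in A (Xf r \<omega>))) \<partial>M) =
    (\<integral>\<^sup>+z. indicator A z * (ennreal (1 / (pi * Kd r z)) * (\<integral>\<^sup>+\<omega>. ennreal ((norm (deriv (Uf r z \<omega>) z))\<^sup>2) * H z (Uf r z \<omega>) \<partial>M)) \<partial>lborel)"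
proof -
  interpret C: prob_space cgauss by (rule prob_space_cgauss)
  interpret CM: pair_prob_space cgauss M ..
  interpret LM: pair_sigma_finite lborel M ..
  note A = A_open A_connected
  define G where "G u = (\<integral>\<^sup>+z. H z u \<partial>count_space (zeros_in A u))" for u
  have Gm: "G \<in> borel_measurable (hol_space A)" unfolding G_def
  proof (rule measurable_zero_sum[OF A measurable_ident_sets[OF refl]])
    have "(\<lambda>p. (snd p, fst p)) \<in> measurable (hol_space A \<Otimes>\<^sub>M borel) (borel \<Otimes>\<^sub>M hol_space A)" by measurable
    from measurable_compose[OF this H] show "(\<lambda>(u, z). H z u) \<in> borel_measurable (hol_space A \<Otimes>\<^sub>M borel)"
      by (simp add: case_prod_beta)
  qed
  have mV: "(\<lambda>p. \<lambda>w\<in>A. of_real (a0 r) * fst p + Yf r (snd p) w) \<in> measurable (cgauss \<Otimes>\<^sub>M M) (hol_space A)"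
  proof (rule measurable_hol_spaceI)
    fix z assume "z \<in> A"
    note [measurable] = measurable_Yf[OF r this]
    show "(\<lambda>p. of_real (a0 r) * fst p + Yf r (snd p) z) \<in> borel_measurable (cgauss \<Otimes>\<^sub>M M)" by measurable
  next
    show "(\<lambda>w. of_real (a0 r) * fst p + Yf r (snd p) w) holomorphic_on A" for p by (intro holomorphic_intros Yf_holomorphic r)
  qed
  define z0 where "z0 = complex_of_real (sqrt q)"
  have z0: "z0 \<in> A" unfolding z0_def by (rule sqrt_mem_annulus[OF q])
  \<comment> \<open>Points off the annulus are sent to one fixed point in it, so that
    \<open>measurable_hol_space_eval\<close> applies on the whole plane; the indicator of
    \<open>A\<close> removes the difference.\<close>
  define pr where "pr z = (if z \<in> A then z else z0)" for z
  have [measurable]: "A \<in> sets borel" using A by simp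
  have pr: "pr z \<in> A" for z unfolding pr_def using z0 by simp
  have prm [measurable]: "pr \<in> borel_measurable borel" unfolding pr_def by measurable
  have fm: "(\<lambda>p. pr (fst p)) \<in> borel_measurable (borel \<Otimes>\<^sub>M M)" by measurable
  have mY: "(\<lambda>p. \<lambda>w\<in>A. Yf r (snd p) w) \<in> measurable (borel \<Otimes>\<^sub>M M) (hol_space A)"
  proof (rule measurable_hol_spaceI)
    fix z assume "z \<in> A"
    note [measurable] = measurable_Yf[OF r this]
    show "(\<lambda>p. Yf r (snd p) z) \<in> borel_measurable (borel \<Otimes>\<^sub>M M)" by measurable
  qed (rule Yf_holomorphic[OF r])
  have m1: "(\<lambda>p. Yf r (snd p) (pr (fst p))) \<in> borel_measurable (borel \<Otimes>\<^sub>M M)"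
    using measurable_hol_space_eval[OF A(1) mY fm] pr by simp
  have m2: "(\<lambda>p. deriv (Yf r (snd p)) (pr (fst p))) \<in> borel_measurable (borel \<Otimes>\<^sub>M M)"
  proof -
    have "(\<lambda>p. (\<lambda>u. \<lambda>z\<in>A. deriv u z) (\<lambda>w\<in>A. Yf r (snd p) w)) \<in> measurable (borel \<Otimes>\<^sub>M M) (hol_space A)"
      by (rule measurable_compose[OF mY measurable_hol_space_deriv[OF A(1)]])
    from measurable_hol_space_eval[OF A(1) this fm] show ?thesis using pr by (simp add: deriv_restrict[OF A(1)])
  qed
  have mD: "(\<lambda>p. (fst p, \<lambda>w\<in>A. Yf r (snd p) w - Yf r (snd p) (pr (fst p)))) \<in> measurable (borel \<Otimes>\<^sub>M M) (borel \<Otimes>\<^sub>M hol_space A)"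
  proof (rule measurable_Pair[OF measurable_fst], rule measurable_hol_spaceI)
    fix z assume "z \<in> A"
    note [measurable] = measurable_Yf[OF r this] m1
    show "(\<lambda>p. Yf r (snd p) z - Yf r (snd p) (pr (fst p))) \<in> borel_measurable (borel \<Otimes>\<^sub>M M)" by measurable
  next
    show "(\<lambda>w. Yf r (snd p) w - Yf r (snd p) (pr (fst p))) holomorphic_on A" for p by (intro holomorphic_intros Yf_holomorphic[OF r])
  qed
  have m3: "(\<lambda>p. H (fst p) (\<lambda>w\<in>A. Yf r (snd p) w - Yf r (snd p) (pr (fst p)))) \<in> borel_measurable (borel \<Otimes>\<^sub>M M)"
    using measurable_compose[OF mD H] by simp
  define \<Phi> where "\<Phi> z \<omega> = indicator A z * (ennreal ((norm (deriv (Yf r \<omega>) z))\<^sup>2 / (pi * (a0 r)\<^sup>2)) *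
     (ennreal (exp (- (norm (Yf r \<omega> z))\<^sup>2 / (a0 r)\<^sup>2)) * H z (\<lambda>w\<in>A. Yf r \<omega> w - Yf r \<omega> z)))" for z \<omega>
  have mB: "(\<lambda>p. \<Phi> (fst p) (snd p)) \<in> borel_measurable (borel \<Otimes>\<^sub>M M)"
  proof -
    have "(\<lambda>p. \<Phi> (fst p) (snd p)) = (\<lambda>p. indicator A (fst p) * (ennreal ((norm (deriv (Yf r (snd p)) (pr (fst p))))\<^sup>2 / (pi * (a0 r)\<^sup>2)) *
     (ennreal (exp (- (norm (Yf r (snd p) (pr (fst p))))\<^sup>2 / (a0 r)\<^sup>2)) * H (fst p) (\<lambda>w\<in>A. Yf r (snd p) w - Yf r (snd p) (pr (fst p))))))"
      unfolding \<Phi>_def pr_def by (auto simp: indicator_def)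
    also have "\<dots> \<in> borel_measurable (borel \<Otimes>\<^sub>M M)" using m1 m2 m3 by measurable
    finally show ?thesis .
  qed
  then have mBl: "(\<lambda>(z, \<omega>). \<Phi> z \<omega>) \<in> borel_measurable (lborel \<Otimes>\<^sub>M M)"
    by (simp add: case_prod_beta cong: measurable_cong_sets)
  have "(\<integral>\<^sup>+\<omega>. (\<integral>\<^sup>+z. H z (Xh r \<omega>) \<partial>count_space (zeros_in A (Xf r \<omega>))) \<partial>M) = (\<integral>\<^sup>+\<omega>. G (Xh r \<omega>) \<partial>M)"
    unfolding G_def by (simp add: Xh_def)
  also have "\<dots> = (\<integral>\<^sup>+p. G (\<lambda>w\<in>A. of_real (a0 r) * fst p + Yf r (snd p) w) \<partial>(cgauss \<Otimes>\<^sub>M M))"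
    by (rule split_law[OF r Gm])
  also have "\<dots> = (\<integral>\<^sup>+\<omega>. (\<integral>\<^sup>+x. G (\<lambda>w\<in>A. of_real (a0 r) * x + Yf r \<omega> w) \<partial>cgauss) \<partial>M)"
    using CM.nn_integral_snd[OF measurable_compose[OF mV Gm]] by (simp only: fst_conv snd_conv)
  also have "\<dots> = (\<integral>\<^sup>+\<omega>. (\<integral>\<^sup>+z. \<Phi> z \<omega> \<partial>lborel) \<partial>M)"
  proof (intro nn_integral_cong)
    fix \<omega> assume \<omega>: "\<omega> \<in> space M"
    show "(\<integral>\<^sup>+x. G (\<lambda>w\<in>A. of_real (a0 r) * x + Yf r \<omega> w) \<partial>cgauss) = (\<integral>\<^sup>+z. \<Phi> z \<omega> \<partial>lborel)"
      unfolding G_def \<Phi>_def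
    proof (rule zeros_of_affine[OF a0_pos[OF r] A Yf_holomorphic[OF r]])
      have "(\<lambda>x. (x, \<omega>)) \<in> measurable borel (borel \<Otimes>\<^sub>M M)" using \<omega> by measurable
      from measurable_compose[OF this m3]
      have [measurable]: "(\<lambda>z. H z (\<lambda>w\<in>A. Yf r \<omega> w - Yf r \<omega> (pr z))) \<in> borel_measurable borel" by simp
      have "(\<lambda>z. indicator A z * H z (\<lambda>w\<in>A. Yf r \<omega> w - Yf r \<omega> z)) = (\<lambda>z. indicator A z * H z (\<lambda>w\<in>A. Yf r \<omega> w - Yf r \<omega> (pr z)))"
        unfolding pr_def by (auto simp: indicator_def)
      also have "\<dots> \<in> borel_measurable borel" by measurable
      finally show "(\<lambda>z. indicator A z * H z (\<lambda>w\<in>A. Yf r \<omega> w - Yf r \<omega> z)) \<in> borel_measurable borel" .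
      have "(\<lambda>x. (x, \<omega>)) \<in> measurable borel (cgauss \<Otimes>\<^sub>M M)" using \<omega> by measurable
      from measurable_compose[OF this measurable_compose[OF mV Gm]]
      show "(\<lambda>x. \<integral>\<^sup>+z. H z (\<lambda>w\<in>A. of_real (a0 r) * x + Yf r \<omega> w) \<partial>count_space (zeros_in A (\<lambda>w\<in>A. of_real (a0 r) * x + Yf r \<omega> w))) \<in> borel_measurable borel"
        unfolding G_def by simp
    qed
  qed
  also have "\<dots> = (\<integral>\<^sup>+z. (\<integral>\<^sup>+\<omega>. \<Phi> z \<omega> \<partial>M) \<partial>lborel)"
    by (rule LM.Fubini'[OF mBl])
  also have "\<dots> = (\<integral>\<^sup>+z. indicator A z * (ennreal (1 / (pi * Kd r z)) * (\<integral>\<^sup>+\<omega>. ennreal ((norm (deriv (Uf r z \<omega>) z))\<^sup>2) * H z (Uf r z \<omega>) \<partial>M)) \<partial>lborel)"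
  proof (intro nn_integral_cong)
    fix z :: complex
    show "(\<integral>\<^sup>+\<omega>. \<Phi> z \<omega> \<partial>M) = indicator A z * (ennreal (1 / (pi * Kd r z)) * (\<integral>\<^sup>+\<omega>. ennreal ((norm (deriv (Uf r z \<omega>) z))\<^sup>2) * H z (Uf r z \<omega>) \<partial>M))"
    proof (cases "z \<in> A")
      case True
      note z = True
      define F where "F u = ennreal ((norm (deriv u z))\<^sup>2) * H z u" for u
      have Fm: "F \<in> borel_measurable (hol_space A)"
      proof -
        have "(\<lambda>u. (\<lambda>w\<in>A. deriv u w) z) \<in> borel_measurable (hol_space A)"
          by (rule measurable_hol_space_component[OF measurable_hol_space_deriv[OF A(1)] z])
        then have [measurable]: "(\<lambda>u. deriv u z) \<in> borel_measurable (hol_space A)" using z by simp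
        have "(\<lambda>u. (z, u)) \<in> measurable (hol_space A) (borel \<Otimes>\<^sub>M hol_space A)" by measurable
        from measurable_compose[OF this H] have [measurable]: "H z \<in> borel_measurable (hol_space A)" by simp
        show ?thesis unfolding F_def by measurable
      qed
      have a: "0 < a0 r" "0 < Kd r z" by (rule a0_pos[OF r], rule Kd(1)[OF r z])
      have D: "deriv (\<lambda>w\<in>A. Yf r \<omega> w - Yf r \<omega> z) z = deriv (Yf r \<omega>) z" for \<omega>
      proof -
        have "(Yf r \<omega> has_field_derivative deriv (Yf r \<omega>) z) (at z)" by (rule holomorphic_derivI[OF Yf_holomorphic[OF r] A(1) z])
        then have "((\<lambda>w. Yf r \<omega> w - Yf r \<omega> z) has_field_derivative deriv (Yf r \<omega>) z) (at z)" by (auto intro!: derivative_eq_intros)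
        then show ?thesis unfolding deriv_restrict[OF A(1) z] by (rule DERIV_imp_deriv)
      qed
      have "\<Phi> z \<omega> = ennreal (1 / (pi * (a0 r)\<^sup>2)) * (ennreal (exp (- (norm (Yf r \<omega> z))\<^sup>2 / (a0 r)\<^sup>2)) * F (\<lambda>w\<in>A. Yf r \<omega> w - Yf r \<omega> z))" for \<omega>
      proof -
        have "ennreal ((norm (deriv (Yf r \<omega>) z))\<^sup>2 / (pi * (a0 r)\<^sup>2)) = ennreal (1 / (pi * (a0 r)\<^sup>2)) * ennreal ((norm (deriv (Yf r \<omega>) z))\<^sup>2)"
          by (subst ennreal_mult[symmetric]) simp_all
        then show ?thesis unfolding \<Phi>_def F_def D using z by (simp add: mult_ac)
      qed
      then have "(\<integral>\<^sup>+\<omega>. \<Phi> z \<omega> \<partial>M) = (\<integral>\<^sup>+\<omega>. ennreal (1 / (pi * (a0 r)\<^sup>2)) * (ennreal (exp (- (norm (Yf r \<omega> z))\<^sup>2 / (a0 r)\<^sup>2)) * F (\<lambda>w\<in>A. Yf r \<omega> w - Yf r \<omega> z)) \<partial>M)"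
        by simp
      also have "\<dots> = ennreal (1 / (pi * (a0 r)\<^sup>2)) * (\<integral>\<^sup>+\<omega>. ennreal (exp (- (norm (Yf r \<omega> z))\<^sup>2 / (a0 r)\<^sup>2)) * F (\<lambda>w\<in>A. Yf r \<omega> w - Yf r \<omega> z) \<partial>M)"
      proof (rule nn_integral_cmult)
        have "(\<lambda>\<omega>. \<lambda>w\<in>A. Yf r \<omega> w - Yf r \<omega> z) \<in> measurable M (hol_space A)"
        proof (rule measurable_hol_spaceI)
          fix w assume w: "w \<in> A"
          note [measurable] = measurable_Yf[OF r w] measurable_Yf[OF r z]
          show "(\<lambda>\<omega>. Yf r \<omega> w - Yf r \<omega> z) \<in> borel_measurable M" by measurable
        next
          show "(\<lambda>w. Yf r \<omega> w - Yf r \<omega> z) holomorphic_on A" for \<omega> by (intro holomorphic_intros Yf_holomorphic[OF r])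
        qed
        note [measurable] = measurable_compose[OF this Fm] measurable_Yf[OF r z]
        show "(\<lambda>\<omega>. ennreal (exp (- (norm (Yf r \<omega> z))\<^sup>2 / (a0 r)\<^sup>2)) * F (\<lambda>w\<in>A. Yf r \<omega> w - Yf r \<omega> z)) \<in> borel_measurable M" by measurable
      qed
      also have "\<dots> = ennreal (1 / (pi * (a0 r)\<^sup>2)) * (ennreal ((a0 r)\<^sup>2 / Kd r z) * (\<integral>\<^sup>+\<omega>. F (Uf r z \<omega>) \<partial>M))"
        unfolding conditional_law[OF r z Fm] ..
      also have "\<dots> = ennreal (1 / (pi * Kd r z)) * (\<integral>\<^sup>+\<omega>. F (Uf r z \<omega>) \<partial>M)"
      proof -
        have "ennreal (1 / (pi * (a0 r)\<^sup>2)) * ennreal ((a0 r)\<^sup>2 / Kd r z) = ennreal (1 / (pi * Kd r z))"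
          using a by (subst ennreal_mult[symmetric]) simp_all
        then show ?thesis by (simp only: mult.assoc[symmetric])
      qed
      finally show ?thesis using z unfolding F_def by simp
    qed (simp add: \<Phi>_def)
  qed
  finally show ?thesis .
qed

text \<open>The Blaschke factor vanishes at z, so the derivative of the process does not enter. The
  squared derivative in the Palm formula becomes, up to a deterministic factor, |X|^2 at z for the
  new parameter; these squares accumulate to the moment that yields the permanent.\<close>

lemma deriv_Uf:
  assumes r: "0 < r" and z: "z \<in> A"
  shows "deriv (Uf r z \<omega>) z = deriv (blaschke q z) z * Xf (r * (norm z)\<^sup>2) \<omega> z"
proof -
  have "(blaschke q z has_field_derivative deriv (blaschke q z) z) (at z)"
    by (rule holomorphic_derivI[OF blaschke_holomorphic[OF q z] A_open z])
  moreover have "(Xf (r * (norm z)\<^sup>2) \<omega> has_field_derivative deriv (Xf (r * (norm z)\<^sup>2) \<omega>) z) (at z)"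
    by (rule holomorphic_derivI[OF Xf_holomorphic[OF r_norm_pos[OF r z]] A_open z])
  ultimately have "((\<lambda>w. blaschke q z w * Xf (r * (norm z)\<^sup>2) \<omega> w) has_field_derivative
    deriv (blaschke q z) z * Xf (r * (norm z)\<^sup>2) \<omega> z + deriv (Xf (r * (norm z)\<^sup>2) \<omega>) z * blaschke q z z) (at z)" by (rule DERIV_mult)
  then show ?thesis unfolding Uf_def deriv_restrict[OF A_open z] blaschke_self[OF q z] by (simp add: DERIV_imp_deriv)
qed

end

section \<open>Gaussian moments and permanents\<close>

lemma measurable_cnj [measurable]: "cnj \<in> borel_measurable borel"
  by (intro borel_measurable_continuous_onI continuous_on_cnj continuous_on_id)

text \<open>The substitution of sqrt \<kappa> * z. The parameter \<kappa> is integrated over in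
  \<open>nn_integral_norm_power_cgauss\<close> to raise the exponent.\<close>

lemma nn_integral_norm_power_scaled:
  assumes \<kappa>: "0 < \<kappa>"
  shows "(\<integral>\<^sup>+z. ennreal (norm z ^ (2 * a) * exp (- \<kappa> * (norm z)\<^sup>2) / pi) \<partial>(lborel :: complex measure)) =
    ennreal (1 / \<kappa> ^ Suc a) * (\<integral>\<^sup>+z. ennreal (norm z ^ (2 * a)) \<partial>cgauss)"
proof -
  define \<psi> where "\<psi> z = ennreal (norm z ^ (2 * a) * exp (- \<kappa> * (norm z)\<^sup>2) / pi)" for z :: complex
  define c where "c = complex_of_real (sqrt \<kappa>)"
  have c: "c \<noteq> 0" "(norm c)\<^sup>2 = \<kappa>" using \<kappa> by (simp_all add: c_def)
  have [measurable]: "\<psi> \<in> borel_measurable borel" unfolding \<psi>_def by measurable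
  have im: "(\<lambda>z. c * z) ` UNIV = UNIV" using c by (intro surjI[of _ "\<lambda>w. w / c"]) simp
  have d: "deriv (\<lambda>z. c * z) z = c" for z by (rule DERIV_imp_deriv) (auto intro!: derivative_eq_intros)
  have sub: "(\<integral>\<^sup>+w. \<psi> (w / c) * indicator ((\<lambda>z. c * z) ` UNIV) w \<partial>lborel) = (\<integral>\<^sup>+z. ennreal ((norm (deriv (\<lambda>z. c * z) z))\<^sup>2) * \<psi> z * indicator UNIV z \<partial>lborel)"
    using c by (intro nn_integral_holomorphic_injective(1)) (auto intro!: holomorphic_intros injI)
  have "\<psi> (w / c) = ennreal (1 / \<kappa> ^ a) * (ennreal (exp (- (norm w)\<^sup>2) / pi) * ennreal (norm w ^ (2 * a)))" for w
  proof -
    have 1: "norm (w / c) ^ (2 * a) = norm w ^ (2 * a) / \<kappa> ^ a" unfolding norm_divide power_divide power_mult c(2) ..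
    have 2: "\<kappa> * (norm (w / c))\<^sup>2 = (norm w)\<^sup>2" using \<kappa> unfolding norm_divide power_divide c(2) by simp
    show ?thesis unfolding \<psi>_def minus_mult_left[symmetric] 1 2 using \<kappa> by (simp add: ennreal_mult[symmetric] mult_ac)
  qed
  then have L: "(\<integral>\<^sup>+w. \<psi> (w / c) \<partial>lborel) = ennreal (1 / \<kappa> ^ a) * (\<integral>\<^sup>+z. ennreal (norm z ^ (2 * a)) \<partial>cgauss)"
    unfolding cgauss_def by (subst nn_integral_density) (simp_all add: nn_integral_cmult)
  have "ennreal \<kappa> * (\<integral>\<^sup>+z. \<psi> z \<partial>lborel) = ennreal (1 / \<kappa> ^ a) * (\<integral>\<^sup>+z. ennreal (norm z ^ (2 * a)) \<partial>cgauss)"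
    using sub unfolding im d c(2) L[symmetric] by (simp add: nn_integral_cmult)
  then have "ennreal (1 / \<kappa>) * (ennreal \<kappa> * (\<integral>\<^sup>+z. \<psi> z \<partial>lborel)) = ennreal (1 / \<kappa>) * (ennreal (1 / \<kappa> ^ a) * (\<integral>\<^sup>+z. ennreal (norm z ^ (2 * a)) \<partial>cgauss))"
    by simp
  moreover have "ennreal (1 / \<kappa>) * ennreal \<kappa> = 1" "ennreal (1 / \<kappa>) * ennreal (1 / \<kappa> ^ a) = ennreal (1 / \<kappa> ^ Suc a)"
    using \<kappa> by (simp_all add: ennreal_mult[symmetric])
  ultimately show ?thesis unfolding \<psi>_def[symmetric] by (simp only: mult.assoc[symmetric] mult_1)
qed

lemma nn_integral_exp_ge_1:
  assumes "0 < c" shows "(\<integral>\<^sup>+\<kappa>. ennreal (c * exp (- \<kappa> * c)) * indicator {1..} \<kappa> \<partial>lborel) = ennreal (exp (- c))"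
proof -
  have "(\<integral>\<^sup>+\<kappa>. ennreal (c * exp (- \<kappa> * c)) * indicator {1..} \<kappa> \<partial>lborel) = ennreal (0 - (- exp (- 1 * c)))"
  proof (rule nn_integral_FTC_atLeast)
    show "((\<lambda>\<kappa>. - exp (- \<kappa> * c)) has_real_derivative c * exp (- \<kappa> * c)) (at \<kappa>)" for \<kappa> by (auto intro!: derivative_eq_intros)
    show "((\<lambda>\<kappa>. - exp (- \<kappa> * c)) \<longlongrightarrow> 0) at_top" using assms by real_asymp
  qed (use assms in auto)
  then show ?thesis by simp
qed

lemma nn_integral_power_ge_1:
  "(\<integral>\<^sup>+\<kappa>. ennreal (1 / \<kappa> ^ Suc (Suc a)) * indicator {1..} \<kappa> \<partial>lborel) = ennreal (1 / real (Suc a))"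
proof -
  have "(\<integral>\<^sup>+\<kappa>. ennreal (1 / \<kappa> ^ Suc (Suc a)) * indicator {1..} \<kappa> \<partial>lborel) = ennreal (0 - (- 1 / (real (Suc a) * 1 ^ Suc a)))"
  proof (rule nn_integral_FTC_atLeast[where F = "\<lambda>\<kappa>. - 1 / (real (Suc a) * \<kappa> ^ Suc a)"])
    fix \<kappa> :: real assume "1 \<le> \<kappa>"
    then have k: "\<kappa> \<noteq> 0" by simp
    have "((\<lambda>\<kappa>. \<kappa> ^ Suc a) has_real_derivative real (Suc a) * \<kappa> ^ a) (at \<kappa>)" using DERIV_pow[of "Suc a" \<kappa> UNIV] by simp
    then have "((\<lambda>\<kappa>. inverse (\<kappa> ^ Suc a)) has_real_derivative - (inverse (\<kappa> ^ Suc a) * (real (Suc a) * \<kappa> ^ a) * inverse (\<kappa> ^ Suc a))) (at \<kappa>)"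
      using k by (intro DERIV_inverse') simp_all
    note D = DERIV_cmult[OF this, of "- 1 / real (Suc a)"]
    have "- 1 / N * - (inverse (\<kappa> ^ Suc a) * (N * \<kappa> ^ a) * inverse (\<kappa> ^ Suc a)) = 1 / \<kappa> ^ Suc (Suc a)" if "N \<noteq> 0" for N :: real
      using k that by (simp add: field_simps)
    from this[of "real (Suc a)"]
    have "- 1 / real (Suc a) * - (inverse (\<kappa> ^ Suc a) * (real (Suc a) * \<kappa> ^ a) * inverse (\<kappa> ^ Suc a)) = 1 / \<kappa> ^ Suc (Suc a)" by linarith
    moreover have "- 1 / real (Suc a) * inverse (x ^ Suc a) = - 1 / (real (Suc a) * x ^ Suc a)" for x :: real
      by (simp add: divide_inverse del: of_nat_Suc power_Suc)
    ultimately show "((\<lambda>\<kappa>. - 1 / (real (Suc a) * \<kappa> ^ Suc a)) has_real_derivative 1 / \<kappa> ^ Suc (Suc a)) (at \<kappa>)"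
      using D by (simp only:)
  next
    show "((\<lambda>\<kappa>. - 1 / (real (Suc a) * \<kappa> ^ Suc a)) \<longlongrightarrow> 0) at_top"
    proof -
      have "((\<lambda>\<kappa>::real. inverse (\<kappa> ^ Suc a)) \<longlongrightarrow> 0) at_top"
        by (intro tendsto_inverse_0_at_top filterlim_pow_at_top filterlim_ident) simp
      from tendsto_mult_right_zero[OF this, of "- 1 / real (Suc a)"]
      show ?thesis by (simp add: divide_inverse mult.assoc[symmetric] del: of_nat_Suc power_Suc)
    qed
  qed auto
  then show ?thesis by simp
qed

text \<open>For nonzero z, exp (-|z|^2) is the integral of |z|^2 exp (- \<kappa> |z|^2) over
  \<kappa> \<ge> 1. Inserting this into the moment for a and exchanging the integrals gives the
  moment for a + 1 times the integral of \<kappa>^(-a-2), which is 1 / (a + 1).\<close>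

lemma nn_integral_norm_power_cgauss: "(\<integral>\<^sup>+z. ennreal (norm z ^ (2 * a)) \<partial>cgauss) = ennreal (fact a)"
proof (induction a)
  case 0
  interpret C: prob_space cgauss by (rule prob_space_cgauss)
  show ?case using C.emeasure_space_1 by simp
next
  case (Suc a)
  define f where "f z \<kappa> = ennreal (norm z ^ (2 * Suc a) * exp (- \<kappa> * (norm z)\<^sup>2) / pi) * indicator {1..} \<kappa>" for z :: complex and \<kappa> :: real
  define X where "X = (\<integral>\<^sup>+z. ennreal (norm z ^ (2 * Suc a)) \<partial>cgauss)"
  have "ennreal (fact a) = (\<integral>\<^sup>+z. ennreal (exp (- (norm z)\<^sup>2) / pi) * ennreal (norm z ^ (2 * a)) \<partial>(lborel :: complex measure))"
    unfolding Suc.IH[symmetric] cgauss_def by (subst nn_integral_density) simp_all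
  also have "\<dots> = (\<integral>\<^sup>+z. (\<integral>\<^sup>+\<kappa>. f z \<kappa> \<partial>lborel) \<partial>lborel)"
  proof (rule nn_integral_cong_AE)
    have "AE z in (lborel :: complex measure). z \<noteq> 0" by (rule AE_lborel_singleton)
    then show "AE z in lborel. ennreal (exp (- (norm z)\<^sup>2) / pi) * ennreal (norm z ^ (2 * a)) = (\<integral>\<^sup>+\<kappa>. f z \<kappa> \<partial>lborel)"
    proof eventually_elim
      fix z :: complex assume z: "z \<noteq> 0"
      have "f z \<kappa> = ennreal (norm z ^ (2 * a) / pi) * (ennreal ((norm z)\<^sup>2 * exp (- \<kappa> * (norm z)\<^sup>2)) * indicator {1..} \<kappa>)" for \<kappa>
      proof -
        have "ennreal (norm z ^ (2 * Suc a) * exp (- \<kappa> * (norm z)\<^sup>2) / pi) = ennreal (norm z ^ (2 * a) / pi) * ennreal ((norm z)\<^sup>2 * exp (- \<kappa> * (norm z)\<^sup>2))"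
          by (subst ennreal_mult[symmetric]) (simp_all add: power_add power2_eq_square)
        then show ?thesis unfolding f_def by (simp add: mult.assoc)
      qed
      then have "(\<integral>\<^sup>+\<kappa>. f z \<kappa> \<partial>lborel) = ennreal (norm z ^ (2 * a) / pi) * ennreal (exp (- (norm z)\<^sup>2))"
        using nn_integral_exp_ge_1[of "(norm z)\<^sup>2"] z by (simp add: nn_integral_cmult)
      also have "\<dots> = ennreal (exp (- (norm z)\<^sup>2) / pi) * ennreal (norm z ^ (2 * a))"
        by (simp add: ennreal_mult[symmetric] mult_ac)
      finally show "ennreal (exp (- (norm z)\<^sup>2) / pi) * ennreal (norm z ^ (2 * a)) = (\<integral>\<^sup>+\<kappa>. f z \<kappa> \<partial>lborel)" by (rule sym)
    qed
  qed
  also have "\<dots> = (\<integral>\<^sup>+\<kappa>. (\<integral>\<^sup>+z. f z \<kappa> \<partial>lborel) \<partial>lborel)"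
  proof (rule lborel_pair.Fubini'[symmetric])
    show "(\<lambda>(z, \<kappa>). f z \<kappa>) \<in> borel_measurable (lborel \<Otimes>\<^sub>M lborel)"
      unfolding f_def case_prod_beta by measurable
  qed
  also have "\<dots> = (\<integral>\<^sup>+\<kappa>. X * (ennreal (1 / \<kappa> ^ Suc (Suc a)) * indicator {1..} \<kappa>) \<partial>lborel)"
  proof (intro nn_integral_cong)
    fix \<kappa> :: real
    show "(\<integral>\<^sup>+z. f z \<kappa> \<partial>lborel) = X * (ennreal (1 / \<kappa> ^ Suc (Suc a)) * indicator {1..} \<kappa>)"
    proof (cases "1 \<le> \<kappa>")
      case True
      then show ?thesis unfolding f_def X_def using nn_integral_norm_power_scaled[of \<kappa> "Suc a"] by (simp add: mult.commute)
    qed (simp add: f_def)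
  qed
  also have "\<dots> = X * ennreal (1 / real (Suc a))"
    by (subst nn_integral_cmult) (simp_all only: nn_integral_power_ge_1, measurable)
  finally have "ennreal (fact a) * ennreal (real (Suc a)) = X * (ennreal (1 / real (Suc a)) * ennreal (real (Suc a)))"
    by (simp only: mult.assoc)
  also have "ennreal (1 / real (Suc a)) * ennreal (real (Suc a)) = 1"
    by (subst ennreal_mult[symmetric]) (simp_all del: of_nat_Suc)
  finally have "X = ennreal (fact a) * ennreal (real (Suc a))" by simp
  also have "\<dots> = ennreal (fact (Suc a))" by (subst ennreal_mult[symmetric]) (simp_all add: mult.commute)
  finally show ?case unfolding X_def .
qed

lemma integrable_norm_power_cgauss: "integrable cgauss (\<lambda>z. norm z ^ (2 * a))"
  by (rule integrableI_nonneg) (simp_all add: nn_integral_norm_power_cgauss)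

lemma norm_power_add_le: "norm z ^ (a + b) \<le> norm z ^ (2 * a) + norm z ^ (2 * b)"
proof -
  have "2 * (norm z ^ a * norm z ^ b) \<le> (norm z ^ a)\<^sup>2 + (norm z ^ b)\<^sup>2" by (rule sum_squares_bound[unfolded mult.assoc])
  moreover have "0 \<le> norm z ^ a * norm z ^ b" by simp
  moreover have "(norm z ^ a)\<^sup>2 = norm z ^ (2 * a)" "(norm z ^ b)\<^sup>2 = norm z ^ (2 * b)"
    by (simp_all add: power_mult[symmetric] mult.commute)
  ultimately show ?thesis unfolding power_add by linarith
qed

lemma integrable_cgauss_monomial: "integrable cgauss (\<lambda>z. z ^ a * cnj (z ^ b))"
proof (rule Bochner_Integration.integrable_bound)
  show "integrable cgauss (\<lambda>z. norm z ^ (2 * a) + norm z ^ (2 * b))"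
    by (intro Bochner_Integration.integrable_add integrable_norm_power_cgauss)
  show "(\<lambda>z. z ^ a * cnj (z ^ b)) \<in> borel_measurable cgauss" by measurable
  show "AE z in cgauss. norm (z ^ a * cnj (z ^ b)) \<le> norm (norm z ^ (2 * a) + norm z ^ (2 * b))"
  proof (intro AE_I2)
    fix z :: complex
    have "norm (z ^ a * cnj (z ^ b)) = norm z ^ (a + b)" by (simp add: norm_mult norm_power power_add)
    then show "norm (z ^ a * cnj (z ^ b)) \<le> norm (norm z ^ (2 * a) + norm z ^ (2 * b))"
      using norm_power_add_le[of z a b] by simp
  qed
qed

text \<open>The characteristic function depends only on the modulus of its argument; a one-point
  index set brings the uniqueness theorem for processes to bear on a single variable.\<close>

lemma integral_cgauss_rotate:
  fixes f :: "complex \<Rightarrow> complex"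
  assumes c: "norm c = 1" and [measurable]: "f \<in> borel_measurable borel"
  shows "(CLINT z|cgauss. f (c * z)) = (CLINT z|cgauss. f z)"
proof -
  let ?P = "PiM {()} (\<lambda>_. borel) :: (unit \<Rightarrow> complex) measure"
  have law: "distr cgauss ?P (\<lambda>x. \<lambda>i\<in>{()}. c * x) = distr cgauss ?P (\<lambda>x. \<lambda>i\<in>{()}. x)"
  proof (rule complex_process_law_unique[OF prob_space_cgauss prob_space_cgauss])
    fix J :: "unit set" and d :: "unit \<Rightarrow> complex"
    have "(\<Sum>j\<in>J. d j * (c * x)) = ((\<Sum>j\<in>J. d j) * c) * x" "(\<Sum>j\<in>J. d j * x) = (\<Sum>j\<in>J. d j) * x" for x
      by (simp_all add: sum_distrib_right mult.assoc)
    then show "(CLINT x|cgauss. iexp (Re (\<Sum>j\<in>J. d j * (c * x)))) = (CLINT x|cgauss. iexp (Re (\<Sum>j\<in>J. d j * x)))"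
      by (simp only: char_cgauss norm_mult c mult_1_right)
  qed simp_all
  have m: "(\<lambda>u. f (u ())) \<in> borel_measurable ?P" by measurable
  have "(CLINT z|cgauss. f (c * z)) = (CLINT u|distr cgauss ?P (\<lambda>x. \<lambda>i\<in>{()}. c * x). f (u ()))"
    using m by (subst integral_distr) (simp_all, measurable)
  also have "\<dots> = (CLINT z|cgauss. f z)"
    unfolding law using m by (subst integral_distr) (simp_all, measurable)
  finally show ?thesis .
qed

lemma integral_cgauss_monomial: "(CLINT z|cgauss. z ^ a * cnj (z ^ b)) = (if a = b then fact a else 0)"
proof (cases "a = b")
  case True
  have "z ^ a * cnj (z ^ a) = of_real (norm z ^ (2 * a))" for z :: complex
    unfolding complex_norm_square[symmetric] by (simp add: norm_power power_mult[symmetric] mult.commute)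
  moreover have "(LINT z|cgauss. norm z ^ (2 * a)) = fact a"
    by (subst integral_eq_nn_integral) (simp_all add: nn_integral_norm_power_cgauss)
  ultimately show ?thesis using True by (simp add: integral_complex_of_real del: of_real_power)
next
  case False
  \<comment> \<open>Rotation by this angle multiplies the monomial by -1, so its integral equals its
    own negative.\<close>
  define t where "t = pi / (real a - real b)"
  define c where "c = cis t"
  have c: "norm c = 1" by (simp add: c_def)
  have "c ^ a * cnj (c ^ b) = cis (real a * t) * cis (- (real b * t))"
    unfolding c_def Complex.DeMoivre by (simp add: cis_cnj)
  also have "\<dots> = cis ((real a - real b) * t)" by (simp add: cis_mult left_diff_distrib)
  also have "\<dots> = -1" using False by (simp add: t_def)
  finally have m: "c ^ a * cnj (c ^ b) = -1" .
  have "(CLINT z|cgauss. z ^ a * cnj (z ^ b)) = (CLINT z|cgauss. (c * z) ^ a * cnj ((c * z) ^ b))"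
    by (rule integral_cgauss_rotate[OF c, symmetric]) measurable
  also have "\<dots> = (CLINT z|cgauss. -1 * (z ^ a * cnj (z ^ b)))"
    unfolding m[symmetric] by (simp add: power_mult_distrib mult_ac)
  also have "\<dots> = - (CLINT z|cgauss. z ^ a * cnj (z ^ b))" by simp
  finally show ?thesis using False by simp
qed

section \<open>Gaussian integration by parts for polynomials\<close>

lemma poly_eq_sum_lessThan:
  fixes p :: "'a::comm_semiring_1 poly"
  shows "degree p < N \<Longrightarrow> poly p x = (\<Sum>i<N. coeff p i * x ^ i)"
  unfolding poly_altdef by (intro sum.mono_neutral_left) (auto simp: coeff_eq_0)

lemma integrable_cgauss_poly: "integrable cgauss (\<lambda>z. poly p z * cnj (poly r z))"
proof -
  have "poly p z * cnj (poly r z) = (\<Sum>i\<le>degree p. \<Sum>j\<le>degree r. (coeff p i * cnj (coeff r j)) * (z ^ i * cnj (z ^ j)))" for z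
    unfolding poly_altdef cnj_sum sum_product by (intro sum.cong refl) (simp add: mult_ac)
  then show ?thesis
    by (simp only:) (intro Bochner_Integration.integrable_sum integrable_mult_right integrable_cgauss_monomial)
qed

text \<open>In the Bargmann-Fock space of \<open>cgauss\<close>, multiplication by z is adjoint to
  differentiation. On monomials both sides come down to (i + 1)! = (i + 1) * i!.\<close>

lemma integral_cgauss_poly_parts:
  "(CLINT z|cgauss. z * (poly p z * cnj (poly r z))) = (CLINT z|cgauss. poly p z * cnj (poly (pderiv r) z))"
proof -
  define N where "N = Suc (max (degree p) (degree r))"
  have P: "poly p z = (\<Sum>i<N. coeff p i * z ^ i)" for z by (rule poly_eq_sum_lessThan) (simp add: N_def)
  have R: "poly r z = (\<Sum>j<Suc N. coeff r j * z ^ j)" for z by (rule poly_eq_sum_lessThan) (simp add: N_def)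
  have R': "poly (pderiv r) z = (\<Sum>j<N. coeff (pderiv r) j * z ^ j)" for z
    by (rule poly_eq_sum_lessThan) (simp add: N_def degree_pderiv)
  have prod: "(\<Sum>i<K. c i * z ^ i) * cnj (\<Sum>j<L. d j * z ^ j) = (\<Sum>i<K. \<Sum>j<L. (c i * cnj (d j)) * (z ^ i * cnj (z ^ j)))"
    for K L :: nat and c d and z :: complex
    unfolding cnj_sum sum_product by (intro sum.cong refl) (simp add: mult_ac)
  have shift: "z * (c * (z ^ i * w)) = c * (z ^ Suc i * w)" for z c w :: complex and i by simp
  have "(CLINT z|cgauss. z * (poly p z * cnj (poly r z))) = (CLINT z|cgauss. \<Sum>i<N. \<Sum>j<Suc N. (coeff p i * cnj (coeff r j)) * (z ^ Suc i * cnj (z ^ j)))"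
    unfolding P R prod sum_distrib_left shift ..
  also have "\<dots> = (\<Sum>i<N. \<Sum>j<Suc N. (coeff p i * cnj (coeff r j)) * (if Suc i = j then fact (Suc i) else 0))"
    by (simp only: Bochner_Integration.integral_sum Bochner_Integration.integrable_sum integrable_mult_right integrable_cgauss_monomial
        integral_mult_right_zero integral_cgauss_monomial)
  also have "\<dots> = (\<Sum>i<N. \<Sum>j<N. (coeff p i * cnj (coeff (pderiv r) j)) * (if i = j then fact i else 0))"
  proof (rule sum.cong[OF refl])
    fix i
    have "(\<Sum>j<Suc N. (coeff p i * cnj (coeff r j)) * (if Suc i = j then fact (Suc i) else 0)) =
      (\<Sum>j<N. (coeff p i * cnj (coeff r (Suc j))) * (if i = j then fact (Suc i) else 0))"
      unfolding sum.lessThan_Suc_shift by (simp cong: if_cong)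
    also have "\<dots> = (\<Sum>j<N. (coeff p i * cnj (coeff (pderiv r) j)) * (if i = j then fact i else 0))"
      by (intro sum.cong refl) (auto simp: coeff_pderiv algebra_simps)
    finally show "(\<Sum>j<Suc N. (coeff p i * cnj (coeff r j)) * (if Suc i = j then fact (Suc i) else 0)) =
      (\<Sum>j<N. (coeff p i * cnj (coeff (pderiv r) j)) * (if i = j then fact i else 0))" .
  qed
  also have "\<dots> = (CLINT z|cgauss. \<Sum>i<N. \<Sum>j<N. (coeff p i * cnj (coeff (pderiv r) j)) * (z ^ i * cnj (z ^ j)))"
    by (simp only: Bochner_Integration.integral_sum Bochner_Integration.integrable_sum integrable_mult_right integrable_cgauss_monomial
        integral_mult_right_zero integral_cgauss_monomial)
  also have "\<dots> = (CLINT z|cgauss. poly p z * cnj (poly (pderiv r) z))"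
    unfolding P R' prod ..
  finally show ?thesis .
qed

lemma norm_prod_le_sum_power:
  fixes x :: "'i \<Rightarrow> real"
  assumes "finite S" "S \<noteq> {}" "\<And>i. i \<in> S \<Longrightarrow> 0 \<le> x i"
  shows "(\<Prod>i\<in>S. x i) \<le> (\<Sum>i\<in>S. x i ^ card S)"
proof -
  define m where "m = Max (x ` S)"
  have "m \<in> x ` S" unfolding m_def using assms by (intro Max_in) auto
  then obtain k where k: "k \<in> S" "m = x k" by blast
  have "(\<Prod>i\<in>S. x i) \<le> (\<Prod>i\<in>S. m)" using assms by (intro prod_mono) (auto simp: m_def)
  also have "\<dots> = x k ^ card S" using k by simp
  also have "\<dots> \<le> (\<Sum>i\<in>S. x i ^ card S)"
    using assms k by (intro member_le_sum) auto
  finally show ?thesis .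
qed

text \<open>With an arbitrary target \<open>J\<close>, unlike with permutations, a value can be used
  up and removed, as the recursion for moments demands. Functions are extensional so that there are
  finitely many.\<close>

definition bijections :: "nat \<Rightarrow> 'b set \<Rightarrow> (nat \<Rightarrow> 'b) set" where
  "bijections n J = {f \<in> {..<n} \<rightarrow>\<^sub>E J. bij_betw f {..<n} J}"

lemma finite_bijections: "finite J \<Longrightarrow> finite (bijections n J)"
  unfolding bijections_def by (rule finite_subset[OF _ finite_PiE[of "{..<n}" "\<lambda>_. J"]]) auto

text \<open>Laplace expansion of a permanent along its last row.\<close>

lemma sum_bijections_Suc:
  fixes g :: "nat \<Rightarrow> 'b \<Rightarrow> complex"
  assumes J: "finite J"
  shows "(\<Sum>f\<in>bijections (Suc n) J. \<Prod>i<Suc n. g i (f i)) = (\<Sum>j\<in>J. g n j * (\<Sum>f\<in>bijections n (J - {j}). \<Prod>i<n. g i (f i)))"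
proof -
  have "(\<Sum>j\<in>J. g n j * (\<Sum>f\<in>bijections n (J - {j}). \<Prod>i<n. g i (f i))) =
    (\<Sum>p\<in>(SIGMA j:J. bijections n (J - {j})). g n (fst p) * (\<Prod>i<n. g i (snd p i)))"
    unfolding sum_distrib_left using J by (subst sum.Sigma) (auto simp: case_prod_beta intro!: finite_bijections)
  also have "\<dots> = (\<Sum>f\<in>bijections (Suc n) J. \<Prod>i<Suc n. g i (f i))"
  proof (rule sum.reindex_bij_witness[where i = "\<lambda>f. (f n, restrict f {..<n})" and j = "\<lambda>p. (snd p)(n := fst p)"])
    fix p assume "p \<in> (SIGMA j:J. bijections n (J - {j}))"
    then obtain j f where p: "p = (j, f)" "j \<in> J" "f \<in> {..<n} \<rightarrow>\<^sub>E (J - {j})" "bij_betw f {..<n} (J - {j})"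
      by (auto simp: bijections_def)
    have "restrict (f(n := j)) {..<n} = f"
    proof
      fix i show "restrict (f(n := j)) {..<n} i = f i" using PiE_arb[OF p(3), of i] by (auto simp: restrict_def)
    qed
    then show "(((snd p)(n := fst p)) n, restrict ((snd p)(n := fst p)) {..<n}) = p" using p by simp
    have "bij_betw (f(n := j)) {..<n} (J - {j})" using p(4) by (rule bij_betw_cong[THEN iffD1, rotated]) auto
    then have "bij_betw (f(n := j)) ({..<n} \<union> {n}) ((J - {j}) \<union> {j})" by (rule bij_betw_combine) auto
    moreover have "(J - {j}) \<union> {j} = J" "{..<n} \<union> {n} = {..<Suc n}" using p(2) by auto
    ultimately have b: "bij_betw (f(n := j)) {..<Suc n} J" by simp
    have "f(n := j) \<in> {..<Suc n} \<rightarrow>\<^sub>E J"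
    proof (rule PiE_I)
      fix i assume "i \<in> {..<Suc n}"
      then show "(f(n := j)) i \<in> J" using p(2) PiE_mem[OF p(3), of i] by (cases "i = n") auto
    next
      fix i assume "i \<notin> {..<Suc n}"
      then show "(f(n := j)) i = undefined" using PiE_arb[OF p(3), of i] by auto
    qed
    then show "(snd p)(n := fst p) \<in> bijections (Suc n) J" using b p(1) by (simp add: bijections_def)
    show "(\<Prod>i<Suc n. g i (((snd p)(n := fst p)) i)) = g n (fst p) * (\<Prod>i<n. g i (snd p i))"
      by (simp add: mult.commute)
  next
    fix f assume "f \<in> bijections (Suc n) J"
    then have f: "f \<in> {..<Suc n} \<rightarrow>\<^sub>E J" "bij_betw f {..<Suc n} J" by (auto simp: bijections_def)
    show "(snd (f n, restrict f {..<n}))(n := fst (f n, restrict f {..<n})) = f"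
    proof
      fix i show "((snd (f n, restrict f {..<n}))(n := fst (f n, restrict f {..<n}))) i = f i"
        using PiE_arb[OF f(1), of i] by (auto simp: restrict_def)
    qed
    have im: "f ` {..<Suc n} = J" "inj_on f {..<Suc n}" using f(2) by (auto simp: bij_betw_def)
    have 1: "f ` {..<n} = J - {f n}"
    proof -
      have "{..<n} = {..<Suc n} - {n}" by auto
      then have "f ` {..<n} = f ` {..<Suc n} - f ` {n}" using im(2) by (simp only: inj_on_image_set_diff[OF im(2)]) (subst inj_on_image_set_diff[OF im(2)]; auto)
      then show ?thesis using im(1) by simp
    qed
    have 2: "bij_betw (restrict f {..<n}) {..<n} (J - {f n})"
      unfolding bij_betw_def using 1 inj_on_subset[OF im(2), of "{..<n}"] by (auto simp: inj_on_def)
    have "restrict f {..<n} \<in> {..<n} \<rightarrow>\<^sub>E (J - {f n})" using 1 by auto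
    moreover have "f n \<in> J" using f(1) by auto
    ultimately show "(f n, restrict f {..<n}) \<in> (SIGMA j:J. bijections n (J - {j}))" using 2 by (simp add: bijections_def)
  qed
  finally show ?thesis by (rule sym)
qed

lemma permanent_eq_bijections:
  "permanent (mat n n (\<lambda>(i, j). g i j)) = (\<Sum>f\<in>bijections n {..<n}. \<Prod>i<n. g i (f i) :: complex)"
proof -
  have "permanent (mat n n (\<lambda>(i, j). g i j)) = (\<Sum>p | p permutes {0..<n}. \<Prod>i = 0..<n. g i (p i))"
    unfolding permanent_def by (auto intro!: sum.cong prod.cong simp: permutes_in_image)
  also have "\<dots> = (\<Sum>f\<in>bijections n {..<n}. \<Prod>i<n. g i (f i))"
  proof (rule sum.reindex_bij_witness[where i = "\<lambda>f i. if i < n then f i else i" and j = "\<lambda>p. restrict p {..<n}"])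
    fix p assume "p \<in> {p. p permutes {0..<n}}"
    then have p: "p permutes {..<n}" by (simp add: lessThan_atLeast0)
    show "(\<lambda>i. if i < n then restrict p {..<n} i else i) = p"
      using permutes_not_in[OF p] by (auto simp: fun_eq_iff)
    have "bij_betw (restrict p {..<n}) {..<n} {..<n}" using permutes_imp_bij[OF p] by (simp add: bij_betw_restrict_eq)
    then show "restrict p {..<n} \<in> bijections n {..<n}" using permutes_in_image[OF p] by (auto simp: bijections_def)
    show "(\<Prod>i<n. g i (restrict p {..<n} i)) = (\<Prod>i = 0..<n. g i (p i))"
      by (simp add: lessThan_atLeast0)
  next
    fix f assume "f \<in> bijections n {..<n}"
    then have f: "f \<in> {..<n} \<rightarrow>\<^sub>E {..<n}" "bij_betw f {..<n} {..<n}" by (auto simp: bijections_def)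
    show "restrict (\<lambda>i. if i < n then f i else i) {..<n} = f"
      using PiE_arb[OF f(1)] by (auto simp: fun_eq_iff restrict_def)
    have "bij_betw (\<lambda>i. if i < n then f i else i) {..<n} {..<n}" using f(2) by (rule bij_betw_cong[THEN iffD1, rotated]) auto
    then have "(\<lambda>i. if i < n then f i else i) permutes {..<n}" by (rule bij_imp_permutes) auto
    then show "(\<lambda>i. if i < n then f i else i) \<in> {p. p permutes {0..<n}}" by (simp add: lessThan_atLeast0)
  qed
  finally show ?thesis .
qed

section \<open>Wick's theorem for Gaussian series\<close>

context iid_gauss
begin

definition moment :: "(nat \<Rightarrow> int \<Rightarrow> complex) \<Rightarrow> nat set \<Rightarrow> nat set \<Rightarrow> complex" where
  "moment a I J = (CLINT \<omega>|M. (\<Prod>i\<in>I. gs (a i) \<omega>) * cnj (\<Prod>j\<in>J. gs (a j) \<omega>))"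

lemma split_law_finite:
  assumes v: "geo_decay v" "seq_ip v v = 1" and a: "\<And>i. i \<in> S \<Longrightarrow> geo_decay (a i)"
  shows "distr M (PiM S (\<lambda>_. borel)) (\<lambda>\<omega>. \<lambda>i\<in>S. gs (a i) \<omega>) =
    distr (cgauss \<Otimes>\<^sub>M M) (PiM S (\<lambda>_. borel)) (\<lambda>p. \<lambda>i\<in>S. seq_ip (a i) v * fst p + gs (\<lambda>n. a i n - seq_ip (a i) v * v n) (snd p))"
proof -
  interpret C: prob_space cgauss by (rule prob_space_cgauss)
  interpret CM: pair_prob_space cgauss M ..
  show ?thesis
  proof (rule complex_process_law_unique[OF prob_space_axioms CM.P.prob_space_axioms measurable_gs[OF a]])
    fix i assume "i \<in> S"
    then have [measurable]: "gs (\<lambda>n. a i n - seq_ip (a i) v * v n) \<in> borel_measurable M"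
      using a v by (intro measurable_gs geo_decay_diff geo_decay_cmult)
    show "(\<lambda>p. seq_ip (a i) v * fst p + gs (\<lambda>n. a i n - seq_ip (a i) v * v n) (snd p)) \<in> borel_measurable (cgauss \<Otimes>\<^sub>M M)"
      by measurable
  next
    fix J :: "'b set" and c :: "'b \<Rightarrow> complex" assume "finite J" "J \<subseteq> S"
    then show "(CLINT \<omega>|M. iexp (Re (\<Sum>j\<in>J. c j * gs (a j) \<omega>))) =
      (CLINT p|cgauss \<Otimes>\<^sub>M M. iexp (Re (\<Sum>j\<in>J. c j * (seq_ip (a j) v * fst p + gs (\<lambda>n. a j n - seq_ip (a j) v * v n) (snd p)))))"
      using a by (intro char_split[OF v, symmetric]) auto
  qed
qed

lemma unit_multiple:
  assumes a: "geo_decay a" and pos: "0 < Re (seq_ip a a)"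
    and s_def: "s = sqrt (Re (seq_ip a a))" and v_def: "v = (\<lambda>n. of_real (1 / s) * a n)"
  shows "geo_decay v" "seq_ip v v = 1" "seq_ip a v = of_real s" "(\<lambda>n. a n - of_real s * v n) = (\<lambda>_. 0)"
    "geo_decay b \<Longrightarrow> of_real s * cnj (seq_ip b v) = seq_ip a b"
proof -
  have s: "s > 0" "s * s = Re (seq_ip a a)" using pos by (simp_all add: s_def)
  have aa: "seq_ip a a = of_real s * of_real s"
    unfolding of_real_mult[symmetric] s(2) by (rule seq_ip_self(1)[OF a])
  show d: "geo_decay v" unfolding v_def by (rule geo_decay_cmult[OF a])
  show av: "seq_ip a v = of_real s"
    unfolding v_def seq_ip_cmult_right[OF a a] aa using s by simp
  show "seq_ip v v = 1"
    using seq_ip_cmult_left[OF a d, of "of_real (1 / s)"] s unfolding av v_def[symmetric] by simp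
  show "(\<lambda>n. a n - of_real s * v n) = (\<lambda>_. 0)" unfolding v_def using s by simp
  show "geo_decay b \<Longrightarrow> of_real s * cnj (seq_ip b v) = seq_ip a b"
    using seq_ip_cmult_right[OF a, of b "of_real (1 / s)"] seq_ip_cnj[of b a] a s unfolding v_def by simp
qed

text \<open>Splitting the series along its own direction leaves no remainder, so it is distributed
  as s times a standard complex Gaussian, whose moments are finite.\<close>

lemma integrable_norm_gs_power:
  assumes a: "geo_decay a" and pos: "0 < Re (seq_ip a a)"
  shows "integrable M (\<lambda>\<omega>. norm (gs a \<omega>) ^ (2 * k))"
proof -
  interpret C: prob_space cgauss by (rule prob_space_cgauss)
  interpret CM: pair_prob_space cgauss M ..
  define s where "s = sqrt (Re (seq_ip a a))"
  define v where "v = (\<lambda>n. of_real (1 / s) * a n)"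
  note U = unit_multiple[OF a pos s_def v_def]
  have m1: "(\<lambda>\<omega>. \<lambda>i\<in>{()}. gs a \<omega>) \<in> measurable M (PiM {()} (\<lambda>_. borel))"
    by (intro measurable_restrict measurable_gs a)
  have m2: "(\<lambda>p. \<lambda>i\<in>{()}. of_real s * fst p) \<in> measurable (cgauss \<Otimes>\<^sub>M M) (PiM {()} (\<lambda>_. borel))"
    by measurable
  have f: "(\<lambda>u. norm (u ()) ^ (2 * k)) \<in> borel_measurable (PiM {()} (\<lambda>_. borel))" by measurable
  have law: "distr M (PiM {()} (\<lambda>_. borel)) (\<lambda>\<omega>. \<lambda>i\<in>{()}. gs a \<omega>) = distr (cgauss \<Otimes>\<^sub>M M) (PiM {()} (\<lambda>_. borel)) (\<lambda>p. \<lambda>i\<in>{()}. of_real s * fst p)"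
    using split_law_finite[OF U(1,2), of "{()}" "\<lambda>_. a"] a unfolding U(3) U(4) gs_zero by simp
  have "integrable (cgauss \<Otimes>\<^sub>M M) (\<lambda>p. norm (complex_of_real s * fst p) ^ (2 * k))"
  proof -
    have "integrable cgauss (\<lambda>x. norm (complex_of_real s) ^ (2 * k) * norm x ^ (2 * k))"
      by (intro integrable_mult_right integrable_norm_power_cgauss)
    then have "integrable cgauss (\<lambda>x. norm (complex_of_real s * x) ^ (2 * k))" by (simp add: norm_mult power_mult_distrib)
    moreover have "distr (cgauss \<Otimes>\<^sub>M M) cgauss fst = cgauss" by (rule distr_pair_fst)
    ultimately have "integrable (distr (cgauss \<Otimes>\<^sub>M M) cgauss fst) (\<lambda>x. norm (complex_of_real s * x) ^ (2 * k))" by simp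
    then show ?thesis by (rule integrable_distr[OF measurable_fst])
  qed
  then have "integrable (distr (cgauss \<Otimes>\<^sub>M M) (PiM {()} (\<lambda>_. borel)) (\<lambda>p. \<lambda>i\<in>{()}. of_real s * fst p)) (\<lambda>u. norm (u ()) ^ (2 * k))"
    by (subst integrable_distr_eq[OF m2 f]) simp
  then show ?thesis unfolding law[symmetric] by (subst (asm) integrable_distr_eq[OF m1 f]) simp
qed

lemma integrable_moment:
  assumes S: "finite I" "finite J" and a: "\<And>i. i \<in> I \<union> J \<Longrightarrow> geo_decay (a i)" "\<And>i. i \<in> I \<union> J \<Longrightarrow> 0 < Re (seq_ip (a i) (a i))"
  shows "integrable M (\<lambda>\<omega>. (\<Prod>i\<in>I. gs (a i) \<omega>) * cnj (\<Prod>j\<in>J. gs (a j) \<omega>))"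
proof -
  have mI: "(\<lambda>\<omega>. \<Prod>i\<in>K. gs (a i) \<omega>) \<in> borel_measurable M" if "K \<subseteq> I \<union> J" for K
    using a that by (intro borel_measurable_prod measurable_gs) auto
  have bd: "(\<Prod>i\<in>K. norm (gs (a i) \<omega>)) \<^sup>2 \<le> 1 + (\<Sum>i\<in>K. norm (gs (a i) \<omega>) ^ (2 * card K))" if "finite K" for K \<omega>
  proof (cases "K = {}")
    case False
    have "(\<Prod>i\<in>K. norm (gs (a i) \<omega>))\<^sup>2 = (\<Prod>i\<in>K. (norm (gs (a i) \<omega>))\<^sup>2)" by (rule prod_power_distrib)
    also have "\<dots> \<le> (\<Sum>i\<in>K. ((norm (gs (a i) \<omega>))\<^sup>2) ^ card K)" by (rule norm_prod_le_sum_power[OF that False]) simp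
    finally show ?thesis by (simp add: power_mult)
  qed simp
  show ?thesis
  proof (rule Bochner_Integration.integrable_bound)
    show "integrable M (\<lambda>\<omega>. (1 + (\<Sum>i\<in>I. norm (gs (a i) \<omega>) ^ (2 * card I))) + (1 + (\<Sum>i\<in>J. norm (gs (a i) \<omega>) ^ (2 * card J))))"
      using a by (intro Bochner_Integration.integrable_add Bochner_Integration.integrable_sum integrable_norm_gs_power) auto
    have [measurable]: "(\<lambda>\<omega>. \<Prod>i\<in>I. gs (a i) \<omega>) \<in> borel_measurable M" "(\<lambda>\<omega>. \<Prod>j\<in>J. gs (a j) \<omega>) \<in> borel_measurable M"
      by (intro mI; simp)+
    show "(\<lambda>\<omega>. (\<Prod>i\<in>I. gs (a i) \<omega>) * cnj (\<Prod>j\<in>J. gs (a j) \<omega>)) \<in> borel_measurable M" by measurable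
    show "AE \<omega> in M. norm ((\<Prod>i\<in>I. gs (a i) \<omega>) * cnj (\<Prod>j\<in>J. gs (a j) \<omega>)) \<le>
      norm ((1 + (\<Sum>i\<in>I. norm (gs (a i) \<omega>) ^ (2 * card I))) + (1 + (\<Sum>i\<in>J. norm (gs (a i) \<omega>) ^ (2 * card J))))"
    proof (intro AE_I2)
      fix \<omega>
      define x where "x = (\<Prod>i\<in>I. norm (gs (a i) \<omega>))"
      define y where "y = (\<Prod>i\<in>J. norm (gs (a i) \<omega>))"
      have "norm ((\<Prod>i\<in>I. gs (a i) \<omega>) * cnj (\<Prod>j\<in>J. gs (a j) \<omega>)) = x * y"
        by (simp only: x_def y_def norm_mult complex_mod_cnj prod_norm)
      also have "\<dots> \<le> x\<^sup>2 + y\<^sup>2"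
      proof -
        have "2 * (x * y) \<le> x\<^sup>2 + y\<^sup>2" using sum_squares_bound[of x y] by simp
        moreover have "0 \<le> x * y" unfolding x_def y_def by (intro mult_nonneg_nonneg prod_nonneg) auto
        ultimately show ?thesis by linarith
      qed
      also have "\<dots> \<le> (1 + (\<Sum>i\<in>I. norm (gs (a i) \<omega>) ^ (2 * card I))) + (1 + (\<Sum>i\<in>J. norm (gs (a i) \<omega>) ^ (2 * card J)))"
        unfolding x_def y_def by (intro add_mono bd S)
      finally show "norm ((\<Prod>i\<in>I. gs (a i) \<omega>) * cnj (\<Prod>j\<in>J. gs (a j) \<omega>)) \<le>
        norm ((1 + (\<Sum>i\<in>I. norm (gs (a i) \<omega>) ^ (2 * card I))) + (1 + (\<Sum>i\<in>J. norm (gs (a i) \<omega>) ^ (2 * card J))))"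
        by simp
    qed
  qed
qed

text \<open>Splitting all series along the direction of \<open>a k\<close> turns the new factor into
  s x and every other factor into an affine polynomial in the fresh Gaussian x. By
  \<open>integral_cgauss_poly_parts\<close> the factor x becomes a derivative of the conjugated
  product, which strikes out one index j of \<open>J\<close> and leaves s * cnj (e j), the inner
  product of \<open>a k\<close> and \<open>a j\<close>. Only then is the remainder
  integrated.\<close>

lemma moment_insert:
  assumes S: "finite I" "finite J" "k \<notin> I"
    and a: "\<And>i. i \<in> insert k (I \<union> J) \<Longrightarrow> geo_decay (a i)" "\<And>i. i \<in> insert k (I \<union> J) \<Longrightarrow> 0 < Re (seq_ip (a i) (a i))"
  shows "moment a (insert k I) J = (\<Sum>j\<in>J. seq_ip (a k) (a j) * moment a I (J - {j}))"
proof -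
  interpret C: prob_space cgauss by (rule prob_space_cgauss)
  interpret CM: pair_prob_space cgauss M ..
  define S where "S = insert k (I \<union> J)"
  define s where "s = sqrt (Re (seq_ip (a k) (a k)))"
  define v where "v = (\<lambda>n. of_real (1 / s) * a k n)"
  have ak: "geo_decay (a k)" "0 < Re (seq_ip (a k) (a k))" using a by auto
  note U = unit_multiple[OF ak s_def v_def]
  define e where "e i = seq_ip (a i) v" for i
  define g where "g i = gs (\<lambda>n. a i n - e i * v n)" for i
  define P :: "(nat \<Rightarrow> complex) measure" where "P = PiM S (\<lambda>_. borel)"
  define F where "F K L u = (\<Prod>i\<in>K. u i) * cnj (\<Prod>j\<in>L. u j)" for K L and u :: "nat \<Rightarrow> complex"
  have Fm: "F K L \<in> borel_measurable P" if "K \<subseteq> S" "L \<subseteq> S" for K L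
  proof -
    have [measurable]: "(\<lambda>u. \<Prod>i\<in>K'. u i) \<in> borel_measurable P" if "K' \<subseteq> S" for K'
      unfolding P_def using that by (intro borel_measurable_prod measurable_component_singleton) auto
    show ?thesis unfolding F_def using that by measurable
  qed
  have gm: "g i \<in> borel_measurable M" if "i \<in> S" for i
    unfolding g_def using that a U(1) by (intro measurable_gs geo_decay_diff geo_decay_cmult) (auto simp: S_def)
  have m1: "(\<lambda>\<omega>. \<lambda>i\<in>S. gs (a i) \<omega>) \<in> measurable M P"
    unfolding P_def using a by (intro measurable_restrict measurable_gs) (auto simp: S_def)
  have m2: "(\<lambda>p. \<lambda>i\<in>S. e i * fst p + g i (snd p)) \<in> measurable (cgauss \<Otimes>\<^sub>M M) P"
    unfolding P_def
  proof (intro measurable_restrict)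
    fix i assume "i \<in> S"
    note [measurable] = gm[OF this]
    show "(\<lambda>p. e i * fst p + g i (snd p)) \<in> borel_measurable (cgauss \<Otimes>\<^sub>M M)" by measurable
  qed
  have law: "distr M P (\<lambda>\<omega>. \<lambda>i\<in>S. gs (a i) \<omega>) = distr (cgauss \<Otimes>\<^sub>M M) P (\<lambda>p. \<lambda>i\<in>S. e i * fst p + g i (snd p))"
    unfolding P_def e_def g_def using a by (intro split_law_finite U(1,2)) (auto simp: S_def)
  have R: "F K L (\<lambda>i\<in>S. h i) = (\<Prod>i\<in>K. h i) * cnj (\<Prod>j\<in>L. h j)" if "K \<subseteq> S" "L \<subseteq> S" for K L h
    unfolding F_def using that by (auto intro!: arg_cong2[where f = "(*)"] arg_cong[where f = cnj] prod.cong)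
  define Q where "Q K L x \<omega> = (\<Prod>i\<in>K. e i * x + g i \<omega>) * cnj (\<Prod>j\<in>L. e j * x + g j \<omega>)" for K L x \<omega>
  have int: "integrable (cgauss \<Otimes>\<^sub>M M) (\<lambda>(x, \<omega>). Q K L x \<omega>)"
    and mom: "moment a K L = (CLINT \<omega>|M. CLINT x|cgauss. Q K L x \<omega>)" if KL: "K \<subseteq> S" "L \<subseteq> S" for K L
  proof -
    have fin: "finite K" "finite L" using KL S(1,2) finite_subset[of _ S] by (auto simp: S_def)
    have "integrable M (\<lambda>\<omega>. (\<Prod>i\<in>K. gs (a i) \<omega>) * cnj (\<Prod>j\<in>L. gs (a j) \<omega>))"
      using KL a by (intro integrable_moment fin) (auto simp: S_def)
    then have "integrable (distr M P (\<lambda>\<omega>. \<lambda>i\<in>S. gs (a i) \<omega>)) (F K L)"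
      by (subst integrable_distr_eq[OF m1 Fm[OF KL]]) (simp only: R[OF KL])
    then have "integrable (cgauss \<Otimes>\<^sub>M M) (\<lambda>p. Q K L (fst p) (snd p))"
      unfolding law by (subst (asm) integrable_distr_eq[OF m2 Fm[OF KL]]) (simp only: R[OF KL] Q_def)
    then show int: "integrable (cgauss \<Otimes>\<^sub>M M) (\<lambda>(x, \<omega>). Q K L x \<omega>)" by (simp add: case_prod_unfold)
    have "moment a K L = (CLINT u|distr M P (\<lambda>\<omega>. \<lambda>i\<in>S. gs (a i) \<omega>). F K L u)"
      by (subst integral_distr[OF m1 Fm[OF KL]]) (simp only: R[OF KL] moment_def)
    also have "\<dots> = (CLINT p|cgauss \<Otimes>\<^sub>M M. (\<lambda>(x, \<omega>). Q K L x \<omega>) p)"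
      unfolding law by (subst integral_distr[OF m2 Fm[OF KL]]) (simp add: R[OF KL] Q_def case_prod_unfold)
    also have "\<dots> = (CLINT \<omega>|M. CLINT x|cgauss. Q K L x \<omega>)" by (rule CM.integral_snd[OF int, symmetric])
    finally show "moment a K L = (CLINT \<omega>|M. CLINT x|cgauss. Q K L x \<omega>)" .
  qed
  have IJ: "insert k I \<subseteq> S" "I \<subseteq> S" "J \<subseteq> S" by (auto simp: S_def)
  have gk: "e k = of_real s" "g k = (\<lambda>_. 0)" unfolding e_def g_def U(3) U(4) gs_zero by simp_all
  have inner: "(CLINT x|cgauss. Q (insert k I) J x \<omega>) = (\<Sum>j\<in>J. seq_ip (a k) (a j) * (CLINT x|cgauss. Q I (J - {j}) x \<omega>))" for \<omega>
  proof -
    define pp where "pp K = (\<Prod>i\<in>K. [:g i \<omega>, e i:])" for K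
    have pe: "poly (pp K) x = (\<Prod>i\<in>K. e i * x + g i \<omega>)" for K x
      unfolding pp_def poly_prod by (simp add: add.commute mult.commute)
    have pd: "pderiv (pp J) = (\<Sum>j\<in>J. pp (J - {j}) * [:e j:])"
      unfolding pp_def pderiv_prod by (simp add: pderiv_pCons)
    have "Q (insert k I) J x \<omega> = of_real s * (x * (poly (pp I) x * cnj (poly (pp J) x)))" for x
      unfolding Q_def pe using S(1,3) by (simp add: gk mult_ac)
    then have "(CLINT x|cgauss. Q (insert k I) J x \<omega>) = of_real s * (CLINT x|cgauss. poly (pp I) x * cnj (poly (pderiv (pp J)) x))"
      by (simp add: integral_cgauss_poly_parts)
    also have "\<dots> = of_real s * (CLINT x|cgauss. \<Sum>j\<in>J. cnj (e j) * (poly (pp I) x * cnj (poly (pp (J - {j})) x)))"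
      unfolding pd poly_sum cnj_sum sum_distrib_left by (simp add: mult_ac)
    also have "\<dots> = of_real s * (\<Sum>j\<in>J. cnj (e j) * (CLINT x|cgauss. poly (pp I) x * cnj (poly (pp (J - {j})) x)))"
      by (subst Bochner_Integration.integral_sum) (simp_all add: integrable_cgauss_poly)
    also have "\<dots> = (\<Sum>j\<in>J. seq_ip (a k) (a j) * (CLINT x|cgauss. Q I (J - {j}) x \<omega>))"
    proof -
      have "of_real s * cnj (e j) = seq_ip (a k) (a j)" if "j \<in> J" for j
        unfolding e_def using that a by (intro U(5)) auto
      then show ?thesis unfolding sum_distrib_left pe Q_def by (intro sum.cong refl) (simp add: mult.assoc[symmetric])
    qed
    finally show ?thesis .
  qed
  have "moment a (insert k I) J = (CLINT \<omega>|M. \<Sum>j\<in>J. seq_ip (a k) (a j) * (CLINT x|cgauss. Q I (J - {j}) x \<omega>))"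
    unfolding mom[OF IJ(1,3)] inner ..
  also have "\<dots> = (\<Sum>j\<in>J. seq_ip (a k) (a j) * (CLINT \<omega>|M. CLINT x|cgauss. Q I (J - {j}) x \<omega>))"
  proof -
    have "integrable M (\<lambda>\<omega>. CLINT x|cgauss. Q I (J - {j}) x \<omega>)" for j
      using IJ by (intro CM.integrable_snd int) auto
    then show ?thesis by (subst Bochner_Integration.integral_sum) simp_all
  qed
  also have "\<dots> = (\<Sum>j\<in>J. seq_ip (a k) (a j) * moment a I (J - {j}))"
    using IJ by (intro sum.cong refl arg_cong2[where f = "(*)"] mom[symmetric]) auto
  finally show ?thesis .
qed

lemma moment_eq_bijections:
  assumes "finite J" "card J = n"
    and "\<And>i. i \<in> {..<n} \<union> J \<Longrightarrow> geo_decay (a i)" "\<And>i. i \<in> {..<n} \<union> J \<Longrightarrow> 0 < Re (seq_ip (a i) (a i))"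
  shows "moment a {..<n} J = (\<Sum>f\<in>bijections n J. \<Prod>i<n. seq_ip (a i) (a (f i)))"
  using assms
proof (induction n arbitrary: J)
  case 0
  then have "J = {}" by simp
  moreover have "bijections 0 ({} :: nat set) = {\<lambda>_. undefined}" by (auto simp: bijections_def bij_betw_def)
  ultimately show ?case by (simp add: moment_def prob_space)
next
  case (Suc n)
  have "moment a {..<Suc n} J = (\<Sum>j\<in>J. seq_ip (a n) (a j) * moment a {..<n} (J - {j}))"
    unfolding lessThan_Suc using Suc.prems by (intro moment_insert) auto
  also have "\<dots> = (\<Sum>j\<in>J. seq_ip (a n) (a j) * (\<Sum>f\<in>bijections n (J - {j}). \<Prod>i<n. seq_ip (a i) (a (f i))))"
    using Suc.prems by (intro sum.cong refl arg_cong2[where f = "(*)"] Suc.IH) auto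
  finally show ?case using sum_bijections_Suc[OF Suc.prems(1), of "\<lambda>i j. seq_ip (a i) (a j)" n] by simp
qed

end

context iid_gauss_annulus
begin

text \<open>The recursion for moments is the expansion of the permanent. Conversely, identification
  with the expectation of a nonnegative variable is what shows the permanent to be real and
  nonnegative.\<close>

theorem expectation_prod_norm_Xf:
  assumes r: "0 < r" and x: "\<And>i. i < n \<Longrightarrow> x i \<in> A"
  defines "p \<equiv> permanent (mat n n (\<lambda>(i, j). szego_kernel q (x i) (x j) r))"
  shows "(\<integral>\<^sup>+\<omega>. (\<Prod>i<n. ennreal ((norm (Xf r \<omega> (x i)))\<^sup>2)) \<partial>M) = ennreal (Re p)" "p = of_real (Re p)" "0 \<le> Re p"
proof -
  define a where "a i = lau q r (x i)" for i
  have a: "geo_decay (a i)" "0 < Re (seq_ip (a i) (a i))" if "i < n" for i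
    unfolding a_def seq_ip_lau[OF q r x[OF that] x[OF that]]
    using lau_decay[OF q r x[OF that]] szego_kernel_diag_pos(1)[OF q r x[OF that]] by auto
  define f where "f \<omega> = (\<Prod>i<n. (norm (Xf r \<omega> (x i)))\<^sup>2)" for \<omega>
  have f: "complex_of_real (f \<omega>) = (\<Prod>i<n. gs (a i) \<omega>) * cnj (\<Prod>i<n. gs (a i) \<omega>)" for \<omega>
    unfolding f_def Xf_def a_def cnj_prod prod.distrib[symmetric] of_real_prod complex_norm_square ..
  have f0: "0 \<le> f \<omega>" for \<omega> unfolding f_def by (intro prod_nonneg) simp
  have i: "integrable M (\<lambda>\<omega>. complex_of_real (f \<omega>))" unfolding f using a by (intro integrable_moment) auto
  have i': "integrable M f" using integrable_Re[OF i] by simp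
  have "p = (\<Sum>h\<in>bijections n {..<n}. \<Prod>i<n. szego_kernel q (x i) (x (h i)) r)"
    unfolding p_def by (rule permanent_eq_bijections)
  also have "\<dots> = (\<Sum>h\<in>bijections n {..<n}. \<Prod>i<n. seq_ip (a i) (a (h i)))"
  proof (intro sum.cong refl prod.cong)
    fix h i assume "h \<in> bijections n {..<n}" "i \<in> {..<n}"
    then have "i < n" "h i < n" by (auto simp: bijections_def)
    then show "szego_kernel q (x i) (x (h i)) r = seq_ip (a i) (a (h i))" unfolding a_def using x by (intro seq_ip_lau[OF q r, symmetric])
  qed
  also have "\<dots> = moment a {..<n} {..<n}" using a by (intro moment_eq_bijections[symmetric]) auto
  also have "\<dots> = (CLINT \<omega>|M. complex_of_real (f \<omega>))" unfolding moment_def f ..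
  also have "\<dots> = of_real (LINT \<omega>|M. f \<omega>)" by (rule integral_complex_of_real)
  finally have p: "p = of_real (LINT \<omega>|M. f \<omega>)" .
  then show "p = of_real (Re p)" by simp
  show "0 \<le> Re p" unfolding p using f0 by simp
  have "(\<integral>\<^sup>+\<omega>. (\<Prod>i<n. ennreal ((norm (Xf r \<omega> (x i)))\<^sup>2)) \<partial>M) = (\<integral>\<^sup>+\<omega>. ennreal (f \<omega>) \<partial>M)"
    unfolding f_def by (simp add: prod_ennreal)
  also have "\<dots> = ennreal (Re p)" unfolding p using f0 by (subst nn_integral_eq_integral[OF i']) simp_all
  finally show "(\<integral>\<^sup>+\<omega>. (\<Prod>i<n. ennreal ((norm (Xf r \<omega> (x i)))\<^sup>2)) \<partial>M) = ennreal (Re p)" .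
qed

end

section \<open>Correlation functions of the zeros\<close>

text \<open>The number of \<open>n\<close>-tuples of distinct points \<open>z j \<in> Z \<inter> B j\<close>.\<close>

fun distinct_sum :: "nat \<Rightarrow> (nat \<Rightarrow> 'b set) \<Rightarrow> 'b set \<Rightarrow> ennreal" where
  "distinct_sum 0 B Z = 1"
| "distinct_sum (Suc n) B Z = (\<integral>\<^sup>+z. indicator (B n) z * distinct_sum n B (Z - {z}) \<partial>count_space Z)"

lemma distinct_sum_cong: "(\<And>j. j < n \<Longrightarrow> B j = B' j) \<Longrightarrow> distinct_sum n B Z = distinct_sum n B' Z"
  by (induction n arbitrary: Z) auto

lemma nn_integral_count_space_diff_indicator:
  "(\<integral>\<^sup>+z. f z \<partial>count_space (Z - S)) = (\<integral>\<^sup>+z. (if z \<in> S then 0 else f z) \<partial>count_space Z)"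
proof -
  have "(\<integral>\<^sup>+z. f z \<partial>count_space (Z - S)) = (\<integral>\<^sup>+z. f z * indicator (Z - S) z \<partial>count_space UNIV)"
    by (subst nn_integral_restrict_space[symmetric]) (simp_all add: restrict_count_space)
  also have "\<dots> = (\<integral>\<^sup>+z. (if z \<in> S then 0 else f z) * indicator Z z \<partial>count_space UNIV)"
    by (intro nn_integral_cong) (simp add: indicator_def)
  also have "\<dots> = (\<integral>\<^sup>+z. (if z \<in> S then 0 else f z) \<partial>count_space Z)"
    by (subst nn_integral_restrict_space[symmetric]) (simp_all add: restrict_count_space)
  finally show ?thesis .
qed

lemma falling_factorial_of_nat: "falling_factorial (of_nat c) k = of_nat (\<Prod>i<k. c - i)"
proof -
  have "(of_nat c :: ennreal) - of_nat i = of_nat (c - i)" for i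
  proof (cases "i \<le> c")
    case True
    then have "(of_nat c :: ennreal) = of_nat (c - i) + of_nat i" by (simp flip: of_nat_add)
    then show ?thesis by simp
  next
    case False
    then have "(of_nat c :: ennreal) \<le> of_nat i" by simp
    then show ?thesis using False by (simp add: diff_eq_0_iff_ennreal less_top[symmetric])
  qed
  then show ?thesis unfolding falling_factorial_def by simp
qed

lemma prod_falling_Suc: "(\<Prod>i<Suc l. c - i) = c * (\<Prod>i<l. (c - 1) - i)" for c :: nat
  unfolding prod.lessThan_Suc_shift by simp

definition blocks :: "nat \<Rightarrow> (nat \<Rightarrow> 'b set) \<Rightarrow> (nat \<Rightarrow> nat) \<Rightarrow> 'b set list" where
  "blocks m \<Lambda> k = concat (map (\<lambda>i. replicate (k i) (\<Lambda> i)) [0..<m])"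

lemma length_blocks: "length (blocks m \<Lambda> k) = (\<Sum>i<m. k i)"
  by (induction m) (simp_all add: blocks_def)

lemma blocks_Suc: "blocks (Suc m) \<Lambda> k = blocks m \<Lambda> k @ replicate (k m) (\<Lambda> m)"
  by (simp add: blocks_def)

lemma blocks_nth_mem: "j < (\<Sum>i<m. k i) \<Longrightarrow> \<exists>i<m. blocks m \<Lambda> k ! j = \<Lambda> i"
  using nth_mem[of j "blocks m \<Lambda> k"] unfolding length_blocks by (auto simp: blocks_def)

lemma distinct_sum_append:
  assumes fin: "finite (Z \<inter> L)"
  shows "distinct_sum (Suc (length bl)) (\<lambda>j. (bl @ [L]) ! j) Z = (\<Sum>z\<in>Z \<inter> L. distinct_sum (length bl) (\<lambda>j. bl ! j) (Z - {z}))"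
proof -
  have "distinct_sum (Suc (length bl)) (\<lambda>j. (bl @ [L]) ! j) Z = (\<integral>\<^sup>+z. indicator L z * distinct_sum (length bl) (\<lambda>j. bl ! j) (Z - {z}) \<partial>count_space Z)"
    using distinct_sum_cong[of "length bl" "\<lambda>j. (bl @ [L]) ! j" "\<lambda>j. bl ! j"] by (simp add: nth_append)
  also have "\<dots> = (\<Sum>z\<in>Z \<inter> L. indicator L z * distinct_sum (length bl) (\<lambda>j. bl ! j) (Z - {z}))"
    using fin by (intro nn_integral_count_space') auto
  finally show ?thesis by simp
qed

text \<open>Points are taken from the last block one at a time. By disjointness, removing one leaves
  the counts of the other blocks alone and lowers that of the last block by one, in step with the
  factors of the falling factorial. The nested induction runs over the length l of the last
  block.\<close>

lemma distinct_sum_blocks: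
  assumes disj: "disjoint_family_on \<Lambda> {..<m}" and fin: "\<And>i. i < m \<Longrightarrow> finite (Z \<inter> \<Lambda> i)"
  shows "distinct_sum (\<Sum>i<m. k i) (\<lambda>j. blocks m \<Lambda> k ! j) Z = (\<Prod>i<m. falling_factorial (of_nat (card (Z \<inter> \<Lambda> i))) (k i))"
  using assms
proof (induction m arbitrary: Z)
  case 0
  then show ?case by simp
next
  case (Suc m)
  have disj: "disjoint_family_on \<Lambda> {..<m}" "\<And>i. i < m \<Longrightarrow> \<Lambda> i \<inter> \<Lambda> m = {}"
    using Suc.prems(1) by (auto simp: disjoint_family_on_def)
  have "finite (Z \<inter> \<Lambda> i)" if "i < Suc m" for i using Suc.prems(2) that by blast
  then have "distinct_sum ((\<Sum>i<m. k i) + l) (\<lambda>j. (blocks m \<Lambda> k @ replicate l (\<Lambda> m)) ! j) Z =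
    (\<Prod>i<m. falling_factorial (of_nat (card (Z \<inter> \<Lambda> i))) (k i)) * falling_factorial (of_nat (card (Z \<inter> \<Lambda> m))) l" for l
  proof (induction l arbitrary: Z)
    case 0
    then show ?case using Suc.IH[OF disj(1), of Z] by (simp add: falling_factorial_def)
  next
    case (Suc l)
    define c where "c = card (Z \<inter> \<Lambda> m)"
    define P where "P = (\<Prod>i<m. falling_factorial (of_nat (card (Z \<inter> \<Lambda> i))) (k i))"
    have f: "finite (Z \<inter> \<Lambda> m)" using Suc.prems by blast
    let ?bl = "blocks m \<Lambda> k @ replicate l (\<Lambda> m)"
    have len: "length ?bl = (\<Sum>i<m. k i) + l" by (simp add: length_blocks)
    have rep: "blocks m \<Lambda> k @ replicate (Suc l) (\<Lambda> m) = ?bl @ [\<Lambda> m]" by (simp add: replicate_append_same)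
    have "distinct_sum ((\<Sum>i<m. k i) + Suc l) (\<lambda>j. (blocks m \<Lambda> k @ replicate (Suc l) (\<Lambda> m)) ! j) Z =
      (\<Sum>z\<in>Z \<inter> \<Lambda> m. distinct_sum ((\<Sum>i<m. k i) + l) (\<lambda>j. ?bl ! j) (Z - {z}))"
      unfolding rep using distinct_sum_append[OF f, of ?bl] unfolding len by simp
    also have "\<dots> = (\<Sum>z\<in>Z \<inter> \<Lambda> m. P * falling_factorial (of_nat (c - 1)) l)"
    proof (intro sum.cong refl)
      fix z assume z: "z \<in> Z \<inter> \<Lambda> m"
      have "finite ((Z - {z}) \<inter> \<Lambda> i)" if "i < Suc m" for i
        using Suc.prems[OF that] by (rule finite_subset[rotated]) auto
      then have "distinct_sum ((\<Sum>i<m. k i) + l) (\<lambda>j. ?bl ! j) (Z - {z}) =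
        (\<Prod>i<m. falling_factorial (of_nat (card ((Z - {z}) \<inter> \<Lambda> i))) (k i)) * falling_factorial (of_nat (card ((Z - {z}) \<inter> \<Lambda> m))) l"
        by (rule Suc.IH)
      also have "card ((Z - {z}) \<inter> \<Lambda> m) = c - 1"
      proof -
        have "(Z - {z}) \<inter> \<Lambda> m = (Z \<inter> \<Lambda> m) - {z}" by auto
        then show ?thesis unfolding c_def using z by (simp add: card_Diff_singleton)
      qed
      also have "(\<Prod>i<m. falling_factorial (of_nat (card ((Z - {z}) \<inter> \<Lambda> i))) (k i)) = P"
        unfolding P_def
      proof (intro prod.cong refl)
        fix i assume "i \<in> {..<m}"
        then have "z \<notin> \<Lambda> i" using disj(2)[of i] z by auto
        then have "(Z - {z}) \<inter> \<Lambda> i = Z \<inter> \<Lambda> i" by auto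
        then show "falling_factorial (of_nat (card ((Z - {z}) \<inter> \<Lambda> i))) (k i) = falling_factorial (of_nat (card (Z \<inter> \<Lambda> i))) (k i)" by simp
      qed
      finally show "distinct_sum ((\<Sum>i<m. k i) + l) (\<lambda>j. ?bl ! j) (Z - {z}) = P * falling_factorial (of_nat (c - 1)) l" .
    qed
    also have "\<dots> = P * (of_nat c * falling_factorial (of_nat (c - 1)) l)"
      by (simp add: c_def mult_ac)
    also have "of_nat c * falling_factorial (of_nat (c - 1)) l = falling_factorial (of_nat c) (Suc l)"
      unfolding falling_factorial_of_nat prod_falling_Suc by simp
    finally show ?case unfolding P_def c_def .
  qed
  then show ?case unfolding blocks_Suc by simp
qed

lemma indicator_block_product:
  assumes "x \<in> extensional {..<\<Sum>i<m. k i}"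
  shows "(indicator (block_product m \<Lambda> k) x :: ennreal) = (\<Prod>j<(\<Sum>i<m. k i). indicator (blocks m \<Lambda> k ! j) (x j))"
proof (cases "x \<in> block_product m \<Lambda> k")
  case True
  then have "x j \<in> blocks m \<Lambda> k ! j" if "j < (\<Sum>i<m. k i)" for j
    using that unfolding block_product_def blocks_def by auto
  then show ?thesis using True by simp
next
  case False
  then obtain j where "j < (\<Sum>i<m. k i)" "x j \<notin> blocks m \<Lambda> k ! j"
    using assms unfolding block_product_def blocks_def PiE_def by auto
  then have "(\<Prod>j<(\<Sum>i<m. k i). indicator (blocks m \<Lambda> k ! j) (x j)) = (0::ennreal)"
    by (intro prod_zero bexI[of _ j]) auto
  then show ?thesis using False by simp
qed

text \<open>The points already removed are stored as the coordinates, with index in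
  \<open>J\<close>, of a sequence, so that all stages of the recursion live on one measurable space;
  a fresh index k holds the next point.\<close>

lemma measurable_distinct_sum:
  assumes A: "open A" "connected A" and B: "\<And>j. B j \<in> sets borel" and J: "finite J"
  shows "(\<lambda>p. distinct_sum n B (zeros_in A (fst p) - snd p ` J)) \<in> borel_measurable (hol_space A \<Otimes>\<^sub>M PiM (UNIV :: nat set) (\<lambda>_. borel))"
  using J
proof (induction n arbitrary: J)
  case 0
  then show ?case by simp
next
  case (Suc n)
  let ?Y = "hol_space A \<Otimes>\<^sub>M PiM (UNIV :: nat set) (\<lambda>_. borel) :: ((complex \<Rightarrow> complex) \<times> (nat \<Rightarrow> complex)) measure"
  obtain k where k: "k \<notin> J" using Suc.prems ex_new_if_finite[OF infinite_UNIV_nat] by blast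
  define \<psi> where "\<psi> p z = (if z \<in> snd p ` J then 0 else indicator (B n) z * distinct_sum n B (zeros_in A (fst p) - ((snd p)(k := z)) ` insert k J))"
    for p :: "(complex \<Rightarrow> complex) \<times> (nat \<Rightarrow> complex)" and z :: complex
  have upd: "(\<lambda>p. (fst (fst p), (snd (fst p))(k := snd p))) \<in> measurable (?Y \<Otimes>\<^sub>M borel) ?Y"
  proof (intro measurable_Pair)
    show "(\<lambda>p. fst (fst p)) \<in> measurable (?Y \<Otimes>\<^sub>M borel) (hol_space A)" by measurable
    show "(\<lambda>p. (snd (fst p))(k := snd p)) \<in> measurable (?Y \<Otimes>\<^sub>M borel) (PiM UNIV (\<lambda>_. borel))"
    proof (rule measurable_PiM_single')
      fix i :: nat
      show "(\<lambda>p. ((snd (fst p))(k := snd p)) i) \<in> measurable (?Y \<Otimes>\<^sub>M borel) borel"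
        by (cases "i = k") (simp_all, measurable)
    qed auto
  qed
  have m1: "(\<lambda>p. distinct_sum n B (zeros_in A (fst (fst p)) - ((snd (fst p))(k := snd p)) ` insert k J)) \<in> borel_measurable (?Y \<Otimes>\<^sub>M borel)"
    using measurable_compose[OF upd Suc.IH[of "insert k J"]] Suc.prems by simp
  have m2: "Measurable.pred (?Y \<Otimes>\<^sub>M borel) (\<lambda>p. snd p \<in> snd (fst p) ` J)"
  proof -
    have "Measurable.pred (?Y \<Otimes>\<^sub>M borel) (\<lambda>p. \<exists>j\<in>J. snd (fst p) j = snd p)"
    proof (rule pred_intros_finite(4)[OF Suc.prems])
      fix j
      have [measurable]: "(\<lambda>p. snd (fst p) j) \<in> borel_measurable (?Y \<Otimes>\<^sub>M borel)"
        "snd \<in> borel_measurable (?Y \<Otimes>\<^sub>M borel)" by measurable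
      show "Measurable.pred (?Y \<Otimes>\<^sub>M borel) (\<lambda>p. snd (fst p) j = snd p)" by measurable
    qed
    then show ?thesis by (rule pred_congI) (auto simp: image_iff)
  qed
  note [measurable] = B m1 m2
  have "(\<lambda>(p, z). \<psi> p z) \<in> borel_measurable (?Y \<Otimes>\<^sub>M borel)" unfolding \<psi>_def case_prod_beta by measurable
  then have "(\<lambda>p. \<integral>\<^sup>+z. \<psi> p z \<partial>count_space (zeros_in A (fst p))) \<in> borel_measurable ?Y"
    by (rule measurable_zero_sum[OF A measurable_fst])
  moreover have "distinct_sum (Suc n) B (zeros_in A (fst p) - snd p ` J) = (\<integral>\<^sup>+z. \<psi> p z \<partial>count_space (zeros_in A (fst p)))" for p
  proof -
    have "((snd p)(k := z)) ` insert k J = insert z (snd p ` J)" for z using k by (auto simp: image_iff)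
    then have "zeros_in A (fst p) - ((snd p)(k := z)) ` insert k J = zeros_in A (fst p) - snd p ` J - {z}" for z by auto
    then show ?thesis unfolding \<psi>_def distinct_sum.simps nn_integral_count_space_diff_indicator by (simp only:)
  qed
  ultimately show ?case by simp
qed

text \<open>In the annulus the Blaschke factor contributes the zero z alone, and z is not among the
  zeros of u; so discarding z undoes the multiplication.\<close>

lemma zeros_in_blaschke_mult:
  assumes q: "0 < q" "q < 1" and z: "z \<in> annulus q" and u: "u holomorphic_on annulus q" "u z \<noteq> 0"
  shows "zeros_in (annulus q) (\<lambda>w. blaschke q z w * u w) - {z} = zeros_in (annulus q) u"
proof -
  let ?A = "annulus q"
  have op: "open ?A" by (rule annulus_open[OF q])
  \<comment> \<open>A point where the product is nonzero has to be exhibited, because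
    \<open>zeros_in\<close> treats the zero function differently. Close to z, but not at z, both
    factors are nonzero.\<close>
  have "isCont u z"
    using holomorphic_on_imp_continuous_on[OF u(1)] op z by (simp add: continuous_on_eq_continuous_at)
  then have "\<forall>\<^sub>F w in at z. u w \<noteq> 0" using u(2) by (intro tendsto_imp_eventually_ne) (auto simp: isCont_def)
  moreover have "\<forall>\<^sub>F w in at z. w \<in> ?A" using eventually_at_in_open'[OF op z] .
  moreover have "\<forall>\<^sub>F w in at z. w \<noteq> z" by (simp add: eventually_at_filter)
  ultimately have "\<forall>\<^sub>F w in at z. u w \<noteq> 0 \<and> w \<in> ?A \<and> w \<noteq> z" by eventually_elim simp
  then obtain w where w: "u w \<noteq> 0" "w \<in> ?A" "w \<noteq> z" using eventually_happens[of _ "at z"] by auto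
  then have "blaschke q z w * u w \<noteq> 0" using blaschke_nonzero[OF q z w(2,3)] by simp
  then have 1: "zeros_in ?A (\<lambda>w. blaschke q z w * u w) = {x \<in> ?A. blaschke q z x * u x = 0}"
    unfolding zeros_in_def using w(2) by auto
  have 2: "zeros_in ?A u = {x \<in> ?A. u x = 0}" unfolding zeros_in_def using u(2) z by auto
  show ?thesis unfolding 1 2 using blaschke_nonzero[OF q z] u(2) by auto
qed

text \<open>The density collected when the points \<open>x (n - 1), \<dots>, x 0\<close> are split off in this order by the Palm formula. A point split off
  earlier enters \<open>ws\<close>: its derivative factor turns the process into one weighted by \<open>|X|^2\<close> at that point.\<close>

fun palm_weight :: "real \<Rightarrow> nat \<Rightarrow> real \<Rightarrow> complex list \<Rightarrow> (nat \<Rightarrow> complex) \<Rightarrow> real" where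
  "palm_weight q 0 r ws x = 1"
| "palm_weight q (Suc n) r ws x =
    (norm (deriv (blaschke q (x n)) (x n)))\<^sup>2 / Re (szego_kernel q (x n) (x n) r) * (\<Prod>i<length ws. (norm (blaschke q (x n) (ws ! i)))\<^sup>2) *
    palm_weight q n (r * (norm (x n))\<^sup>2) (x n # ws) x"

text \<open>The points still to be split off, followed by those already split off. Moving x n from
  the end of the first group to the head of the second leaves the sequence unchanged, so
  \<open>per_moment\<close> is invariant under a step of the Palm recursion.\<close>

definition joined :: "nat \<Rightarrow> complex list \<Rightarrow> (nat \<Rightarrow> complex) \<Rightarrow> nat \<Rightarrow> complex" where
  "joined n ws x i = (if i < n then x i else ws ! (i - n))"

definition per_moment :: "real \<Rightarrow> nat \<Rightarrow> real \<Rightarrow> complex list \<Rightarrow> (nat \<Rightarrow> complex) \<Rightarrow> real" where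
  "per_moment q n r ws x = Re (permanent (mat (n + length ws) (n + length ws)
     (\<lambda>(i, j). szego_kernel q (joined n ws x i) (joined n ws x j) (r * (\<Prod>k<n. (norm (x k))\<^sup>2)))))"

lemma joined_Suc: "joined n (x n # ws) x = joined (Suc n) ws x"
proof
  fix i show "joined n (x n # ws) x i = joined (Suc n) ws x i"
  proof (cases "i < n")
    case False
    then obtain d where "i = n + d" using le_Suc_ex not_less by blast
    then show ?thesis by (cases d) (simp_all add: joined_def)
  qed (simp add: joined_def)
qed

lemma per_moment_Suc: "per_moment q n (r * (norm (x n))\<^sup>2) (x n # ws) x = per_moment q (Suc n) r ws x"
  unfolding per_moment_def joined_Suc by (simp add: mult_ac)

lemma palm_weight_cong: "(\<And>j. j < n \<Longrightarrow> x j = y j) \<Longrightarrow> palm_weight q n r ws x = palm_weight q n r ws y"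
proof (induction n arbitrary: r ws)
  case (Suc n)
  have "x n = y n" "\<And>r ws. palm_weight q n r ws x = palm_weight q n r ws y" using Suc by auto
  then show ?case by simp
qed simp

lemma permanent_cong:
  assumes "\<And>i j. i < n \<Longrightarrow> j < n \<Longrightarrow> f i j = g i j"
  shows "permanent (mat n n (\<lambda>(i, j). f i j)) = permanent (mat n n (\<lambda>(i, j). g i j))"
proof -
  have "mat n n (\<lambda>(i, j). f i j) = mat n n (\<lambda>(i, j). g i j)" using assms by (intro eq_matI) auto
  then show ?thesis by simp
qed

lemma per_moment_cong: assumes "\<And>j. j < n \<Longrightarrow> x j = y j" shows "per_moment q n r ws x = per_moment q n r ws y"
proof -
  have "joined n ws x = joined n ws y" using assms by (auto simp: joined_def fun_eq_iff)
  moreover have "(\<Prod>k<n. (norm (x k))\<^sup>2) = (\<Prod>k<n. (norm (y k))\<^sup>2)" using assms by (intro prod.cong) auto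
  ultimately show ?thesis unfolding per_moment_def by simp
qed

section \<open>Measurability of the collected densities\<close>

context
  fixes q :: real assumes q: "0 < q" "q < 1"
begin

lemma palm_weight_nonneg:
  "0 < r \<Longrightarrow> (\<And>j. j < n \<Longrightarrow> x j \<in> annulus q) \<Longrightarrow> 0 \<le> palm_weight q n r ws x"
proof (induction n arbitrary: r ws)
  case (Suc n)
  have xn: "x n \<in> annulus q" using Suc.prems by simp
  have "0 < r * (norm (x n))\<^sup>2" using Suc.prems(1) annulus_nonzero[OF q xn] by simp
  then have "0 \<le> palm_weight q n (r * (norm (x n))\<^sup>2) (x n # ws) x" using Suc.prems(2) by (intro Suc.IH) auto
  then show ?case using szego_kernel_diag_pos(1)[OF q Suc.prems(1) xn] by (auto intro!: mult_nonneg_nonneg divide_nonneg_pos prod_nonneg)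
qed simp

lemma measurable_theta: "theta q \<in> borel_measurable borel"
proof -
  have "theta q holomorphic_on - {0}" using theta_holomorphic[OF q, of "\<lambda>x. x" "- {0}"] by auto
  then have "(\<lambda>z. indicator (- {0}) z *\<^sub>R theta q z) \<in> borel_measurable borel"
    by (intro borel_measurable_continuous_on_indicator holomorphic_on_imp_continuous_on) auto
  then have "(\<lambda>z. if z = 0 then theta q 0 else indicator (- {0}) z *\<^sub>R theta q z) \<in> borel_measurable borel" by measurable
  also have "(\<lambda>z. if z = 0 then theta q 0 else indicator (- {0}) z *\<^sub>R theta q z) = theta q" by auto
  finally show ?thesis .
qed

lemma measurable_szego_kernel:
  assumes [measurable]: "f \<in> borel_measurable N" "g \<in> borel_measurable N" "r \<in> borel_measurable N"
    and A: "\<And>x. x \<in> space N \<Longrightarrow> f x \<in> annulus q" "\<And>x. x \<in> space N \<Longrightarrow> g x \<in> annulus q" "\<And>x. x \<in> space N \<Longrightarrow> 0 < r x"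
  shows "(\<lambda>x. szego_kernel q (f x) (g x) (r x)) \<in> borel_measurable N"
proof -
  note [measurable] = measurable_theta
  have "(\<lambda>x. theta_red q 1 * theta q (- of_real (r x) * f x * cnj (g x)) / (theta q (- of_real (r x)) * theta q (f x * cnj (g x)))) \<in> borel_measurable N"
    by measurable
  then show ?thesis by (rule measurable_cong[THEN iffD1, rotated]) (simp add: szego_kernel_theta[OF q] A)
qed

text \<open>The list of points grows by the variable point x n, so the induction is carried out for
  lists of measurable functions in place of fixed points.\<close>

lemma measurable_palm_weight:
  assumes x: "\<And>j. j < N \<Longrightarrow> (\<lambda>p. x p j) \<in> borel_measurable Y" "\<And>j p. j < N \<Longrightarrow> p \<in> space Y \<Longrightarrow> x p j \<in> annulus q"
  shows "n \<le> N \<Longrightarrow> r \<in> borel_measurable Y \<Longrightarrow> (\<And>p. p \<in> space Y \<Longrightarrow> 0 < r p) \<Longrightarrow>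
    (\<And>g. g \<in> set gs \<Longrightarrow> g \<in> borel_measurable Y) \<Longrightarrow>
    (\<lambda>p. palm_weight q n (r p) (map (\<lambda>g. g p) gs) (x p)) \<in> borel_measurable Y"
proof (induction n arbitrary: r gs)
  case (Suc n)
  note [measurable] = Suc.prems(2) measurable_theta
  have n: "n < N" using Suc.prems(1) by simp
  note [measurable] = x(1)[OF n]
  have pos: "0 < r p * (norm (x p n))\<^sup>2" if "p \<in> space Y" for p
    using Suc.prems(3)[OF that] annulus_nonzero[OF q x(2)[OF n that]] by simp
  have 1: "(\<lambda>p. palm_weight q n (r p * (norm (x p n))\<^sup>2) (map (\<lambda>g. g p) ((\<lambda>p. x p n) # gs)) (x p)) \<in> borel_measurable Y"
    using Suc.prems n pos x(1)[OF n] by (intro Suc.IH) auto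
  have 2: "(\<lambda>p. norm (blaschke q (x p n) ((gs ! i) p))) \<in> borel_measurable Y" if "i < length gs" for i
  proof -
    have [measurable]: "gs ! i \<in> borel_measurable Y" using Suc.prems(4) that by simp
    show ?thesis unfolding blaschke_def by measurable
  qed
  have 3: "(\<lambda>p. norm (deriv (blaschke q (x p n)) (x p n))) \<in> borel_measurable Y"
  proof -
    have "(\<lambda>p. norm (theta_red q 1 / theta q (cnj (x p n) * x p n))) \<in> borel_measurable Y" by measurable
    then show ?thesis
      by (rule measurable_cong[THEN iffD1, rotated]) (simp add: DERIV_imp_deriv[OF deriv_blaschke_self[OF q x(2)[OF n]]])
  qed
  have 4: "(\<lambda>p. szego_kernel q (x p n) (x p n) (r p)) \<in> borel_measurable Y"
    using x[OF n] Suc.prems by (intro measurable_szego_kernel)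
  have 5: "(\<lambda>p. \<Prod>i<length gs. (norm (blaschke q (x p n) ((gs ! i) p)))\<^sup>2) \<in> borel_measurable Y"
    using 2 by (intro borel_measurable_prod borel_measurable_power) auto
  have e: "(\<Prod>i<length gs. (norm (blaschke q (x p n) (map (\<lambda>g. g p) gs ! i)))\<^sup>2) = (\<Prod>i<length gs. (norm (blaschke q (x p n) ((gs ! i) p)))\<^sup>2)" for p
    by (intro prod.cong) auto
  note [measurable] = 3 4 5 1[simplified]
  show ?case unfolding palm_weight.simps length_map e by measurable
qed simp

lemma measurable_per_moment:
  assumes x: "\<And>j. j < n \<Longrightarrow> (\<lambda>p. x p j) \<in> borel_measurable Y" "\<And>j p. j < n \<Longrightarrow> p \<in> space Y \<Longrightarrow> x p j \<in> annulus q"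
    and r: "0 < r" and ws: "set ws \<subseteq> annulus q"
  shows "(\<lambda>p. per_moment q n r ws (x p)) \<in> borel_measurable Y"
proof -
  let ?N = "n + length ws"
  have j: "(\<lambda>p. joined n ws (x p) i) \<in> borel_measurable Y" "\<And>p. p \<in> space Y \<Longrightarrow> joined n ws (x p) i \<in> annulus q" if "i < ?N" for i
    using x[of i] ws that by (cases "i < n"; auto simp: joined_def subset_iff)+
  have rm: "(\<lambda>p. r * (\<Prod>k<n. (norm (x p k))\<^sup>2)) \<in> borel_measurable Y"
    using x(1) by (intro borel_measurable_times borel_measurable_prod borel_measurable_power borel_measurable_norm) auto
  have rp: "0 < r * (\<Prod>k<n. (norm (x p k))\<^sup>2)" if "p \<in> space Y" for p
    using r annulus_nonzero[OF q x(2)[OF _ that]] by (intro mult_pos_pos prod_pos) auto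
  have "(\<lambda>p. \<Sum>h\<in>bijections ?N {..<?N}. \<Prod>i<?N. szego_kernel q (joined n ws (x p) i) (joined n ws (x p) (h i)) (r * (\<Prod>k<n. (norm (x p k))\<^sup>2))) \<in> borel_measurable Y"
  proof (intro borel_measurable_sum borel_measurable_prod measurable_szego_kernel j rm rp)
    fix h i assume "h \<in> bijections ?N {..<?N}" "i \<in> {..<?N}"
    then show "i < ?N" "h i < ?N" by (auto simp: bijections_def)
    then show "i < ?N" "h i < ?N" by auto
  qed
  moreover have "Re \<in> borel_measurable borel" by (intro borel_measurable_continuous_onI continuous_intros)
  ultimately show ?thesis unfolding per_moment_def permanent_eq_bijections by (rule measurable_compose)
qed

end

section \<open>Iteration of the Palm formula\<close>

context iid_gauss_annulus
begin

abbreviation refm :: "complex measure" where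
  "refm \<equiv> restrict_space (scale_measure (ennreal (1 / pi)) lborel) A"

lemma space_refm: "space refm = A"
  by (simp add: space_restrict_space space_scale_measure)

lemma sets_refm: "sets refm = sets (restrict_space borel A)"
  by (simp add: sets_restrict_space sets_scale_measure)

lemma measurable_refm_borel: "f \<in> measurable borel N \<Longrightarrow> f \<in> measurable refm N"
  unfolding measurable_cong_sets[OF sets_refm refl] by (rule measurable_restrict_space1)

lemma nn_integral_refm:
  assumes f: "f \<in> borel_measurable (restrict_space borel A)"
  shows "(\<integral>\<^sup>+z. f z \<partial>refm) = (\<integral>\<^sup>+z. indicator A z * (ennreal (1 / pi) * f z) \<partial>lborel)"
proof -
  have AS: "A \<in> sets borel" using A_open by simp
  have m: "(\<lambda>z. f z * indicator A z) \<in> borel_measurable borel"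
    using f AS by (subst (asm) borel_measurable_restrict_space_iff_ennreal) simp_all
  have "(\<integral>\<^sup>+z. f z \<partial>refm) = (\<integral>\<^sup>+z. f z * indicator A z \<partial>scale_measure (ennreal (1 / pi)) lborel)"
    using AS by (subst nn_integral_restrict_space) (simp_all add: space_scale_measure sets_scale_measure)
  also have "\<dots> = ennreal (1 / pi) * (\<integral>\<^sup>+z. f z * indicator A z \<partial>lborel)"
    using m by (intro nn_integral_scale_measure) simp
  also have "\<dots> = (\<integral>\<^sup>+z. ennreal (1 / pi) * (f z * indicator A z) \<partial>lborel)"
    using m by (intro nn_integral_cmult[symmetric]) simp
  finally show ?thesis by (simp add: mult_ac)
qed

lemma sigma_finite_refm: "sigma_finite_measure refm"
proof -
  have "bounded A" by (rule bounded_subset[of "ball 0 1"]) (auto simp: annulus_def)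
  then have "emeasure lborel A < \<infinity>" by (rule emeasure_bounded_finite)
  then have "emeasure refm (space refm) \<noteq> \<infinity>"
    unfolding space_refm using A_open
    by (subst emeasure_restrict_space) (simp_all add: space_scale_measure sets_scale_measure ennreal_mult_eq_top_iff)
  then interpret F: finite_measure refm by (rule finite_measureI)
  show ?thesis by unfold_locales
qed

lemma measurable_coordinate: "j < n \<Longrightarrow> (\<lambda>x. x j) \<in> borel_measurable (PiM {..<n} (\<lambda>_. refm))"
proof -
  assume "j < n"
  then have "(\<lambda>x. x j) \<in> measurable (PiM {..<n} (\<lambda>_. refm)) refm" by (intro measurable_component_singleton) simp
  moreover have "(\<lambda>z. z) \<in> measurable refm borel" by (rule measurable_refm_borel) simp
  ultimately show ?thesis by (rule measurable_compose)
qed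

lemma space_coordinate: "x \<in> space (PiM {..<n} (\<lambda>_. refm)) \<Longrightarrow> j < n \<Longrightarrow> x j \<in> A"
  by (auto simp: space_PiM space_refm PiE_def Pi_def)

lemma measurable_indicators:
  assumes B: "\<And>j. B j \<in> sets borel"
  shows "(\<lambda>x. \<Prod>j<n. indicator (B j) (x j) :: ennreal) \<in> borel_measurable (PiM {..<n} (\<lambda>_. refm))"
proof (rule borel_measurable_prod_ennreal)
  fix j assume "j \<in> {..<n}"
  then have [measurable]: "(\<lambda>x. x j) \<in> borel_measurable (PiM {..<n} (\<lambda>_. refm))" by (intro measurable_coordinate) simp
  note [measurable] = B
  show "(\<lambda>x. indicator (B j) (x j) :: ennreal) \<in> borel_measurable (PiM {..<n} (\<lambda>_. refm))" by measurable
qed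

lemma measurable_palm_weight_refm:
  assumes "0 < r" shows "palm_weight q n r ws \<in> borel_measurable (PiM {..<n} (\<lambda>_. refm))"
proof -
  have "(\<lambda>p. palm_weight q n r (map (\<lambda>g. g p) (map (\<lambda>w _. w) ws)) p) \<in> borel_measurable (PiM {..<n} (\<lambda>_. refm))"
    by (rule measurable_palm_weight[where x = "\<lambda>p. p" and N = n and r = "\<lambda>_. r", OF q])
       (use assms in \<open>auto intro: measurable_coordinate space_coordinate\<close>)
  then show ?thesis by (simp add: comp_def)
qed

lemma measurable_per_moment_refm:
  assumes "0 < r" "set ws \<subseteq> A" shows "per_moment q n r ws \<in> borel_measurable (PiM {..<n} (\<lambda>_. refm))"
  by (rule measurable_per_moment[where x = "\<lambda>p. p", OF q])
     (use assms in \<open>auto intro: measurable_coordinate space_coordinate\<close>)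

text \<open>Induction on the number of zeros, for all parameters and all lists \<open>ws\<close> at
  once. The Palm formula at z replaces r by r |z|^2. Each factor |X|^2 at a point w of
  \<open>ws\<close> acquires |h_z(w)|^2 in front of the square for the new process, and the
  derivative adds the square at z, that is, puts z at the head of \<open>ws\<close>. The
  deterministic factors build up \<open>palm_weight\<close>. When no zero is left to split off, the
  moment is that of \<open>expectation_prod_norm_Xf\<close>.\<close>

lemma distinct_sum_moment:
  assumes r: "0 < r" and ws: "set ws \<subseteq> A" and B: "\<And>j. B j \<in> sets borel"
  shows "(\<integral>\<^sup>+\<omega>. (\<Prod>i<length ws. ennreal ((norm (Xf r \<omega> (ws ! i)))\<^sup>2)) * distinct_sum n B (zeros_in A (Xf r \<omega>)) \<partial>M) =
    (\<integral>\<^sup>+x. (\<Prod>j<n. indicator (B j) (x j)) * (ennreal (palm_weight q n r ws x) * ennreal (per_moment q n r ws x)) \<partial>PiM {..<n} (\<lambda>_. refm))"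
  using r ws
proof (induction n arbitrary: r ws)
  case 0
  have "(\<integral>\<^sup>+\<omega>. (\<Prod>i<length ws. ennreal ((norm (Xf r \<omega> (ws ! i)))\<^sup>2)) \<partial>M) = ennreal (per_moment q 0 r ws (\<lambda>_. undefined))"
    using expectation_prod_norm_Xf(1)[OF 0(1), of "length ws" "\<lambda>i. ws ! i"] 0(2)
    by (auto simp: per_moment_def joined_def subset_iff)
  then show ?case by (simp add: PiM_empty nn_integral_count_space_finite)
next
  case (Suc n)
  note r = Suc.prems(1) and ws = Suc.prems(2)
  interpret P: product_sigma_finite "\<lambda>_ :: nat. refm" by (intro product_sigma_finite.intro sigma_finite_refm)
  define W where "W u = (\<Prod>i<length ws. ennreal ((norm (u (ws ! i)))\<^sup>2))" for u :: "complex \<Rightarrow> complex"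
  define H where "H z u = indicator (B n) z * (W u * distinct_sum n B (zeros_in A u - {z}))" for z :: complex and u
  have Hm: "(\<lambda>(z, u). H z u) \<in> borel_measurable (borel \<Otimes>\<^sub>M hol_space A)"
  proof -
    have "(\<lambda>p. (snd p, (\<lambda>_. fst p) :: nat \<Rightarrow> complex)) \<in> measurable (borel \<Otimes>\<^sub>M hol_space A) (hol_space A \<Otimes>\<^sub>M PiM UNIV (\<lambda>_. borel))"
      by (intro measurable_Pair measurable_snd measurable_PiM_single') simp_all
    from measurable_compose[OF this measurable_distinct_sum[OF A_open A_connected B, of "{0}" n]]
    have [measurable]: "(\<lambda>p. distinct_sum n B (zeros_in A (snd p) - {fst p})) \<in> borel_measurable (borel \<Otimes>\<^sub>M hol_space A)" by simp
    have [measurable]: "(\<lambda>p. W (snd p)) \<in> borel_measurable (borel \<Otimes>\<^sub>M hol_space A)"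
      unfolding W_def
    proof (rule borel_measurable_prod_ennreal)
      fix i assume "i \<in> {..<length ws}"
      then have "ws ! i \<in> A" using ws by auto
      note [measurable] = measurable_hol_space_component[OF measurable_snd this]
      show "(\<lambda>p. ennreal ((norm (snd p (ws ! i)))\<^sup>2)) \<in> borel_measurable (borel \<Otimes>\<^sub>M hol_space A)" by measurable
    qed
    note [measurable] = B
    show ?thesis unfolding H_def case_prod_beta by measurable
  qed
  define c where "c z = (norm (deriv (blaschke q z) z))\<^sup>2 * (\<Prod>i<length ws. (norm (blaschke q z (ws ! i)))\<^sup>2)" for z
  have c0: "0 \<le> c z" for z unfolding c_def by (intro mult_nonneg_nonneg prod_nonneg) auto
  let ?I = "\<lambda>x. \<Prod>j<n. indicator (B j) (x j) :: ennreal"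
  let ?J = "\<lambda>x. \<Prod>j<Suc n. indicator (B j) (x j) :: ennreal"
  define g where "g x = ?J x * (ennreal (palm_weight q (Suc n) r ws x) * ennreal (per_moment q (Suc n) r ws x))" for x
  have gm: "g \<in> borel_measurable (PiM (insert n {..<n}) (\<lambda>_. refm))"
    unfolding g_def lessThan_Suc[symmetric]
    by (intro borel_measurable_times_ennreal measurable_indicators B measurable_compose[OF _ measurable_ennreal]
        measurable_palm_weight_refm measurable_per_moment_refm r ws)
  have step: "(\<integral>\<^sup>+\<omega>. ennreal ((norm (deriv (Uf r z \<omega>) z))\<^sup>2) * H z (Uf r z \<omega>) \<partial>M) =
    ennreal (Kd r z) * (\<integral>\<^sup>+x. g (x(n := z)) \<partial>PiM {..<n} (\<lambda>_. refm))" if z: "z \<in> A" for z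
  proof -
    let ?r = "r * (norm z)\<^sup>2"
    have r': "0 < ?r" by (rule r_norm_pos[OF r z])
    have zws: "set (z # ws) \<subseteq> A" using z ws by simp
    have "ennreal ((norm (deriv (Uf r z \<omega>) z))\<^sup>2) * H z (Uf r z \<omega>) =
      (indicator (B n) z * ennreal (c z)) * ((\<Prod>i<length (z # ws). ennreal ((norm (Xf ?r \<omega> ((z # ws) ! i)))\<^sup>2)) * distinct_sum n B (zeros_in A (Xf ?r \<omega>)))" for \<omega>
    proof (cases "Xf ?r \<omega> z = 0")
      \<comment> \<open>If the new process vanishes at z as well, then z is a multiple zero, and
        discarding it would not give back the zeros of \<open>Xf\<close>. Both sides are 0 in this
        case, as each contains the square of \<open>Xf\<close> at z.\<close>
      case True
      have "(\<Prod>i<length (z # ws). ennreal ((norm (Xf ?r \<omega> ((z # ws) ! i)))\<^sup>2)) = 0"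
        using True by (intro prod_zero bexI[of _ 0]) auto
      then show ?thesis unfolding deriv_Uf[OF r z] True by simp
    next
      case False
      have zs: "zeros_in A (Uf r z \<omega>) - {z} = zeros_in A (Xf ?r \<omega>)"
        unfolding Uf_def zeros_in_restrict by (rule zeros_in_blaschke_mult[OF q z Xf_holomorphic[OF r'] False])
      have "W (Uf r z \<omega>) = (\<Prod>i<length ws. ennreal ((norm (blaschke q z (ws ! i)))\<^sup>2) * ennreal ((norm (Xf ?r \<omega> (ws ! i)))\<^sup>2))"
        unfolding W_def
      proof (intro prod.cong refl)
        fix i assume "i \<in> {..<length ws}"
        then have "ws ! i \<in> A" using ws by auto
        then show "ennreal ((norm (Uf r z \<omega> (ws ! i)))\<^sup>2) = ennreal ((norm (blaschke q z (ws ! i)))\<^sup>2) * ennreal ((norm (Xf ?r \<omega> (ws ! i)))\<^sup>2)"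
          unfolding Uf_def by (simp add: norm_mult power_mult_distrib ennreal_mult)
      qed
      also have "\<dots> = ennreal (\<Prod>i<length ws. (norm (blaschke q z (ws ! i)))\<^sup>2) * (\<Prod>i<length ws. ennreal ((norm (Xf ?r \<omega> (ws ! i)))\<^sup>2))"
        unfolding prod.distrib by (simp add: prod_ennreal)
      finally have Wz: "W (Uf r z \<omega>) = ennreal (\<Prod>i<length ws. (norm (blaschke q z (ws ! i)))\<^sup>2) * (\<Prod>i<length ws. ennreal ((norm (Xf ?r \<omega> (ws ! i)))\<^sup>2))" .
      have hd: "(\<Prod>i<length (z # ws). ennreal ((norm (Xf ?r \<omega> ((z # ws) ! i)))\<^sup>2)) = ennreal ((norm (Xf ?r \<omega> z))\<^sup>2) * (\<Prod>i<length ws. ennreal ((norm (Xf ?r \<omega> (ws ! i)))\<^sup>2))"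
        unfolding list.size(4) add_Suc_right add_0_right prod.lessThan_Suc_shift by simp
      have cz: "ennreal (c z) = ennreal ((norm (deriv (blaschke q z) z))\<^sup>2) * ennreal (\<Prod>i<length ws. (norm (blaschke q z (ws ! i)))\<^sup>2)"
        unfolding c_def by (intro ennreal_mult) (auto intro: prod_nonneg)
      have dz: "ennreal ((norm (deriv (Uf r z \<omega>) z))\<^sup>2) = ennreal ((norm (deriv (blaschke q z) z))\<^sup>2) * ennreal ((norm (Xf ?r \<omega> z))\<^sup>2)"
        unfolding deriv_Uf[OF r z] by (simp add: norm_mult power_mult_distrib ennreal_mult)
      show ?thesis unfolding H_def zs Wz hd cz dz by (simp only: mult_ac)
    qed
    then have "(\<integral>\<^sup>+\<omega>. ennreal ((norm (deriv (Uf r z \<omega>) z))\<^sup>2) * H z (Uf r z \<omega>) \<partial>M) =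
      (\<integral>\<^sup>+\<omega>. (indicator (B n) z * ennreal (c z)) * ((\<Prod>i<length (z # ws). ennreal ((norm (Xf ?r \<omega> ((z # ws) ! i)))\<^sup>2)) * distinct_sum n B (zeros_in A (Xf ?r \<omega>))) \<partial>M)"
      by (simp only:)
    also have "\<dots> = (indicator (B n) z * ennreal (c z)) * (\<integral>\<^sup>+\<omega>. (\<Prod>i<length (z # ws). ennreal ((norm (Xf ?r \<omega> ((z # ws) ! i)))\<^sup>2)) * distinct_sum n B (zeros_in A (Xf ?r \<omega>)) \<partial>M)"
    proof (rule nn_integral_cmult)
      have [measurable]: "(\<lambda>\<omega>. \<Prod>i<length (z # ws). ennreal ((norm (Xf ?r \<omega> ((z # ws) ! i)))\<^sup>2)) \<in> borel_measurable M"
      proof (rule borel_measurable_prod_ennreal)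
        fix i assume "i \<in> {..<length (z # ws)}"
        then have "(z # ws) ! i \<in> set (z # ws)" by (intro nth_mem) simp
        then have "(z # ws) ! i \<in> A" using zws by blast
        note [measurable] = measurable_Xf[OF r' this]
        show "(\<lambda>\<omega>. ennreal ((norm (Xf ?r \<omega> ((z # ws) ! i)))\<^sup>2)) \<in> borel_measurable M" by measurable
      qed
      have "(\<lambda>\<omega>. (Xh ?r \<omega>, (\<lambda>_. 0) :: nat \<Rightarrow> complex)) \<in> measurable M (hol_space A \<Otimes>\<^sub>M PiM UNIV (\<lambda>_. borel))"
        by (intro measurable_Pair measurable_Xh r' measurable_const) (simp add: space_PiM)
      from measurable_compose[OF this measurable_distinct_sum[OF A_open A_connected B, of "{}" n]]
      have [measurable]: "(\<lambda>\<omega>. distinct_sum n B (zeros_in A (Xf ?r \<omega>))) \<in> borel_measurable M" by (simp add: Xh_def)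
      show "(\<lambda>\<omega>. (\<Prod>i<length (z # ws). ennreal ((norm (Xf ?r \<omega> ((z # ws) ! i)))\<^sup>2)) * distinct_sum n B (zeros_in A (Xf ?r \<omega>))) \<in> borel_measurable M"
        by measurable
    qed
    also have "\<dots> = (indicator (B n) z * ennreal (c z)) * (\<integral>\<^sup>+x. ?I x * (ennreal (palm_weight q n ?r (z # ws) x) * ennreal (per_moment q n ?r (z # ws) x)) \<partial>PiM {..<n} (\<lambda>_. refm))"
      unfolding Suc.IH[OF r' zws] ..
    also have "\<dots> = ennreal (Kd r z) * (\<integral>\<^sup>+x. g (x(n := z)) \<partial>PiM {..<n} (\<lambda>_. refm))"
    proof -
      have K: "0 < Kd r z" by (rule Kd(1)[OF r z])
      define E where "E = (\<integral>\<^sup>+x. ?I x * (ennreal (palm_weight q n ?r (z # ws) x) * ennreal (per_moment q n ?r (z # ws) x)) \<partial>PiM {..<n} (\<lambda>_. refm))"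
      have "(\<integral>\<^sup>+x. g (x(n := z)) \<partial>PiM {..<n} (\<lambda>_. refm)) =
        (\<integral>\<^sup>+x. (indicator (B n) z * ennreal (c z / Kd r z)) * (?I x * (ennreal (palm_weight q n ?r (z # ws) x) * ennreal (per_moment q n ?r (z # ws) x))) \<partial>PiM {..<n} (\<lambda>_. refm))"
      proof (intro nn_integral_cong)
        fix x assume "x \<in> space (PiM {..<n} (\<lambda>_. refm) :: (nat \<Rightarrow> complex) measure)"
        then have x: "x j \<in> A" if "j < n" for j using that by (auto simp: space_PiM space_refm PiE_def Pi_def)
        have 1: "palm_weight q (Suc n) r ws (x(n := z)) = c z / Kd r z * palm_weight q n ?r (z # ws) x"
          using palm_weight_cong[of n "x(n := z)" x q ?r "z # ws"] by (simp add: c_def Kd_def)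
        have 2: "per_moment q (Suc n) r ws (x(n := z)) = per_moment q n ?r (z # ws) x"
          using per_moment_Suc[of q n r "x(n := z)" ws] per_moment_cong[of n "x(n := z)" x q ?r "z # ws"] by simp
        have 3: "?J (x(n := z)) = indicator (B n) z * ?I x" by (simp add: mult.commute)
        have "ennreal (c z / Kd r z * palm_weight q n ?r (z # ws) x) = ennreal (c z / Kd r z) * ennreal (palm_weight q n ?r (z # ws) x)"
          using c0[of z] K palm_weight_nonneg[OF q r', of n x "z # ws"] x by (intro ennreal_mult) auto
        then show "g (x(n := z)) = (indicator (B n) z * ennreal (c z / Kd r z)) * (?I x * (ennreal (palm_weight q n ?r (z # ws) x) * ennreal (per_moment q n ?r (z # ws) x)))"
          unfolding g_def 1 2 3 by (simp only: mult_ac)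
      qed
      also have "\<dots> = (indicator (B n) z * ennreal (c z / Kd r z)) * E"
        unfolding E_def
        by (intro nn_integral_cmult borel_measurable_times_ennreal measurable_indicators B measurable_compose[OF _ measurable_ennreal]
            measurable_palm_weight_refm measurable_per_moment_refm r' zws)
      finally have G: "(\<integral>\<^sup>+x. g (x(n := z)) \<partial>PiM {..<n} (\<lambda>_. refm)) = (indicator (B n) z * ennreal (c z / Kd r z)) * E" .
      have "ennreal (Kd r z) * ennreal (c z / Kd r z) = ennreal (c z)"
        using K c0[of z] by (subst ennreal_mult[symmetric]) simp_all
      then have "ennreal (Kd r z) * ((indicator (B n) z * ennreal (c z / Kd r z)) * E) = (indicator (B n) z * ennreal (c z)) * E"
        by (metis mult.assoc mult.left_commute)
      then show ?thesis unfolding G E_def by (rule sym)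
    qed
    finally show ?thesis .
  qed
  have "(\<integral>\<^sup>+\<omega>. W (Xf r \<omega>) * distinct_sum (Suc n) B (zeros_in A (Xf r \<omega>)) \<partial>M) =
    (\<integral>\<^sup>+\<omega>. (\<integral>\<^sup>+z. H z (Xh r \<omega>) \<partial>count_space (zeros_in A (Xf r \<omega>))) \<partial>M)"
  proof (intro nn_integral_cong)
    fix \<omega>
    have "W (Xh r \<omega>) = W (Xf r \<omega>)" unfolding W_def Xh_def
    proof (intro prod.cong refl)
      fix i assume "i \<in> {..<length ws}"
      then have "ws ! i \<in> A" using ws by auto
      then show "ennreal ((norm (restrict (Xf r \<omega>) A (ws ! i)))\<^sup>2) = ennreal ((norm (Xf r \<omega> (ws ! i)))\<^sup>2)" by simp
    qed
    then have "H z (Xh r \<omega>) = W (Xf r \<omega>) * (indicator (B n) z * distinct_sum n B (zeros_in A (Xf r \<omega>) - {z}))" for z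
      unfolding H_def Xh_def zeros_in_restrict by (simp only: mult_ac)
    then show "W (Xf r \<omega>) * distinct_sum (Suc n) B (zeros_in A (Xf r \<omega>)) = (\<integral>\<^sup>+z. H z (Xh r \<omega>) \<partial>count_space (zeros_in A (Xf r \<omega>)))"
      by (simp add: nn_integral_cmult)
  qed
  also have "\<dots> = (\<integral>\<^sup>+z. indicator A z * (ennreal (1 / (pi * Kd r z)) * (\<integral>\<^sup>+\<omega>. ennreal ((norm (deriv (Uf r z \<omega>) z))\<^sup>2) * H z (Uf r z \<omega>) \<partial>M)) \<partial>lborel)"
    by (rule palm_formula[OF r Hm])
  also have "\<dots> = (\<integral>\<^sup>+z. indicator A z * (ennreal (1 / pi) * (\<integral>\<^sup>+x. g (x(n := z)) \<partial>PiM {..<n} (\<lambda>_. refm))) \<partial>lborel)"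
  proof (intro nn_integral_cong)
    fix z :: complex
    show "indicator A z * (ennreal (1 / (pi * Kd r z)) * (\<integral>\<^sup>+\<omega>. ennreal ((norm (deriv (Uf r z \<omega>) z))\<^sup>2) * H z (Uf r z \<omega>) \<partial>M)) =
      indicator A z * (ennreal (1 / pi) * (\<integral>\<^sup>+x. g (x(n := z)) \<partial>PiM {..<n} (\<lambda>_. refm)))"
    proof (cases "z \<in> A")
      case True
      have "ennreal (1 / (pi * Kd r z)) * ennreal (Kd r z) = ennreal (1 / pi)"
        using Kd(1)[OF r True] by (subst ennreal_mult[symmetric]) simp_all
      then show ?thesis unfolding step[OF True] by (simp only: mult.assoc[symmetric])
    qed simp
  qed
  also have "\<dots> = (\<integral>\<^sup>+z. (\<integral>\<^sup>+x. g (x(n := z)) \<partial>PiM {..<n} (\<lambda>_. refm)) \<partial>refm)"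
  proof (rule nn_integral_refm[symmetric])
    interpret PF: sigma_finite_measure "PiM {..<n} (\<lambda>_. refm) :: (nat \<Rightarrow> complex) measure" by (rule P.sigma_finite) simp
    have "(\<lambda>p. (snd p)(n := fst p)) \<in> measurable (refm \<Otimes>\<^sub>M PiM {..<n} (\<lambda>_. refm)) (PiM (insert n {..<n}) (\<lambda>_. refm))"
      by (rule measurable_fun_upd[where J = "{..<n}"]) auto
    from measurable_compose[OF this gm]
    have "(\<lambda>(z, x). g (x(n := z))) \<in> borel_measurable (refm \<Otimes>\<^sub>M PiM {..<n} (\<lambda>_. refm))" by (simp add: case_prod_beta)
    then have "(\<lambda>z. \<integral>\<^sup>+x. g (x(n := z)) \<partial>PiM {..<n} (\<lambda>_. refm)) \<in> borel_measurable refm"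
      by (rule PF.borel_measurable_nn_integral)
    then show "(\<lambda>z. \<integral>\<^sup>+x. g (x(n := z)) \<partial>PiM {..<n} (\<lambda>_. refm)) \<in> borel_measurable (restrict_space borel A)"
      by (simp only: measurable_cong_sets[OF sets_refm refl])
  qed
  also have "\<dots> = (\<integral>\<^sup>+x. g x \<partial>PiM (insert n {..<n}) (\<lambda>_. refm))"
    by (rule P.product_nn_integral_insert_rev[symmetric, OF _ _ gm]) simp_all
  finally show ?case unfolding W_def g_def lessThan_Suc[symmetric] .
qed

end

text \<open>Splitting off a = x n contributes |h'|^2 / K = C / t * theta (- r) / theta (- r'), where
  C is \<open>theta_red q 1\<close>, t is theta at |a|^2 and r' = r |a|^2; these theta quotients
  telescope. Each pair of points contributes once, when the one of lower index is split off, and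
  \<open>norm_blaschke_commute\<close> reverses its arguments to match the determinant.\<close>

lemma of_real_palm_weight:
  assumes q: "0 < q" "q < 1" and r: "0 < r" and x: "\<And>j. j < n \<Longrightarrow> x j \<in> annulus q" and ws: "set ws \<subseteq> annulus q"
  shows "complex_of_real (palm_weight q n r ws x) =
    theta q (- of_real r) / theta q (- of_real (r * (\<Prod>k<n. (norm (x k))\<^sup>2))) * (\<Prod>k<n. theta_red q 1 / theta q (cnj (x k) * x k)) *
    of_real ((\<Prod>k<n. \<Prod>i<length ws. (norm (blaschke q (x k) (ws ! i)))\<^sup>2) * (\<Prod>k<n. \<Prod>i<k. (norm (blaschke q (x k) (x i)))\<^sup>2))"
  using r x ws
proof (induction n arbitrary: r ws)
  case 0
  then show ?case using theta_nonzero_neg[OF q 0(1)] by simp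
next
  case (Suc n)
  define a where "a = x n"
  define C where "C = theta_red q 1"
  define t where "t = theta q (cnj a * a)"
  define r' where "r' = r * (norm a)\<^sup>2"
  note r = Suc.prems(1)
  have a: "a \<in> annulus q" using Suc.prems(2) by (simp add: a_def)
  have r': "0 < r'" using r annulus_nonzero[OF q a] by (simp add: r'_def)
  have C0: "C \<noteq> 0" unfolding C_def by (rule theta_red_1_nonzero[OF q])
  have t0: "t \<noteq> 0" unfolding t_def by (rule blaschke_denom[OF q a a])
  have th0: "theta q (- of_real r) \<noteq> 0" "theta q (- of_real r') \<noteq> 0"
    by (rule theta_nonzero_neg[OF q r], rule theta_nonzero_neg[OF q r'])
  have K: "szego_kernel q a a r = C * theta q (- of_real r') / (theta q (- of_real r) * t)"
    unfolding C_def t_def r'_def by (rule szego_kernel_diag[OF q r a])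
  have Kr: "szego_kernel q a a r = of_real (Re (szego_kernel q a a r))" "0 < Re (szego_kernel q a a r)"
    using szego_kernel_diag_pos[OF q r a] by blast+
  have ct: "cnj t = t" unfolding t_def theta_cnj[OF q, symmetric] by (simp add: mult.commute)
  have cth: "cnj (theta q (- of_real s)) = theta q (- of_real s)" for s
    unfolding theta_cnj[OF q, symmetric] by simp
  \<comment> \<open>C is written in terms of quantities already known to be real, the diagonal
    kernel among them. Its reality turns |C / t|^2 into (C / t)^2, which cancels against the
    kernel.\<close>
  have cC: "cnj C = C"
  proof -
    have "C = szego_kernel q a a r * (theta q (- of_real r) * t) / theta q (- of_real r')" unfolding K using th0 t0 by simp
    moreover have "cnj (szego_kernel q a a r) = szego_kernel q a a r" by (subst (1 2) Kr(1)) simp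
    ultimately show ?thesis by (metis complex_cnj_divide complex_cnj_mult ct cth)
  qed
  have d: "deriv (blaschke q a) a = C / t"
    unfolding C_def t_def by (rule DERIV_imp_deriv[OF deriv_blaschke_self[OF q a]])
  have dK: "complex_of_real ((norm (deriv (blaschke q a) a))\<^sup>2 / Re (szego_kernel q a a r)) = C / t * (theta q (- of_real r) / theta q (- of_real r'))"
  proof -
    have "complex_of_real ((norm (deriv (blaschke q a) a))\<^sup>2 / Re (szego_kernel q a a r)) = (C / t) * cnj (C / t) / szego_kernel q a a r"
      unfolding of_real_divide complex_norm_square d using Kr(1) by simp
    also have "\<dots> = C / t * (theta q (- of_real r) / theta q (- of_real r'))"
      unfolding K complex_cnj_divide cC ct using C0 t0 th0 by (simp add: field_simps)
    finally show ?thesis .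
  qed
  have ws': "set (a # ws) \<subseteq> annulus q" using a Suc.prems(3) by simp
  have IH: "complex_of_real (palm_weight q n r' (a # ws) x) =
    theta q (- of_real r') / theta q (- of_real (r' * (\<Prod>k<n. (norm (x k))\<^sup>2))) * (\<Prod>k<n. theta_red q 1 / theta q (cnj (x k) * x k)) *
    of_real ((\<Prod>k<n. \<Prod>i<length (a # ws). (norm (blaschke q (x k) ((a # ws) ! i)))\<^sup>2) * (\<Prod>k<n. \<Prod>i<k. (norm (blaschke q (x k) (x i)))\<^sup>2))"
    by (rule Suc.IH[OF r' _ ws']) (use Suc.prems(2) in auto)
  have p1: "r' * (\<Prod>k<n. (norm (x k))\<^sup>2) = r * (\<Prod>k<Suc n. (norm (x k))\<^sup>2)" by (simp add: r'_def a_def mult_ac)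
  have p2: "(\<Prod>k<n. \<Prod>i<length (a # ws). (norm (blaschke q (x k) ((a # ws) ! i)))\<^sup>2) =
    (\<Prod>i<n. (norm (blaschke q a (x i)))\<^sup>2) * (\<Prod>k<n. \<Prod>i<length ws. (norm (blaschke q (x k) (ws ! i)))\<^sup>2)"
  proof -
    have "(\<Prod>i<length (a # ws). (norm (blaschke q (x k) ((a # ws) ! i)))\<^sup>2) =
      (norm (blaschke q a (x k)))\<^sup>2 * (\<Prod>i<length ws. (norm (blaschke q (x k) (ws ! i)))\<^sup>2)" if "k < n" for k
    proof -
      have xk: "x k \<in> annulus q" using Suc.prems(2) that by simp
      show ?thesis unfolding list.size(4) add_Suc_right add_0_right prod.lessThan_Suc_shift
        using norm_blaschke_commute[OF q a xk] by simp
    qed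
    then show ?thesis unfolding prod.distrib[symmetric] by (intro prod.cong) auto
  qed
  have "complex_of_real (palm_weight q (Suc n) r ws x) =
    complex_of_real ((norm (deriv (blaschke q a) a))\<^sup>2 / Re (szego_kernel q a a r)) * of_real (\<Prod>i<length ws. (norm (blaschke q a (ws ! i)))\<^sup>2) *
    complex_of_real (palm_weight q n r' (a # ws) x)"
    unfolding palm_weight.simps a_def[symmetric] r'_def[symmetric] of_real_mult ..
  also have "\<dots> = theta q (- of_real r) / theta q (- of_real (r * (\<Prod>k<Suc n. (norm (x k))\<^sup>2))) *
    ((\<Prod>k<n. theta_red q 1 / theta q (cnj (x k) * x k)) * (C / t)) *
    of_real ((\<Prod>k<n. \<Prod>i<length ws. (norm (blaschke q (x k) (ws ! i)))\<^sup>2) * (\<Prod>i<length ws. (norm (blaschke q a (ws ! i)))\<^sup>2) *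
      ((\<Prod>k<n. \<Prod>i<k. (norm (blaschke q (x k) (x i)))\<^sup>2) * (\<Prod>i<n. (norm (blaschke q a (x i)))\<^sup>2)))"
  proof -
    have alg: "(c * (e / f)) * u * (f / g * p * (v * w * y)) = e / g * (p * c) * (w * u * (y * v))" if "f \<noteq> 0" for c e f u g p v w y :: complex
      using that by simp
    show ?thesis unfolding dK IH p1 p2 of_real_mult by (rule alg[OF th0(2)])
  qed
  finally show ?case unfolding prod.lessThan_Suc a_def C_def t_def .
qed

text \<open>The weight and the determinant for the parameter s contain the same product over points
  and pairs and differ only in their theta quotients, theta (- r) / theta (- s) for the weight and
  theta (- s P) / theta (- s) for the determinant, P being the product of the |x k|^2. Their ratio
  is the prefactor. As s = r P, the fourth powers arise from one square due to conditioning and one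
  due to the determinant.\<close>

lemma palm_weight_per_moment:
  assumes q: "0 < q" "q < 1" and r: "0 < r" and x: "\<And>j. j < n \<Longrightarrow> x j \<in> annulus q"
    and per: "permanent (mat n n (\<lambda>(i, j). szego_kernel q (x i) (x j) (r * (\<Prod>l<n. (cmod (x l))\<^sup>2)))) = of_real (per_moment q n r [] x)"
  shows "complex_of_real (palm_weight q n r [] x * per_moment q n r [] x) =
    theta q (- of_real r) / theta q (- of_real (r * (\<Prod>k<n. cmod (x k) ^ 4))) *
    perdet (mat n n (\<lambda>(i, j). szego_kernel q (x i) (x j) (r * (\<Prod>l<n. (cmod (x l))\<^sup>2))))"
proof -
  define s where "s = r * (\<Prod>l<n. (cmod (x l))\<^sup>2)"
  have s: "0 < s" unfolding s_def using r annulus_nonzero[OF q x] by (intro mult_pos_pos prod_pos) auto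
  have s2: "s * (\<Prod>l<n. (cmod (x l))\<^sup>2) = r * (\<Prod>k<n. cmod (x k) ^ 4)"
    unfolding s_def mult.assoc prod.distrib[symmetric] power_add[symmetric] by simp
  have "0 < r * (\<Prod>k<n. cmod (x k) ^ 4)" using r annulus_nonzero[OF q x] by (intro mult_pos_pos prod_pos) auto
  then have t0: "theta q (- of_real (r * (\<Prod>k<n. cmod (x k) ^ 4))) \<noteq> 0" by (rule theta_nonzero_neg[OF q])
  have D: "Determinant.det (mat n n (\<lambda>(i, j). szego_kernel q (x i) (x j) s)) =
    (\<Prod>k<n. theta_red q 1 / theta q (cnj (x k) * x k)) * (theta q (- of_real (r * (\<Prod>k<n. cmod (x k) ^ 4))) / theta q (- of_real s)) *
    of_real (\<Prod>k<n. \<Prod>i<k. (norm (blaschke q (x k) (x i)))\<^sup>2)"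
    unfolding s2[symmetric] using s x by (intro det_szego_kernel[OF q]) auto
  have P: "complex_of_real (palm_weight q n r [] x) = theta q (- of_real r) / theta q (- of_real s) *
    (\<Prod>k<n. theta_red q 1 / theta q (cnj (x k) * x k)) * of_real (\<Prod>k<n. \<Prod>i<k. (norm (blaschke q (x k) (x i)))\<^sup>2)"
    using of_real_palm_weight[where n = n and ws = "[]", OF q r x] by (simp add: s_def)
  show ?thesis
    unfolding perdet_def per s_def[symmetric] per[unfolded s_def[symmetric]] D of_real_mult P using t0 by simp
qed

section \<open>Almost sure regularity and the zero process\<close>

context iid_gauss
begin

text \<open>Split along its own direction, the variable is distributed as a nonzero multiple of a
  complex Gaussian, whose law has no atoms.\<close>

lemma AE_gs_nonzero:
  assumes a: "geo_decay a" and pos: "0 < Re (seq_ip a a)"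
  shows "AE \<omega> in M. gs a \<omega> \<noteq> 0"
proof -
  interpret C: prob_space cgauss by (rule prob_space_cgauss)
  define s where "s = sqrt (Re (seq_ip a a))"
  define v where "v = (\<lambda>n. of_real (1 / s) * a n)"
  note U = unit_multiple[OF a pos s_def v_def]
  have s: "s \<noteq> 0" using pos by (simp add: s_def)
  let ?P = "PiM {()} (\<lambda>_. borel) :: (unit \<Rightarrow> complex) measure"
  have m1: "(\<lambda>\<omega>. \<lambda>i\<in>{()}. gs a \<omega>) \<in> measurable M ?P" by (intro measurable_restrict measurable_gs a)
  have m2: "(\<lambda>p. \<lambda>i\<in>{()}. of_real s * fst p) \<in> measurable (cgauss \<Otimes>\<^sub>M M) ?P" by measurable
  have f: "(\<lambda>u. indicator {0} (u ()) :: ennreal) \<in> borel_measurable ?P" by measurable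
  have law: "distr M ?P (\<lambda>\<omega>. \<lambda>i\<in>{()}. gs a \<omega>) = distr (cgauss \<Otimes>\<^sub>M M) ?P (\<lambda>p. \<lambda>i\<in>{()}. of_real s * fst p)"
    using split_law_finite[OF U(1,2), of "{()}" "\<lambda>_. a"] a unfolding U(3) U(4) gs_zero by simp
  have f': "(\<lambda>u. indicator {0} (u ()) :: ennreal) \<in> borel_measurable (distr N ?P g)" for N :: "'z measure" and g
    using f by simp
  have "(\<integral>\<^sup>+\<omega>. indicator {0} (gs a \<omega>) \<partial>M) = (\<integral>\<^sup>+u. indicator {0} (u ()) \<partial>distr M ?P (\<lambda>\<omega>. \<lambda>i\<in>{()}. gs a \<omega>))"
    by (subst nn_integral_distr[OF m1 f']) simp
  also have "\<dots> = (\<integral>\<^sup>+p. indicator {0} (complex_of_real s * fst p) \<partial>(cgauss \<Otimes>\<^sub>M M))"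
    unfolding law by (subst nn_integral_distr[OF m2 f']) simp
  also have "\<dots> = (\<integral>\<^sup>+x. indicator {0} x \<partial>distr (cgauss \<Otimes>\<^sub>M M) cgauss fst)"
    using s by (subst nn_integral_distr[OF measurable_fst]) (auto simp: indicator_def intro!: nn_integral_cong)
  also have "\<dots> = emeasure cgauss {0}" unfolding distr_pair_fst by simp
  also have "\<dots> = (\<integral>\<^sup>+z. ennreal (exp (- (cmod z)\<^sup>2) / pi) * indicator {0} z \<partial>lborel)"
    unfolding cgauss_def by (subst emeasure_density) simp_all
  also have "\<dots> = (\<integral>\<^sup>+z. 0 \<partial>(lborel :: complex measure))"
  proof (rule nn_integral_cong_AE)
    have "AE z in (lborel :: complex measure). z \<noteq> 0" by (rule AE_lborel_singleton)
    then show "AE z in lborel. ennreal (exp (- (cmod z)\<^sup>2) / pi) * indicator {0} z = 0" by eventually_elim simp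
  qed
  finally have "(\<integral>\<^sup>+\<omega>. indicator {0} (gs a \<omega>) \<partial>M) = 0" by simp
  moreover have "(\<lambda>\<omega>. indicator {0} (gs a \<omega>) :: ennreal) \<in> borel_measurable M"
    by (rule measurable_compose[OF measurable_gs[OF a]]) simp
  ultimately have "AE \<omega> in M. (indicator {0} (gs a \<omega>) :: ennreal) = 0" by (simp add: nn_integral_0_iff_AE)
  then show ?thesis by eventually_elim (auto simp: indicator_def split: if_splits)
qed

end

lemma borel_measurable_completion_AE:
  assumes g: "g \<in> borel_measurable M" and eq: "AE x in M. f x = g x"
  shows "f \<in> borel_measurable (completion M)"
proof (rule measurableI)
  fix S :: "'b set" assume S: "S \<in> sets borel"
  have 1: "g -` S \<inter> space M \<in> sets (completion M)" using measurable_sets[OF g S] by simp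
  have 2: "AE x in completion M. x \<in> g -` S \<inter> space M \<longleftrightarrow> x \<in> f -` S \<inter> space M"
    using AE_completion[OF eq] by eventually_elim auto
  have 3: "f -` S \<inter> space M \<subseteq> space (completion M)" by simp
  show "f -` S \<inter> space (completion M) \<in> sets (completion M)"
    unfolding space_completion by (rule completion.in_sets_AE[OF 2 1 3])
qed simp

context iid_gauss_annulus
begin

text \<open>The growth condition identifies the original Laurent series with \<open>Xf\<close>, and
  the nonzero value at z0 excludes the zero function, for which \<open>zeros_in\<close> departs from
  the zero set. Finiteness comes from the compact hull inside the annulus.\<close>

lemma emeasure_zero_process:
  assumes r: "0 < r" and \<Lambda>: "\<Lambda> \<in> bounded_sets_in A" and \<omega>: "good \<omega>" "Xf r \<omega> z0 \<noteq> 0" "z0 \<in> A"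
  shows "emeasure (gaussian_zero_process q r \<zeta> \<omega>) \<Lambda> = of_nat (card (zeros_in A (Xf r \<omega>) \<inter> \<Lambda>))" "finite (zeros_in A (Xf r \<omega>) \<inter> \<Lambda>)"
proof -
  obtain K where K: "\<Lambda> \<in> sets borel" "compact K" "\<Lambda> \<subseteq> K" "K \<subseteq> A" using \<Lambda> by (auto simp: bounded_sets_in_def)
  have "finite (zeros_in A (Xf r \<omega>) \<inter> K)" by (rule zeros_in_compact_finite[OF A_open A_connected Xf_holomorphic[OF r] K(2,4)])
  then show fin: "finite (zeros_in A (Xf r \<omega>) \<inter> \<Lambda>)" by (rule finite_subset[rotated]) (use K in auto)
  have Z: "{z \<in> A. laurent_sum q r (\<lambda>n. \<zeta> n \<omega>) z = 0} = zeros_in A (Xf r \<omega>)"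
    unfolding zeros_in_def using laurent_sum_eq_Xf[OF r \<omega>(1)] \<omega>(2,3) by auto
  have L: "\<Lambda> \<in> sets (restrict_space borel A)" using K A_open by (subst sets_restrict_space_iff) auto
  have sub: "zeros_in A (Xf r \<omega>) \<subseteq> A" unfolding zeros_in_def by auto
  have "(\<lambda>z. z) \<in> measurable (count_space (zeros_in A (Xf r \<omega>))) (restrict_space borel A)"
    using sub by (auto simp: space_restrict_space)
  then have "emeasure (gaussian_zero_process q r \<zeta> \<omega>) \<Lambda> = emeasure (count_space (zeros_in A (Xf r \<omega>))) ((\<lambda>z. z) -` \<Lambda> \<inter> zeros_in A (Xf r \<omega>))"
    unfolding gaussian_zero_process_def zero_measure_def Z using L by (subst emeasure_distr) simp_all
  also have "(\<lambda>z. z) -` \<Lambda> \<inter> zeros_in A (Xf r \<omega>) = zeros_in A (Xf r \<omega>) \<inter> \<Lambda>" by auto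
  finally show "emeasure (gaussian_zero_process q r \<zeta> \<omega>) \<Lambda> = of_nat (card (zeros_in A (Xf r \<omega>) \<inter> \<Lambda>))"
    using fin by (simp add: emeasure_count_space)
qed

lemma AE_regular:
  assumes r: "0 < r"
  obtains z0 where "z0 \<in> A" "AE \<omega> in M. good \<omega> \<and> Xf r \<omega> z0 \<noteq> 0"
proof
  let ?z = "complex_of_real (sqrt q)"
  show z: "?z \<in> A" by (rule sqrt_mem_annulus[OF q])
  have "AE \<omega> in M. Xf r \<omega> ?z \<noteq> 0"
    unfolding Xf_def using szego_kernel_diag_pos(1)[OF q r z]
    by (intro AE_gs_nonzero lau_decay[OF q r z]) (simp add: seq_ip_lau[OF q r z z])
  with AE_good show "AE \<omega> in M. good \<omega> \<and> Xf r \<omega> ?z \<noteq> 0" by eventually_elim simp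
qed

lemma point_process_zeros:
  assumes r: "0 < r" shows "point_process M A (gaussian_zero_process q r \<zeta>)"
proof -
  obtain z0 where z0: "z0 \<in> A" "AE \<omega> in M. good \<omega> \<and> Xf r \<omega> z0 \<noteq> 0" using AE_regular[OF r] .
  show ?thesis unfolding point_process_def
  proof (intro conjI ballI)
    show "sets (gaussian_zero_process q r \<zeta> \<omega>) = sets (restrict_space borel A)" for \<omega>
      by (simp add: gaussian_zero_process_def zero_measure_def)
    show "AE \<omega> in M. \<forall>\<Lambda>\<in>bounded_sets_in A. emeasure (gaussian_zero_process q r \<zeta> \<omega>) \<Lambda> \<in> \<nat>"
      using z0(2) by eventually_elim (simp add: emeasure_zero_process(1)[OF r _ _ _ z0(1)])
    fix \<Lambda> assume \<Lambda>: "\<Lambda> \<in> bounded_sets_in A"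
    then have [measurable]: "\<Lambda> \<in> sets borel" by (simp add: bounded_sets_in_def)
    define g where "g \<omega> = (\<integral>\<^sup>+z. indicator \<Lambda> z \<partial>count_space (zeros_in A (Xh r \<omega>)))" for \<omega>
    have "(\<lambda>(\<omega>, z). indicator \<Lambda> z :: ennreal) \<in> borel_measurable (M \<Otimes>\<^sub>M borel)" by measurable
    then have gm: "g \<in> borel_measurable M"
      unfolding g_def by (rule measurable_zero_sum[OF A_open A_connected measurable_Xh[OF r]])
    have "AE \<omega> in M. emeasure (gaussian_zero_process q r \<zeta> \<omega>) \<Lambda> = g \<omega>"
      using z0(2)
    proof eventually_elim
      case (elim \<omega>)
      have fin: "finite (zeros_in A (Xf r \<omega>) \<inter> \<Lambda>)" using elim by (intro emeasure_zero_process(2)[OF r \<Lambda> _ _ z0(1)]) auto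
      have "g \<omega> = (\<Sum>z\<in>zeros_in A (Xf r \<omega>) \<inter> \<Lambda>. indicator \<Lambda> z)"
        unfolding g_def Xh_def zeros_in_restrict using fin by (intro nn_integral_count_space') auto
      also have "\<dots> = of_nat (card (zeros_in A (Xf r \<omega>) \<inter> \<Lambda>))" by simp
      finally show ?case using elim emeasure_zero_process(1)[OF r \<Lambda> _ _ z0(1)] by simp
    qed
    then show "(\<lambda>\<omega>. emeasure (gaussian_zero_process q r \<zeta> \<omega>) \<Lambda>) \<in> borel_measurable (completion M)"
      by (rule borel_measurable_completion_AE[OF gm])
  qed
qed

text \<open>The form in which the induction produces the density, real by construction; the
  expression by theta and \<open>perdet\<close> is derived at points of the annulus.\<close>

definition zero_corr :: "real \<Rightarrow> nat \<Rightarrow> (nat \<Rightarrow> complex) \<Rightarrow> real" where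
  "zero_corr r n x = palm_weight q n r [] x * per_moment q n r [] x"

lemma permanent_per_moment:
  assumes r: "0 < r" and x: "\<And>j. j < n \<Longrightarrow> x j \<in> A"
  shows "permanent (mat n n (\<lambda>(i, j). szego_kernel q (x i) (x j) (r * (\<Prod>l<n. (cmod (x l))\<^sup>2)))) = of_real (per_moment q n r [] x)"
    "0 \<le> per_moment q n r [] x"
proof -
  let ?s = "r * (\<Prod>l<n. (cmod (x l))\<^sup>2)"
  have s: "0 < ?s" using r annulus_nonzero[OF q x] by (intro mult_pos_pos prod_pos) auto
  have p: "per_moment q n r [] x = Re (permanent (mat n n (\<lambda>(i, j). szego_kernel q (x i) (x j) ?s)))"
    unfolding per_moment_def list.size(3) add_0_right
    by (intro arg_cong[where f = Re] permanent_cong) (simp add: joined_def)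
  show "permanent (mat n n (\<lambda>(i, j). szego_kernel q (x i) (x j) ?s)) = of_real (per_moment q n r [] x)"
    unfolding p using s x by (rule expectation_prod_norm_Xf(2))
  show "0 \<le> per_moment q n r [] x" unfolding p using s x by (rule expectation_prod_norm_Xf(3))
qed

lemma correlation_function_zeros:
  assumes r: "0 < r" shows "correlation_function M A (gaussian_zero_process q r \<zeta>) refm n (zero_corr r n)"
proof -
  let ?Y = "PiM {..<n} (\<lambda>_. refm) :: (nat \<Rightarrow> complex) measure"
  obtain z0 where z0: "z0 \<in> A" "AE \<omega> in M. good \<omega> \<and> Xf r \<omega> z0 \<noteq> 0" using AE_regular[OF r] .
  show ?thesis unfolding correlation_function_def
  proof (intro conjI ballI allI impI)
    note [measurable] = measurable_palm_weight_refm[OF r, of n "[]"] measurable_per_moment_refm[OF r, of "[]" n, simplified]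
    show "zero_corr r n \<in> borel_measurable ?Y" unfolding zero_corr_def[abs_def] by measurable
  next
    fix x assume "x \<in> {..<n} \<rightarrow>\<^sub>E A"
    then have x: "x j \<in> A" if "j < n" for j using that by auto
    show "0 \<le> zero_corr r n x"
      unfolding zero_corr_def by (intro mult_nonneg_nonneg palm_weight_nonneg[OF q r x] permanent_per_moment(2)[OF r x])
  next
    fix m :: nat and \<Lambda> :: "nat \<Rightarrow> complex set" and k :: "nat \<Rightarrow> nat"
    assume "(\<forall>i<m. \<Lambda> i \<in> bounded_sets_in A) \<and> disjoint_family_on \<Lambda> {..<m} \<and> (\<Sum>i<m. k i) = n"
    then have \<Lambda>: "\<And>i. i < m \<Longrightarrow> \<Lambda> i \<in> bounded_sets_in A" and disj: "disjoint_family_on \<Lambda> {..<m}" and n: "(\<Sum>i<m. k i) = n" by auto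
    \<comment> \<open>Beyond n the sets are empty, because \<open>distinct_sum_moment\<close> asks
      for Borel sets at every index and list access is meaningful only within the list.\<close>
    define B where "B j = (if j < n then blocks m \<Lambda> k ! j else {})" for j
    have B: "B j \<in> sets borel" for j
    proof (cases "j < n")
      case True
      then obtain i where "i < m" "blocks m \<Lambda> k ! j = \<Lambda> i" using blocks_nth_mem[of j k m \<Lambda>] n by auto
      then show ?thesis using \<Lambda>[of i] True by (simp add: B_def bounded_sets_in_def)
    qed (simp add: B_def)
    have "(\<integral>\<^sup>+\<omega>. (\<Prod>i<m. falling_factorial (emeasure (gaussian_zero_process q r \<zeta> \<omega>) (\<Lambda> i)) (k i)) \<partial>completion M) =
      (\<integral>\<^sup>+\<omega>. (\<Prod>i<m. falling_factorial (emeasure (gaussian_zero_process q r \<zeta> \<omega>) (\<Lambda> i)) (k i)) \<partial>M)"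
      by (rule nn_integral_completion)
    also have "\<dots> = (\<integral>\<^sup>+\<omega>. distinct_sum n B (zeros_in A (Xf r \<omega>)) \<partial>M)"
    proof (rule nn_integral_cong_AE, use z0(2) in eventually_elim)
      fix \<omega> assume \<omega>: "good \<omega> \<and> Xf r \<omega> z0 \<noteq> 0"
      have e: "emeasure (gaussian_zero_process q r \<zeta> \<omega>) (\<Lambda> i) = of_nat (card (zeros_in A (Xf r \<omega>) \<inter> \<Lambda> i))"
        "finite (zeros_in A (Xf r \<omega>) \<inter> \<Lambda> i)" if "i < m" for i
        using \<omega> by (intro emeasure_zero_process[OF r \<Lambda>[OF that] _ _ z0(1)]; simp)+
      have "(\<Prod>i<m. falling_factorial (emeasure (gaussian_zero_process q r \<zeta> \<omega>) (\<Lambda> i)) (k i)) =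
        (\<Prod>i<m. falling_factorial (of_nat (card (zeros_in A (Xf r \<omega>) \<inter> \<Lambda> i))) (k i))"
        by (intro prod.cong refl) (simp add: e)
      also have "\<dots> = distinct_sum n (\<lambda>j. blocks m \<Lambda> k ! j) (zeros_in A (Xf r \<omega>))"
        unfolding n[symmetric] by (rule distinct_sum_blocks[OF disj e(2), symmetric])
      also have "\<dots> = distinct_sum n B (zeros_in A (Xf r \<omega>))" by (rule distinct_sum_cong) (simp add: B_def)
      finally show "(\<Prod>i<m. falling_factorial (emeasure (gaussian_zero_process q r \<zeta> \<omega>) (\<Lambda> i)) (k i)) = distinct_sum n B (zeros_in A (Xf r \<omega>))" .
    qed
    also have "\<dots> = (\<integral>\<^sup>+x. (\<Prod>j<n. indicator (B j) (x j)) * (ennreal (palm_weight q n r [] x) * ennreal (per_moment q n r [] x)) \<partial>?Y)"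
      using distinct_sum_moment[OF r _ B, of "[]" n] by simp
    also have "\<dots> = (\<integral>\<^sup>+x. ennreal (zero_corr r n x) * indicator (block_product m \<Lambda> k) x \<partial>?Y)"
    proof (intro nn_integral_cong)
      fix x assume xs: "x \<in> space ?Y"
      then have x: "\<And>j. j < n \<Longrightarrow> x j \<in> A" by (rule space_coordinate)
      have "x \<in> extensional {..<\<Sum>i<m. k i}" using xs unfolding n by (simp add: space_PiM PiE_def)
      then have "(indicator (block_product m \<Lambda> k) x :: ennreal) = (\<Prod>j<n. indicator (blocks m \<Lambda> k ! j) (x j))"
        using indicator_block_product[of x k m \<Lambda>] unfolding n by simp
      also have "\<dots> = (\<Prod>j<n. indicator (B j) (x j))" by (intro prod.cong) (auto simp: B_def)
      finally have I: "(indicator (block_product m \<Lambda> k) x :: ennreal) = (\<Prod>j<n. indicator (B j) (x j))" .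
      have "ennreal (zero_corr r n x) = ennreal (palm_weight q n r [] x) * ennreal (per_moment q n r [] x)"
        unfolding zero_corr_def by (rule ennreal_mult[OF palm_weight_nonneg[OF q r x] permanent_per_moment(2)[OF r x]])
      then show "(\<Prod>j<n. indicator (B j) (x j)) * (ennreal (palm_weight q n r [] x) * ennreal (per_moment q n r [] x)) =
        ennreal (zero_corr r n x) * indicator (block_product m \<Lambda> k) x" unfolding I by (simp only: mult.commute)
    qed
    finally show "(\<integral>\<^sup>+\<omega>. (\<Prod>i<m. falling_factorial (emeasure (gaussian_zero_process q r \<zeta> \<omega>) (\<Lambda> i)) (k i)) \<partial>completion M) =
      (\<integral>\<^sup>+x\<in>block_product m \<Lambda> k. ennreal (zero_corr r n x) \<partial>?Y)" .
  qed
qed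

end

theorem theorem1p3:
  fixes M :: "'a measure" and \<zeta> :: "int \<Rightarrow> 'a \<Rightarrow> complex" and q r :: real
  assumes "prob_space M"
    and "0 < q" and "q < 1" and "0 < r"
    and "prob_space.indep_vars M (\<lambda>_. borel) \<zeta> UNIV"
    and "\<And>n. std_complex_gaussian M (\<zeta> n)"
  shows "point_process M (annulus q) (gaussian_zero_process q r \<zeta>) \<and>
    (\<exists>\<rho> :: nat \<Rightarrow> (nat \<Rightarrow> complex) \<Rightarrow> real.
      (\<forall>n. correlation_function M (annulus q) (gaussian_zero_process q r \<zeta>)
        (restrict_space (scale_measure (ennreal (1 / pi)) lborel) (annulus q)) n (\<rho> n)) \<and>
      (\<forall>n z. (\<forall>i<n. z i \<in> annulus q) \<longrightarrow>
        complex_of_real (\<rho> n z) =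
          theta q (- of_real r) / theta q (- of_real (r * (\<Prod>k<n. cmod (z k) ^ 4))) *
          perdet (mat n n (\<lambda>(i, j).
            szego_kernel q (z i) (z j) (r * (\<Prod>l<n. (cmod (z l))\<^sup>2))))))"
proof -
  interpret prob_space M by fact
  interpret iid_gauss_annulus M \<zeta> q
    using assms(2,3,5,6) by unfold_locales (auto simp: std_complex_gaussian_def)
  note q = assms(2,3) and r = assms(4)
  show ?thesis
  proof (intro conjI exI[of _ "zero_corr r"] allI impI)
    show "point_process M (annulus q) (gaussian_zero_process q r \<zeta>)" by (rule point_process_zeros[OF r])
    show "correlation_function M (annulus q) (gaussian_zero_process q r \<zeta>)
        (restrict_space (scale_measure (ennreal (1 / pi)) lborel) (annulus q)) n (zero_corr r n)" for n
      by (rule correlation_function_zeros[OF r])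
    fix n and z :: "nat \<Rightarrow> complex" assume "\<forall>i<n. z i \<in> annulus q"
    then have z: "\<And>i. i < n \<Longrightarrow> z i \<in> annulus q" by blast
    show "complex_of_real (zero_corr r n z) =
          theta q (- of_real r) / theta q (- of_real (r * (\<Prod>k<n. cmod (z k) ^ 4))) *
          perdet (mat n n (\<lambda>(i, j). szego_kernel q (z i) (z j) (r * (\<Prod>l<n. (cmod (z l))\<^sup>2))))"
      unfolding zero_corr_def by (rule palm_weight_per_moment[OF q r z permanent_per_moment(1)[OF r z]])
  qed
qed

end
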